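(* Let $n\ge2$ and let $f_n=f_{n-1}$ be equal even nonnegative continuous functions on $\mathbb R^n$. Consider the question: given two origin-symmetric convex bodies $K$ and $L$ in $\mathbb R^n$ such that $$\mu_{n-1}(K\cap\xi^\perp)\le\mu_{n-1}(L\cap\xi^\perp)\qquad\text{for every }\xi\in S^{n-1},$$ does it follow that $\mu_n(K)\le\mu_n(L)$? The answer is affirmative if $n\le4$ (the implication holds for all such $K,L$) and negative if $n\ge5$ (there exist such $K,L$ with $\mu_n(K)>\mu_n(L)$).
   Context: $\mu_n$ is the measure on $\mathbb R^n$ with density $f_n$. For $\xi\in S^{n-1}$, $\xi^\perp$ is the hyperplane through the origin orthogonal to $\xi$, and $\mu_{n-1}(B)=\int_B f_{n-1}(x)\,dx$ for bounded Borel $B\subset\xi^\perp$, where $dx$ is $(n-1)$-dimensional Lebesgue measure on $\xi^\perp$. A convex body is a compact convex set with non-empty interior.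
   Formalization: In the negative part (n ≥ 5) the density is additionally assumed not to be identically zero; for the zero density all measures vanish, so no K, L with μ_n(K) > μ_n(L) exist and the claim as stated fails. *)

theory Defs
  imports "HOL-Analysis.Analysis"
begin

definition orthonormal_basis_of :: "'a::euclidean_space set \<Rightarrow> 'a set \<Rightarrow> bool" where
  "orthonormal_basis_of S B \<longleftrightarrow>
     B \<subseteq> S \<and> pairwise orthogonal B \<and> (\<forall>b\<in>B. norm b = 1) \<and> span B = S"

lemma orthonormal_basis_of_exists:
  assumes "subspace S"
  shows "\<exists>B. orthonormal_basis_of S B"
  using orthonormal_basis_subspace[OF assms] unfolding orthonormal_basis_of_def by metis

text \<open>
  Lebesgue measure of dimension \<^term>\<open>dim S\<close> on a linear subspace \<^term>\<open>S\<close>, regarded as a Borel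
  measure on the ambient space concentrated on \<^term>\<open>S\<close>. As for \<^const>\<open>lborel\<close>, it is the image of a
  product of one-dimensional Lebesgue measures, taken in the coordinates of an orthonormal basis
  of \<^term>\<open>S\<close>. Lebesgue measure being invariant under orthogonal maps, the choice of basis does not
  matter.
\<close>
definition subspace_lborel :: "'a::euclidean_space set \<Rightarrow> 'a measure" where
  "subspace_lborel S =
     (let B = (SOME B. orthonormal_basis_of S B)
      in distr (\<Pi>\<^sub>M b\<in>B. (lborel :: real measure)) borel (\<lambda>c. \<Sum>b\<in>B. c b *\<^sub>R b))"

definition hyperplane_perp :: "'a::euclidean_space \<Rightarrow> 'a set" where
  "hyperplane_perp \<xi> = {x. \<xi> \<bullet> x = 0}"

definition body_measure :: "('a::euclidean_space \<Rightarrow> real) \<Rightarrow> 'a measure" where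
  "body_measure f = density lborel (\<lambda>x. ennreal (f x))"

definition section_measure :: "('a::euclidean_space \<Rightarrow> real) \<Rightarrow> 'a \<Rightarrow> 'a measure" where
  "section_measure f \<xi> = density (subspace_lborel (hyperplane_perp \<xi>)) (\<lambda>x. ennreal (f x))"

definition convex_body :: "'a::euclidean_space set \<Rightarrow> bool" where
  "convex_body K \<longleftrightarrow> compact K \<and> convex K \<and> interior K \<noteq> {}"

definition origin_symmetric :: "'a::euclidean_space set \<Rightarrow> bool" where
  "origin_symmetric K \<longleftrightarrow> uminus ` K = K"

definition sections_le :: "('a::euclidean_space \<Rightarrow> real) \<Rightarrow> 'a set \<Rightarrow> 'a set \<Rightarrow> bool" where
  "sections_le f K L \<longleftrightarrow>
     (\<forall>\<xi>\<in>sphere 0 1. emeasure (section_measure f \<xi>) (K \<inter> hyperplane_perp \<xi>)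
                    \<le> emeasure (section_measure f \<xi>) (L \<inter> hyperplane_perp \<xi>))"

end

theory Submission
  imports Defs "HOL-Probability.Distributions" "HOL-Real_Asymp.Real_Asymp"
begin

text \<open>
  \<^emph>\<open>Dimension at most four.\<close> Let \<open>D = f (1\<^sub>L - 1\<^sub>K)\<close>. Sections are tested with weights
  \<open>P \<xi> = \<integral>\<^sub>K k(\<xi>, y \<bullet> \<xi> / h) dy\<close>, where \<open>k\<close> is a difference of Gaussians in its second argument such that
  Brunn-Minkowski for the slabs \<open>{y \<in> K. \<bar>y \<bullet> \<xi>\<bar> \<le> a}\<close> gives \<open>P \<ge> 0\<close>. Exchanging the order of
  integration over incident pairs \<open>x \<bottom> \<xi>\<close> turns \<open>\<integral> P(\<xi>) (\<integral>\<^bsub>\<xi>\<^sup>\<perp>\<^esub> D) d\<xi> / \<bar>\<xi>\<bar> \<ge> 0\<close> into an integral of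
  \<open>D x / \<bar>x\<bar>\<close> against averages of \<open>P\<close> over \<open>x\<^sup>\<perp>\<close>. After rescaling these converge, as \<open>h \<rightarrow> 0\<close>, to a
  multiple of the length of the chord of \<open>K\<close> through \<open>x\<close>, which is at least \<open>2 \<bar>x\<bar>\<close> on \<open>K\<close> and at most
  \<open>2 \<bar>x\<bar>\<close> off \<open>K\<close>. Hence \<open>\<integral> D \<ge> 0\<close>. For \<open>n \<le> 4\<close> the kernel can be chosen so that the
  limiting constant is positive.

  \<^emph>\<open>Dimension at least five.\<close> Near a point \<open>e\<close> with \<open>f e > 0\<close> use coordinates \<open>t (e + \<rho> z)\<close>, \<open>z \<bottom> e\<close>, and let
  \<open>K\<close> be \<open>\<bar>t\<bar> \<le> T z = 1 - M \<bar>z\<bar>\<^bsup>2l\<^esup> - A \<bar>z\<bar>\<^sup>2\<close>. As the mean of \<open>(z \<bullet> u)\<^bsup>2l\<^esup>\<close> over the unit sphere of the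
  \<open>(n - 1)\<close>-dimensional space \<open>e\<^sup>\<perp>\<close> is smaller than \<open>1 / (2 l + 1)\<close>, \<open>M\<close> fits strictly in between; the upper bound makes
  \<open>K\<close> convex, and the lower one gives a function \<open>g\<close> with positive integrals over all hyperplanes
  but \<open>\<integral> T g < 0\<close>. Perturbing \<open>T\<close> by a small multiple of \<open>g\<close>, weighted to compensate for \<open>f\<close>, enlarges every
  section and decreases the measure.
\<close>

section \<open>Lebesgue measure on subspaces\<close>

text \<open>Why four. A Gaussian ridge averaged over directions decays like 1/r on the (n -
  1)-dimensional hyperplane orthogonal to x. This is not integrable, so after rescaling it does not
  concentrate on the line through x. One difference of such kernels gains two powers of r, enough
  for n = 2 and n = 3; n = 4 takes a second difference. On the other side, the mean of the 2l-th
  power of a coordinate over the unit sphere of an (n - 1)-dimensional space is exactly 1 / (2 l +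
  1) for n = 4 and smaller for n > 4; this gap is the room for the counterexample.

  The density f is merely continuous and may vanish away from some small set. Hence the
  counterexample varies only in a double cone around a point where f is positive. The weight that
  corrects for f is a polynomial approximation of a continuous function, so that the perturbation
  has bounded second differences, which the term with A absorbs. A factor \<theta> > 1 in both
  integral inequalities pays for the approximation errors.\<close>

definition orthonormal :: "'a::euclidean_space set \<Rightarrow> bool" where
  "orthonormal B \<longleftrightarrow> pairwise orthogonal B \<and> (\<forall>b\<in>B. norm b = 1)"

text \<open>\<open>subspace_lborel\<close> for an explicit basis, so that integrals can be computed
  by induction on the basis. \<open>onb_lborel_unique\<close> then removes the choice hidden in
  \<open>subspace_lborel\<close>.\<close>

definition onb_lborel :: "'a::euclidean_space set \<Rightarrow> 'a measure" where
  "onb_lborel B = distr (\<Pi>\<^sub>M b\<in>B. (lborel :: real measure)) borel (\<lambda>c. \<Sum>b\<in>B. c b *\<^sub>R b)"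

lemma orthonormal_finite: "orthonormal B \<Longrightarrow> finite B"
  unfolding orthonormal_def by (metis pairwise_orthogonal_imp_finite)

lemma orthonormal_subset: "orthonormal B \<Longrightarrow> A \<subseteq> B \<Longrightarrow> orthonormal A"
  unfolding orthonormal_def by (meson pairwise_subset subsetD)

lemma orthonormal_insert_orthogonal_span:
  assumes "orthonormal (insert e B)" "e \<notin> B" "x \<in> span B"
  shows "x \<bullet> e = 0"
proof -
  have "\<And>b. b \<in> B \<Longrightarrow> orthogonal e b"
    using assms(1,2) unfolding orthonormal_def pairwise_def by auto
  then show ?thesis
    using orthogonal_to_span[OF assms(3)] by (simp add: orthogonal_def inner_commute)
qed

lemma sets_onb_lborel [simp, measurable_cong]: "sets (onb_lborel B) = sets borel"
  by (simp add: onb_lborel_def)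

lemma space_onb_lborel [simp]: "space (onb_lborel B) = UNIV"
  by (simp add: onb_lborel_def)

interpretation lborel_prod: product_sigma_finite "\<lambda>_::'a. lborel :: real measure" ..

lemma coords_measurable [measurable]:
  "(\<lambda>c. \<Sum>b\<in>B. c b *\<^sub>R (b::'a::euclidean_space)) \<in> (\<Pi>\<^sub>M b\<in>B. (lborel :: real measure)) \<rightarrow>\<^sub>M borel"
  by (intro borel_measurable_sum) measurable

lemma nn_integral_onb_empty:
  assumes [measurable]: "F \<in> borel_measurable borel"
  shows "(\<integral>\<^sup>+x. F x \<partial>onb_lborel {}) = F 0"
  unfolding onb_lborel_def by (subst nn_integral_distr) (auto simp: PiM_empty nn_integral_count_space_finite)

text \<open>Tonelli for one more basis vector: the induction step of the integral formulas on
  subspaces.\<close>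

lemma nn_integral_onb_insert:
  assumes [simp]: "finite B" "e \<notin> B" and [measurable]: "F \<in> borel_measurable borel"
  shows "(\<integral>\<^sup>+x. F x \<partial>onb_lborel (insert e B)) = (\<integral>\<^sup>+t. (\<integral>\<^sup>+x. F (x + t *\<^sub>R e) \<partial>onb_lborel B) \<partial>lborel)"
proof -
  have "(\<integral>\<^sup>+x. F x \<partial>onb_lborel (insert e B))
      = (\<integral>\<^sup>+c. F (\<Sum>b\<in>insert e B. c b *\<^sub>R b) \<partial>(\<Pi>\<^sub>M b\<in>insert e B. (lborel :: real measure)))"
    unfolding onb_lborel_def by (rule nn_integral_distr) measurable
  also have "\<dots> = (\<integral>\<^sup>+t. (\<integral>\<^sup>+c. F (\<Sum>b\<in>insert e B. (c(e := t)) b *\<^sub>R b) \<partial>(\<Pi>\<^sub>M b\<in>B. (lborel :: real measure))) \<partial>lborel)"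
    by (rule lborel_prod.product_nn_integral_insert_rev) (auto intro!: measurable_compose[OF coords_measurable])
  also have "\<dots> = (\<integral>\<^sup>+t. (\<integral>\<^sup>+c. F ((\<Sum>b\<in>B. c b *\<^sub>R b) + t *\<^sub>R e) \<partial>(\<Pi>\<^sub>M b\<in>B. (lborel :: real measure))) \<partial>lborel)"
  proof (intro nn_integral_cong arg_cong[where f=F])
    fix t c
    have "(\<Sum>b\<in>B. (c(e := t)) b *\<^sub>R b) = (\<Sum>b\<in>B. c b *\<^sub>R b)"
      by (rule sum.cong) (use assms(2) in auto)
    then show "(\<Sum>b\<in>insert e B. (c(e := t)) b *\<^sub>R b) = (\<Sum>b\<in>B. c b *\<^sub>R b) + t *\<^sub>R e"
      by (simp add: add.commute)
  qed
  also have "\<dots> = (\<integral>\<^sup>+t. (\<integral>\<^sup>+x. F (x + t *\<^sub>R e) \<partial>onb_lborel B) \<partial>lborel)"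
    unfolding onb_lborel_def by (subst nn_integral_distr) (auto intro: nn_integral_cong)
  finally show ?thesis .
qed

lemma AE_onb_span:
  assumes "finite (B::'a::euclidean_space set)"
  shows "AE x in onb_lborel B. x \<in> span B"
proof -
  have "{x\<in>space borel. x \<in> span B} \<in> sets borel"
    using closed_span[of B] by (simp add: borel_closed)
  moreover have "(\<Sum>b\<in>B. c b *\<^sub>R b) \<in> span B" for c
    by (intro span_sum span_scale span_base)
  ultimately show ?thesis
    unfolding onb_lborel_def by (subst AE_distr_iff) auto
qed

section \<open>Gaussian integrals and invariance in orthonormal coordinates\<close>

lemma nn_integral_gaussian:
  assumes "a > 0"
  shows "(\<integral>\<^sup>+t. ennreal (exp (- a * t\<^sup>2 / 2)) \<partial>lborel) = ennreal (sqrt (2 * pi / a))"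
proof -
  define \<sigma> where "\<sigma> = 1 / sqrt a"
  have s: "\<sigma> > 0" "\<sigma>\<^sup>2 = 1 / a" using assms by (auto simp: \<sigma>_def power_divide)
  have "(\<integral>\<^sup>+t. ennreal (normal_density 0 \<sigma> t) \<partial>lborel) = 1"
    using integrable_normal_density[OF s(1), of 0] integral_normal_density[OF s(1), of 0] s(1)
    by (subst nn_integral_eq_integral) auto
  moreover have "ennreal (exp (- a * t\<^sup>2 / 2)) = ennreal (sqrt (2 * pi / a)) * ennreal (normal_density 0 \<sigma> t)" for t
    using assms s by (simp add: normal_density_def ennreal_mult[symmetric] mult.commute)
  ultimately show ?thesis
    by (simp add: nn_integral_cmult)
qed

lemma norm_orthonormal_insert:
  assumes "orthonormal (insert e B)" "e \<notin> B" "x \<in> span B"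
  shows "(norm (x + t *\<^sub>R e))\<^sup>2 = (norm x)\<^sup>2 + t\<^sup>2"
proof -
  have "norm e = 1" using assms(1) by (simp add: orthonormal_def)
  then show ?thesis
    using orthonormal_insert_orthogonal_span[OF assms]
    by (simp add: power2_norm_eq_inner inner_add_left inner_add_right inner_commute)
       (metis norm_eq_1 mult.right_neutral power2_eq_square)
qed

lemma nn_integral_onb_gaussian:
  assumes "orthonormal (B::'a::euclidean_space set)" "a > 0"
  shows "(\<integral>\<^sup>+x. ennreal (exp (- a * (norm x)\<^sup>2 / 2)) \<partial>onb_lborel B) = ennreal (sqrt (2 * pi / a) ^ card B)"
  using orthonormal_finite[OF assms(1)] assms(1)
proof (induction B)
  case empty
  then show ?case by (simp add: nn_integral_onb_empty)
next
  case (insert e B)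
  have "(\<integral>\<^sup>+x. ennreal (exp (- a * (norm x)\<^sup>2 / 2)) \<partial>onb_lborel (insert e B))
    = (\<integral>\<^sup>+t. (\<integral>\<^sup>+x. ennreal (exp (- a * (norm (x + t *\<^sub>R e))\<^sup>2 / 2)) \<partial>onb_lborel B) \<partial>lborel)"
    using insert by (subst nn_integral_onb_insert) auto
  also have "\<dots> = (\<integral>\<^sup>+t. (\<integral>\<^sup>+x. ennreal (exp (- a * t\<^sup>2 / 2)) * ennreal (exp (- a * (norm x)\<^sup>2 / 2)) \<partial>onb_lborel B) \<partial>lborel)"
  proof (rule nn_integral_cong, rule nn_integral_cong_AE)
    fix t :: real
    show "AE x in onb_lborel B. ennreal (exp (- a * (norm (x + t *\<^sub>R e))\<^sup>2 / 2))
       = ennreal (exp (- a * t\<^sup>2 / 2)) * ennreal (exp (- a * (norm x)\<^sup>2 / 2))"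
      using AE_onb_span[OF insert.hyps(1)]
    proof eventually_elim
      case (elim x)
      have "- a * (norm (x + t *\<^sub>R e))\<^sup>2 / 2 = - a * t\<^sup>2 / 2 + - a * (norm x)\<^sup>2 / 2"
        unfolding norm_orthonormal_insert[OF insert.prems insert.hyps(2) elim] by (simp add: field_simps)
      then show ?case
        by (simp only: exp_add ennreal_mult[OF exp_ge_zero exp_ge_zero])
    qed
  qed
  also have "\<dots> = ennreal (sqrt (2 * pi / a)) * ennreal (sqrt (2 * pi / a) ^ card B)"
    using insert.IH orthonormal_subset[OF insert.prems]
    by (simp add: nn_integral_cmult nn_integral_multc nn_integral_gaussian[OF assms(2), simplified] subset_insertI)
  also have "\<dots> = ennreal (sqrt (2 * pi / a) ^ card (insert e B))"
    using insert.hyps assms(2) by (simp add: ennreal_mult[symmetric])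
  finally show ?case .
qed

text \<open>A ball lies under a multiple of a Gaussian with known integral, which bounds its measure
  without computing volumes.\<close>

lemma sigma_finite_onb_lborel:
  assumes "orthonormal (B::'a::euclidean_space set)"
  shows "sigma_finite_measure (onb_lborel B)"
proof
  let ?A = "range (\<lambda>n. cball (0::'a) (real n))"
  have "emeasure (onb_lborel B) (cball 0 (real n)) \<noteq> \<infinity>" for n
  proof -
    have "emeasure (onb_lborel B) (cball 0 (real n)) = (\<integral>\<^sup>+x. indicator (cball 0 (real n)) x \<partial>onb_lborel B)"
      by simp
    also have "\<dots> \<le> (\<integral>\<^sup>+x. ennreal (exp ((real n)\<^sup>2 / 2)) * ennreal (exp (- 1 * (norm x)\<^sup>2 / 2)) \<partial>onb_lborel B)"
    proof (rule nn_integral_mono)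
      fix x :: 'a
      show "indicator (cball 0 (real n)) x \<le> ennreal (exp ((real n)\<^sup>2 / 2)) * ennreal (exp (- 1 * (norm x)\<^sup>2 / 2))"
      proof (cases "norm x \<le> real n")
        case True
        then have "(norm x)\<^sup>2 \<le> (real n)\<^sup>2" by (simp add: power_mono)
        then have "1 \<le> exp ((real n)\<^sup>2 / 2 + - 1 * (norm x)\<^sup>2 / 2)"
          by simp
        then show ?thesis using True
          by (simp only: ennreal_mult[symmetric, OF exp_ge_zero exp_ge_zero] exp_add[symmetric]) simp
      qed simp
    qed
    also have "\<dots> < \<infinity>"
      by (subst nn_integral_cmult) (simp_all only: nn_integral_onb_gaussian[OF assms zero_less_one], simp_all add: ennreal_mult_less_top)
    finally show ?thesis by simp
  qed
  moreover have "\<exists>i. x \<in> cball 0 (real i)" for x :: 'a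
    using real_arch_simple[of "norm x"] by simp
  ultimately show "\<exists>A. countable A \<and> A \<subseteq> sets (onb_lborel B) \<and> \<Union>A = space (onb_lborel B) \<and> (\<forall>a\<in>A. emeasure (onb_lborel B) a \<noteq> \<infinity>)"
    by (intro exI[of _ ?A]) auto
qed

lemma nn_integral_onb_translate:
  assumes "orthonormal (B::'a::euclidean_space set)" "a \<in> span B" "F \<in> borel_measurable borel"
  shows "(\<integral>\<^sup>+x. F (x + a) \<partial>onb_lborel B) = (\<integral>\<^sup>+x. F x \<partial>onb_lborel B)"
  using orthonormal_finite[OF assms(1)] assms
proof (induction B arbitrary: a F)
  case empty
  then show ?case by (simp add: nn_integral_onb_empty)
next
  case (insert e B)
  note [measurable] = insert.prems(3)
  have B: "orthonormal B" using orthonormal_subset[OF insert.prems(1)] by auto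
  interpret sigma_finite_measure "onb_lborel B" using sigma_finite_onb_lborel[OF B] .
  obtain k where k: "a - k *\<^sub>R e \<in> span B" using insert.prems(2) by (auto simp: span_insert)
  define G where "G t = (\<integral>\<^sup>+x. F (x + t *\<^sub>R e) \<partial>onb_lborel B)" for t
  have [measurable]: "G \<in> borel_measurable borel" unfolding G_def by measurable
  have "(\<integral>\<^sup>+x. F (x + a) \<partial>onb_lborel (insert e B))
      = (\<integral>\<^sup>+t. (\<integral>\<^sup>+x. F ((x + (a - k *\<^sub>R e)) + (t + k) *\<^sub>R e) \<partial>onb_lborel B) \<partial>lborel)"
    by (subst nn_integral_onb_insert) (use insert.hyps in \<open>auto simp: algebra_simps\<close>)
  also have "\<dots> = (\<integral>\<^sup>+t. G (t + k) \<partial>lborel)"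
    unfolding G_def by (intro nn_integral_cong insert.IH[OF B k]) measurable
  also have "\<dots> = (\<integral>\<^sup>+t. G t \<partial>lborel)"
    using nn_integral_real_affine[of G 1 k] by (simp add: add.commute)
  also have "\<dots> = (\<integral>\<^sup>+x. F x \<partial>onb_lborel (insert e B))"
    unfolding G_def by (subst nn_integral_onb_insert) (use insert in auto)
  finally show ?case .
qed

lemma nn_integral_onb_scale:
  assumes "orthonormal (B::'a::euclidean_space set)" "F \<in> borel_measurable borel" "h \<noteq> 0"
  shows "(\<integral>\<^sup>+x. F x \<partial>onb_lborel B) = ennreal (\<bar>h\<bar> ^ card B) * (\<integral>\<^sup>+x. F (h *\<^sub>R x) \<partial>onb_lborel B)"
  using orthonormal_finite[OF assms(1)] assms(1,2)
proof (induction B arbitrary: F)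
  case empty
  then show ?case by (simp add: nn_integral_onb_empty)
next
  case (insert e B)
  note [measurable] = insert.prems(2)
  have B: "orthonormal B" using orthonormal_subset[OF insert.prems(1)] by auto
  interpret sigma_finite_measure "onb_lborel B" using sigma_finite_onb_lborel[OF B] .
  define G where "G t = (\<integral>\<^sup>+x. F (x + t *\<^sub>R e) \<partial>onb_lborel B)" for t
  have [measurable]: "G \<in> borel_measurable borel" unfolding G_def by measurable
  have "(\<integral>\<^sup>+x. F x \<partial>onb_lborel (insert e B)) = (\<integral>\<^sup>+t. G t \<partial>lborel)"
    unfolding G_def by (subst nn_integral_onb_insert) (use insert in auto)
  also have "\<dots> = ennreal \<bar>h\<bar> * (\<integral>\<^sup>+t. G (h * t) \<partial>lborel)"
    using nn_integral_real_affine[of G h 0] assms(3) by simp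
  also have "\<dots> = ennreal \<bar>h\<bar> * (\<integral>\<^sup>+t. ennreal (\<bar>h\<bar> ^ card B) * (\<integral>\<^sup>+x. F (h *\<^sub>R x + (h * t) *\<^sub>R e) \<partial>onb_lborel B) \<partial>lborel)"
    unfolding G_def by (intro arg_cong2[where f="(*)"] nn_integral_cong refl insert.IH[OF B]) measurable
  also have "\<dots> = ennreal (\<bar>h\<bar> ^ card (insert e B)) * (\<integral>\<^sup>+t. (\<integral>\<^sup>+x. F (h *\<^sub>R (x + t *\<^sub>R e)) \<partial>onb_lborel B) \<partial>lborel)"
    using insert.hyps by (simp add: nn_integral_cmult algebra_simps ennreal_mult)
  also have "\<dots> = ennreal (\<bar>h\<bar> ^ card (insert e B)) * (\<integral>\<^sup>+x. F (h *\<^sub>R x) \<partial>onb_lborel (insert e B))"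
    by (subst nn_integral_onb_insert) (use insert in auto)
  finally show ?case .
qed

text \<open>Two translation-invariant measures are proportional, by computing
  \<open>\<integral>\<integral> G(x) F(y + x)\<close> in both orders; the Gaussian fixes the constant.\<close>

lemma onb_lborel_unique:
  assumes B: "orthonormal (B::'a::euclidean_space set)" and C: "orthonormal C" and span: "span B = span C"
  shows "onb_lborel B = onb_lborel C"
proof (rule measure_eqI)
  fix Y assume "Y \<in> sets (onb_lborel B)"
  then have [measurable]: "Y \<in> sets borel" by simp
  interpret MB: sigma_finite_measure "onb_lborel B" using sigma_finite_onb_lborel[OF B] .
  interpret MC: sigma_finite_measure "onb_lborel C" using sigma_finite_onb_lborel[OF C] .
  interpret pair_sigma_finite "onb_lborel B" "onb_lborel C" ..
  have card: "card B = card C"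
    using B C span dim_eq_card_independent[of B] dim_eq_card_independent[of C]
      pairwise_orthogonal_independent[of B] pairwise_orthogonal_independent[of C]
    unfolding orthonormal_def by (metis dim_span norm_zero zero_neq_one)
  define G where "G x = ennreal (exp (- 1 * (norm (x::'a))\<^sup>2 / 2))" for x
  define g where "g = ennreal (sqrt (2 * pi / 1) ^ card B)"
  have [measurable]: "G \<in> borel_measurable borel" unfolding G_def by measurable
  have GB: "(\<integral>\<^sup>+x. G x \<partial>onb_lborel B) = g" and GC: "(\<integral>\<^sup>+x. G x \<partial>onb_lborel C) = g"
    unfolding G_def g_def using nn_integral_onb_gaussian[OF B, of 1] nn_integral_onb_gaussian[OF C, of 1] card by auto
  have "g * emeasure (onb_lborel C) Y
     = (\<integral>\<^sup>+x. G x * (\<integral>\<^sup>+y. indicator Y y \<partial>onb_lborel C) \<partial>onb_lborel B)"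
    by (simp add: nn_integral_multc GB)
  also have "\<dots> = (\<integral>\<^sup>+x. (\<integral>\<^sup>+y. G x * indicator Y (y + x) \<partial>onb_lborel C) \<partial>onb_lborel B)"
  proof (rule nn_integral_cong_AE, use AE_onb_span[OF orthonormal_finite[OF B]] in eventually_elim)
    fix x assume "x \<in> span B"
    then show "G x * (\<integral>\<^sup>+y. indicator Y y \<partial>onb_lborel C) = (\<integral>\<^sup>+y. G x * indicator Y (y + x) \<partial>onb_lborel C)"
      by (subst nn_integral_onb_translate[OF C, symmetric, of x]) (auto simp: span nn_integral_cmult)
  qed
  also have "\<dots> = (\<integral>\<^sup>+y. (\<integral>\<^sup>+x. G x * indicator Y (y + x) \<partial>onb_lborel B) \<partial>onb_lborel C)"
    by (rule Fubini'[symmetric]) measurable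
  also have "\<dots> = (\<integral>\<^sup>+y. (\<integral>\<^sup>+x. G (x - y) * indicator Y x \<partial>onb_lborel B) \<partial>onb_lborel C)"
  proof (rule nn_integral_cong_AE, use AE_onb_span[OF orthonormal_finite[OF C]] in eventually_elim)
    fix y assume "y \<in> span C"
    then show "(\<integral>\<^sup>+x. G x * indicator Y (y + x) \<partial>onb_lborel B) = (\<integral>\<^sup>+x. G (x - y) * indicator Y x \<partial>onb_lborel B)"
      using nn_integral_onb_translate[OF B, of y "\<lambda>x. G (x - y) * indicator Y x"] by (simp add: span add.commute)
  qed
  also have "\<dots> = (\<integral>\<^sup>+x. (\<integral>\<^sup>+y. G (x - y) * indicator Y x \<partial>onb_lborel C) \<partial>onb_lborel B)"
    by (rule Fubini') measurable
  also have "\<dots> = (\<integral>\<^sup>+x. g * indicator Y x \<partial>onb_lborel B)"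
  proof (rule nn_integral_cong_AE, use AE_onb_span[OF orthonormal_finite[OF B]] in eventually_elim)
    fix x assume x: "x \<in> span B"
    have "(\<integral>\<^sup>+y. G (x - y) \<partial>onb_lborel C) = (\<integral>\<^sup>+y. G (y - x) \<partial>onb_lborel C)"
      by (simp add: G_def norm_minus_commute)
    also have "\<dots> = g"
      using nn_integral_onb_translate[OF C, of "-x" G] x by (simp add: span span_neg GC)
    finally show "(\<integral>\<^sup>+y. G (x - y) * indicator Y x \<partial>onb_lborel C) = g * indicator Y x"
      by (simp add: nn_integral_multc)
  qed
  also have "\<dots> = g * emeasure (onb_lborel B) Y"
    by (simp add: nn_integral_cmult)
  finally show "emeasure (onb_lborel B) Y = emeasure (onb_lborel C) Y"
    by (simp add: g_def ennreal_mult_cancel_left)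
qed simp

section \<open>Passage from bases to subspaces\<close>

lemma orthonormal_basis_of_iff: "orthonormal_basis_of S B \<longleftrightarrow> orthonormal B \<and> span B = S"
  unfolding orthonormal_basis_of_def orthonormal_def using span_superset[of B] by auto

lemma orthonormal_basis_obtain:
  assumes "subspace S"
  obtains B where "orthonormal B" "span B = S" "card B = dim S"
proof -
  obtain B where B: "orthonormal B" "span B = S"
    using orthonormal_basis_of_exists[OF assms] by (auto simp: orthonormal_basis_of_iff)
  then have "independent B"
    unfolding orthonormal_def by (intro pairwise_orthogonal_independent) auto
  then have "card B = dim S" using B(2) by (metis dim_eq_card_independent dim_span)
  with B that show ?thesis by blast
qed

lemma subspace_lborel_onb:
  assumes "orthonormal B" "span B = S"
  shows "subspace_lborel S = onb_lborel B"
proof -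
  define C where "C = (SOME B. orthonormal_basis_of S B)"
  have "orthonormal_basis_of S C"
    unfolding C_def by (rule someI[of _ B]) (use assms in \<open>simp add: orthonormal_basis_of_iff\<close>)
  then have C: "orthonormal C" "span C = S" by (simp_all add: orthonormal_basis_of_iff)
  have "subspace_lborel S = onb_lborel C"
    unfolding subspace_lborel_def Let_def onb_lborel_def C_def ..
  also have "\<dots> = onb_lborel B"
    by (rule onb_lborel_unique[OF C(1) assms(1)]) (simp add: C(2) assms(2))
  finally show ?thesis .
qed

lemma subspace_lborel_UNIV: "subspace_lborel (UNIV::'a::euclidean_space set) = lborel"
proof -
  have "orthonormal (Basis :: 'a set)"
    unfolding orthonormal_def pairwise_def orthogonal_def by (auto simp: inner_not_same_Basis)
  then have "subspace_lborel (UNIV::'a set) = onb_lborel Basis"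
    by (rule subspace_lborel_onb) (rule span_Basis)
  also have "\<dots> = lborel"
    unfolding onb_lborel_def by (rule lborel_eq[symmetric])
  finally show ?thesis .
qed

lemma sets_subspace_lborel [simp, measurable_cong]: "sets (subspace_lborel S) = sets borel"
  by (simp add: subspace_lborel_def Let_def)

lemma space_subspace_lborel [simp]: "space (subspace_lborel S) = UNIV"
  by (simp add: subspace_lborel_def Let_def)

lemma sigma_finite_subspace_lborel:
  assumes "subspace S"
  shows "sigma_finite_measure (subspace_lborel S)"
proof -
  obtain B where B: "orthonormal B" "span B = S" "card B = dim S"
    using orthonormal_basis_obtain[OF assms] .
  show ?thesis
    using sigma_finite_onb_lborel[OF B(1)] by (simp add: subspace_lborel_onb[OF B(1,2)])
qed

lemma AE_subspace_lborel:
  assumes "subspace S"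
  shows "AE x in subspace_lborel S. x \<in> S"
proof -
  obtain B where B: "orthonormal B" "span B = S" "card B = dim S"
    using orthonormal_basis_obtain[OF assms] .
  show ?thesis
    using AE_onb_span[OF orthonormal_finite[OF B(1)]] B(2) by (simp only: subspace_lborel_onb[OF B(1,2)])
qed

lemma nn_integral_subspace_translate:
  assumes "subspace S" "a \<in> S" "F \<in> borel_measurable borel"
  shows "(\<integral>\<^sup>+x. F (x + a) \<partial>subspace_lborel S) = (\<integral>\<^sup>+x. F x \<partial>subspace_lborel S)"
proof -
  obtain B where B: "orthonormal B" "span B = S" "card B = dim S"
    using orthonormal_basis_obtain[OF assms(1)] .
  show ?thesis
    using nn_integral_onb_translate[OF B(1)] assms B by (simp add: subspace_lborel_onb[OF B(1,2)])
qed

lemma nn_integral_subspace_scale: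
  assumes "subspace S" "F \<in> borel_measurable borel" "h \<noteq> 0"
  shows "(\<integral>\<^sup>+x. F x \<partial>subspace_lborel S) = ennreal (\<bar>h\<bar> ^ dim S) * (\<integral>\<^sup>+x. F (h *\<^sub>R x) \<partial>subspace_lborel S)"
proof -
  obtain B where B: "orthonormal B" "span B = S" "card B = dim S"
    using orthonormal_basis_obtain[OF assms(1)] .
  show ?thesis
    unfolding subspace_lborel_onb[OF B(1,2)] B(3)[symmetric] by (rule nn_integral_onb_scale[OF B(1) assms(2,3)])
qed

lemma nn_integral_subspace_gaussian:
  assumes "subspace (S::'a::euclidean_space set)" "a > 0"
  shows "(\<integral>\<^sup>+x. ennreal (exp (- a * (norm x)\<^sup>2 / 2)) \<partial>subspace_lborel S) = ennreal (sqrt (2 * pi / a) ^ dim S)"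
proof -
  obtain B where B: "orthonormal B" "span B = S" "card B = dim S"
    using orthonormal_basis_obtain[OF assms(1)] .
  show ?thesis
    using nn_integral_onb_gaussian[OF B(1)] assms B by (simp add: subspace_lborel_onb[OF B(1,2)])
qed

section \<open>Hyperplanes and iterated integration\<close>

lemma subspace_hyperplane_perp [simp]: "subspace (hyperplane_perp e)"
  unfolding hyperplane_perp_def by (rule subspace_hyperplane)

lemma hyperplane_perp_scaleR: "c \<noteq> 0 \<Longrightarrow> hyperplane_perp (c *\<^sub>R e) = hyperplane_perp e"
  by (simp add: hyperplane_perp_def)

lemma closed_hyperplane_perp [simp]: "closed (hyperplane_perp e)"
  unfolding hyperplane_perp_def by (rule closed_hyperplane)

lemma onb_of_hyperplane_section:
  assumes S: "subspace S" and e: "e \<in> S" "norm e = 1"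
    and B: "orthonormal B" "span B = S \<inter> hyperplane_perp e"
  shows "orthonormal (insert e B)" "e \<notin> B" "span (insert e B) = S"
proof -
  have BS: "b \<in> S \<inter> hyperplane_perp e" if "b \<in> B" for b
    using that B(2) span_base by blast
  have "e \<bullet> e = 1" using e(2) by (simp add: norm_eq_1)
  then show "e \<notin> B" using BS[of e] by (auto simp: hyperplane_perp_def)
  show "orthonormal (insert e B)"
    using B(1) e(2) BS unfolding orthonormal_def
    by (auto simp: pairwise_insert orthogonal_def hyperplane_perp_def inner_commute)
  show "span (insert e B) = S"
  proof
    show "span (insert e B) \<subseteq> S"
      using S e(1) BS by (intro span_minimal) auto
    show "S \<subseteq> span (insert e B)"
    proof
      fix x assume "x \<in> S"
      then have "x - (x \<bullet> e) *\<^sub>R e \<in> span B"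
        using S e(1) \<open>e \<bullet> e = 1\<close> unfolding B(2)
        by (auto simp: hyperplane_perp_def inner_diff_right inner_commute subspace_diff subspace_scale)
      then show "x \<in> span (insert e B)" by (auto simp: span_insert)
    qed
  qed
qed

lemma dim_hyperplane_section:
  assumes S: "subspace S" and e: "e \<in> S" "norm e = 1"
  shows "dim S = Suc (dim (S \<inter> hyperplane_perp e))"
proof -
  have sub: "subspace (S \<inter> hyperplane_perp e)" by (rule subspace_inter[OF S subspace_hyperplane_perp])
  obtain B where B: "orthonormal B" "span B = S \<inter> hyperplane_perp e" "card B = dim (S \<inter> hyperplane_perp e)"
    using orthonormal_basis_obtain[OF sub] by metis
  note * = onb_of_hyperplane_section[OF S e B(1,2)]
  have "independent (insert e B)"
    using *(1) unfolding orthonormal_def by (intro pairwise_orthogonal_independent) auto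
  then have "dim S = card (insert e B)" by (metis "*"(3) dim_eq_card_independent dim_span)
  then show ?thesis using B(3) *(2) orthonormal_finite[OF B(1)] by simp
qed

lemma nn_integral_subspace_split:
  assumes S: "subspace S" and e: "e \<in> S" "norm e = 1" and F: "F \<in> borel_measurable borel"
  shows "(\<integral>\<^sup>+x. F x \<partial>subspace_lborel S)
       = (\<integral>\<^sup>+t. (\<integral>\<^sup>+x. F (x + t *\<^sub>R e) \<partial>subspace_lborel (S \<inter> hyperplane_perp e)) \<partial>lborel)"
proof -
  have sub: "subspace (S \<inter> hyperplane_perp e)" by (rule subspace_inter[OF S subspace_hyperplane_perp])
  obtain B where B: "orthonormal B" "span B = S \<inter> hyperplane_perp e"
    using orthonormal_basis_obtain[OF sub] by metis
  note * = onb_of_hyperplane_section[OF S e B]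
  show ?thesis
    unfolding subspace_lborel_onb[OF *(1,3)] subspace_lborel_onb[OF B]
    by (rule nn_integral_onb_insert) (use F *(2) orthonormal_finite[OF B(1)] in auto)
qed

lemma nn_integral_lborel_split:
  assumes "norm e = 1" and "F \<in> borel_measurable borel"
  shows "(\<integral>\<^sup>+x. F x \<partial>lborel) = (\<integral>\<^sup>+t. (\<integral>\<^sup>+x. F (x + t *\<^sub>R e) \<partial>subspace_lborel (hyperplane_perp e)) \<partial>lborel)"
  using nn_integral_subspace_split[of UNIV e F] assms by (simp add: subspace_lborel_UNIV)

text \<open>In orthonormal coordinates the iterated integral of a radial function sees only the
  number of coordinates. This weak form of rotation invariance makes the constant of the kernel the
  same for every hyperplane.\<close>

lemma nn_integral_radial_unique:
  assumes "subspace (S::'a::euclidean_space set)" "subspace (S'::'a set)" "dim S = dim S'"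
    and "F \<in> borel_measurable borel"
  shows "(\<integral>\<^sup>+x. F (norm x) \<partial>subspace_lborel S) = (\<integral>\<^sup>+x. F (norm x) \<partial>subspace_lborel S')"
proof -
  \<comment> \<open>The induction runs over all \<open>F\<close> at once: splitting off a coordinate
    \<open>t\<close> turns \<open>F r\<close> into
    \<open>F (sqrt (r\<^sup>2 + t\<^sup>2))\<close>.\<close>
  have "\<exists>c. \<forall>B::'a set. orthonormal B \<longrightarrow> card B = k \<longrightarrow> (\<integral>\<^sup>+x. F (norm x) \<partial>onb_lborel B) = c"
    if "F \<in> borel_measurable borel" for k and F :: "real \<Rightarrow> ennreal"
    using that
  proof (induction k arbitrary: F)
    case 0
    note [measurable] = 0
    show ?case
    proof (intro exI allI impI)
      fix B :: "'a set" assume "orthonormal B" "card B = 0"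
      then have "B = {}" using orthonormal_finite[of B] by simp
      then show "(\<integral>\<^sup>+x. F (norm x) \<partial>onb_lborel B) = F 0"
        by (simp add: nn_integral_onb_empty)
    qed
  next
    case (Suc k)
    note [measurable] = Suc.prems
    have "\<forall>t. \<exists>c. \<forall>B::'a set. orthonormal B \<longrightarrow> card B = k \<longrightarrow>
        (\<integral>\<^sup>+x. F (sqrt ((norm x)\<^sup>2 + t\<^sup>2)) \<partial>onb_lborel B) = c"
    proof
      fix t
      show "\<exists>c. \<forall>B::'a set. orthonormal B \<longrightarrow> card B = k \<longrightarrow>
        (\<integral>\<^sup>+x. F (sqrt ((norm x)\<^sup>2 + t\<^sup>2)) \<partial>onb_lborel B) = c"
        using Suc.IH[of "\<lambda>r. F (sqrt (r\<^sup>2 + t\<^sup>2))"] by simp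
    qed
    then obtain c where c: "\<And>t B. orthonormal (B::'a set) \<Longrightarrow> card B = k \<Longrightarrow>
        (\<integral>\<^sup>+x. F (sqrt ((norm x)\<^sup>2 + t\<^sup>2)) \<partial>onb_lborel B) = c t"
      by metis
    show ?case
    proof (intro exI allI impI)
      fix C :: "'a set" assume C: "orthonormal C" "card C = Suc k"
      then obtain e B where eB: "C = insert e B" "e \<notin> B" "card B = k" "finite B"
        by (metis card_Suc_eq card.infinite nat.distinct(1) finite_insert)
      have B: "orthonormal B" using C eB orthonormal_subset by blast
      have "(\<integral>\<^sup>+x. F (norm x) \<partial>onb_lborel C) = (\<integral>\<^sup>+t. (\<integral>\<^sup>+x. F (norm (x + t *\<^sub>R e)) \<partial>onb_lborel B) \<partial>lborel)"
        unfolding eB by (rule nn_integral_onb_insert) (use eB in auto)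
      also have "\<dots> = (\<integral>\<^sup>+t. c t \<partial>lborel)"
      proof (rule nn_integral_cong)
        fix t :: real
        have "(\<integral>\<^sup>+x. F (norm (x + t *\<^sub>R e)) \<partial>onb_lborel B) = (\<integral>\<^sup>+x. F (sqrt ((norm x)\<^sup>2 + t\<^sup>2)) \<partial>onb_lborel B)"
        proof (rule nn_integral_cong_AE, use AE_onb_span[OF eB(4)] in eventually_elim)
          fix x assume "x \<in> span B"
          then show "F (norm (x + t *\<^sub>R e)) = F (sqrt ((norm x)\<^sup>2 + t\<^sup>2))"
            using norm_orthonormal_insert[of e B x t] C eB by (metis norm_ge_zero real_sqrt_unique)
        qed
        then show "(\<integral>\<^sup>+x. F (norm (x + t *\<^sub>R e)) \<partial>onb_lborel B) = c t"
          using c[OF B eB(3)] by simp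
      qed
      finally show "(\<integral>\<^sup>+x. F (norm x) \<partial>onb_lborel C) = (\<integral>\<^sup>+t. c t \<partial>lborel)" .
    qed
  qed
  then obtain c where c: "\<And>B::'a set. orthonormal B \<Longrightarrow> card B = dim S \<Longrightarrow> (\<integral>\<^sup>+x. F (norm x) \<partial>onb_lborel B) = c"
    using assms(4) by metis
  obtain B B' where B: "orthonormal B" "span B = S" "card B = dim S"
    and B': "orthonormal B'" "span B' = S'" "card B' = dim S'"
    using orthonormal_basis_obtain[OF assms(1)] orthonormal_basis_obtain[OF assms(2)] by metis
  show ?thesis
    using c[OF B(1,3)] c[OF B'(1)] B'(3) assms(3)
    by (simp add: subspace_lborel_onb[OF B(1,2)] subspace_lborel_onb[OF B'(1,2)])
qed

text \<open>The factor is the Jacobian of the projection along \<open>e\<close>. Thickening the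
  hyperplane to the slab \<open>0 \<le> x \<bullet> \<xi> \<le> 1\<close> exposes it as the length,
  in the parameter \<open>t\<close>, of the segment in which a line parallel to \<open>e\<close>
  meets the slab, so that Tonelli and translation invariance suffice.\<close>

lemma nn_integral_hyperplane_graph:
  fixes \<xi> e :: "'a::euclidean_space"
  assumes \<xi>: "norm \<xi> = 1" and e: "norm e = 1" and nz: "\<xi> \<bullet> e \<noteq> 0"
    and [measurable]: "F \<in> borel_measurable borel"
  shows "(\<integral>\<^sup>+x. F x \<partial>subspace_lborel (hyperplane_perp \<xi>)) =
     ennreal (1 / \<bar>\<xi> \<bullet> e\<bar>) * (\<integral>\<^sup>+x. F (x - ((x \<bullet> \<xi>) / (\<xi> \<bullet> e)) *\<^sub>R e) \<partial>subspace_lborel (hyperplane_perp e))"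
proof -
  \<comment> \<open>both sides equal the integral of \<open>G\<close>, split along \<open>\<xi>\<close> and along \<open>e\<close>\<close>
  define G where "G x = F (x - ((x \<bullet> \<xi>) / (\<xi> \<bullet> e)) *\<^sub>R e) * indicator {0..1} (x \<bullet> \<xi>)" for x
  have [measurable]: "G \<in> borel_measurable borel" unfolding G_def by measurable
  have \<xi>1: "\<xi> \<bullet> \<xi> = 1" and e1: "e \<bullet> e = 1" using \<xi> e by (auto simp: norm_eq_1)
  have "(\<integral>\<^sup>+x. G x \<partial>lborel) = (\<integral>\<^sup>+s. (\<integral>\<^sup>+x. G (x + s *\<^sub>R \<xi>) \<partial>subspace_lborel (hyperplane_perp \<xi>)) \<partial>lborel)"
    by (rule nn_integral_lborel_split[OF \<xi>]) measurable
  also have "\<dots> = (\<integral>\<^sup>+s. (\<integral>\<^sup>+x. F x \<partial>subspace_lborel (hyperplane_perp \<xi>)) * indicator {0..1} (s::real) \<partial>lborel)"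
  proof (rule nn_integral_cong, goal_cases)
    case (1 s)
    define a where "a = s *\<^sub>R (\<xi> - (1 / (\<xi> \<bullet> e)) *\<^sub>R e)"
    have a: "a \<in> hyperplane_perp \<xi>"
      using nz \<xi>1 by (simp add: a_def hyperplane_perp_def inner_diff_right)
    have "(\<integral>\<^sup>+x. G (x + s *\<^sub>R \<xi>) \<partial>subspace_lborel (hyperplane_perp \<xi>))
        = (\<integral>\<^sup>+x. F (x + a) * indicator {0..1} s \<partial>subspace_lborel (hyperplane_perp \<xi>))"
    proof (rule nn_integral_cong_AE, use AE_subspace_lborel[OF subspace_hyperplane_perp] in eventually_elim)
      fix x assume "x \<in> hyperplane_perp \<xi>"
      then have "x \<bullet> \<xi> = 0" by (simp add: hyperplane_perp_def inner_commute)
      then have "(x + s *\<^sub>R \<xi>) \<bullet> \<xi> = s" using \<xi>1 by (simp add: inner_add_left)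
      then show "G (x + s *\<^sub>R \<xi>) = F (x + a) * indicator {0..1} s"
        by (simp add: G_def a_def algebra_simps)
    qed
    also have "\<dots> = (\<integral>\<^sup>+x. F x \<partial>subspace_lborel (hyperplane_perp \<xi>)) * indicator {0..1} s"
      using nn_integral_subspace_translate[OF _ a, of F] by (simp add: nn_integral_multc)
    finally show ?case .
  qed
  also have "\<dots> = (\<integral>\<^sup>+x. F x \<partial>subspace_lborel (hyperplane_perp \<xi>))"
    by (simp add: nn_integral_cmult)
  finally have 1: "(\<integral>\<^sup>+x. G x \<partial>lborel) = (\<integral>\<^sup>+x. F x \<partial>subspace_lborel (hyperplane_perp \<xi>))" .

  interpret H: sigma_finite_measure "subspace_lborel (hyperplane_perp e)"
    by (intro sigma_finite_subspace_lborel) simp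
  interpret pair_sigma_finite lborel "subspace_lborel (hyperplane_perp e)" ..
  have "(\<integral>\<^sup>+x. G x \<partial>lborel) = (\<integral>\<^sup>+t. (\<integral>\<^sup>+x. G (x + t *\<^sub>R e) \<partial>subspace_lborel (hyperplane_perp e)) \<partial>lborel)"
    by (rule nn_integral_lborel_split[OF e]) measurable
  also have "\<dots> = (\<integral>\<^sup>+x. (\<integral>\<^sup>+t. G (x + t *\<^sub>R e) \<partial>lborel) \<partial>subspace_lborel (hyperplane_perp e))"
    by (rule Fubini'[symmetric]) measurable
  also have "\<dots> = (\<integral>\<^sup>+x. F (x - ((x \<bullet> \<xi>) / (\<xi> \<bullet> e)) *\<^sub>R e) * ennreal (1 / \<bar>\<xi> \<bullet> e\<bar>) \<partial>subspace_lborel (hyperplane_perp e))"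
  proof (rule nn_integral_cong)
    fix x :: 'a
    define c where "c = \<xi> \<bullet> e"
    have "c \<noteq> 0" using nz by (simp add: c_def)
    have "(\<integral>\<^sup>+t. G (x + t *\<^sub>R e) \<partial>lborel)
       = (\<integral>\<^sup>+t. F (x - ((x \<bullet> \<xi>) / c) *\<^sub>R e) * indicator {0..1} (x \<bullet> \<xi> + c * t) \<partial>lborel)"
      using \<open>c \<noteq> 0\<close> by (intro nn_integral_cong)
        (simp add: G_def c_def inner_add_left inner_commute[of e \<xi>] add_divide_distrib algebra_simps)
    also have "\<dots> = F (x - ((x \<bullet> \<xi>) / c) *\<^sub>R e) * (\<integral>\<^sup>+t. indicator {0..1} (x \<bullet> \<xi> + c * t) \<partial>lborel)"
      by (rule nn_integral_cmult) measurable
    also have "(\<integral>\<^sup>+t. indicator {0..1} (x \<bullet> \<xi> + c * t) \<partial>lborel) = ennreal (1 / \<bar>c\<bar>)"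
    proof -
      have "(1::ennreal) = (\<integral>\<^sup>+t. indicator {0..1::real} t \<partial>lborel)" by simp
      also have "\<dots> = ennreal \<bar>c\<bar> * (\<integral>\<^sup>+t. indicator {0..1} (x \<bullet> \<xi> + c * t) \<partial>lborel)"
        by (rule nn_integral_real_affine[OF _ \<open>c \<noteq> 0\<close>]) measurable
      finally have "ennreal (1 / \<bar>c\<bar>) * 1 = ennreal (1 / \<bar>c\<bar>) * (ennreal \<bar>c\<bar> * (\<integral>\<^sup>+t. indicator {0..1} (x \<bullet> \<xi> + c * t) \<partial>lborel))"
        by simp
      then show ?thesis using \<open>c \<noteq> 0\<close>
        by (simp add: mult.assoc[symmetric] ennreal_mult[symmetric])
    qed
    finally show "(\<integral>\<^sup>+t. G (x + t *\<^sub>R e) \<partial>lborel)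
      = F (x - ((x \<bullet> \<xi>) / (\<xi> \<bullet> e)) *\<^sub>R e) * ennreal (1 / \<bar>\<xi> \<bullet> e\<bar>)" by (simp add: c_def)
  qed
  also have "\<dots> = ennreal (1 / \<bar>\<xi> \<bullet> e\<bar>) * (\<integral>\<^sup>+x. F (x - ((x \<bullet> \<xi>) / (\<xi> \<bullet> e)) *\<^sub>R e) \<partial>subspace_lborel (hyperplane_perp e))"
    by (subst nn_integral_multc) (auto simp: mult.commute)
  finally show ?thesis using 1 by simp
qed

section \<open>Incident pairs of points and hyperplanes\<close>

lemma AE_subspace_lborel_inner_nonzero:
  assumes S: "subspace (S::'a::euclidean_space set)" and v: "v \<in> S" "v \<noteq> 0"
  shows "AE x in subspace_lborel S. x \<bullet> v \<noteq> 0"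
proof -
  define e where "e = v /\<^sub>R norm v"
  have e: "e \<in> S" "norm e = 1" using v S by (auto simp: e_def subspace_scale)
  have "(\<integral>\<^sup>+x. indicator {x. x \<bullet> e = 0} x \<partial>subspace_lborel S)
     = (\<integral>\<^sup>+t. (\<integral>\<^sup>+x. indicator {x. x \<bullet> e = 0} (x + t *\<^sub>R e) \<partial>subspace_lborel (S \<inter> hyperplane_perp e)) \<partial>lborel)"
    by (rule nn_integral_subspace_split[OF S e]) measurable
  also have "\<dots> = (\<integral>\<^sup>+t. (\<integral>\<^sup>+x. indicator {0} (t::real) \<partial>subspace_lborel (S \<inter> hyperplane_perp e)) \<partial>lborel)"
  proof (rule nn_integral_cong, rule nn_integral_cong_AE)
    fix t :: real
    have "subspace (S \<inter> hyperplane_perp e)" by (rule subspace_inter[OF S subspace_hyperplane_perp])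
    from AE_subspace_lborel[OF this]
    show "AE x in subspace_lborel (S \<inter> hyperplane_perp e). indicator {x. x \<bullet> e = 0} (x + t *\<^sub>R e) = (indicator {0} t :: ennreal)"
    proof eventually_elim
      case (elim x)
      then have "x \<bullet> e = 0" by (simp add: hyperplane_perp_def inner_commute)
      moreover have "e \<bullet> e = 1" using e(2) by (simp add: norm_eq_1)
      ultimately show ?case by (simp add: inner_add_left indicator_def)
    qed
  qed
  also have "\<dots> = 0"
    by (simp add: nn_integral_multc mult.commute)
  finally have "emeasure (subspace_lborel S) {x. x \<bullet> e = 0} = 0"
    by (simp add: nn_integral_indicator)
  then have "AE x in subspace_lborel S. x \<notin> {x. x \<bullet> e = 0}"
    by (intro AE_not_in) (auto simp: null_sets_def)
  then show ?thesis
    by (rule AE_mp) (use v in \<open>auto simp: e_def\<close>)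
qed

lemma AE_lborel_inner_nonzero:
  assumes "v \<noteq> (0::'a::euclidean_space)"
  shows "AE x in lborel. x \<bullet> v \<noteq> 0"
  using AE_subspace_lborel_inner_nonzero[of UNIV v, OF subspace_UNIV UNIV_I assms]
  by (simp only: subspace_lborel_UNIV)

text \<open>Inversion invariance of \<open>ds / \<bar>s\<bar>\<close>, from its scaling invariance by computing
  \<open>\<integral>\<integral> g(s) V(t / s)\<close> in both orders.\<close>

lemma nn_integral_inverse_real:
  fixes V :: "real \<Rightarrow> ennreal"
  assumes [measurable]: "V \<in> borel_measurable borel" and "c \<noteq> 0"
  shows "(\<integral>\<^sup>+s. ennreal (1 / \<bar>s\<bar>) * V (c / s) \<partial>lborel) = (\<integral>\<^sup>+s. ennreal (1 / \<bar>s\<bar>) * V s \<partial>lborel)"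
proof -
  have scale: "(\<integral>\<^sup>+s. ennreal (1 / \<bar>s\<bar>) * U s \<partial>lborel) = (\<integral>\<^sup>+s. ennreal (1 / \<bar>s\<bar>) * U (k * s) \<partial>lborel)"
    if [measurable]: "U \<in> borel_measurable borel" and "k \<noteq> 0" for U k
  proof -
    have "(\<integral>\<^sup>+s. ennreal (1 / \<bar>s\<bar>) * U s \<partial>lborel) = ennreal \<bar>k\<bar> * (\<integral>\<^sup>+s. ennreal (1 / \<bar>k * s\<bar>) * U (k * s) \<partial>lborel)"
      using nn_integral_real_affine[of "\<lambda>s. ennreal (1 / \<bar>s\<bar>) * U s" k 0] \<open>k \<noteq> 0\<close> by simp
    also have "\<dots> = (\<integral>\<^sup>+s. ennreal (1 / \<bar>s\<bar>) * U (k * s) \<partial>lborel)"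
      using \<open>k \<noteq> 0\<close> by (subst nn_integral_cmult[symmetric])
        (auto simp: mult.assoc[symmetric] ennreal_mult[symmetric] abs_mult intro!: nn_integral_cong)
    finally show ?thesis .
  qed
  have nz: "AE s in lborel. s \<noteq> (0::real)" by (rule AE_lborel_singleton)
  define g :: "real \<Rightarrow> ennreal" where "g = indicator {1..2}"
  define \<gamma> where "\<gamma> = (\<integral>\<^sup>+s. ennreal (1 / \<bar>s\<bar>) * g s \<partial>lborel)"
  have [measurable]: "g \<in> borel_measurable borel" by (simp add: g_def)
  have "\<gamma> \<le> (\<integral>\<^sup>+s. indicator {1..2::real} s \<partial>lborel)"
    unfolding \<gamma>_def g_def by (intro nn_integral_mono) (auto simp: indicator_def)
  then have "\<gamma> \<noteq> top" by (auto simp: top_unique)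
  have "(\<integral>\<^sup>+s. ennreal (1/2) * indicator {1..2::real} s \<partial>lborel) \<le> \<gamma>"
    unfolding \<gamma>_def g_def
  proof (rule nn_integral_mono)
    fix s :: real
    show "ennreal (1/2) * indicator {1..2} s \<le> ennreal (1 / \<bar>s\<bar>) * indicator {1..2} s"
    proof (cases "s \<in> {1..2}")
      case True
      then have "1/2 \<le> 1 / \<bar>s\<bar>" by (simp add: field_simps)
      then have "ennreal (1/2) \<le> ennreal (1 / \<bar>s\<bar>)" by (rule ennreal_leI)
      then show ?thesis using True by (simp only: indicator_simps(1) mult_1_right)
    qed simp
  qed
  then have "\<gamma> \<noteq> 0" by (auto simp: nn_integral_cmult)
  let ?m = "\<lambda>s::real. ennreal (1 / \<bar>s\<bar>)"
  have "\<gamma> * (\<integral>\<^sup>+t. ?m t * V t \<partial>lborel) = (\<integral>\<^sup>+s. ?m s * g s * (\<integral>\<^sup>+t. ?m t * V t \<partial>lborel) \<partial>lborel)"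
    unfolding \<gamma>_def by (rule nn_integral_multc[symmetric]) measurable
  also have "\<dots> = (\<integral>\<^sup>+s. (\<integral>\<^sup>+t. ?m s * g s * (?m t * V (t / s)) \<partial>lborel) \<partial>lborel)"
  proof (rule nn_integral_cong_AE, use nz in eventually_elim)
    case (elim s)
    then show ?case
      using scale[of V "1 / s"] by (subst nn_integral_cmult) auto
  qed
  also have "\<dots> = (\<integral>\<^sup>+t. (\<integral>\<^sup>+s. ?m s * g s * (?m t * V (t / s)) \<partial>lborel) \<partial>lborel)"
    by (rule lborel_pair.Fubini') measurable
  also have "\<dots> = (\<integral>\<^sup>+t. (\<integral>\<^sup>+s. ?m s * g (t * s) * (?m t * V (1 / s)) \<partial>lborel) \<partial>lborel)"
  proof (rule nn_integral_cong_AE, use nz in eventually_elim)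
    case (elim t)
    then show ?case
      using scale[of "\<lambda>s. g s * (?m t * V (t / s))" t] by (simp add: mult.assoc)
  qed
  also have "\<dots> = (\<integral>\<^sup>+s. (\<integral>\<^sup>+t. ?m s * g (t * s) * (?m t * V (1 / s)) \<partial>lborel) \<partial>lborel)"
    by (rule lborel_pair.Fubini') measurable
  also have "\<dots> = (\<integral>\<^sup>+s. (?m s * V (1 / s)) * \<gamma> \<partial>lborel)"
  proof (rule nn_integral_cong_AE, use nz in eventually_elim)
    case (elim s)
    then have \<gamma>: "\<gamma> = (\<integral>\<^sup>+t. ?m t * g (s * t) \<partial>lborel)"
      unfolding \<gamma>_def by (intro scale) measurable
    have "(?m s * V (1 / s)) * \<gamma> = (\<integral>\<^sup>+t. (?m s * V (1 / s)) * (?m t * g (s * t)) \<partial>lborel)"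
      unfolding \<gamma> by (rule nn_integral_cmult[symmetric]) measurable
    also have "\<dots> = (\<integral>\<^sup>+t. ?m s * g (t * s) * (?m t * V (1 / s)) \<partial>lborel)"
      by (rule nn_integral_cong) (simp add: ac_simps)
    finally show ?case ..
  qed
  also have "\<dots> = \<gamma> * (\<integral>\<^sup>+s. ?m s * V (1 / s) \<partial>lborel)"
    by (subst nn_integral_multc) (auto simp: mult.commute)
  finally have inv: "(\<integral>\<^sup>+t. ?m t * V t \<partial>lborel) = (\<integral>\<^sup>+s. ?m s * V (1 / s) \<partial>lborel)"
    using \<open>\<gamma> \<noteq> top\<close> \<open>\<gamma> \<noteq> 0\<close> by (simp add: ennreal_mult_cancel_left)
  show ?thesis
    unfolding inv using scale[of "\<lambda>s. V (1 / s)" "1 / c"] \<open>c \<noteq> 0\<close> by simp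
qed

text \<open>With the weight \<open>1 / norm \<xi>\<close> both sides scale alike in the normal
  vector, so normals may range over the whole space instead of the unit sphere.\<close>

lemma nn_integral_hyperplane_graph':
  fixes \<xi> e :: "'a::euclidean_space"
  assumes e: "norm e = 1" and nz: "\<xi> \<bullet> e \<noteq> 0" and [measurable]: "F \<in> borel_measurable borel"
  shows "ennreal (1 / norm \<xi>) * (\<integral>\<^sup>+x. F x \<partial>subspace_lborel (hyperplane_perp \<xi>)) =
     ennreal (1 / \<bar>\<xi> \<bullet> e\<bar>) * (\<integral>\<^sup>+x. F (x - ((x \<bullet> \<xi>) / (\<xi> \<bullet> e)) *\<^sub>R e) \<partial>subspace_lborel (hyperplane_perp e))"
proof -
  have \<xi>: "\<xi> \<noteq> 0" using nz by auto
  define u where "u = \<xi> /\<^sub>R norm \<xi>"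
  have u: "norm u = 1" "u \<bullet> e \<noteq> 0" using \<xi> nz by (auto simp: u_def)
  have "hyperplane_perp \<xi> = hyperplane_perp u"
    using \<xi> by (simp add: u_def hyperplane_perp_scaleR)
  moreover have "(x \<bullet> u) / (u \<bullet> e) = (x \<bullet> \<xi>) / (\<xi> \<bullet> e)" for x
    using \<xi> by (simp add: u_def divide_simps)
  moreover have "ennreal (1 / norm \<xi>) * ennreal (1 / \<bar>u \<bullet> e\<bar>) = ennreal (1 / \<bar>\<xi> \<bullet> e\<bar>)"
    using \<xi> by (simp add: u_def ennreal_mult[symmetric] abs_mult)
  ultimately show ?thesis
    using nn_integral_hyperplane_graph[OF u(1) e u(2), of F] by (simp add: mult.assoc[symmetric])
qed

text \<open>Integrating over all normals gives points and normals the same role. Write them as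
  \<open>x + b *\<^sub>R e\<close> and \<open>\<xi> + a *\<^sub>R e\<close> with \<open>x\<close>,
  \<open>\<xi>\<close> orthogonal to \<open>e\<close>. They are incident iff
  \<open>a * b = - (x \<bullet> \<xi>)\<close>; one side integrates with da / |a|, the other with db
  / |b|, and the inversion \<open>b = - (x \<bullet> \<xi>) / a\<close> exchanges the two. Dimension
  at least 2 makes \<open>x \<bullet> \<xi>\<close> nonzero almost everywhere.\<close>

lemma nn_integral_incidence:
  fixes \<Phi> :: "'a::euclidean_space \<times> 'a \<Rightarrow> ennreal"
  assumes dim: "DIM('a) \<ge> 2" and [measurable]: "\<Phi> \<in> borel_measurable (borel \<Otimes>\<^sub>M borel)"
  shows "(\<integral>\<^sup>+\<xi>. ennreal (1 / norm \<xi>) * (\<integral>\<^sup>+x. \<Phi> (x, \<xi>) \<partial>subspace_lborel (hyperplane_perp \<xi>)) \<partial>lborel)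
       = (\<integral>\<^sup>+x. ennreal (1 / norm x) * (\<integral>\<^sup>+\<xi>. \<Phi> (x, \<xi>) \<partial>subspace_lborel (hyperplane_perp x)) \<partial>lborel)"
proof -
  obtain e :: 'a where e: "norm e = 1" using vector_choose_size[of 1] by auto
  then have e0: "e \<noteq> 0" and ee: "e \<bullet> e = 1" by (auto simp: norm_eq_1)
  define H where "H = subspace_lborel (hyperplane_perp e)"
  have [measurable_cong]: "sets H = sets borel" by (simp add: H_def)
  interpret H: sigma_finite_measure H unfolding H_def by (rule sigma_finite_subspace_lborel) simp
  interpret HH: pair_sigma_finite H H ..
  interpret LH: pair_sigma_finite lborel H ..
  have AEH: "AE x in H. x \<bullet> e = 0"
    using AE_subspace_lborel[of "hyperplane_perp e", OF subspace_hyperplane_perp]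
    unfolding H_def by eventually_elim (simp add: hyperplane_perp_def inner_commute)
  \<comment> \<open>The left side in these coordinates. The right side is the same formula for the
    transposed function.\<close>
  have half: "(\<integral>\<^sup>+\<xi>. ennreal (1 / norm \<xi>) * (\<integral>\<^sup>+x. U (x, \<xi>) \<partial>subspace_lborel (hyperplane_perp \<xi>)) \<partial>lborel)
     = (\<integral>\<^sup>+\<xi>. (\<integral>\<^sup>+x. (\<integral>\<^sup>+a. ennreal (1 / \<bar>a\<bar>) * U (x + (- (x \<bullet> \<xi>) / a) *\<^sub>R e, \<xi> + a *\<^sub>R e) \<partial>lborel) \<partial>H) \<partial>H)"
    if [measurable]: "U \<in> borel_measurable (borel \<Otimes>\<^sub>M borel)" for U :: "'a \<times> 'a \<Rightarrow> ennreal"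
  proof -
    define G where "G \<xi> = ennreal (1 / \<bar>\<xi> \<bullet> e\<bar>) * (\<integral>\<^sup>+x. U (x - ((x \<bullet> \<xi>) / (\<xi> \<bullet> e)) *\<^sub>R e, \<xi>) \<partial>H)" for \<xi>
    have [measurable]: "G \<in> borel_measurable borel" unfolding G_def by measurable
    have "(\<integral>\<^sup>+\<xi>. ennreal (1 / norm \<xi>) * (\<integral>\<^sup>+x. U (x, \<xi>) \<partial>subspace_lborel (hyperplane_perp \<xi>)) \<partial>lborel)
       = (\<integral>\<^sup>+\<xi>. G \<xi> \<partial>lborel)"
    proof (rule nn_integral_cong_AE, use AE_lborel_inner_nonzero[OF e0] in eventually_elim)
      case (elim \<xi>)
      then show ?case
        unfolding G_def H_def by (intro nn_integral_hyperplane_graph'[OF e]) measurable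
    qed
    also have "\<dots> = (\<integral>\<^sup>+a. (\<integral>\<^sup>+\<xi>. G (\<xi> + a *\<^sub>R e) \<partial>H) \<partial>lborel)"
      unfolding H_def by (rule nn_integral_lborel_split[OF e]) measurable
    also have "\<dots> = (\<integral>\<^sup>+\<xi>. (\<integral>\<^sup>+a. G (\<xi> + a *\<^sub>R e) \<partial>lborel) \<partial>H)"
      by (rule LH.Fubini'[symmetric]) measurable
    also have "\<dots> = (\<integral>\<^sup>+\<xi>. (\<integral>\<^sup>+a. (\<integral>\<^sup>+x. ennreal (1 / \<bar>a\<bar>) * U (x + (- (x \<bullet> \<xi>) / a) *\<^sub>R e, \<xi> + a *\<^sub>R e) \<partial>H) \<partial>lborel) \<partial>H)"
    proof (rule nn_integral_cong_AE, use AEH in eventually_elim)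
      case (elim \<xi>)
      have *: "(\<xi> + a *\<^sub>R e) \<bullet> e = a" for a using elim ee by (simp add: inner_add_left)
      have "G (\<xi> + a *\<^sub>R e) = (\<integral>\<^sup>+x. ennreal (1 / \<bar>a\<bar>) * U (x + (- (x \<bullet> \<xi>) / a) *\<^sub>R e, \<xi> + a *\<^sub>R e) \<partial>H)" for a
      proof -
        have "G (\<xi> + a *\<^sub>R e) = ennreal (1 / \<bar>a\<bar>) * (\<integral>\<^sup>+x. U (x - ((x \<bullet> (\<xi> + a *\<^sub>R e)) / a) *\<^sub>R e, \<xi> + a *\<^sub>R e) \<partial>H)"
          unfolding G_def * ..
        also have "\<dots> = ennreal (1 / \<bar>a\<bar>) * (\<integral>\<^sup>+x. U (x + (- (x \<bullet> \<xi>) / a) *\<^sub>R e, \<xi> + a *\<^sub>R e) \<partial>H)"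
        proof (rule arg_cong[where f="\<lambda>z. _ * z"], rule nn_integral_cong_AE, use AEH in eventually_elim)
          case (elim x)
          then show ?case by (simp add: inner_add_right)
        qed
        also have "\<dots> = (\<integral>\<^sup>+x. ennreal (1 / \<bar>a\<bar>) * U (x + (- (x \<bullet> \<xi>) / a) *\<^sub>R e, \<xi> + a *\<^sub>R e) \<partial>H)"
          by (rule nn_integral_cmult[symmetric]) measurable
        finally show ?thesis .
      qed
      then show ?case by simp
    qed
    also have "\<dots> = (\<integral>\<^sup>+\<xi>. (\<integral>\<^sup>+x. (\<integral>\<^sup>+a. ennreal (1 / \<bar>a\<bar>) * U (x + (- (x \<bullet> \<xi>) / a) *\<^sub>R e, \<xi> + a *\<^sub>R e) \<partial>lborel) \<partial>H) \<partial>H)"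
      by (intro nn_integral_cong LH.Fubini'[symmetric]) measurable
    finally show ?thesis .
  qed
  have nzH: "AE \<xi> in H. AE x in H. x \<bullet> \<xi> \<noteq> 0"
  proof -
    have "dim (hyperplane_perp e) \<ge> 1"
      using dim_hyperplane_section[of UNIV e] e dim by simp
    then obtain v where "v \<in> hyperplane_perp e" "v \<noteq> 0"
      by (metis dim_eq_0 le_0_eq subsetI singleton_iff zero_neq_one)
    then have "AE \<xi> in H. \<xi> \<bullet> v \<noteq> 0"
      unfolding H_def by (intro AE_subspace_lborel_inner_nonzero) auto
    with AE_subspace_lborel[of "hyperplane_perp e", folded H_def, OF subspace_hyperplane_perp] show ?thesis
    proof eventually_elim
      case (elim \<xi>)
      then have "\<xi> \<noteq> 0" by auto
      then show ?case
        unfolding H_def by (intro AE_subspace_lborel_inner_nonzero) (use elim in auto)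
    qed
  qed
  have "(\<integral>\<^sup>+\<xi>. ennreal (1 / norm \<xi>) * (\<integral>\<^sup>+x. \<Phi> (x, \<xi>) \<partial>subspace_lborel (hyperplane_perp \<xi>)) \<partial>lborel)
     = (\<integral>\<^sup>+\<xi>. (\<integral>\<^sup>+x. (\<integral>\<^sup>+a. ennreal (1 / \<bar>a\<bar>) * \<Phi> (x + (- (x \<bullet> \<xi>) / a) *\<^sub>R e, \<xi> + a *\<^sub>R e) \<partial>lborel) \<partial>H) \<partial>H)"
    by (rule half) measurable
  also have "\<dots> = (\<integral>\<^sup>+\<xi>. (\<integral>\<^sup>+x. (\<integral>\<^sup>+b. ennreal (1 / \<bar>b\<bar>) * \<Phi> (x + b *\<^sub>R e, \<xi> + (- (\<xi> \<bullet> x) / b) *\<^sub>R e) \<partial>lborel) \<partial>H) \<partial>H)"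
  proof (rule nn_integral_cong_AE, use nzH in eventually_elim)
    case (elim \<xi>)
    show ?case
    proof (rule nn_integral_cong_AE, use elim in eventually_elim)
      case (elim x)
      define c where "c = - (x \<bullet> \<xi>)"
      have c: "c \<noteq> 0" "- (\<xi> \<bullet> x) = c" using elim by (auto simp: c_def inner_commute)
      define V where "V b = \<Phi> (x + b *\<^sub>R e, \<xi> + (c / b) *\<^sub>R e)" for b
      have [measurable]: "V \<in> borel_measurable borel" unfolding V_def by measurable
      have "(\<integral>\<^sup>+a. ennreal (1 / \<bar>a\<bar>) * \<Phi> (x + (c / a) *\<^sub>R e, \<xi> + a *\<^sub>R e) \<partial>lborel)
         = (\<integral>\<^sup>+a. ennreal (1 / \<bar>a\<bar>) * V (c / a) \<partial>lborel)"
      proof (rule nn_integral_cong_AE, use AE_lborel_singleton[of "0::real"] in eventually_elim)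
        case (elim a)
        then show ?case using c(1) by (simp add: V_def)
      qed
      also have "\<dots> = (\<integral>\<^sup>+b. ennreal (1 / \<bar>b\<bar>) * V b \<partial>lborel)"
        by (rule nn_integral_inverse_real) (use c in auto)
      finally show ?case unfolding c(2) c_def[symmetric] V_def .
    qed
  qed
  also have "\<dots> = (\<integral>\<^sup>+x. (\<integral>\<^sup>+\<xi>. (\<integral>\<^sup>+b. ennreal (1 / \<bar>b\<bar>) * \<Phi> (x + b *\<^sub>R e, \<xi> + (- (\<xi> \<bullet> x) / b) *\<^sub>R e) \<partial>lborel) \<partial>H) \<partial>H)"
    by (rule HH.Fubini') measurable
  also have "\<dots> = (\<integral>\<^sup>+x. ennreal (1 / norm x) * (\<integral>\<^sup>+\<xi>. \<Phi> (x, \<xi>) \<partial>subspace_lborel (hyperplane_perp x)) \<partial>lborel)"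
  proof -
    have "(\<lambda>z. \<Phi> (snd z, fst z)) \<in> borel_measurable (borel \<Otimes>\<^sub>M borel)" by measurable
    from half[OF this] show ?thesis by (simp only: fst_conv snd_conv)
  qed
  finally show ?thesis .
qed

section \<open>Prekopa-Leindler and symmetric slabs\<close>

text \<open>With \<open>a\<close> the maximum of \<open>X\<close> and \<open>b\<close> the minimum
  of \<open>Y\<close>, the half-size copies of \<open>X\<close> and \<open>Y\<close> formed by the
  midpoints with \<open>b\<close> and with \<open>a\<close> lie in \<open>C\<close> on the two sides
  of \<open>(a + b) / 2\<close>, hence share at most that point.\<close>

lemma emeasure_lborel_midpoint_sets_compact:
  fixes X Y C :: "real set"
  assumes X: "compact X" "X \<noteq> {}" and Y: "compact Y" "Y \<noteq> {}" and [measurable]: "C \<in> sets borel"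
    and mid: "\<And>x y. x \<in> X \<Longrightarrow> y \<in> Y \<Longrightarrow> (x + y) / 2 \<in> C"
  shows "emeasure lborel X + emeasure lborel Y \<le> 2 * emeasure lborel C"
proof -
  have [measurable]: "X \<in> sets borel" "Y \<in> sets borel" using X Y by (auto simp: borel_compact)
  obtain a where a: "a \<in> X" "\<And>x. x \<in> X \<Longrightarrow> x \<le> a" using compact_attains_sup[OF X] by auto
  obtain b where b: "b \<in> Y" "\<And>y. y \<in> Y \<Longrightarrow> b \<le> y" using compact_attains_inf[OF Y] by auto
  have half: "2 * emeasure lborel {c. 2 * c - d \<in> S} = emeasure lborel S"
    if [measurable]: "S \<in> sets borel" for S :: "real set" and d
    using nn_integral_real_affine[of "indicator S" 2 "-d"]
    by (simp add: nn_integral_indicator[symmetric] indicator_def[abs_def] del: nn_integral_indicator)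
  let ?U = "{c. 2 * c - b \<in> X}" and ?V = "{c. 2 * c - a \<in> Y}"
  have "?U \<inter> ?V \<subseteq> {(a + b) / 2}"
  proof
    fix c assume "c \<in> ?U \<inter> ?V"
    then have "2 * c - b \<le> a" "b \<le> 2 * c - a" using a b by auto
    then show "c \<in> {(a + b) / 2}" by auto
  qed
  then have "emeasure lborel (?U \<inter> ?V) = 0"
    using emeasure_mono[of "?U \<inter> ?V" "{(a + b) / 2}" lborel] by simp
  then have "emeasure lborel ?U + emeasure lborel ?V = emeasure lborel (?U \<union> ?V)"
    by (subst emeasure_Un_Int) auto
  also have "\<dots> \<le> emeasure lborel C"
  proof (rule emeasure_mono)
    show "?U \<union> ?V \<subseteq> C"
    proof
      fix c assume "c \<in> ?U \<union> ?V"
      then show "c \<in> C" using mid[of "2 * c - b" b] mid[of a "2 * c - a"] a b by auto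
    qed
  qed auto
  finally have "2 * (emeasure lborel ?U + emeasure lborel ?V) \<le> 2 * emeasure lborel C"
    by (rule mult_left_mono) simp
  then show ?thesis by (simp add: distrib_left half)
qed

lemma UN_cball_nat: "(\<Union>n. cball x (real n)) = UNIV"
proof -
  have "\<exists>n. y \<in> cball x (real n)" for y using real_arch_simple[of "dist x y"] by simp
  then show ?thesis by blast
qed

lemma emeasure_lborel_inner_compact:
  fixes X :: "real set"
  assumes [measurable]: "X \<in> sets borel" and x0: "x0 \<in> X" and c: "c < emeasure lborel X"
  obtains T where "compact T" "T \<noteq> {}" "T \<subseteq> X" "c < emeasure lborel T"
proof -
  have "(SUP n. emeasure lborel (X \<inter> cball 0 (real n))) = emeasure lborel (\<Union>n. X \<inter> cball 0 (real n))"
    by (rule SUP_emeasure_incseq) (auto simp: incseq_def)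
  also have "(\<Union>n. X \<inter> cball 0 (real n)) = X"
    using UN_cball_nat[of "0::real"] by blast
  finally have "c < (SUP n. emeasure lborel (X \<inter> cball 0 (real n)))" using c by simp
  then obtain n where n: "c < emeasure lborel (X \<inter> cball 0 (real n))"
    unfolding less_SUP_iff by blast
  define Z where "Z = X \<inter> cball 0 (real n)"
  have [measurable]: "Z \<in> sets borel" by (simp add: Z_def)
  have "emeasure lborel Z \<le> emeasure lborel (cball (0::real) (real n))"
    by (rule emeasure_mono) (auto simp: Z_def)
  then have Zfin: "emeasure lborel Z < \<infinity>"
    using emeasure_lborel_cball_finite by (rule order.strict_trans1)
  obtain e where e: "e > 0" "c + ennreal e < emeasure lborel Z"
  proof -
    obtain s where s: "emeasure lborel Z = ennreal s" "0 \<le> s"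
      using Zfin by (cases "emeasure lborel Z") auto
    obtain r where r: "c = ennreal r" "0 \<le> r"
      using n s unfolding Z_def[symmetric] by (cases c) auto
    have "r < s" using n r s unfolding Z_def[symmetric] by (simp add: ennreal_less_iff)
    have "c + ennreal ((s - r) / 2) = ennreal (r + (s - r) / 2)"
      using r \<open>r < s\<close> by (subst ennreal_plus) auto
    also have "\<dots> < emeasure lborel Z"
    proof -
      have "r + (s - r) / 2 < s" using \<open>r < s\<close> by (simp add: field_simps)
      then show ?thesis unfolding s(1) using r(2) \<open>r < s\<close> by (intro ennreal_lessI) auto
    qed
    finally have "c + ennreal ((s - r) / 2) < emeasure lborel Z" .
    with \<open>r < s\<close> show ?thesis by (intro that[of "(s - r) / 2"]) auto
  qed
  obtain T where T: "closed T" "T \<subseteq> Z" "emeasure lebesgue (Z - T) < ennreal e"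
  proof -
    have "Z \<in> sets lebesgue" using \<open>Z \<in> sets borel\<close> by (intro sets_completionI_sets) simp
    then show ?thesis by (rule sets_lebesgue_inner_closed[OF _ e(1)]) (rule that)
  qed
  have [measurable]: "T \<in> sets borel" using T(1) by (rule borel_closed)
  have "emeasure lborel Z \<le> emeasure lborel T + emeasure lborel (Z - T)"
    using emeasure_subadditive[of T lborel "Z - T"] T(2) by (auto simp: Un_absorb1)
  also have "\<dots> \<le> emeasure lborel T + ennreal e"
    using T(3) by (intro add_left_mono) auto
  finally have "c + ennreal e < emeasure lborel T + ennreal e"
    by (rule order.strict_trans2[OF e(2)])
  then have "ennreal e + c < ennreal e + emeasure lborel T" by (simp only: add.commute)
  then have "c < emeasure lborel T" by (simp add: ennreal_add_left_cancel_less)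
  then have "c < emeasure lborel (insert x0 T)"
    by (rule order.strict_trans2) (auto intro: emeasure_mono)
  moreover have "compact T"
    using T(1,2) bounded_subset[OF bounded_cball, of T 0 "real n"] by (auto simp: compact_eq_bounded_closed Z_def)
  ultimately show ?thesis
    using T(2) x0 by (intro that[of "insert x0 T"]) (auto simp: Z_def)
qed

lemma emeasure_lborel_midpoint_sets:
  fixes X Y C :: "real set"
  assumes [measurable]: "X \<in> sets borel" "Y \<in> sets borel" "C \<in> sets borel"
    and ne: "X \<noteq> {}" "Y \<noteq> {}"
    and mid: "\<And>x y. x \<in> X \<Longrightarrow> y \<in> Y \<Longrightarrow> (x + y) / 2 \<in> C"
  shows "emeasure lborel X + emeasure lborel Y \<le> 2 * emeasure lborel C"
proof -
  obtain x0 y0 where xy: "x0 \<in> X" "y0 \<in> Y" using ne by auto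
  have "c + d \<le> 2 * emeasure lborel C" if cd: "c < emeasure lborel X" "d < emeasure lborel Y" for c d
  proof -
    obtain S where S: "compact S" "S \<noteq> {}" "S \<subseteq> X" "c < emeasure lborel S"
      using emeasure_lborel_inner_compact[OF _ xy(1) cd(1)] by auto
    obtain T where T: "compact T" "T \<noteq> {}" "T \<subseteq> Y" "d < emeasure lborel T"
      using emeasure_lborel_inner_compact[OF _ xy(2) cd(2)] by auto
    have "c + d \<le> emeasure lborel S + emeasure lborel T"
      using S T by (intro add_mono) auto
    also have "\<dots> \<le> 2 * emeasure lborel C"
      using S T mid by (intro emeasure_lborel_midpoint_sets_compact) auto
    finally show ?thesis .
  qed
  note approx = this
  \<comment> \<open>A null set has no measure strictly below its own, so \<open>approx\<close> says
    nothing about it. Then a single point of the null set, paired with all of the other set, already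
    gives the bound.\<close>
  have zero: "emeasure lborel Z \<le> 2 * emeasure lborel C"
    if [measurable]: "Z \<in> sets borel" and z: "\<And>x. x \<in> Z \<Longrightarrow> (x + w) / 2 \<in> C" and ne: "z0 \<in> Z" for Z w z0
  proof (rule dense_le)
    fix c assume c: "c < emeasure lborel Z"
    obtain S where S: "compact S" "S \<noteq> {}" "S \<subseteq> Z" "c < emeasure lborel S"
      using emeasure_lborel_inner_compact[OF _ ne c] by auto
    then show "c \<le> 2 * emeasure lborel C"
      using emeasure_lborel_midpoint_sets_compact[of S "{w}" C] z by (auto simp: subset_eq)
  qed
  show ?thesis
  proof (cases "emeasure lborel X = 0 \<or> emeasure lborel Y = 0")
    case True
    then show ?thesis
      using zero[of X y0 x0] zero[of Y x0 y0] mid xy by (auto simp: add.commute[of _ x0])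
  next
    case False
    then have pos: "0 < emeasure lborel X" "0 < emeasure lborel Y" by (auto simp: zero_less_iff_neq_zero)
    consider "emeasure lborel X = top" | "emeasure lborel Y = top"
      | x y where "emeasure lborel X = ennreal x" "emeasure lborel Y = ennreal y" "x \<ge> 0" "y \<ge> 0"
      by (metis ennreal_cases)
    then show ?thesis
    proof cases
      case 1
      have "emeasure lborel X \<le> 2 * emeasure lborel C"
        by (rule dense_le) (use approx[OF _ pos(2)] in auto)
      then show ?thesis using 1 by (simp add: top_unique)
    next
      case 2
      have "emeasure lborel Y \<le> 2 * emeasure lborel C"
        by (rule dense_le) (use approx[OF pos(1)] in auto)
      then show ?thesis using 2 by (simp add: top_unique)
    next
      case 3
      show ?thesis
      proof (cases "2 * emeasure lborel C")
        case (real z)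
        have "x + y \<le> z"
        proof (rule field_le_epsilon)
          fix e :: real assume "e > 0"
          define d where "d = min (e/2) (min x y / 2)"
          have xy: "x > 0" "y > 0" using pos 3 by auto
          have d: "0 < d" "d < x" "d < y" "2 * d \<le> e" using \<open>e > 0\<close> xy by (auto simp: d_def)
          have "ennreal (x - d) + ennreal (y - d) \<le> 2 * emeasure lborel C"
            by (rule approx) (use 3 d in \<open>auto simp: ennreal_less_iff\<close>)
          then have "(x - d) + (y - d) \<le> z"
            using real d by (simp add: ennreal_plus[symmetric] del: ennreal_plus)
          then show "x + y \<le> z + e" using d by simp
        qed
        then show ?thesis using real 3 by (simp add: ennreal_plus[symmetric] del: ennreal_plus)
      qed simp
    qed
  qed
qed

section \<open>From sets on the line to functions on Euclidean space\<close>

lemma nn_integral_layers: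
  fixes f :: "real \<Rightarrow> ennreal"
  assumes [measurable]: "f \<in> borel_measurable borel" and a: "a > 0" and f: "\<And>x. f x \<le> ennreal a"
  shows "(\<integral>\<^sup>+x. f x \<partial>lborel)
    = ennreal a * (\<integral>\<^sup>+t. indicator {0<..<1} t * emeasure lborel {x. ennreal (t * a) < f x} \<partial>lborel)"
proof -
  have "(\<integral>\<^sup>+x. f x \<partial>lborel)
     = (\<integral>\<^sup>+x. ennreal a * (\<integral>\<^sup>+t. indicator {0<..<1} t * indicator {x. ennreal (t * a) < f x} x \<partial>lborel) \<partial>lborel)"
  proof (rule nn_integral_cong)
    fix x :: real
    obtain r where r: "f x = ennreal r" "0 \<le> r" "r \<le> a"
      using f[of x] a by (cases "f x") (auto simp: top_unique)
    have "(indicator {0<..<1} t * indicator {x. ennreal (t * a) < f x} x :: ennreal) = indicator {0<..<r / a} t" for t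
    proof (cases "0 < t")
      case True
      then have "ennreal (t * a) < f x \<longleftrightarrow> t < r / a"
        using r a by (simp add: ennreal_less_iff pos_less_divide_eq)
      moreover have "t < 1" if "t < r / a" using that r a by (simp add: pos_less_divide_eq) (smt (verit) mult_less_cancel_right2)
      ultimately show ?thesis using True by (auto simp: indicator_def)
    qed simp
    then have "(\<integral>\<^sup>+t. indicator {0<..<1} t * indicator {x. ennreal (t * a) < f x} x \<partial>lborel) = ennreal (r / a)"
      using r a by simp
    then show "f x = ennreal a * (\<integral>\<^sup>+t. indicator {0<..<1} t * indicator {x. ennreal (t * a) < f x} x \<partial>lborel)"
      using r a by (simp add: ennreal_mult[symmetric])
  qed
  also have "\<dots> = ennreal a * (\<integral>\<^sup>+x. (\<integral>\<^sup>+t. indicator {0<..<1} t * indicator {x. ennreal (t * a) < f x} x \<partial>lborel) \<partial>lborel)"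
    by (rule nn_integral_cmult) measurable
  also have "(\<integral>\<^sup>+x. (\<integral>\<^sup>+t. indicator {0<..<1} t * indicator {x. ennreal (t * a) < f x} x \<partial>lborel) \<partial>lborel)
      = (\<integral>\<^sup>+t. (\<integral>\<^sup>+x. indicator {0<..<1} t * indicator {x. ennreal (t * a) < f x} x \<partial>lborel) \<partial>lborel)"
    by (rule lborel_pair.Fubini') measurable
  also have "\<dots> = (\<integral>\<^sup>+t. indicator {0<..<1} t * emeasure lborel {x. ennreal (t * a) < f x} \<partial>lborel)"
    by (intro nn_integral_cong) (simp add: nn_integral_cmult)
  finally show ?thesis .
qed

lemma ennreal_mult_le_square_of_add:
  fixes u v w :: ennreal
  assumes "u + v \<le> 2 * w"
  shows "u * v \<le> w\<^sup>2"
proof (cases "w = top")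
  case True
  then show ?thesis by (simp add: power2_eq_square)
next
  case False
  then have "2 * w < top" by (simp add: ennreal_mult_less_top less_top)
  with assms have "u < top" "v < top" by (auto simp: less_top[symmetric] top_unique)
  with False obtain a b c where *: "u = ennreal a" "v = ennreal b" "w = ennreal c" "0 \<le> a" "0 \<le> b" "0 \<le> c"
    by (metis ennreal_cases less_irrefl)
  have "(2::ennreal) = ennreal 2" by simp
  with assms * have "a + b \<le> 2 * c"
    by (simp add: ennreal_plus[symmetric] ennreal_mult[symmetric] del: ennreal_plus ennreal_numeral)
  then have "(a + b)\<^sup>2 \<le> (2 * c)\<^sup>2" using * by (intro power_mono) auto
  moreover have "4 * (a * b) \<le> (a + b)\<^sup>2" using zero_le_power2[of "a - b"] by (simp add: power2_eq_square algebra_simps)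
  ultimately have "a * b \<le> c\<^sup>2" by (simp add: power_mult_distrib)
  then show ?thesis using * by (simp add: ennreal_mult[symmetric] ennreal_power)
qed

text \<open>Heights are measured relative to the suprema \<open>a\<close>, \<open>b\<close> of
  \<open>f\<close>, \<open>g\<close>, and to \<open>c = sqrt (a * b)\<close> for \<open>h\<close>.
  At every relative height \<open>t < 1\<close> the superlevel sets of \<open>f\<close> and
  \<open>g\<close> are nonempty and their midpoints lie in that of \<open>h\<close>, so the
  inequality for sets applies at each \<open>t\<close>. Integrating over \<open>t\<close> gives a
  bound on a sum, and the arithmetic-geometric mean inequality turns it into one on the
  product.\<close>

lemma prekopa_leindler_real_bounded:
  fixes f g h :: "real \<Rightarrow> ennreal"
  assumes [measurable]: "f \<in> borel_measurable borel" "g \<in> borel_measurable borel" "h \<in> borel_measurable borel"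
    and bd: "\<And>x. f x \<le> ennreal A" "\<And>x. g x \<le> ennreal A"
    and mid: "\<And>x y. f x * g y \<le> (h ((x + y) / 2))\<^sup>2"
  shows "(\<integral>\<^sup>+x. f x \<partial>lborel) * (\<integral>\<^sup>+x. g x \<partial>lborel) \<le> (\<integral>\<^sup>+x. h x \<partial>lborel)\<^sup>2"
proof (cases "(SUP x. f x) = 0 \<or> (SUP x. g x) = 0")
  case True
  then have "(\<forall>x. f x = 0) \<or> (\<forall>x. g x = 0)"
    by (metis SUP_upper UNIV_I le_zero_eq)
  then show ?thesis by auto
next
  case False
  have "(SUP x. f x) \<le> ennreal A" "(SUP x. g x) \<le> ennreal A" using bd by (auto intro: SUP_least)
  with False obtain a b where ab: "(SUP x. f x) = ennreal a" "(SUP x. g x) = ennreal b" "a > 0" "b > 0"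
    by (cases "SUP x. f x"; cases "SUP x. g x") (auto simp: top_unique less_le)
  define c where "c = sqrt (a * b)"
  have c: "c > 0" "c * c = a * b" using ab by (auto simp: c_def)
  have fa: "f x \<le> ennreal a" and gb: "g x \<le> ennreal b" for x using ab by (metis SUP_upper UNIV_I)+
  \<comment> \<open>Truncation at \<open>c\<close> provides the bound required by the layer formula
    and only lowers the right-hand side.\<close>
  define h' where "h' x = min (h x) (ennreal c)" for x
  have [measurable]: "h' \<in> borel_measurable borel" unfolding h'_def by measurable
  define lf where "lf t = indicator {0<..<1} t * emeasure lborel {x. ennreal (t * a) < f x}" for t
  define lg where "lg t = indicator {0<..<1} t * emeasure lborel {x. ennreal (t * b) < g x}" for t
  define lh where "lh t = indicator {0<..<1} t * emeasure lborel {x. ennreal (t * c) < h' x}" for t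
  have [measurable]: "lf \<in> borel_measurable borel" "lg \<in> borel_measurable borel" "lh \<in> borel_measurable borel"
    unfolding lf_def lg_def lh_def by measurable
  have le: "lf t + lg t \<le> 2 * lh t" for t
  proof (cases "t \<in> {0<..<1}")
    case True
    then have t: "0 < t" "t < 1" by auto
    have "emeasure lborel {x. ennreal (t * a) < f x} + emeasure lborel {x. ennreal (t * b) < g x}
       \<le> 2 * emeasure lborel {x. ennreal (t * c) < h' x}"
    proof (rule emeasure_lborel_midpoint_sets)
      have "ennreal (t * a) < (SUP x. f x)" "ennreal (t * b) < (SUP x. g x)"
        using ab t by (auto simp: ennreal_less_iff)
      then show "{x. ennreal (t * a) < f x} \<noteq> {}" "{x. ennreal (t * b) < g x} \<noteq> {}"
        by (auto simp: less_SUP_iff)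
    next
      fix x y assume "x \<in> {x. ennreal (t * a) < f x}" "y \<in> {x. ennreal (t * b) < g x}"
      moreover obtain p q where pq: "f x = ennreal p" "g y = ennreal q" "0 \<le> p" "0 \<le> q"
        using fa[of x] gb[of y] by (cases "f x"; cases "g y") (auto simp: top_unique)
      ultimately have "t * a < p" "t * b < q" using t ab by (auto simp: ennreal_less_iff)
      moreover have "0 < t * a" "0 < t * b" using t ab by auto
      ultimately have "(t * a) * (t * b) < p * q" by (intro mult_strict_mono) auto
      moreover have "(t * c)\<^sup>2 = (t * a) * (t * b)"
        using arg_cong[OF c(2), of "\<lambda>z. t * t * z"] by (simp add: power2_eq_square ac_simps)
      ultimately have "(t * c)\<^sup>2 < p * q" by simp
      moreover have "ennreal (p * q) \<le> (h ((x + y) / 2))\<^sup>2"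
        using mid[of x y] pq by (simp add: ennreal_mult)
      ultimately have "ennreal ((t * c)\<^sup>2) < (h ((x + y) / 2))\<^sup>2"
        by (smt (verit) ennreal_less_iff order.strict_trans2 zero_le_power2)
      then have "ennreal (t * c) < h ((x + y) / 2)"
        using t c by (metis ennreal_power less_eq_real_def mult_pos_pos not_le power_mono zero_le)
      moreover have "ennreal (t * c) < ennreal c" using t c by (simp add: ennreal_less_iff)
      ultimately show "(x + y) / 2 \<in> {x. ennreal (t * c) < h' x}" by (simp add: h'_def)
    qed measurable
    then show ?thesis using True by (simp add: lf_def lg_def lh_def)
  qed (simp add: lf_def lg_def lh_def)
  let ?F = "\<integral>\<^sup>+t. lf t \<partial>lborel" and ?G = "\<integral>\<^sup>+t. lg t \<partial>lborel" and ?H = "\<integral>\<^sup>+t. lh t \<partial>lborel"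
  have "?F + ?G = (\<integral>\<^sup>+t. lf t + lg t \<partial>lborel)" by (rule nn_integral_add[symmetric]) measurable
  also have "\<dots> \<le> (\<integral>\<^sup>+t. 2 * lh t \<partial>lborel)" by (rule nn_integral_mono) (rule le)
  also have "\<dots> = 2 * ?H" by (rule nn_integral_cmult) measurable
  finally have "?F * ?G \<le> ?H\<^sup>2" by (rule ennreal_mult_le_square_of_add)
  have "(\<integral>\<^sup>+x. f x \<partial>lborel) * (\<integral>\<^sup>+x. g x \<partial>lborel) = (ennreal a * ?F) * (ennreal b * ?G)"
    unfolding lf_def lg_def
    using nn_integral_layers[of f a] nn_integral_layers[of g b] fa gb ab by simp
  also have "\<dots> = (ennreal c * ennreal c) * (?F * ?G)"
    using ab c by (simp add: ennreal_mult[symmetric] ac_simps) (simp add: ennreal_mult ac_simps)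
  also have "\<dots> \<le> (ennreal c * ennreal c) * ?H\<^sup>2"
    by (rule mult_left_mono) (use \<open>?F * ?G \<le> ?H\<^sup>2\<close> in auto)
  also have "\<dots> = (\<integral>\<^sup>+x. h' x \<partial>lborel)\<^sup>2"
    unfolding lh_def
    using nn_integral_layers[of h' c] c by (simp add: h'_def power2_eq_square ac_simps)
  also have "\<dots> \<le> (\<integral>\<^sup>+x. h x \<partial>lborel)\<^sup>2"
    by (intro power_mono nn_integral_mono) (auto simp: h'_def)
  finally show ?thesis .
qed

lemma prekopa_leindler_real:
  fixes f g h :: "real \<Rightarrow> ennreal"
  assumes [measurable]: "f \<in> borel_measurable borel" "g \<in> borel_measurable borel" "h \<in> borel_measurable borel"
    and mid: "\<And>x y. f x * g y \<le> (h ((x + y) / 2))\<^sup>2"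
  shows "(\<integral>\<^sup>+x. f x \<partial>lborel) * (\<integral>\<^sup>+x. g x \<partial>lborel) \<le> (\<integral>\<^sup>+x. h x \<partial>lborel)\<^sup>2"
proof -
  have trunc: "(SUP n. (\<integral>\<^sup>+x. min (u x) (ennreal (real n)) \<partial>lborel)) = (\<integral>\<^sup>+x. u x \<partial>lborel)"
    if [measurable]: "u \<in> borel_measurable borel" for u :: "real \<Rightarrow> ennreal"
  proof -
    have "(SUP n. min z (ennreal (real n))) = z" for z :: ennreal
      by (simp add: inf_min[symmetric] inf_SUP[symmetric] ennreal_of_nat_eq_real_of_nat[symmetric] ennreal_SUP_of_nat_eq_top)
    then have "(\<integral>\<^sup>+x. u x \<partial>lborel) = (\<integral>\<^sup>+x. (SUP n. min (u x) (ennreal (real n))) \<partial>lborel)" by simp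
    also have "\<dots> = (SUP n. (\<integral>\<^sup>+x. min (u x) (ennreal (real n)) \<partial>lborel))"
      by (rule nn_integral_monotone_convergence_SUP)
         (auto simp: incseq_def le_fun_def intro: min.coboundedI1 min.coboundedI2 ennreal_leI)
    finally show ?thesis by simp
  qed
  have "(\<integral>\<^sup>+x. min (f x) (ennreal (real n)) \<partial>lborel) * (\<integral>\<^sup>+x. min (g x) (ennreal (real m)) \<partial>lborel) \<le> (\<integral>\<^sup>+x. h x \<partial>lborel)\<^sup>2" for n m
  proof (rule prekopa_leindler_real_bounded[where A="real (max n m)"])
    fix x y
    have "min (f x) (ennreal (real n)) * min (g y) (ennreal (real m)) \<le> f x * g y" by (intro mult_mono) auto
    also note mid
    finally show "min (f x) (ennreal (real n)) * min (g y) (ennreal (real m)) \<le> (h ((x + y) / 2))\<^sup>2" .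
  qed (auto simp: min_le_iff_disj intro!: ennreal_leI)
  then have "(SUP n. (\<integral>\<^sup>+x. min (f x) (ennreal (real n)) \<partial>lborel)) * (SUP m. (\<integral>\<^sup>+x. min (g x) (ennreal (real m)) \<partial>lborel)) \<le> (\<integral>\<^sup>+x. h x \<partial>lborel)\<^sup>2"
    by (simp add: SUP_mult_left_ennreal SUP_mult_right_ennreal SUP_le_iff)
  then show ?thesis by (simp add: trunc)
qed

text \<open>The inequality tensorises: applied to the integrals over \<open>B\<close>, the induction
  hypothesis is precisely the midpoint condition for the functions of the remaining
  coordinate.\<close>

lemma prekopa_leindler_onb:
  fixes f g h :: "'a::euclidean_space \<Rightarrow> ennreal"
  assumes "orthonormal B"
    and "f \<in> borel_measurable borel" "g \<in> borel_measurable borel" "h \<in> borel_measurable borel"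
    and mid: "\<And>x y. f x * g y \<le> (h ((1/2) *\<^sub>R (x + y)))\<^sup>2"
  shows "(\<integral>\<^sup>+x. f x \<partial>onb_lborel B) * (\<integral>\<^sup>+x. g x \<partial>onb_lborel B) \<le> (\<integral>\<^sup>+x. h x \<partial>onb_lborel B)\<^sup>2"
  using orthonormal_finite[OF assms(1)] assms
proof (induction B arbitrary: f g h)
  case empty
  then show ?case using empty.prems(5)[of 0 0] by (simp add: nn_integral_onb_empty)
next
  case (insert e B)
  note [measurable] = insert.prems(2-4)
  have B: "orthonormal B" using orthonormal_subset[OF insert.prems(1)] by auto
  interpret sigma_finite_measure "onb_lborel B" using sigma_finite_onb_lborel[OF B] .
  have split: "(\<integral>\<^sup>+x. u x \<partial>onb_lborel (insert e B)) = (\<integral>\<^sup>+t. (\<integral>\<^sup>+x. u (x + t *\<^sub>R e) \<partial>onb_lborel B) \<partial>lborel)"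
    if "u \<in> borel_measurable borel" for u
    by (rule nn_integral_onb_insert[OF insert.hyps that])
  show ?case
    unfolding split[OF insert.prems(2)] split[OF insert.prems(3)] split[OF insert.prems(4)]
  proof (rule prekopa_leindler_real)
    fix s t :: real
    show "(\<integral>\<^sup>+x. f (x + s *\<^sub>R e) \<partial>onb_lborel B) * (\<integral>\<^sup>+x. g (x + t *\<^sub>R e) \<partial>onb_lborel B)
       \<le> (\<integral>\<^sup>+x. h (x + ((s + t) / 2) *\<^sub>R e) \<partial>onb_lborel B)\<^sup>2"
    proof (rule insert.IH[OF B])
      fix x y
      show "f (x + s *\<^sub>R e) * g (y + t *\<^sub>R e) \<le> (h ((1 / 2) *\<^sub>R (x + y) + ((s + t) / 2) *\<^sub>R e))\<^sup>2"
        using insert.prems(5)[of "x + s *\<^sub>R e" "y + t *\<^sub>R e"]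
        by (simp add: algebra_simps add_divide_distrib)
    qed measurable
  qed measurable
qed

lemma brunn_minkowski_midpoint:
  fixes X Y C :: "'a::euclidean_space set"
  assumes [measurable]: "X \<in> sets borel" "Y \<in> sets borel" "C \<in> sets borel"
    and mid: "\<And>x y. x \<in> X \<Longrightarrow> y \<in> Y \<Longrightarrow> (1/2) *\<^sub>R (x + y) \<in> C"
  shows "emeasure lborel X * emeasure lborel Y \<le> (emeasure lborel C)\<^sup>2"
proof -
  obtain B :: "'a set" where B: "orthonormal B" "span B = UNIV"
    using orthonormal_basis_obtain[OF subspace_UNIV] by metis
  have eq: "onb_lborel B = (lborel :: 'a measure)"
    by (rule trans[OF subspace_lborel_onb[OF B, symmetric] subspace_lborel_UNIV])
  have "(\<integral>\<^sup>+x. indicator X x \<partial>onb_lborel B) * (\<integral>\<^sup>+x. indicator Y x \<partial>onb_lborel B) \<le> (\<integral>\<^sup>+x. indicator C x \<partial>onb_lborel B)\<^sup>2"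
    by (rule prekopa_leindler_onb[OF B(1)]) (use mid in \<open>auto simp: indicator_def\<close>)
  then show ?thesis by (simp add: eq)
qed

lemma ennreal_power2_le_imp_le:
  fixes x y :: ennreal
  assumes "x\<^sup>2 \<le> y\<^sup>2"
  shows "x \<le> y"
proof (cases y)
  case (real b)
  then have "x\<^sup>2 \<le> ennreal (b\<^sup>2)" using assms by (simp add: ennreal_power)
  also have "\<dots> < top" by simp
  finally have "x\<^sup>2 < top" .
  then obtain a where "x = ennreal a" "0 \<le> a" by (cases x) (auto simp: power2_eq_square)
  with real assms show ?thesis
    by (auto simp: ennreal_power intro: power2_le_imp_le)
qed simp

lemma nn_integral_lborel_uminus:
  fixes F :: "'a::euclidean_space \<Rightarrow> ennreal"
  assumes "F \<in> borel_measurable borel"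
  shows "(\<integral>\<^sup>+x. F (- x) \<partial>lborel) = (\<integral>\<^sup>+x. F x \<partial>lborel)"
  using nn_integral_subspace_scale[of UNIV F "-1"] assms by (simp add: subspace_lborel_UNIV)

lemma convex_body_borel: "convex_body K \<Longrightarrow> K \<in> sets borel"
  by (simp add: convex_body_def borel_compact)

lemma origin_symmetric_uminus: "origin_symmetric K \<Longrightarrow> - x \<in> K \<longleftrightarrow> x \<in> K"
  unfolding origin_symmetric_def by (metis image_eqI imageE minus_minus)

text \<open>The parts of \<open>K\<close> with \<open>a \<le> y \<bullet> \<xi> < 3 * a\<close> and
  with \<open>a \<le> - (y \<bullet> \<xi>) < 3 * a\<close> are mirror images, and midpoints between
  them fall into the central slab. By Brunn-Minkowski each has at most the central measure. The
  width ratio 3 is the source of the constants 9, 18 and 81 in the kernels.\<close>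

lemma convex_body_slab_le:
  fixes K :: "'a::euclidean_space set"
  assumes K: "convex_body K" "origin_symmetric K"
  shows "emeasure lborel (K \<inter> {y. \<bar>y \<bullet> \<xi>\<bar> < 3 * a}) \<le> 3 * emeasure lborel (K \<inter> {y. \<bar>y \<bullet> \<xi>\<bar> < a})"
proof -
  have [measurable]: "K \<in> sets borel" using K by (simp add: convex_body_borel)
  define X where "X = K \<inter> {y. a \<le> y \<bullet> \<xi> \<and> y \<bullet> \<xi> < 3 * a}"
  define Y where "Y = K \<inter> {y. a \<le> - (y \<bullet> \<xi>) \<and> - (y \<bullet> \<xi>) < 3 * a}"
  define C where "C = K \<inter> {y. \<bar>y \<bullet> \<xi>\<bar> < a}"
  have [measurable]: "X \<in> sets borel" "Y \<in> sets borel" "C \<in> sets borel"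
    unfolding X_def Y_def C_def by measurable
  have "(indicator Y x :: ennreal) = indicator X (- x)" for x
    using origin_symmetric_uminus[OF K(2), of x] by (auto simp: X_def Y_def indicator_def)
  then have XY: "emeasure lborel Y = emeasure lborel X"
    using nn_integral_lborel_uminus[of "indicator X"] by (simp flip: nn_integral_indicator)
  have "emeasure lborel X * emeasure lborel Y \<le> (emeasure lborel C)\<^sup>2"
  proof (rule brunn_minkowski_midpoint)
    fix x y assume xy: "x \<in> X" "y \<in> Y"
    have "(1/2) *\<^sub>R x + (1/2) *\<^sub>R y \<in> K"
      using K xy unfolding convex_body_def by (intro convexD) (auto simp: X_def Y_def)
    then show "(1/2) *\<^sub>R (x + y) \<in> C"
      using xy by (auto simp: C_def X_def Y_def scaleR_add_right inner_add_left abs_if)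
  qed measurable
  then have "(emeasure lborel X)\<^sup>2 \<le> (emeasure lborel C)\<^sup>2" by (simp add: XY power2_eq_square)
  then have XC: "emeasure lborel X \<le> emeasure lborel C"
    by (rule ennreal_power2_le_imp_le)
  have "emeasure lborel (K \<inter> {y. \<bar>y \<bullet> \<xi>\<bar> < 3 * a}) \<le> emeasure lborel (C \<union> (X \<union> Y))"
    by (rule emeasure_mono) (auto simp: C_def X_def Y_def)
  also have "\<dots> \<le> emeasure lborel C + (emeasure lborel X + emeasure lborel Y)"
    by (intro order_trans[OF emeasure_subadditive] add_left_mono emeasure_subadditive) auto
  also have "\<dots> \<le> emeasure lborel C + (emeasure lborel C + emeasure lborel C)"
    using XC XY by (intro add_mono) auto
  also have "\<dots> = 3 * emeasure lborel C"
    by (simp add: distrib_right[symmetric, of 1 1, simplified] add.assoc[symmetric] mult_2[symmetric]) 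
       (metis (no_types) distrib_right mult_1 numeral_Bit1 numeral_One one_add_one add.commute)
  finally show ?thesis unfolding C_def .
qed

text \<open>The weight is minus the derivative of \<open>exp (- (a\<^sup>2) / 2)\<close>. This
  presents a Gaussian as a mixture of slabs and so transfers inequalities from slabs to smooth
  weights.\<close>

lemma nn_integral_gaussian_layers:
  assumes "k > 0"
  shows "(\<integral>\<^sup>+a. ennreal (a * exp (- (a\<^sup>2) / 2)) * indicator {0..} a * indicator {a. \<bar>s\<bar> < k * a} a \<partial>lborel)
    = ennreal (exp (- ((s / k)\<^sup>2) / 2))"
proof -
  define b where "b = \<bar>s\<bar> / k"
  have b: "b \<ge> 0" "b\<^sup>2 = (s / k)\<^sup>2" using assms by (auto simp: b_def power_divide)
  have "(\<integral>\<^sup>+a. ennreal (a * exp (- (a\<^sup>2) / 2)) * indicator {0..} a * indicator {a. \<bar>s\<bar> < k * a} a \<partial>lborel)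
     = (\<integral>\<^sup>+a. ennreal (a * exp (- (a\<^sup>2) / 2)) * indicator {b..} a \<partial>lborel)"
  proof (rule nn_integral_cong_AE, use AE_lborel_singleton[of b] in eventually_elim)
    case (elim a)
    have "\<bar>s\<bar> < k * a \<longleftrightarrow> b < a" using assms by (simp add: b_def pos_divide_less_eq mult.commute)
    then show ?case using elim b(1) by (auto simp: indicator_def)
  qed
  also have "\<dots> = ennreal (0 - (- exp (- (b\<^sup>2) / 2)))"
  proof (rule nn_integral_FTC_atLeast)
    show "((\<lambda>a::real. - exp (- (a\<^sup>2) / 2)) \<longlongrightarrow> 0) at_top" by real_asymp
  qed (use b in \<open>auto intro!: derivative_eq_intros mult_nonneg_nonneg\<close>)
  finally show ?thesis using b by simp
qed

text \<open>\<open>convex_body_slab_le\<close> averaged over \<open>a\<close>. The width ratio 3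
  becomes the factor \<open>1/3\<close> and the denominator 18 = 2 * 3 * 3.\<close>

lemma convex_body_gaussian_slab_le:
  fixes K :: "'a::euclidean_space set"
  assumes K: "convex_body K" "origin_symmetric K"
  shows "(\<integral>\<^sup>+y. ennreal ((1/3) * exp (- ((y \<bullet> \<xi>)\<^sup>2) / 18)) * indicator K y \<partial>lborel)
     \<le> (\<integral>\<^sup>+y. ennreal (exp (- ((y \<bullet> \<xi>)\<^sup>2) / 2)) * indicator K y \<partial>lborel)"
proof -
  have [measurable]: "K \<in> sets borel" using K by (simp add: convex_body_borel)
  define w where "w a = ennreal (a * exp (- (a\<^sup>2) / 2)) * indicator {0..} a" for a :: real
  have [measurable]: "w \<in> borel_measurable borel" unfolding w_def by measurable
  have layers: "(\<integral>\<^sup>+y. ennreal (exp (- (((y \<bullet> \<xi>) / k)\<^sup>2) / 2)) * indicator K y \<partial>lborel)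
     = (\<integral>\<^sup>+a. w a * emeasure lborel (K \<inter> {y. \<bar>y \<bullet> \<xi>\<bar> < k * a}) \<partial>lborel)" if "k > 0" for k
  proof -
    have "(\<integral>\<^sup>+y. ennreal (exp (- (((y \<bullet> \<xi>) / k)\<^sup>2) / 2)) * indicator K y \<partial>lborel)
       = (\<integral>\<^sup>+y. (\<integral>\<^sup>+a. w a * indicator {a. \<bar>y \<bullet> \<xi>\<bar> < k * a} a * indicator K y \<partial>lborel) \<partial>lborel)"
    proof (rule nn_integral_cong)
      fix y :: 'a
      have "(\<integral>\<^sup>+a. w a * indicator {a. \<bar>y \<bullet> \<xi>\<bar> < k * a} a * indicator K y \<partial>lborel)
        = (\<integral>\<^sup>+a. w a * indicator {a. \<bar>y \<bullet> \<xi>\<bar> < k * a} a \<partial>lborel) * indicator K y"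
        by (rule nn_integral_multc) measurable
      then show "ennreal (exp (- (((y \<bullet> \<xi>) / k)\<^sup>2) / 2)) * indicator K y
         = (\<integral>\<^sup>+a. w a * indicator {a. \<bar>y \<bullet> \<xi>\<bar> < k * a} a * indicator K y \<partial>lborel)"
        unfolding w_def nn_integral_gaussian_layers[OF that] by simp
    qed
    also have "\<dots> = (\<integral>\<^sup>+a. (\<integral>\<^sup>+y. w a * indicator {a. \<bar>y \<bullet> \<xi>\<bar> < k * a} a * indicator K y \<partial>lborel) \<partial>lborel)"
      by (rule lborel_pair.Fubini') measurable
    also have "\<dots> = (\<integral>\<^sup>+a. w a * emeasure lborel (K \<inter> {y. \<bar>y \<bullet> \<xi>\<bar> < k * a}) \<partial>lborel)"
    proof (rule nn_integral_cong)
      fix a :: real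
      have "(\<integral>\<^sup>+y. w a * indicator {a. \<bar>y \<bullet> \<xi>\<bar> < k * a} a * indicator K y \<partial>lborel)
         = (\<integral>\<^sup>+y. w a * indicator (K \<inter> {y. \<bar>y \<bullet> \<xi>\<bar> < k * a}) y \<partial>lborel)"
        by (rule nn_integral_cong) (auto simp: indicator_def)
      then show "(\<integral>\<^sup>+y. w a * indicator {a. \<bar>y \<bullet> \<xi>\<bar> < k * a} a * indicator K y \<partial>lborel)
         = w a * emeasure lborel (K \<inter> {y. \<bar>y \<bullet> \<xi>\<bar> < k * a})"
        by (simp add: nn_integral_cmult_indicator)
    qed
    finally show ?thesis .
  qed
  have "(\<integral>\<^sup>+y. ennreal ((1/3) * exp (- ((y \<bullet> \<xi>)\<^sup>2) / 18)) * indicator K y \<partial>lborel)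
      = (\<integral>\<^sup>+y. ennreal (1/3) * (ennreal (exp (- (((y \<bullet> \<xi>) / 3)\<^sup>2) / 2)) * indicator K y) \<partial>lborel)"
  proof -
    have "ennreal ((1/3) * exp (- (s\<^sup>2) / 18)) = ennreal (1/3) * ennreal (exp (- ((s / 3)\<^sup>2) / 2))" for s :: real
      by (subst ennreal_mult[symmetric]) (auto simp: power_divide)
    then show ?thesis by (simp only: mult.assoc)
  qed
  also have "\<dots> = ennreal (1/3) * (\<integral>\<^sup>+y. ennreal (exp (- (((y \<bullet> \<xi>) / 3)\<^sup>2) / 2)) * indicator K y \<partial>lborel)"
    by (rule nn_integral_cmult) measurable
  also have "\<dots> = ennreal (1/3) * (\<integral>\<^sup>+a. w a * emeasure lborel (K \<inter> {y. \<bar>y \<bullet> \<xi>\<bar> < 3 * a}) \<partial>lborel)"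
    by (subst layers) auto
  also have "\<dots> \<le> ennreal (1/3) * (\<integral>\<^sup>+a. 3 * (w a * emeasure lborel (K \<inter> {y. \<bar>y \<bullet> \<xi>\<bar> < a})) \<partial>lborel)"
    using convex_body_slab_le[OF K] by (intro mult_left_mono nn_integral_mono) (auto simp: mult.left_commute intro: mult_left_mono)
  also have "\<dots> = ennreal (1/3) * 3 * (\<integral>\<^sup>+a. w a * emeasure lborel (K \<inter> {y. \<bar>y \<bullet> \<xi>\<bar> < a}) \<partial>lborel)"
    unfolding mult.assoc by (rule arg_cong[where f="\<lambda>z. _ * z"], rule nn_integral_cmult) measurable
  also have "ennreal (1/3) * 3 = 1"
  proof -
    have "ennreal (1/3) * ennreal 3 = 1" by (simp only: ennreal_mult[symmetric]) simp
    then show ?thesis by (simp only: ennreal_numeral)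
  qed
  also have "1 * (\<integral>\<^sup>+a. w a * emeasure lborel (K \<inter> {y. \<bar>y \<bullet> \<xi>\<bar> < a}) \<partial>lborel)
     = (\<integral>\<^sup>+y. ennreal (exp (- ((y \<bullet> \<xi>)\<^sup>2) / 2)) * indicator K y \<partial>lborel)"
    using layers[of 1] by simp
  finally show ?thesis .
qed

section \<open>The affirmative answer in low dimension\<close>

definition perp_part :: "'a::euclidean_space \<Rightarrow> 'a \<Rightarrow> 'a" where
  "perp_part x y = y - ((x \<bullet> y) / (x \<bullet> x)) *\<^sub>R x"

lemma perp_part_in: "x \<noteq> 0 \<Longrightarrow> perp_part x y \<in> hyperplane_perp x"
  by (simp add: perp_part_def hyperplane_perp_def inner_diff_right)

lemma perp_part_inner: "\<xi> \<in> hyperplane_perp x \<Longrightarrow> perp_part x y \<bullet> \<xi> = y \<bullet> \<xi>"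
  by (simp add: perp_part_def hyperplane_perp_def inner_diff_left)

lemma perp_part_add: "v \<in> hyperplane_perp x \<Longrightarrow> x \<noteq> 0 \<Longrightarrow> perp_part x (v + t *\<^sub>R x) = v"
  by (simp add: perp_part_def hyperplane_perp_def inner_add_right)

lemma zero_in_interior:
  fixes K :: "'a::euclidean_space set"
  assumes "convex_body K" "origin_symmetric K"
  shows "0 \<in> interior K"
proof -
  obtain x where x: "x \<in> interior K" using assms unfolding convex_body_def by auto
  have "uminus ` interior K = interior K"
    using interior_negations[of K] assms(2) by (simp add: origin_symmetric_def)
  then have "- x \<in> interior K" using x by blast
  moreover have "convex (interior K)" using assms(1) by (simp add: convex_body_def convex_interior)
  ultimately have "(1/2) *\<^sub>R x + (1/2) *\<^sub>R (- x) \<in> interior K" using x by (intro convexD) auto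
  then show ?thesis by simp
qed

text \<open>As 0 is an interior point, the line through \<open>x\<close> meets the frontier in its
  two extreme points only. Off these, \<open>indicator K\<close> is continuous at
  \<open>t *\<^sub>R x\<close>, which dominated convergence needs below.\<close>

lemma convex_body_frontier_line_null:
  fixes K :: "'a::euclidean_space set"
  assumes K: "convex_body K" "origin_symmetric K" and x: "x \<noteq> 0"
  shows "AE t in lborel. t *\<^sub>R x \<in> interior K \<or> t *\<^sub>R x \<notin> K"
proof -
  have K': "compact K" "convex K" using K by (auto simp: convex_body_def)
  define S where "S = (\<lambda>t::real. t *\<^sub>R x) -` K"
  have "closed S" unfolding S_def using K'(1) by (intro closed_vimage compact_imp_closed) (auto intro!: continuous_intros)
  obtain R where R: "\<And>y. y \<in> K \<Longrightarrow> norm y \<le> R" using K'(1) compact_imp_bounded bounded_iff by metis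
  have "bounded S"
    unfolding bounded_iff
  proof (intro exI ballI)
    fix t assume "t \<in> S"
    then have "norm (t *\<^sub>R x) \<le> R" using R[of "t *\<^sub>R x"] by (simp add: S_def)
    then show "norm t \<le> R / norm x" using x by (simp add: field_simps)
  qed
  with \<open>closed S\<close> have cS: "compact S" by (simp add: compact_eq_bounded_closed)
  have "0 \<in> S" using zero_in_interior[OF K] interior_subset by (auto simp: S_def)
  then obtain a b where a: "a \<in> S" "\<And>t. t \<in> S \<Longrightarrow> t \<le> a" and b: "b \<in> S" "\<And>t. t \<in> S \<Longrightarrow> b \<le> t"
    using compact_attains_sup[OF cS] compact_attains_inf[OF cS] by (metis empty_iff)
  have ins: "s *\<^sub>R x \<in> interior K" if "r \<in> S" "0 < s / r" "s / r < 1 \<or> False" for s r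
  proof -
    have "r \<noteq> 0" using that by auto
    have "r *\<^sub>R x - (1 - s / r) *\<^sub>R (r *\<^sub>R x - 0) \<in> interior K"
      using mem_interior_convex_shrink[OF K'(2) zero_in_interior[OF K], of "r *\<^sub>R x" "1 - s / r"] that
      by (auto simp: S_def)
    then show ?thesis using \<open>r \<noteq> 0\<close> by (simp add: algebra_simps)
  qed
  have *: "t *\<^sub>R x \<in> interior K \<or> t *\<^sub>R x \<notin> K" if "t \<noteq> a" "t \<noteq> b" for t
  proof (cases "t \<in> S")
    case True
    then have t: "b < t" "t < a" using a(2)[of t] b(2)[of t] that by auto
    consider "t = 0" | "t > 0" | "t < 0" by linarith
    then have "t *\<^sub>R x \<in> interior K"
    proof cases
      case 1 then show ?thesis using zero_in_interior[OF K] by simp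
    next
      case 2 then show ?thesis using ins[OF a(1), of t] t by simp
    next
      case 3 then show ?thesis using ins[OF b(1), of t] t by (simp add: divide_simps)
    qed
    then show ?thesis by simp
  qed (simp add: S_def)
  show ?thesis
    using AE_lborel_singleton[of a] AE_lborel_singleton[of b] by eventually_elim (use * in auto)
qed

text \<open>The kernel \<open>p - q\<close> tests \<open>K\<close> in the direction \<open>\<xi>\<close> nonnegatively, while its average over
  \<open>\<xi> \<in> x\<^sup>\<perp>\<close> concentrates, as \<open>h \<rightarrow> 0\<close>, on the line through \<open>x\<close>.\<close>

lemma weighted_chord_comparison:
  fixes K :: "'a::euclidean_space set" and p q :: "'a \<Rightarrow> real \<Rightarrow> ennreal" and Zp Zq :: "real \<Rightarrow> real"
    and D E :: "'a \<Rightarrow> ennreal"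
  assumes dim: "DIM('a) \<ge> 2" and K: "convex_body K" "origin_symmetric K"
    and pm [measurable]: "(\<lambda>(\<xi>, s). p \<xi> s) \<in> borel_measurable (borel \<Otimes>\<^sub>M borel)"
    and qm [measurable]: "(\<lambda>(\<xi>, s). q \<xi> s) \<in> borel_measurable (borel \<Otimes>\<^sub>M borel)"
    and Zm [measurable]: "Zp \<in> borel_measurable borel" "Zq \<in> borel_measurable borel"
    and Zp: "\<And>x v. x \<noteq> 0 \<Longrightarrow> v \<in> hyperplane_perp x \<Longrightarrow>
          (\<integral>\<^sup>+\<xi>. p \<xi> (v \<bullet> \<xi>) \<partial>subspace_lborel (hyperplane_perp x)) = ennreal (Zp (norm v))"
    and Zq: "\<And>x v. x \<noteq> 0 \<Longrightarrow> v \<in> hyperplane_perp x \<Longrightarrow>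
          (\<integral>\<^sup>+\<xi>. q \<xi> (v \<bullet> \<xi>) \<partial>subspace_lborel (hyperplane_perp x)) = ennreal (Zq (norm v))"
    and pos: "\<And>\<xi> \<eta>. (\<integral>\<^sup>+y. q \<xi> (y \<bullet> \<eta>) * indicator K y \<partial>lborel) \<le> (\<integral>\<^sup>+y. p \<xi> (y \<bullet> \<eta>) * indicator K y \<partial>lborel)"
    and Zb: "\<And>r. 0 \<le> Zq r" "\<And>r. Zq r \<le> Zp r" "\<And>r. Zp r \<le> C"
    and c: "c > 0" "\<And>x::'a. x \<noteq> 0 \<Longrightarrow>
          (\<integral>\<^sup>+v. ennreal (Zp (norm v) - Zq (norm v)) \<partial>subspace_lborel (hyperplane_perp x)) = ennreal c"
    and DE [measurable]: "D \<in> borel_measurable borel" "E \<in> borel_measurable borel"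
    and bd: "\<epsilon> > 0" "\<And>x. D x \<le> ennreal M * indicator {x. \<epsilon> \<le> norm x \<and> norm x \<le> R} x"
      "\<And>x. E x \<le> ennreal M * indicator {x. \<epsilon> \<le> norm x \<and> norm x \<le> R} x"
    and cmp: "\<And>\<xi>. \<xi> \<noteq> 0 \<Longrightarrow> (\<integral>\<^sup>+x. D x \<partial>subspace_lborel (hyperplane_perp \<xi>)) \<le> (\<integral>\<^sup>+x. E x \<partial>subspace_lborel (hyperplane_perp \<xi>))"
  shows "(\<integral>\<^sup>+x. D x * emeasure lborel {t::real. t *\<^sub>R x \<in> K} \<partial>lborel) \<le> (\<integral>\<^sup>+x. E x * emeasure lborel {t::real. t *\<^sub>R x \<in> K} \<partial>lborel)"
proof -
  define H where "H x = subspace_lborel (hyperplane_perp (x::'a))" for x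
  have [measurable_cong]: "sets (H x) = sets borel" for x by (simp add: H_def)
  have Hsf: "sigma_finite_measure (H x)" for x unfolding H_def by (rule sigma_finite_subspace_lborel) simp
  have AEH: "AE v in H x. v \<in> hyperplane_perp x" for x
    unfolding H_def by (rule AE_subspace_lborel) simp
  have dimH: "dim (hyperplane_perp x) = DIM('a) - 1" if "x \<noteq> 0" for x :: 'a
    unfolding hyperplane_perp_def by (rule dim_hyperplane[OF that])
  define Z where "Z r = Zp r - Zq r" for r
  have [measurable]: "Z \<in> borel_measurable borel" unfolding Z_def by measurable
  have [measurable]: "K \<in> sets borel" using K by (simp add: convex_body_borel)
  have cK: "compact K" using K by (simp add: convex_body_def)
  obtain R0 where R0: "R0 > 0" "\<And>y. y \<in> K \<Longrightarrow> norm y \<le> R0"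
    using compact_imp_bounded[OF cK] bounded_pos by metis
  have Kfin: "emeasure lborel K < \<infinity>" using emeasure_compact_finite[OF cK] .
  have [measurable]: "(\<lambda>x. norm (perp_part x y)) \<in> borel_measurable borel" "(\<lambda>y. norm (perp_part x y)) \<in> borel_measurable borel"
     "(\<lambda>(x, y). norm (perp_part x (y::'a))) \<in> borel_measurable (borel \<Otimes>\<^sub>M borel)" for x y :: 'a
    unfolding perp_part_def by measurable
  define Pp where "Pp h \<xi> = (\<integral>\<^sup>+y. p \<xi> (y \<bullet> (\<xi> /\<^sub>R h)) * indicator K y \<partial>lborel)" for h \<xi>
  define Pq where "Pq h \<xi> = (\<integral>\<^sup>+y. q \<xi> (y \<bullet> (\<xi> /\<^sub>R h)) * indicator K y \<partial>lborel)" for h \<xi>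
  define P where "P h \<xi> = Pp h \<xi> - Pq h \<xi>" for h \<xi>
  define k where "k = DIM('a) - 1"
  define Q where "Q h x = (\<integral>\<^sup>+y. ennreal (Z (norm (perp_part x y) / h)) * indicator K y \<partial>lborel)" for h x
  define N where "N h x = (\<integral>\<^sup>+t. (\<integral>\<^sup>+v. indicator K (h *\<^sub>R v + t *\<^sub>R x) * ennreal (Z (norm v)) \<partial>H x) \<partial>lborel)" for h x
  have [measurable]: "Pp h \<in> borel_measurable borel" "Pq h \<in> borel_measurable borel" for h
    unfolding Pp_def[abs_def] Pq_def[abs_def] by measurable
  then have [measurable]: "P h \<in> borel_measurable borel" for h
    unfolding P_def[abs_def] by measurable
  have [measurable]: "Q h \<in> borel_measurable borel" for h
    unfolding Q_def[abs_def] by measurable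
  \<comment> \<open>For \<open>\<xi>\<close> orthogonal to \<open>x\<close>, the product
    \<open>y \<bullet> \<xi>\<close> depends only on the component of \<open>y\<close> orthogonal to
    \<open>x\<close>, so averaging over \<open>\<xi>\<close> leaves a radial function of that
    component.\<close>
  have avg: "(\<integral>\<^sup>+\<xi>. (\<integral>\<^sup>+y. w \<xi> (y \<bullet> (\<xi> /\<^sub>R h)) * indicator K y \<partial>lborel) \<partial>H x)
      = (\<integral>\<^sup>+y. ennreal (W (norm (perp_part x y) / h)) * indicator K y \<partial>lborel)"
    if [measurable]: "(\<lambda>(\<xi>, s). w \<xi> s) \<in> borel_measurable (borel \<Otimes>\<^sub>M borel)" and x: "x \<noteq> 0" and h: "h > 0"
      and W: "\<And>v. v \<in> hyperplane_perp x \<Longrightarrow> (\<integral>\<^sup>+\<xi>. w \<xi> (v \<bullet> \<xi>) \<partial>subspace_lborel (hyperplane_perp x)) = ennreal (W (norm v))"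
    for w :: "'a \<Rightarrow> real \<Rightarrow> ennreal" and W x h
  proof -
    interpret Hx: sigma_finite_measure "H x" by (rule Hsf)
    interpret pair_sigma_finite lborel "H x" ..
    have "(\<integral>\<^sup>+\<xi>. (\<integral>\<^sup>+y. w \<xi> (y \<bullet> (\<xi> /\<^sub>R h)) * indicator K y \<partial>lborel) \<partial>H x)
       = (\<integral>\<^sup>+y. (\<integral>\<^sup>+\<xi>. w \<xi> (y \<bullet> (\<xi> /\<^sub>R h)) * indicator K y \<partial>H x) \<partial>lborel)"
      by (rule Fubini') measurable
    also have "\<dots> = (\<integral>\<^sup>+y. ennreal (W (norm (perp_part x y) / h)) * indicator K y \<partial>lborel)"
    proof (rule nn_integral_cong)
      fix y
      define v where "v = perp_part x y /\<^sub>R h"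
      have v: "v \<in> hyperplane_perp x"
        unfolding v_def by (intro subspace_scale perp_part_in x) simp
      have "(\<integral>\<^sup>+\<xi>. w \<xi> (y \<bullet> (\<xi> /\<^sub>R h)) * indicator K y \<partial>H x) = (\<integral>\<^sup>+\<xi>. w \<xi> (y \<bullet> (\<xi> /\<^sub>R h)) \<partial>H x) * indicator K y"
        by (rule nn_integral_multc) measurable
      also have "(\<integral>\<^sup>+\<xi>. w \<xi> (y \<bullet> (\<xi> /\<^sub>R h)) \<partial>H x) = (\<integral>\<^sup>+\<xi>. w \<xi> (v \<bullet> \<xi>) \<partial>H x)"
      proof (rule nn_integral_cong_AE, use AEH in eventually_elim)
        case (elim \<xi>)
        then show ?case by (simp add: v_def perp_part_inner)
      qed
      also have "\<dots> = ennreal (W (norm v))" unfolding H_def by (rule W[OF v])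
      also have "norm v = norm (perp_part x y) / h" using h by (simp add: v_def field_simps)
      finally show "(\<integral>\<^sup>+\<xi>. w \<xi> (y \<bullet> (\<xi> /\<^sub>R h)) * indicator K y \<partial>H x) = ennreal (W (norm (perp_part x y) / h)) * indicator K y" .
    qed
    finally show ?thesis .
  qed
  \<comment> \<open>Adding the finite average of \<open>Pq\<close> to both sides avoids subtraction
    of integrals in \<open>ennreal\<close>; by \<open>pos\<close>, the difference \<open>P\<close>
    is not truncated.\<close>
  have PQ: "(\<integral>\<^sup>+\<xi>. P h \<xi> \<partial>H x) = Q h x" if x: "x \<noteq> 0" and h: "h > 0" for x h
  proof -
    let ?I = "\<lambda>W. (\<integral>\<^sup>+y. ennreal (W (norm (perp_part x y) / h)) * indicator K y \<partial>lborel)"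
    have "?I Zq \<le> (\<integral>\<^sup>+y. ennreal C * indicator K y \<partial>lborel)"
      using order_trans[OF Zb(2,3)] by (intro nn_integral_mono mult_right_mono ennreal_leI) auto
    also have "\<dots> < \<infinity>" using Kfin by (simp add: nn_integral_cmult ennreal_mult_less_top)
    finally have fin: "?I Zq < \<infinity>" .
    have "(\<integral>\<^sup>+\<xi>. P h \<xi> \<partial>H x) + ?I Zq = (\<integral>\<^sup>+\<xi>. P h \<xi> \<partial>H x) + (\<integral>\<^sup>+\<xi>. Pq h \<xi> \<partial>H x)"
      unfolding Pq_def by (subst avg[OF qm x h Zq[OF x]]) auto
    also have "\<dots> = (\<integral>\<^sup>+\<xi>. P h \<xi> + Pq h \<xi> \<partial>H x)"
      by (rule nn_integral_add[symmetric]) measurable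
    also have "\<dots> = (\<integral>\<^sup>+\<xi>. Pp h \<xi> \<partial>H x)"
    proof (rule nn_integral_cong)
      fix \<xi>
      have "Pq h \<xi> \<le> Pp h \<xi>" unfolding Pq_def Pp_def by (rule pos)
      then show "P h \<xi> + Pq h \<xi> = Pp h \<xi>" by (simp add: P_def diff_add_cancel_ennreal)
    qed
    also have "\<dots> = ?I Zp"
      unfolding Pp_def by (rule avg[OF pm x h Zp[OF x]]) auto
    also have "\<dots> = (\<integral>\<^sup>+y. ennreal (Z (norm (perp_part x y) / h)) * indicator K y + ennreal (Zq (norm (perp_part x y) / h)) * indicator K y \<partial>lborel)"
      using Zb by (intro nn_integral_cong) (simp add: Z_def distrib_right[symmetric] ennreal_plus[symmetric] del: ennreal_plus)
    also have "\<dots> = Q h x + ?I Zq"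
      unfolding Q_def by (rule nn_integral_add) measurable
    finally have "?I Zq + (\<integral>\<^sup>+\<xi>. P h \<xi> \<partial>H x) = ?I Zq + Q h x" by (simp only: add.commute)
    then show ?thesis using fin unfolding ennreal_add_left_cancel by auto
  qed
  \<comment> \<open>Scaling the hyperplane by \<open>h\<close> extracts \<open>h ^ k\<close> and
    leaves \<open>N\<close>, which samples \<open>K\<close> at
    \<open>h *\<^sub>R v + t *\<^sub>R x\<close>, near the line through \<open>x\<close>. The weight
    \<open>1 / norm x\<close> is consumed by measuring \<open>t\<close> in units of
    \<open>x\<close>.\<close>
  have QN: "ennreal (1 / norm x) * Q h x = ennreal (h ^ k) * N h x" if x: "x \<noteq> 0" and h: "h > 0" for x h
  proof -
    interpret Hx: sigma_finite_measure "H x" by (rule Hsf)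
    define e where "e = x /\<^sub>R norm x"
    have e: "norm e = 1" "hyperplane_perp e = hyperplane_perp x"
      using x by (auto simp: e_def hyperplane_perp_scaleR)
    define G where "G t = (\<integral>\<^sup>+v. indicator K (h *\<^sub>R v + t *\<^sub>R e) * ennreal (Z (norm v)) \<partial>H x)" for t
    have [measurable]: "G \<in> borel_measurable borel" unfolding G_def by measurable
    have "Q h x = (\<integral>\<^sup>+t. (\<integral>\<^sup>+v. ennreal (Z (norm (perp_part x (v + t *\<^sub>R e)) / h)) * indicator K (v + t *\<^sub>R e) \<partial>H x) \<partial>lborel)"
      unfolding Q_def H_def e(2)[symmetric] by (rule nn_integral_lborel_split[OF e(1)]) measurable
    also have "\<dots> = (\<integral>\<^sup>+t. (\<integral>\<^sup>+v. ennreal (Z (norm v / h)) * indicator K (v + t *\<^sub>R e) \<partial>H x) \<partial>lborel)"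
    proof (rule nn_integral_cong, rule nn_integral_cong_AE, use AEH[of x] in eventually_elim)
      case (elim t v)
      then show ?case unfolding e_def using x by (simp add: perp_part_add)
    qed
    also have "\<dots> = (\<integral>\<^sup>+t. ennreal (h ^ k) * G t \<partial>lborel)"
    proof (rule nn_integral_cong)
      fix t :: real
      show "(\<integral>\<^sup>+v. ennreal (Z (norm v / h)) * indicator K (v + t *\<^sub>R e) \<partial>H x) = ennreal (h ^ k) * G t"
        using nn_integral_subspace_scale[OF subspace_hyperplane_perp, of "\<lambda>v. ennreal (Z (norm v / h)) * indicator K (v + t *\<^sub>R e)" h x]
          h dimH[OF x] by (simp add: G_def H_def k_def mult.commute)
    qed
    also have "\<dots> = ennreal (h ^ k) * (\<integral>\<^sup>+t. G t \<partial>lborel)"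
      by (rule nn_integral_cmult) measurable
    also have "(\<integral>\<^sup>+t. G t \<partial>lborel) = ennreal (norm x) * (\<integral>\<^sup>+t. G (norm x * t) \<partial>lborel)"
      using nn_integral_real_affine[of G "norm x" 0] x by simp
    also have "(\<integral>\<^sup>+t. G (norm x * t) \<partial>lborel) = N h x"
    proof -
      have "(norm x * t) *\<^sub>R e = t *\<^sub>R x" for t using x by (simp add: e_def field_simps)
      then show ?thesis unfolding G_def N_def by simp
    qed
    finally have "ennreal (1 / norm x) * Q h x = (ennreal (1 / norm x) * ennreal (norm x)) * (ennreal (h ^ k) * N h x)"
      by (simp add: ac_simps)
    also have "ennreal (1 / norm x) * ennreal (norm x) = 1"
      using x by (simp add: ennreal_mult[symmetric])
    finally show ?thesis by simp
  qed
  \<comment> \<open>The comparison of sections is integrated against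
    \<open>P h \<xi> / norm \<xi>\<close>; the incidence formula moves the weight to the points, and
    \<open>h ^ k\<close> cancels.\<close>
  have le1: "(\<integral>\<^sup>+x. D x * N h x \<partial>lborel) \<le> (\<integral>\<^sup>+x. E x * N h x \<partial>lborel)" if h: "h > 0" for h
  proof -
    have F: "(\<integral>\<^sup>+\<xi>. ennreal (1 / norm \<xi>) * ((\<integral>\<^sup>+x. F x \<partial>H \<xi>) * P h \<xi>) \<partial>lborel) = ennreal (h ^ k) * (\<integral>\<^sup>+x. F x * N h x \<partial>lborel)"
      if [measurable]: "F \<in> borel_measurable borel" for F
    proof -
      have "(\<integral>\<^sup>+\<xi>. ennreal (1 / norm \<xi>) * ((\<integral>\<^sup>+x. F x \<partial>H \<xi>) * P h \<xi>) \<partial>lborel)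
         = (\<integral>\<^sup>+\<xi>. ennreal (1 / norm \<xi>) * (\<integral>\<^sup>+x. F x * P h \<xi> \<partial>H \<xi>) \<partial>lborel)"
        by (intro nn_integral_cong arg_cong2[where f="(*)"] refl nn_integral_multc[symmetric]) measurable
      also have "\<dots> = (\<integral>\<^sup>+x. ennreal (1 / norm x) * (\<integral>\<^sup>+\<xi>. F x * P h \<xi> \<partial>H x) \<partial>lborel)"
        unfolding H_def using nn_integral_incidence[OF dim, of "\<lambda>(x, \<xi>). F x * P h \<xi>"] by simp
      also have "\<dots> = (\<integral>\<^sup>+x. F x * (ennreal (1 / norm x) * Q h x) \<partial>lborel)"
      proof (rule nn_integral_cong_AE, use AE_lborel_singleton[of "0::'a"] in eventually_elim)
        case (elim x)
        have "(\<integral>\<^sup>+\<xi>. F x * P h \<xi> \<partial>H x) = F x * Q h x"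
          by (subst nn_integral_cmult) (auto simp: PQ[OF elim h])
        then show ?case by (simp add: ac_simps)
      qed
      also have "\<dots> = (\<integral>\<^sup>+x. ennreal (h ^ k) * (ennreal (1 / h ^ k) * (F x * (ennreal (1 / norm x) * Q h x))) \<partial>lborel)"
        using h by (simp add: mult.assoc[symmetric] ennreal_mult[symmetric])
      also have "\<dots> = ennreal (h ^ k) * (\<integral>\<^sup>+x. ennreal (1 / h ^ k) * (F x * (ennreal (1 / norm x) * Q h x)) \<partial>lborel)"
        by (rule nn_integral_cmult) measurable
      also have "(\<integral>\<^sup>+x. ennreal (1 / h ^ k) * (F x * (ennreal (1 / norm x) * Q h x)) \<partial>lborel) = (\<integral>\<^sup>+x. F x * N h x \<partial>lborel)"
      proof (rule nn_integral_cong_AE, use AE_lborel_singleton[of "0::'a"] in eventually_elim)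
        case (elim x)
        have "ennreal (1 / h ^ k) * (F x * (ennreal (1 / norm x) * Q h x)) = (ennreal (1 / h ^ k) * ennreal (h ^ k)) * (F x * N h x)"
          unfolding QN[OF elim h] by (simp add: ac_simps)
        also have "ennreal (1 / h ^ k) * ennreal (h ^ k) = 1" using h by (simp add: ennreal_mult[symmetric])
        finally show ?case by simp
      qed
      finally show ?thesis .
    qed
    have "ennreal (h ^ k) * (\<integral>\<^sup>+x. D x * N h x \<partial>lborel) \<le> ennreal (h ^ k) * (\<integral>\<^sup>+x. E x * N h x \<partial>lborel)"
      unfolding F[OF DE(1), symmetric] F[OF DE(2), symmetric]
    proof (rule nn_integral_mono_AE, use AE_lborel_singleton[of "0::'a"] in eventually_elim)
      case (elim \<xi>)
      then show ?case unfolding H_def by (intro mult_left_mono mult_right_mono cmp) auto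
    qed
    then show ?thesis using h by (subst (asm) ennreal_mult_le_mult_iff) auto
  qed
  define hh where "hh i = 1 / real (Suc i)" for i
  have hh: "hh i > 0" for i by (simp add: hh_def)
  have hh0: "hh \<longlonglongrightarrow> 0" unfolding hh_def by (rule LIMSEQ_inverse_real_of_nat[unfolded inverse_eq_divide])
  \<comment> \<open>Orthogonality gives \<open>norm (t *\<^sub>R x) \<le> norm (h *\<^sub>R v + t
    *\<^sub>R x)\<close>, so only bounded \<open>t\<close> contribute, uniformly in
    \<open>h\<close>: a majorant for the limit.\<close>
  have ub: "(\<integral>\<^sup>+v. indicator K (h *\<^sub>R v + t *\<^sub>R x) * ennreal (Z (norm v)) \<partial>H x) \<le> ennreal c * indicator {- (R0 / norm x) .. R0 / norm x} t"
    if x: "x \<noteq> 0" for x h t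
  proof -
    have "(\<integral>\<^sup>+v. indicator K (h *\<^sub>R v + t *\<^sub>R x) * ennreal (Z (norm v)) \<partial>H x)
       \<le> (\<integral>\<^sup>+v. indicator {- (R0 / norm x) .. R0 / norm x} t * ennreal (Z (norm v)) \<partial>H x)"
    proof (rule nn_integral_mono_AE, use AEH[of x] in eventually_elim)
      case (elim v)
      have "\<bar>t\<bar> \<le> R0 / norm x" if "h *\<^sub>R v + t *\<^sub>R x \<in> K"
      proof -
        have "norm (t *\<^sub>R x) \<le> norm (h *\<^sub>R v + t *\<^sub>R x)"
        proof (rule power2_le_imp_le)
          have "v \<bullet> x = 0" using elim by (simp add: hyperplane_perp_def inner_commute)
          then show "(norm (t *\<^sub>R x))\<^sup>2 \<le> (norm (h *\<^sub>R v + t *\<^sub>R x))\<^sup>2"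
            unfolding power2_norm_eq_inner
              by (simp add: inner_add_left inner_add_right inner_commute)
                 (metis inner_ge_zero mult.assoc mult_nonneg_nonneg zero_le_square)
        qed simp
        also have "\<dots> \<le> R0" using R0 that by simp
        finally show ?thesis using x by (simp add: field_simps)
      qed
      then show ?case by (auto simp: indicator_def abs_le_iff)
    qed
    also have "\<dots> = ennreal c * indicator {- (R0 / norm x) .. R0 / norm x} t"
      using c(2)[OF x] by (subst nn_integral_cmult) (auto simp: Z_def H_def mult.commute)
    finally show ?thesis .
  qed
  have Nb: "N h x \<le> ennreal (2 * (R0 / norm x) * c)" if x: "x \<noteq> 0" and h: "h > 0" for x h
  proof -
    have "N h x \<le> (\<integral>\<^sup>+t. ennreal c * indicator {- (R0 / norm x) .. R0 / norm x} t \<partial>lborel)"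
      unfolding N_def by (rule nn_integral_mono) (rule ub[OF x])
    also have "\<dots> = ennreal c * ennreal (2 * (R0 / norm x))"
      using R0(1) by (subst nn_integral_cmult) auto
    also have "\<dots> = ennreal (2 * (R0 / norm x) * c)" using c(1) R0(1) by (simp add: ennreal_mult[symmetric] mult.commute)
    finally show ?thesis .
  qed
  define \<Lambda> where "\<Lambda> x = emeasure lborel {t::real. t *\<^sub>R x \<in> K}" for x
  have N\<Lambda>: "(\<lambda>i. N (hh i) x) \<longlonglongrightarrow> ennreal c * \<Lambda> x" if x: "x \<noteq> 0" for x
  proof -
    interpret Hx: sigma_finite_measure "H x" by (rule Hsf)
    define u where "u i t = (\<integral>\<^sup>+v. indicator K (hh i *\<^sub>R v + t *\<^sub>R x) * ennreal (Z (norm v)) \<partial>H x)" for i t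
    have [measurable]: "u i \<in> borel_measurable borel" for i unfolding u_def[abs_def] by measurable
    have cx: "(\<integral>\<^sup>+v. ennreal (Z (norm v)) \<partial>H x) = ennreal c" using c(2)[OF x] by (simp add: Z_def H_def)
    have lim: "(\<lambda>i. u i t) \<longlonglongrightarrow> ennreal c * indicator K (t *\<^sub>R x)" if t: "t *\<^sub>R x \<in> interior K \<or> t *\<^sub>R x \<notin> K" for t
    proof -
      have "(\<lambda>i. u i t) \<longlonglongrightarrow> (\<integral>\<^sup>+v. indicator K (t *\<^sub>R x) * ennreal (Z (norm v)) \<partial>H x)"
        unfolding u_def
      proof (rule nn_integral_dominated_convergence[where w="\<lambda>v. ennreal (Z (norm v))"])
        show "AE v in H x. (\<lambda>i. indicator K (hh i *\<^sub>R v + t *\<^sub>R x) * ennreal (Z (norm v))) \<longlonglongrightarrow> indicator K (t *\<^sub>R x) * ennreal (Z (norm v))"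
        proof (rule AE_I2)
          fix v
          have conv: "(\<lambda>i. hh i *\<^sub>R v + t *\<^sub>R x) \<longlonglongrightarrow> 0 *\<^sub>R v + t *\<^sub>R x"
            by (intro tendsto_intros hh0)
          have "\<forall>\<^sub>F i in sequentially. indicator K (hh i *\<^sub>R v + t *\<^sub>R x) = (indicator K (t *\<^sub>R x) :: ennreal)"
          proof (cases "t *\<^sub>R x \<in> interior K")
            case True
            then have "\<forall>\<^sub>F i in sequentially. hh i *\<^sub>R v + t *\<^sub>R x \<in> interior K"
              using conv by (intro topological_tendstoD) auto
            then show ?thesis
              by eventually_elim (use True interior_subset in \<open>auto simp: indicator_def\<close>)
          next
            case False
            then have "t *\<^sub>R x \<in> - K" using t by auto
            moreover have "open (- K)" using cK by (simp add: compact_imp_closed open_Compl)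
            ultimately have "\<forall>\<^sub>F i in sequentially. hh i *\<^sub>R v + t *\<^sub>R x \<in> - K"
              using conv by (intro topological_tendstoD) auto
            then show ?thesis
              by eventually_elim (use \<open>t *\<^sub>R x \<in> - K\<close> in \<open>auto simp: indicator_def\<close>)
          qed
          then show "(\<lambda>i. indicator K (hh i *\<^sub>R v + t *\<^sub>R x) * ennreal (Z (norm v))) \<longlonglongrightarrow> indicator K (t *\<^sub>R x) * ennreal (Z (norm v))"
            by (intro tendsto_eventually) (auto elim: eventually_mono)
        qed
        show "(\<integral>\<^sup>+v. ennreal (Z (norm v)) \<partial>H x) < \<infinity>" using cx by simp
      qed (measurable, auto simp: indicator_def)
      also have "(\<integral>\<^sup>+v. indicator K (t *\<^sub>R x) * ennreal (Z (norm v)) \<partial>H x) = ennreal c * indicator K (t *\<^sub>R x)"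
        using cx by (subst nn_integral_cmult) (auto simp: mult.commute)
      finally show ?thesis .
    qed
    have "(\<lambda>i. \<integral>\<^sup>+t. u i t \<partial>lborel) \<longlonglongrightarrow> (\<integral>\<^sup>+t. ennreal c * indicator K (t *\<^sub>R x) \<partial>lborel)"
    proof (rule nn_integral_dominated_convergence[where w="\<lambda>t. ennreal c * indicator {- (R0 / norm x) .. R0 / norm x} t"])
      show "AE t in lborel. (\<lambda>i. u i t) \<longlonglongrightarrow> ennreal c * indicator K (t *\<^sub>R x)"
        using convex_body_frontier_line_null[OF K x] by eventually_elim (rule lim)
      show "AE t in lborel. u i t \<le> ennreal c * indicator {- (R0 / norm x) .. R0 / norm x} t" for i
        unfolding u_def by (rule AE_I2) (rule ub[OF x])
      show "(\<integral>\<^sup>+t. ennreal c * indicator {- (R0 / norm x) .. R0 / norm x} t \<partial>lborel) < \<infinity>"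
        using R0(1) by (subst nn_integral_cmult) (auto simp: ennreal_mult_less_top)
    qed measurable
    also have "(\<integral>\<^sup>+t. ennreal c * indicator K (t *\<^sub>R x) \<partial>lborel) = ennreal c * \<Lambda> x"
    proof -
      have "(indicator K (t *\<^sub>R x) :: ennreal) = indicator {t::real. t *\<^sub>R x \<in> K} t" for t by (simp add: indicator_def)
      moreover have "{t::real. t *\<^sub>R x \<in> K} \<in> sets borel" by measurable
      ultimately show ?thesis unfolding \<Lambda>_def by (simp add: nn_integral_cmult_indicator)
    qed
    finally show ?thesis unfolding N_def u_def .
  qed
  have lim: "(\<lambda>i. \<integral>\<^sup>+x. F x * N (hh i) x \<partial>lborel) \<longlonglongrightarrow> ennreal c * (\<integral>\<^sup>+x. F x * \<Lambda> x \<partial>lborel)"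
    if [measurable]: "F \<in> borel_measurable borel"
      and Fb: "\<And>x. F x \<le> ennreal M * indicator {x. \<epsilon> \<le> norm x \<and> norm x \<le> R} x" for F
  proof -
    \<comment> \<open>\<open>N'\<close> equals \<open>N\<close> off the origin. In \<open>N\<close>
      the measure itself varies with \<open>x\<close>, whereas \<open>Q\<close> integrates over a
      fixed space and is visibly measurable in \<open>x\<close>.\<close>
    define N' where "N' i x = ennreal (1 / hh i ^ k) * (ennreal (1 / norm x) * Q (hh i) x)" for i x
    have [measurable]: "N' i \<in> borel_measurable borel" for i unfolding N'_def[abs_def] by measurable
    have N': "N' i x = N (hh i) x" if "x \<noteq> 0" for i x
    proof -
      have "N' i x = (ennreal (1 / hh i ^ k) * ennreal (hh i ^ k)) * N (hh i) x"
        unfolding N'_def QN[OF that hh] by (simp add: mult.assoc)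
      also have "ennreal (1 / hh i ^ k) * ennreal (hh i ^ k) = 1"
        using hh[of i] by (simp add: ennreal_mult[symmetric])
      finally show ?thesis by simp
    qed
    have [measurable]: "\<Lambda> \<in> borel_measurable borel"
    proof -
      have "(\<lambda>x. \<integral>\<^sup>+t. indicator K (t *\<^sub>R x) \<partial>(lborel::real measure)) \<in> borel_measurable borel" by measurable
      moreover have "(\<integral>\<^sup>+t. indicator K (t *\<^sub>R x) \<partial>(lborel::real measure)) = \<Lambda> x" for x
      proof -
        have "(indicator K (t *\<^sub>R x) :: ennreal) = indicator {t::real. t *\<^sub>R x \<in> K} t" for t by (simp add: indicator_def)
        moreover have "{t::real. t *\<^sub>R x \<in> K} \<in> sets borel" by measurable
        ultimately show ?thesis unfolding \<Lambda>_def by simp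
      qed
      ultimately show ?thesis by simp
    qed
    have [measurable]: "cball (0::'a) R \<in> sets borel" by simp
    have "(\<lambda>i. \<integral>\<^sup>+x. F x * N' i x \<partial>lborel) \<longlonglongrightarrow> (\<integral>\<^sup>+x. F x * (ennreal c * \<Lambda> x) \<partial>lborel)"
    \<comment> \<open>The bound on \<open>N\<close> grows like \<open>1 / norm x\<close>. This is
      why \<open>D\<close> and \<open>E\<close> have to vanish for
      \<open>norm x < \<epsilon>\<close>.\<close>
    proof (rule nn_integral_dominated_convergence[where w="\<lambda>x. ennreal (M * (2 * (R0 / \<epsilon>) * c)) * indicator (cball 0 R) x"])
      show "AE x in lborel. F x * N' i x \<le> ennreal (M * (2 * (R0 / \<epsilon>) * c)) * indicator (cball 0 R) x" for i
      proof (rule AE_I2)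
        fix x
        show "F x * N' i x \<le> ennreal (M * (2 * (R0 / \<epsilon>) * c)) * indicator (cball 0 R) x"
        proof (cases "\<epsilon> \<le> norm x \<and> norm x \<le> R")
          case True
          then have "x \<noteq> 0" using bd(1) by auto
          have "F x * N' i x \<le> ennreal M * ennreal (2 * (R0 / norm x) * c)"
            unfolding N'[OF \<open>x \<noteq> 0\<close>] using Fb[of x] True Nb[OF \<open>x \<noteq> 0\<close> hh[of i]] by (intro mult_mono) auto
          also have "\<dots> \<le> ennreal M * ennreal (2 * (R0 / \<epsilon>) * c)"
            using True bd(1) R0(1) c(1) \<open>x \<noteq> 0\<close> by (intro mult_left_mono ennreal_leI mult_right_mono divide_left_mono mult_left_mono mult_pos_pos) auto
          also have "\<dots> = ennreal (M * (2 * (R0 / \<epsilon>) * c))"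
            using bd(1) R0(1) c(1) by (subst ennreal_mult'') auto
          finally show ?thesis using True by simp
        next
          case False
          then show ?thesis using Fb[of x] by simp
        qed
      qed
      show "AE x in lborel. (\<lambda>i. F x * N' i x) \<longlonglongrightarrow> F x * (ennreal c * \<Lambda> x)"
        using AE_lborel_singleton[of "0::'a"]
      proof eventually_elim
        case (elim x)
        have "F x \<le> ennreal M" using Fb[of x] by (auto simp: indicator_def split: if_splits intro: order_trans)
        then have "F x < top" by (simp add: le_less_trans)
        then show ?case unfolding N'[OF elim] by (intro ennreal_tendsto_cmult N\<Lambda>[OF elim])
      qed
      show "(\<integral>\<^sup>+x. ennreal (M * (2 * (R0 / \<epsilon>) * c)) * indicator (cball 0 R) (x::'a) \<partial>lborel) < \<infinity>"
        using emeasure_lborel_cball_finite[of "0::'a" R] by (simp add: nn_integral_cmult_indicator ennreal_mult_less_top)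
    qed measurable
    moreover have "(\<integral>\<^sup>+x. F x * N' i x \<partial>lborel) = (\<integral>\<^sup>+x. F x * N (hh i) x \<partial>lborel)" for i
    proof (rule nn_integral_cong_AE, use AE_lborel_singleton[of "0::'a"] in eventually_elim)
      case (elim x)
      then show ?case by (simp add: N')
    qed
    moreover have "(\<integral>\<^sup>+x. F x * (ennreal c * \<Lambda> x) \<partial>lborel) = ennreal c * (\<integral>\<^sup>+x. F x * \<Lambda> x \<partial>lborel)"
      by (subst nn_integral_cmult[symmetric]) (auto simp: ac_simps)
    ultimately show ?thesis by simp
  qed
  have "ennreal c * (\<integral>\<^sup>+x. D x * \<Lambda> x \<partial>lborel) \<le> ennreal c * (\<integral>\<^sup>+x. E x * \<Lambda> x \<partial>lborel)"
    using lim[OF DE(1) bd(2)] lim[OF DE(2) bd(3)] le1[OF hh] by (intro LIMSEQ_le) auto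
  then have "(\<integral>\<^sup>+x. D x * \<Lambda> x \<partial>lborel) \<le> (\<integral>\<^sup>+x. E x * \<Lambda> x \<partial>lborel)"
    using c(1) by (subst (asm) ennreal_mult_le_mult_iff) auto
  then show ?thesis unfolding \<Lambda>_def .
qed

section \<open>Averages of Gaussian ridge functions and their decay\<close>

lemma nn_integral_subspace_gaussian_ridge:
  fixes S :: "'a::euclidean_space set"
  assumes S: "subspace S" and v: "v \<in> S" and a: "a > 0" and b: "b \<ge> 0" and k: "dim S = Suc k"
  shows "(\<integral>\<^sup>+\<xi>. ennreal (exp (- a * (norm \<xi>)\<^sup>2 / 2) * exp (- b * (v \<bullet> \<xi>)\<^sup>2 / 2)) \<partial>subspace_lborel S)
    = ennreal (sqrt (2 * pi / a) ^ k * sqrt (2 * pi / (a + b * (norm v)\<^sup>2)))"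
proof (cases "v = 0")
  case True
  then show ?thesis
    using nn_integral_subspace_gaussian[OF S a] k by (simp add: mult.commute)
next
  case False
  define e where "e = v /\<^sub>R norm v"
  have e: "e \<in> S" "norm e = 1" using False v S by (auto simp: e_def subspace_scale)
  have ve: "v = norm v *\<^sub>R e" using False by (simp add: e_def)
  define T where "T = S \<inter> hyperplane_perp e"
  have T: "subspace T" unfolding T_def by (rule subspace_inter[OF S subspace_hyperplane_perp])
  have dimT: "dim T = k" using dim_hyperplane_section[OF S e] k by (simp add: T_def)
  \<comment> \<open>In the direction of \<open>v\<close> the quadratic form has coefficient
    \<open>c\<close>, in all orthogonal directions it keeps \<open>a\<close>. So averaging turns a
    Gaussian in \<open>v \<bullet> \<xi>\<close> into an inverse square root in
    \<open>norm v\<close>.\<close>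
  define c where "c = a + b * (norm v)\<^sup>2"
  have c: "c > 0" using a b by (simp add: c_def add_pos_nonneg)
  have "(\<integral>\<^sup>+\<xi>. ennreal (exp (- a * (norm \<xi>)\<^sup>2 / 2) * exp (- b * (v \<bullet> \<xi>)\<^sup>2 / 2)) \<partial>subspace_lborel S)
    = (\<integral>\<^sup>+s. (\<integral>\<^sup>+w. ennreal (exp (- a * (norm (w + s *\<^sub>R e))\<^sup>2 / 2) * exp (- b * (v \<bullet> (w + s *\<^sub>R e))\<^sup>2 / 2)) \<partial>subspace_lborel T) \<partial>lborel)"
    unfolding T_def by (rule nn_integral_subspace_split[OF S e]) measurable
  also have "\<dots> = (\<integral>\<^sup>+s. (\<integral>\<^sup>+w. ennreal (exp (- c * s\<^sup>2 / 2)) * ennreal (exp (- a * (norm w)\<^sup>2 / 2)) \<partial>subspace_lborel T) \<partial>lborel)"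
  proof (rule nn_integral_cong, rule nn_integral_cong_AE, use AE_subspace_lborel[OF T] in eventually_elim)
    case (elim s w)
    then have we: "w \<bullet> e = 0" by (simp add: T_def hyperplane_perp_def inner_commute)
    have ee: "e \<bullet> e = 1" using e(2) by (simp add: norm_eq_1)
    have n: "(norm (w + s *\<^sub>R e))\<^sup>2 = (norm w)\<^sup>2 + s\<^sup>2"
      unfolding power2_norm_eq_inner using we ee
      by (simp add: inner_add_left inner_add_right inner_commute power2_eq_square)
    have i: "v \<bullet> (w + s *\<^sub>R e) = norm v * s"
      by (subst ve) (use we ee in \<open>simp add: inner_add_right inner_commute\<close>)
    have "- a * (norm (w + s *\<^sub>R e))\<^sup>2 / 2 + - b * (v \<bullet> (w + s *\<^sub>R e))\<^sup>2 / 2 = - c * s\<^sup>2 / 2 + - a * (norm w)\<^sup>2 / 2"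
      unfolding n i c_def by (simp add: field_simps power_mult_distrib)
    then show ?case
      by (simp only: exp_add[symmetric] ennreal_mult[symmetric, OF exp_ge_zero exp_ge_zero])
  qed
  also have "\<dots> = (\<integral>\<^sup>+s. ennreal (exp (- c * s\<^sup>2 / 2)) * ennreal (sqrt (2 * pi / a) ^ k) \<partial>lborel)"
    using nn_integral_subspace_gaussian[OF T a] dimT by (intro nn_integral_cong) (subst nn_integral_cmult, auto)
  also have "\<dots> = ennreal (sqrt (2 * pi / c)) * ennreal (sqrt (2 * pi / a) ^ k)"
    using nn_integral_gaussian[OF c] by (subst nn_integral_multc) auto
  also have "\<dots> = ennreal (sqrt (2 * pi / a) ^ k * sqrt (2 * pi / c))"
    using a c by (subst ennreal_mult[symmetric]) (auto simp: mult.commute)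
  finally show ?thesis unfolding c_def .
qed

lemma nn_integral_inverse_quadratic_le:
  assumes "A > 0"
  shows "(\<integral>\<^sup>+t. ennreal (1 / (A + t\<^sup>2)) \<partial>lborel) \<le> ennreal (pi / sqrt A)"
proof -
  let ?F = "\<lambda>t::real. ennreal (1 / (A + t\<^sup>2))"
  have half: "(\<integral>\<^sup>+t. ?F t * indicator {0..} t \<partial>lborel) = ennreal (pi / (2 * sqrt A) - arctan (0 / sqrt A) / sqrt A)"
  proof (rule nn_integral_FTC_atLeast)
    show "((\<lambda>t. arctan (t / sqrt A) / sqrt A) \<longlongrightarrow> pi / (2 * sqrt A)) at_top"
    proof -
      have "((\<lambda>t. arctan (t / sqrt A)) \<longlongrightarrow> pi / 2) at_top"
        using assms by (intro filterlim_compose[OF tendsto_arctan_at_top])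
          (auto intro!: filterlim_at_top_mult_tendsto_pos[of "\<lambda>_. 1 / sqrt A" "1 / sqrt A" _ "\<lambda>t. t", simplified] filterlim_ident)
      then have "((\<lambda>t. arctan (t / sqrt A) / sqrt A) \<longlongrightarrow> (pi / 2) / sqrt A) at_top"
        using assms by (intro tendsto_divide tendsto_const) auto
      then show ?thesis by simp
    qed
    fix t :: real
    have "((\<lambda>t. arctan (t / sqrt A) / sqrt A) has_real_derivative (1 / sqrt A) * inverse (1 + (t / sqrt A)\<^sup>2) / sqrt A) (at t)"
      using assms by (auto intro!: derivative_eq_intros simp: mult.assoc)
    moreover have "(1 / sqrt A) * inverse (1 + (t / sqrt A)\<^sup>2) / sqrt A = 1 / (A + t\<^sup>2)"
    proof -
      have "1 + (t / sqrt A)\<^sup>2 = (A + t\<^sup>2) / A" using assms by (simp add: power_divide field_simps)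
      then have "(1 / sqrt A) * inverse (1 + (t / sqrt A)\<^sup>2) / sqrt A = (A / (A + t\<^sup>2)) / (sqrt A * sqrt A)"
        by simp
      also have "\<dots> = 1 / (A + t\<^sup>2)" using assms by simp
      finally show ?thesis .
    qed
    ultimately show "((\<lambda>t. arctan (t / sqrt A) / sqrt A) has_real_derivative 1 / (A + t\<^sup>2)) (at t)" by simp
    show "0 \<le> 1 / (A + t\<^sup>2)" using assms by (simp add: add_nonneg_nonneg)
  qed measurable
  have "(\<integral>\<^sup>+t. ?F t \<partial>lborel) \<le> (\<integral>\<^sup>+t. ?F t * indicator {0..} t + ?F (- t) * indicator {0..} (- t) \<partial>lborel)"
    by (intro nn_integral_mono) (auto simp: indicator_def)
  also have "\<dots> = (\<integral>\<^sup>+t. ?F t * indicator {0..} t \<partial>lborel) + (\<integral>\<^sup>+t. ?F (- t) * indicator {0..} (- t) \<partial>lborel)"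
    by (rule nn_integral_add) measurable
  also have "(\<integral>\<^sup>+t. ?F (- t) * indicator {0..} (- t) \<partial>lborel) = (\<integral>\<^sup>+t. ?F t * indicator {0..} t \<partial>lborel)"
    by (rule nn_integral_lborel_uminus) measurable
  finally show ?thesis
    unfolding half using assms by (simp add: ennreal_plus[symmetric] del: ennreal_plus)
qed

text \<open>Decay of order one above the dimension is integrable. In the induction, one factor is
  bounded by \<open>1 / sqrt (A + t\<^sup>2)\<close> and the others are left to the hypothesis for
  \<open>A + t\<^sup>2\<close>, which returns a second such factor. Their product is integrable in
  \<open>t\<close>.\<close>

lemma nn_integral_onb_decay_le:
  fixes B :: "'a::euclidean_space set"
  assumes "orthonormal B" "A > 0"
  shows "(\<integral>\<^sup>+x. ennreal ((1 / sqrt (A + (norm x)\<^sup>2)) ^ Suc (card B)) \<partial>onb_lborel B) \<le> ennreal (pi ^ card B / sqrt A)"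
  using orthonormal_finite[OF assms(1)] assms
proof (induction B arbitrary: A)
  case empty
  then show ?case by (simp add: nn_integral_onb_empty)
next
  case (insert e B)
  have B: "orthonormal B" using orthonormal_subset[OF insert.prems(1)] by auto
  let ?k = "card B"
  have "(\<integral>\<^sup>+x. ennreal ((1 / sqrt (A + (norm x)\<^sup>2)) ^ Suc (card (insert e B))) \<partial>onb_lborel (insert e B))
     = (\<integral>\<^sup>+t. (\<integral>\<^sup>+x. ennreal ((1 / sqrt (A + (norm (x + t *\<^sub>R e))\<^sup>2)) ^ Suc (card (insert e B))) \<partial>onb_lborel B) \<partial>lborel)"
    by (rule nn_integral_onb_insert[OF insert.hyps]) measurable
  also have "\<dots> \<le> (\<integral>\<^sup>+t. ennreal (pi ^ ?k) * ennreal (1 / (A + t\<^sup>2)) \<partial>lborel)"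
  proof (rule nn_integral_mono)
    fix t :: real
    have At: "A + t\<^sup>2 > 0" using insert.prems(2) by (simp add: add_pos_nonneg)
    have "(\<integral>\<^sup>+x. ennreal ((1 / sqrt (A + (norm (x + t *\<^sub>R e))\<^sup>2)) ^ Suc (card (insert e B))) \<partial>onb_lborel B)
      \<le> (\<integral>\<^sup>+x. ennreal (1 / sqrt (A + t\<^sup>2)) * ennreal ((1 / sqrt ((A + t\<^sup>2) + (norm x)\<^sup>2)) ^ Suc ?k) \<partial>onb_lborel B)"
    proof (rule nn_integral_mono_AE, use AE_onb_span[OF insert.hyps(1)] in eventually_elim)
      case (elim x)
      have n: "A + (norm (x + t *\<^sub>R e))\<^sup>2 = (A + t\<^sup>2) + (norm x)\<^sup>2"
        using norm_orthonormal_insert[OF insert.prems(1) insert.hyps(2) elim, of t] by simp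
      have "1 / sqrt ((A + t\<^sup>2) + (norm x)\<^sup>2) \<le> 1 / sqrt (A + t\<^sup>2)"
        using At by (intro divide_left_mono mult_pos_pos) (auto simp: add_pos_nonneg)
      then have "(1 / sqrt ((A + t\<^sup>2) + (norm x)\<^sup>2)) * (1 / sqrt ((A + t\<^sup>2) + (norm x)\<^sup>2)) ^ Suc ?k
         \<le> (1 / sqrt (A + t\<^sup>2)) * (1 / sqrt ((A + t\<^sup>2) + (norm x)\<^sup>2)) ^ Suc ?k"
        using At by (intro mult_right_mono) auto
      then show ?case
        unfolding n using insert.hyps At
        by (subst ennreal_mult[symmetric]) (auto intro!: ennreal_leI)
    qed
    also have "\<dots> \<le> ennreal (1 / sqrt (A + t\<^sup>2)) * ennreal (pi ^ ?k / sqrt (A + t\<^sup>2))"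
      using insert.IH[OF B At] by (subst nn_integral_cmult) (auto intro!: mult_left_mono)
    also have "\<dots> = ennreal (pi ^ ?k) * ennreal (1 / (A + t\<^sup>2))"
    proof -
      have "(1 / sqrt (A + t\<^sup>2)) * (pi ^ ?k / sqrt (A + t\<^sup>2)) = pi ^ ?k * (1 / (A + t\<^sup>2))"
        using At by (simp add: real_sqrt_mult_self)
      then show ?thesis using At by (simp add: ennreal_mult[symmetric])
    qed
    finally show "(\<integral>\<^sup>+x. ennreal ((1 / sqrt (A + (norm (x + t *\<^sub>R e))\<^sup>2)) ^ Suc (card (insert e B))) \<partial>onb_lborel B)
      \<le> ennreal (pi ^ ?k) * ennreal (1 / (A + t\<^sup>2))" .
  qed
  also have "\<dots> \<le> ennreal (pi ^ ?k) * ennreal (pi / sqrt A)"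
    using nn_integral_inverse_quadratic_le[OF insert.prems(2)] by (subst nn_integral_cmult) (auto intro!: mult_left_mono)
  also have "\<dots> = ennreal (pi ^ card (insert e B) / sqrt A)"
    using insert.hyps insert.prems(2) by (simp add: ennreal_mult[symmetric] mult.commute)
  finally show ?case .
qed

lemma nn_integral_subspace_decay_finite:
  fixes S :: "'a::euclidean_space set"
  assumes S: "subspace S" and bd: "\<And>x. F x \<le> ennreal (C * (1 / sqrt (1 + (norm x)\<^sup>2)) ^ Suc (dim S))" and "C \<ge> 0"
  shows "(\<integral>\<^sup>+x. F x \<partial>subspace_lborel S) < \<infinity>"
proof -
  obtain B where B: "orthonormal B" "span B = S" "card B = dim S"
    using orthonormal_basis_obtain[OF S] .
  have "(\<integral>\<^sup>+x. F x \<partial>subspace_lborel S) \<le> (\<integral>\<^sup>+x. ennreal C * ennreal ((1 / sqrt (1 + (norm x)\<^sup>2)) ^ Suc (card B)) \<partial>onb_lborel B)"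
    unfolding subspace_lborel_onb[OF B(1,2)]
    using bd \<open>C \<ge> 0\<close> by (intro nn_integral_mono) (simp add: B(3) ennreal_mult[symmetric])
  also have "\<dots> \<le> ennreal C * ennreal (pi ^ card B / sqrt 1)"
    using nn_integral_onb_decay_le[OF B(1) zero_less_one] by (subst nn_integral_cmult) (auto intro!: mult_left_mono)
  also have "\<dots> < \<infinity>" by (simp add: ennreal_mult_less_top)
  finally show ?thesis .
qed

lemma nn_integral_subspace_pos:
  fixes S :: "'a::euclidean_space set"
  assumes S: "subspace S" and [measurable]: "F \<in> borel_measurable borel" and pos: "\<And>x. F x > 0"
  shows "(\<integral>\<^sup>+x. F x \<partial>subspace_lborel S) > 0"
proof (rule ccontr)
  assume "\<not> ?thesis"
  then have "(\<integral>\<^sup>+x. F x \<partial>subspace_lborel S) = 0" by (simp add: zero_less_iff_neq_zero)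
  then have "AE x in subspace_lborel S. F x = 0" by (subst (asm) nn_integral_0_iff_AE) auto
  then have "AE x in subspace_lborel S. ennreal (exp (- 1 * (norm x)\<^sup>2 / 2)) = 0"
    by eventually_elim (use pos in \<open>auto simp: less_le\<close>)
  then have "(\<integral>\<^sup>+x. ennreal (exp (- 1 * (norm x)\<^sup>2 / 2)) \<partial>subspace_lborel S) = 0"
    by (subst nn_integral_0_iff_AE) auto
  moreover have "ennreal (sqrt (2 * pi / 1) ^ dim S) > 0" by simp
  ultimately show False using nn_integral_subspace_gaussian[OF S, of 1] by simp
qed

text \<open>Up to a constant, the averaged kernels are \<open>1/\<alpha> - 1/\<beta>\<close> for \<open>n = 2, 3\<close> and
  \<open>(1/\<alpha> - 1/\<beta>) - (1/\<beta> - 1/\<gamma>)/9\<close> for \<open>n = 4\<close>, where \<open>\<alpha>\<close>, \<open>\<beta>\<close>, \<open>\<gamma>\<close> are the square roots of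
  \<open>1 + r\<^sup>2\<close>, \<open>9 + r\<^sup>2\<close>, \<open>81 + r\<^sup>2\<close>.\<close>

lemma kernel_bounds:
  fixes r :: real
  defines "\<alpha> \<equiv> sqrt (1 + r\<^sup>2)" and "\<beta> \<equiv> sqrt (9 + r\<^sup>2)" and "\<gamma> \<equiv> sqrt (81 + r\<^sup>2)"
  shows "1 / \<alpha> - 1 / \<beta> > 0" "1 / \<alpha> - 1 / \<beta> \<le> 4 * (1 / \<alpha>) ^ 3"
    "1 / \<alpha> + 1 / (9 * \<gamma>) - 10 / (9 * \<beta>) > 0" "1 / \<alpha> + 1 / (9 * \<gamma>) - 10 / (9 * \<beta>) \<le> 320 * (1 / \<alpha>) ^ 4"
proof -
  have a: "\<alpha> \<ge> 1" "\<alpha>\<^sup>2 = 1 + r\<^sup>2" by (auto simp: \<alpha>_def)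
  have b: "\<beta>\<^sup>2 = 9 + r\<^sup>2" "\<alpha> < \<beta>" by (auto simp: \<alpha>_def \<beta>_def)
  have c: "\<gamma>\<^sup>2 = 81 + r\<^sup>2" "\<beta> < \<gamma>" by (auto simp: \<gamma>_def \<beta>_def)
  have pos: "\<alpha> > 0" "\<beta> > 0" "\<gamma> > 0" using a b c by auto
  show "1 / \<alpha> - 1 / \<beta> > 0" using pos b(2) by (simp add: frac_less2)
  have ab: "1 / \<alpha> - 1 / \<beta> = 8 / (\<alpha> * \<beta> * (\<alpha> + \<beta>))"
  proof -
    have "(\<beta> - \<alpha>) * (\<alpha> + \<beta>) = 8" using a(2) b(1) by (simp add: algebra_simps power2_eq_square)
    then have "8 / (\<alpha> * \<beta> * (\<alpha> + \<beta>)) = (\<beta> - \<alpha>) * (\<alpha> + \<beta>) / (\<alpha> * \<beta> * (\<alpha> + \<beta>))" by simp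
    also have "\<dots> = (\<beta> - \<alpha>) / (\<alpha> * \<beta>)"
      using pos by (intro nonzero_mult_divide_mult_cancel_right) auto
    also have "\<dots> = 1 / \<alpha> - 1 / \<beta>" using pos by (simp add: diff_divide_distrib)
    finally show ?thesis ..
  qed
  have bc: "1 / \<beta> - 1 / \<gamma> = 72 / (\<beta> * \<gamma> * (\<beta> + \<gamma>))"
  proof -
    have "(\<gamma> - \<beta>) * (\<beta> + \<gamma>) = 72" using c(1) b(1) by (simp add: algebra_simps power2_eq_square)
    then have "72 / (\<beta> * \<gamma> * (\<beta> + \<gamma>)) = (\<gamma> - \<beta>) * (\<beta> + \<gamma>) / (\<beta> * \<gamma> * (\<beta> + \<gamma>))" by simp
    also have "\<dots> = (\<gamma> - \<beta>) / (\<beta> * \<gamma>)"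
      using pos by (intro nonzero_mult_divide_mult_cancel_right) auto
    also have "\<dots> = 1 / \<beta> - 1 / \<gamma>" using pos by (simp add: diff_divide_distrib)
    finally show ?thesis ..
  qed
  have "2 * \<alpha> ^ 3 \<le> \<alpha> * \<beta> * (\<alpha> + \<beta>)"
  proof -
    have "\<alpha> * \<alpha> * (\<alpha> + \<alpha>) \<le> \<alpha> * \<beta> * (\<alpha> + \<beta>)" using pos b(2) by (intro mult_mono) auto
    then show ?thesis by (simp add: power3_eq_cube algebra_simps)
  qed
  then have "8 / (\<alpha> * \<beta> * (\<alpha> + \<beta>)) \<le> 8 / (2 * \<alpha> ^ 3)" using pos by (intro divide_left_mono) auto
  then show "1 / \<alpha> - 1 / \<beta> \<le> 4 * (1 / \<alpha>) ^ 3" unfolding ab by (simp add: power_divide)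
  \<comment> \<open>Since 72 / 9 = 8, both differences share the factor \<open>8 / \<beta>\<close>
    and leave \<open>1 / X - 1 / Y\<close>. The terms of order \<open>r ^ 3\<close> in the
    denominator cancel; the numerator \<open>Y - X\<close> stays bounded, as both summands in it are
    at most 80.\<close>
  define X where "X = \<alpha> * (\<alpha> + \<beta>)"
  define Y where "Y = \<gamma> * (\<gamma> + \<beta>)"
  have XY: "0 < X" "X < Y" using pos b c unfolding X_def Y_def by (auto intro!: mult_strict_mono)
  have "1 / \<alpha> + 1 / (9 * \<gamma>) - 10 / (9 * \<beta>) = (1 / \<alpha> - 1 / \<beta>) - (1 / \<beta> - 1 / \<gamma>) / 9"
  proof -
    have "1 / (9 * \<gamma>) = (1 / \<gamma>) / 9" "10 / (9 * \<beta>) = 10 * (1 / \<beta>) / 9" by simp_all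
    then show ?thesis by (simp only:) (simp add: field_simps)
  qed
  also have "\<dots> = (8 / \<beta>) * (1 / X - 1 / Y)"
    unfolding ab bc X_def Y_def using pos by (simp add: divide_simps) (simp add: algebra_simps)
  finally have eq: "1 / \<alpha> + 1 / (9 * \<gamma>) - 10 / (9 * \<beta>) = (8 / \<beta>) * (1 / X - 1 / Y)" .
  show "1 / \<alpha> + 1 / (9 * \<gamma>) - 10 / (9 * \<beta>) > 0"
    unfolding eq using XY pos by (simp add: frac_less2)
  have "Y - X = (\<gamma>\<^sup>2 - \<alpha>\<^sup>2) + \<beta> * (\<gamma> - \<alpha>)" by (simp add: X_def Y_def algebra_simps power2_eq_square)
  also have "\<beta> * (\<gamma> - \<alpha>) \<le> (\<gamma> + \<alpha>) * (\<gamma> - \<alpha>)" using pos b c by (intro mult_right_mono) auto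
  also have "(\<gamma> + \<alpha>) * (\<gamma> - \<alpha>) = \<gamma>\<^sup>2 - \<alpha>\<^sup>2" by (simp add: algebra_simps power2_eq_square)
  finally have YX: "Y - X \<le> 160" using a c by simp
  have "4 * \<alpha> ^ 4 \<le> X * Y"
  proof -
    have "\<alpha> * (\<alpha> + \<alpha>) \<le> X" "\<alpha> * (\<alpha> + \<alpha>) \<le> Y" unfolding X_def Y_def using pos b c by (auto intro!: mult_mono)
    then have "(\<alpha> * (\<alpha> + \<alpha>)) * (\<alpha> * (\<alpha> + \<alpha>)) \<le> X * Y" using pos XY by (intro mult_mono) auto
    then show ?thesis by (simp add: power4_eq_xxxx algebra_simps)
  qed
  have "1 / X - 1 / Y = (Y - X) / (X * Y)" using XY by (simp add: field_simps)
  also have "\<dots> \<le> 160 / (4 * \<alpha> ^ 4)"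
    using YX \<open>4 * \<alpha> ^ 4 \<le> X * Y\<close> pos by (intro frac_le) auto
  \<comment> \<open>Using only \<open>\<beta> \<ge> 1\<close> gives away one power of decay, but
    exponent 4 already suffices on hyperplanes of dimension 3.\<close>
  finally have "(8 / \<beta>) * (1 / X - 1 / Y) \<le> 8 * (160 / (4 * \<alpha> ^ 4))"
    using XY pos a b by (intro mult_mono) (auto simp: frac_le field_simps)
  then show "1 / \<alpha> + 1 / (9 * \<gamma>) - 10 / (9 * \<beta>) \<le> 320 * (1 / \<alpha>) ^ 4"
    unfolding eq by (simp add: power_divide)
qed

text \<open>With \<open>g\<close> Gaussian in \<open>\<xi>\<close> and \<open>\<phi>\<close>
  Gaussian in the slab variable, the kernel is \<open>(g 1 - g 9) * \<phi> 1\<close> in dimension 2,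
  \<open>g 1 * (\<phi> 1 - \<phi> (1/9))\<close> in dimension 3, and
  \<open>(g 1 - g 9) * (\<phi> 1 - \<phi> (1/9))\<close> in dimension 4. The first factor is
  nonnegative pointwise; the second only after integration over \<open>K\<close>, by convexity. The
  averaged kernel has to decay with the dimension of the space as exponent, which is the restriction
  on the dimension.\<close>

lemma chord_comparison:
  fixes K :: "'a::euclidean_space set" and D E :: "'a \<Rightarrow> ennreal"
  assumes dim: "2 \<le> DIM('a)" "DIM('a) \<le> 4" and K: "convex_body K" "origin_symmetric K"
    and DE: "D \<in> borel_measurable borel" "E \<in> borel_measurable borel"
    and bd: "\<epsilon> > 0" "\<And>x. D x \<le> ennreal M * indicator {x. \<epsilon> \<le> norm x \<and> norm x \<le> R} x"
      "\<And>x. E x \<le> ennreal M * indicator {x. \<epsilon> \<le> norm x \<and> norm x \<le> R} x"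
    and cmp: "\<And>\<xi>. \<xi> \<noteq> 0 \<Longrightarrow> (\<integral>\<^sup>+x. D x \<partial>subspace_lborel (hyperplane_perp \<xi>)) \<le> (\<integral>\<^sup>+x. E x \<partial>subspace_lborel (hyperplane_perp \<xi>))"
  shows "(\<integral>\<^sup>+x. D x * emeasure lborel {t::real. t *\<^sub>R x \<in> K} \<partial>lborel) \<le> (\<integral>\<^sup>+x. E x * emeasure lborel {t::real. t *\<^sub>R x \<in> K} \<partial>lborel)"
proof -
  have [measurable]: "K \<in> sets borel" using K by (simp add: convex_body_borel)
  define g where "g a \<xi> = ennreal (exp (- a * (norm \<xi>)\<^sup>2 / 2))" for a and \<xi> :: 'a
  \<comment> \<open>The factor \<open>sqrt b\<close> lets the average in \<open>avg\<close> depend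
    on \<open>a\<close> and \<open>b\<close> through \<open>a / b\<close> alone, up to a power of
    \<open>a\<close>.\<close>
  define \<phi> where "\<phi> b s = ennreal (sqrt b * exp (- b * s\<^sup>2 / 2))" for b s :: real
  have [measurable]: "g a \<in> borel_measurable borel" "\<phi> b \<in> borel_measurable borel" for a b
    unfolding g_def \<phi>_def by measurable
  have dimH: "dim (hyperplane_perp x) = DIM('a) - 1" if "x \<noteq> 0" for x :: 'a
    unfolding hyperplane_perp_def by (rule dim_hyperplane[OF that])
  define k where "k = DIM('a) - 2"
  have dimH': "dim (hyperplane_perp x) = Suc k" if "x \<noteq> 0" for x :: 'a
    using dimH[OF that] dim by (simp add: k_def)
  define w where "w = sqrt (2 * pi)"
  have w: "w > 0" by (simp add: w_def)
  have avg: "(\<integral>\<^sup>+\<xi>. g a \<xi> * \<phi> b (v \<bullet> \<xi>) \<partial>subspace_lborel (hyperplane_perp x)) = ennreal (sqrt (1 / a) ^ k * w ^ Suc k / sqrt (a / b + (norm v)\<^sup>2))"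
    if x: "x \<noteq> 0" and v: "v \<in> hyperplane_perp x" and a: "a > 0" and b: "b > 0" for x v :: 'a and a b
  proof -
    have "(\<integral>\<^sup>+\<xi>. g a \<xi> * \<phi> b (v \<bullet> \<xi>) \<partial>subspace_lborel (hyperplane_perp x))
       = (\<integral>\<^sup>+\<xi>. ennreal (sqrt b) * ennreal (exp (- a * (norm \<xi>)\<^sup>2 / 2) * exp (- b * (v \<bullet> \<xi>)\<^sup>2 / 2)) \<partial>subspace_lborel (hyperplane_perp x))"
      using b by (intro nn_integral_cong) (simp add: g_def \<phi>_def ennreal_mult[symmetric] ac_simps)
    also have "\<dots> = ennreal (sqrt b) * ennreal (sqrt (2 * pi / a) ^ k * sqrt (2 * pi / (a + b * (norm v)\<^sup>2)))"
      unfolding nn_integral_subspace_gaussian_ridge[OF subspace_hyperplane_perp v a less_imp_le[OF b] dimH'[OF x], symmetric]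
      by (rule nn_integral_cmult) measurable
    also have "\<dots> = ennreal (sqrt (1 / a) ^ k * w ^ Suc k / sqrt (a / b + (norm v)\<^sup>2))"
    proof -
      have "a + b * (norm v)\<^sup>2 = b * (a / b + (norm v)\<^sup>2)" using b by (simp add: field_simps)
      then have "sqrt b * (sqrt (2 * pi / a) ^ k * sqrt (2 * pi / (a + b * (norm v)\<^sup>2))) = sqrt (1 / a) ^ k * w ^ Suc k / sqrt (a / b + (norm v)\<^sup>2)"
        using b by (simp add: w_def real_sqrt_mult real_sqrt_divide power_divide power_mult_distrib)
      then show ?thesis using a b by (simp add: ennreal_mult[symmetric])
    qed
    finally show ?thesis .
  qed
  have s1: "1 / sqrt (1 + r\<^sup>2) \<le> 1" for r :: real
  proof -
    have "1 \<le> sqrt (1 + r\<^sup>2)" by simp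
    then have "inverse (sqrt (1 + r\<^sup>2)) \<le> 1" unfolding inverse_le_1_iff ..
    then show ?thesis by (simp only: inverse_eq_divide)
  qed
  have wle: "z / sqrt (1 + r\<^sup>2) \<le> z" if "z > 0" for r z :: real
    using mult_left_mono[OF s1[of r], of z] that by simp
  have g91: "g 9 \<xi> \<le> g 1 \<xi>" for \<xi>
    unfolding g_def by (intro ennreal_leI) simp
  have slab: "(\<integral>\<^sup>+y. \<phi> (1/9) (y \<bullet> \<eta>) * indicator K y \<partial>lborel) \<le> (\<integral>\<^sup>+y. \<phi> 1 (y \<bullet> \<eta>) * indicator K y \<partial>lborel)" for \<eta>
    using convex_body_gaussian_slab_le[OF K, of \<eta>] by (simp add: \<phi>_def real_sqrt_divide)
  \<comment> \<open>\<open>Suc (Suc k)\<close> is the dimension of the hyperplane plus one: enough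
    decay for a finite integral. Positivity makes it nonzero, radiality makes it the same for all
    \<open>x\<close>.\<close>
  have exc: "\<exists>c>0. \<forall>x::'a. x \<noteq> 0 \<longrightarrow> (\<integral>\<^sup>+v. ennreal (F (norm v)) \<partial>subspace_lborel (hyperplane_perp x)) = ennreal c"
    if [measurable]: "F \<in> borel_measurable borel" and F: "\<And>r. F r > 0" "\<And>r. F r \<le> C * (1 / sqrt (1 + r\<^sup>2)) ^ Suc (Suc k)" for F C
  proof -
    obtain e :: 'a where e: "norm e = 1" using vector_choose_size[of 1] by auto
    then have e0: "e \<noteq> 0" by auto
    let ?I = "\<lambda>x. (\<integral>\<^sup>+v. ennreal (F (norm v)) \<partial>subspace_lborel (hyperplane_perp (x::'a)))"
    have "C \<ge> 0" using F(1)[of 0] F(2)[of 0] by simp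
    then have "?I e < \<infinity>"
      by (intro nn_integral_subspace_decay_finite[where C=C]) (auto intro!: ennreal_leI F(2) simp: dimH'[OF e0] simp del: power_Suc)
    moreover have "?I e > 0" by (intro nn_integral_subspace_pos) (auto simp: F(1))
    ultimately obtain c where c: "?I e = ennreal c" "c > 0" by (cases "?I e") auto
    moreover have "?I x = ?I e" if "x \<noteq> 0" for x
      using that e0 by (intro nn_integral_radial_unique) (auto simp: dimH')
    ultimately show ?thesis by auto
  qed
  consider "DIM('a) = 2" | "DIM('a) = 3" | "DIM('a) = 4" using dim by linarith
  then show ?thesis
  proof cases
    case 1
    then have k: "k = 0" by (simp add: k_def)
    have "\<exists>c>0. \<forall>x::'a. x \<noteq> 0 \<longrightarrow> (\<integral>\<^sup>+v. ennreal (w / sqrt (1 + (norm v)\<^sup>2) - w / sqrt (9 + (norm v)\<^sup>2)) \<partial>subspace_lborel (hyperplane_perp x)) = ennreal c"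
    proof (rule exc[where C="w * 4"])
      fix r :: real
      have eq: "w / sqrt (1 + r\<^sup>2) - w / sqrt (9 + r\<^sup>2) = w * (1 / sqrt (1 + r\<^sup>2) - 1 / sqrt (9 + r\<^sup>2))"
        by (simp add: right_diff_distrib)
      show "w / sqrt (1 + r\<^sup>2) - w / sqrt (9 + r\<^sup>2) > 0"
        unfolding eq using w kernel_bounds(1)[of r] by simp
      have "1 / sqrt (1 + r\<^sup>2) - 1 / sqrt (9 + r\<^sup>2) \<le> 4 * (1 / sqrt (1 + r\<^sup>2)) ^ 3" by (rule kernel_bounds(2))
      also have "\<dots> \<le> 4 * (1 / sqrt (1 + r\<^sup>2)) ^ Suc (Suc k)"
        unfolding k by (intro mult_left_mono power_decreasing s1) auto
      finally have f: "1 / sqrt (1 + r\<^sup>2) - 1 / sqrt (9 + r\<^sup>2) \<le> 4 * (1 / sqrt (1 + r\<^sup>2)) ^ Suc (Suc k)" .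
      show "w / sqrt (1 + r\<^sup>2) - w / sqrt (9 + r\<^sup>2) \<le> w * 4 * (1 / sqrt (1 + r\<^sup>2)) ^ Suc (Suc k)"
        unfolding eq mult.assoc by (rule mult_left_mono[OF f]) (use w in simp)
    qed measurable
    then obtain c where c: "c > 0" "\<And>x::'a. x \<noteq> 0 \<Longrightarrow>
          (\<integral>\<^sup>+v. ennreal (w / sqrt (1 + (norm v)\<^sup>2) - w / sqrt (9 + (norm v)\<^sup>2)) \<partial>subspace_lborel (hyperplane_perp x)) = ennreal c" by auto
    show ?thesis
    proof (rule weighted_chord_comparison[where p="\<lambda>\<xi> s. g 1 \<xi> * \<phi> 1 s" and q="\<lambda>\<xi> s. g 9 \<xi> * \<phi> 1 s"
        and Zp="\<lambda>r. w / sqrt (1 + r\<^sup>2)" and Zq="\<lambda>r. w / sqrt (9 + r\<^sup>2)" and C=w, OF dim(1) K _ _ _ _ _ _ _ _ _ _ c DE bd cmp])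
      show "(\<integral>\<^sup>+y. g 9 \<xi> * \<phi> 1 (y \<bullet> \<eta>) * indicator K y \<partial>lborel) \<le> (\<integral>\<^sup>+y. g 1 \<xi> * \<phi> 1 (y \<bullet> \<eta>) * indicator K y \<partial>lborel)" for \<xi> \<eta>
        by (intro nn_integral_mono mult_right_mono g91) auto
      show "w / sqrt (9 + r\<^sup>2) \<le> w / sqrt (1 + r\<^sup>2)" for r
        using w by (intro divide_left_mono mult_pos_pos) (auto simp: add_pos_nonneg)
      show "w / sqrt (1 + r\<^sup>2) \<le> w" for r
        using wle[OF w] by simp
      show "(\<integral>\<^sup>+\<xi>. g 1 \<xi> * \<phi> 1 (v \<bullet> \<xi>) \<partial>subspace_lborel (hyperplane_perp x)) = ennreal (w / sqrt (1 + (norm v)\<^sup>2))"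
        if "x \<noteq> 0" "v \<in> hyperplane_perp x" for x v
        using avg[OF that, of 1 1] k by simp
      show "(\<integral>\<^sup>+\<xi>. g 9 \<xi> * \<phi> 1 (v \<bullet> \<xi>) \<partial>subspace_lborel (hyperplane_perp x)) = ennreal (w / sqrt (9 + (norm v)\<^sup>2))"
        if "x \<noteq> 0" "v \<in> hyperplane_perp x" for x v
        using avg[OF that, of 9 1] k by simp
    qed (use w in \<open>auto simp: add_pos_nonneg\<close>)
  next
    case 2
    then have k: "k = 1" by (simp add: k_def)
    define u where "u = w * w"
    have u: "u > 0" using w by (simp add: u_def)
    have "\<exists>c>0. \<forall>x::'a. x \<noteq> 0 \<longrightarrow> (\<integral>\<^sup>+v. ennreal (u / sqrt (1 + (norm v)\<^sup>2) - u / sqrt (9 + (norm v)\<^sup>2)) \<partial>subspace_lborel (hyperplane_perp x)) = ennreal c"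
    proof (rule exc[where C="u * 4"])
      fix r :: real
      have eq: "u / sqrt (1 + r\<^sup>2) - u / sqrt (9 + r\<^sup>2) = u * (1 / sqrt (1 + r\<^sup>2) - 1 / sqrt (9 + r\<^sup>2))"
        by (simp add: right_diff_distrib)
      show "u / sqrt (1 + r\<^sup>2) - u / sqrt (9 + r\<^sup>2) > 0"
        unfolding eq using u kernel_bounds(1)[of r] by simp
      have kk: "Suc (Suc k) = 3" by (simp add: k)
      show "u / sqrt (1 + r\<^sup>2) - u / sqrt (9 + r\<^sup>2) \<le> u * 4 * (1 / sqrt (1 + r\<^sup>2)) ^ Suc (Suc k)"
        unfolding eq mult.assoc kk by (rule mult_left_mono[OF kernel_bounds(2)]) (use u in simp)
    qed measurable
    then obtain c where c: "c > 0" "\<And>x::'a. x \<noteq> 0 \<Longrightarrow>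
          (\<integral>\<^sup>+v. ennreal (u / sqrt (1 + (norm v)\<^sup>2) - u / sqrt (9 + (norm v)\<^sup>2)) \<partial>subspace_lborel (hyperplane_perp x)) = ennreal c" by auto
    show ?thesis
    proof (rule weighted_chord_comparison[where p="\<lambda>\<xi> s. g 1 \<xi> * \<phi> 1 s" and q="\<lambda>\<xi> s. g 1 \<xi> * \<phi> (1/9) s"
        and Zp="\<lambda>r. u / sqrt (1 + r\<^sup>2)" and Zq="\<lambda>r. u / sqrt (9 + r\<^sup>2)" and C=u, OF dim(1) K _ _ _ _ _ _ _ _ _ _ c DE bd cmp])
      show "(\<integral>\<^sup>+y. g 1 \<xi> * \<phi> (1/9) (y \<bullet> \<eta>) * indicator K y \<partial>lborel) \<le> (\<integral>\<^sup>+y. g 1 \<xi> * \<phi> 1 (y \<bullet> \<eta>) * indicator K y \<partial>lborel)" for \<xi> \<eta>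
        unfolding mult.assoc using slab[of \<eta>] by (simp add: nn_integral_cmult mult_left_mono)
      show "u / sqrt (9 + r\<^sup>2) \<le> u / sqrt (1 + r\<^sup>2)" for r
        using u by (intro divide_left_mono mult_pos_pos) (auto simp: add_pos_nonneg)
      show "u / sqrt (1 + r\<^sup>2) \<le> u" for r
        using wle[OF u] by simp
      show "(\<integral>\<^sup>+\<xi>. g 1 \<xi> * \<phi> 1 (v \<bullet> \<xi>) \<partial>subspace_lborel (hyperplane_perp x)) = ennreal (u / sqrt (1 + (norm v)\<^sup>2))"
        if "x \<noteq> 0" "v \<in> hyperplane_perp x" for x v
        using avg[OF that, of 1 1] k by (simp add: u_def)
      show "(\<integral>\<^sup>+\<xi>. g 1 \<xi> * \<phi> (1/9) (v \<bullet> \<xi>) \<partial>subspace_lborel (hyperplane_perp x)) = ennreal (u / sqrt (9 + (norm v)\<^sup>2))"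
        if "x \<noteq> 0" "v \<in> hyperplane_perp x" for x v
        using avg[OF that, of 1 "1/9"] k by (simp add: u_def)
    qed (use u in \<open>auto simp: add_pos_nonneg\<close>)
  next
    case 3
    then have k: "k = 2" by (simp add: k_def)
    define u where "u = w * w * w"
    have u: "u > 0" using w by (simp add: u_def)
    let ?P = "\<lambda>r. u / sqrt (1 + r\<^sup>2) + u / (9 * sqrt (81 + r\<^sup>2))" and ?Q = "\<lambda>r. 10 * u / (9 * sqrt (9 + r\<^sup>2))"
    have eq: "?P r - ?Q r = u * (1 / sqrt (1 + r\<^sup>2) + 1 / (9 * sqrt (81 + r\<^sup>2)) - 10 / (9 * sqrt (9 + r\<^sup>2)))" for r
      by (simp add: right_diff_distrib distrib_left)
    have "\<exists>c>0. \<forall>x::'a. x \<noteq> 0 \<longrightarrow> (\<integral>\<^sup>+v. ennreal (?P (norm v) - ?Q (norm v)) \<partial>subspace_lborel (hyperplane_perp x)) = ennreal c"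
    proof (rule exc[where C="u * 320"])
      fix r :: real
      show "?P r - ?Q r > 0"
        unfolding eq using u kernel_bounds(3)[of r] by simp
      have kk: "Suc (Suc k) = 4" by (simp add: k)
      show "?P r - ?Q r \<le> u * 320 * (1 / sqrt (1 + r\<^sup>2)) ^ Suc (Suc k)"
        unfolding eq mult.assoc kk by (rule mult_left_mono[OF kernel_bounds(4)]) (use u in simp)
    qed measurable
    then obtain c where c: "c > 0" "\<And>x::'a. x \<noteq> 0 \<Longrightarrow>
          (\<integral>\<^sup>+v. ennreal (?P (norm v) - ?Q (norm v)) \<partial>subspace_lborel (hyperplane_perp x)) = ennreal c" by auto
    show ?thesis
    proof (rule weighted_chord_comparison[where p="\<lambda>\<xi> s. g 1 \<xi> * \<phi> 1 s + g 9 \<xi> * \<phi> (1/9) s" and q="\<lambda>\<xi> s. g 1 \<xi> * \<phi> (1/9) s + g 9 \<xi> * \<phi> 1 s"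
        and Zp="?P" and Zq="?Q" and C="u + u", OF dim(1) K _ _ _ _ _ _ _ _ _ _ c DE bd cmp])
      show "(\<integral>\<^sup>+y. (g 1 \<xi> * \<phi> (1/9) (y \<bullet> \<eta>) + g 9 \<xi> * \<phi> 1 (y \<bullet> \<eta>)) * indicator K y \<partial>lborel)
         \<le> (\<integral>\<^sup>+y. (g 1 \<xi> * \<phi> 1 (y \<bullet> \<eta>) + g 9 \<xi> * \<phi> (1/9) (y \<bullet> \<eta>)) * indicator K y \<partial>lborel)" for \<xi> \<eta>
      proof -
        let ?I = "\<lambda>b. (\<integral>\<^sup>+y. \<phi> b (y \<bullet> \<eta>) * indicator K y \<partial>lborel)"
        have expand: "(\<integral>\<^sup>+y. (g 1 \<xi> * \<phi> b (y \<bullet> \<eta>) + g 9 \<xi> * \<phi> b' (y \<bullet> \<eta>)) * indicator K y \<partial>lborel) = g 1 \<xi> * ?I b + g 9 \<xi> * ?I b'" for b b'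
          by (simp add: distrib_right nn_integral_add nn_integral_cmult mult.assoc)
        \<comment> \<open>The product of the two nonnegative differences, expanded without
          subtraction: the common part \<open>g 9 \<xi>\<close> cancels and \<open>d\<close>
          multiplies the slab inequality.\<close>
        define d where "d = g 1 \<xi> - g 9 \<xi>"
        have g: "g 1 \<xi> = g 9 \<xi> + d" unfolding d_def using g91[of \<xi>] by (simp add: add_diff_inverse_ennreal)
        have "g 1 \<xi> * ?I (1/9) + g 9 \<xi> * ?I 1 = g 9 \<xi> * ?I (1/9) + g 9 \<xi> * ?I 1 + d * ?I (1/9)"
          unfolding g by (simp add: distrib_right ac_simps)
        also have "\<dots> \<le> g 9 \<xi> * ?I (1/9) + g 9 \<xi> * ?I 1 + d * ?I 1"
          by (intro add_left_mono mult_left_mono slab) auto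
        also have "\<dots> = g 1 \<xi> * ?I 1 + g 9 \<xi> * ?I (1/9)"
          unfolding g by (simp add: distrib_right ac_simps)
        finally show ?thesis unfolding expand .
      qed
      show "?Q r \<le> ?P r" for r
      proof -
        have "0 < ?P r - ?Q r" unfolding eq using u kernel_bounds(3)[of r] by simp
        then show ?thesis by simp
      qed
      show "?P r \<le> u + u" for r
      proof (rule add_mono)
        show "u / sqrt (1 + r\<^sup>2) \<le> u" using wle[OF u] by simp
        have "1 \<le> 81 + r\<^sup>2" using zero_le_power2[of r] by linarith
        then have "1 \<le> sqrt (81 + r\<^sup>2)" by (simp only: real_sqrt_ge_1_iff)
        then have h: "1 \<le> 9 * sqrt (81 + r\<^sup>2)" by linarith
        then have "0 < 9 * sqrt (81 + r\<^sup>2)" by linarith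
        moreover have "u \<le> u * (9 * sqrt (81 + r\<^sup>2))" using mult_left_mono[OF h, of u] u by simp
        ultimately show "u / (9 * sqrt (81 + r\<^sup>2)) \<le> u" by (rule mult_imp_div_pos_le)
      qed
      show "(\<integral>\<^sup>+\<xi>. g 1 \<xi> * \<phi> 1 (v \<bullet> \<xi>) + g 9 \<xi> * \<phi> (1/9) (v \<bullet> \<xi>) \<partial>subspace_lborel (hyperplane_perp x)) = ennreal (?P (norm v))"
        if "x \<noteq> 0" "v \<in> hyperplane_perp x" for x v
        using avg[OF that, of 1 1] avg[OF that, of 9 "1/9"] k u
        by (subst nn_integral_add) (auto simp: u_def eval_nat_numeral real_sqrt_divide ennreal_plus[symmetric] mult.assoc simp del: ennreal_plus)
      show "(\<integral>\<^sup>+\<xi>. g 1 \<xi> * \<phi> (1/9) (v \<bullet> \<xi>) + g 9 \<xi> * \<phi> 1 (v \<bullet> \<xi>) \<partial>subspace_lborel (hyperplane_perp x)) = ennreal (?Q (norm v))"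
        if "x \<noteq> 0" "v \<in> hyperplane_perp x" for x v
      proof -
        have 1: "(\<integral>\<^sup>+\<xi>. g 1 \<xi> * \<phi> (1/9) (v \<bullet> \<xi>) \<partial>subspace_lborel (hyperplane_perp x)) = ennreal (u / sqrt (9 + (norm v)\<^sup>2))"
          using avg[OF that, of 1 "1/9"] k by (simp add: u_def eval_nat_numeral mult.assoc)
        have 2: "(\<integral>\<^sup>+\<xi>. g 9 \<xi> * \<phi> 1 (v \<bullet> \<xi>) \<partial>subspace_lborel (hyperplane_perp x)) = ennreal (u / sqrt (9 + (norm v)\<^sup>2) / 9)"
          using avg[OF that, of 9 1] k by (simp add: u_def eval_nat_numeral mult.assoc real_sqrt_divide mult.commute)
        have "ennreal (u / sqrt (9 + (norm v)\<^sup>2)) + ennreal (u / sqrt (9 + (norm v)\<^sup>2) / 9)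
           = ennreal (u / sqrt (9 + (norm v)\<^sup>2) + u / sqrt (9 + (norm v)\<^sup>2) / 9)"
          using u by (intro ennreal_plus[symmetric]) auto
        also have "u / sqrt (9 + (norm v)\<^sup>2) + u / sqrt (9 + (norm v)\<^sup>2) / 9 = ?Q (norm v)"
        proof -
          have "z + z / 9 = 10 / 9 * z" for z :: real by simp
          then have "u / sqrt (9 + (norm v)\<^sup>2) + u / sqrt (9 + (norm v)\<^sup>2) / 9 = 10 / 9 * (u / sqrt (9 + (norm v)\<^sup>2))" .
          then show ?thesis by (simp only: times_divide_times_eq)
        qed
        finally show ?thesis by (subst nn_integral_add) (auto simp: 1 2)
      qed
    qed (use u in \<open>auto simp: add_pos_nonneg\<close>)
  qed
qed

section \<open>Comparison of two bodies in dimension at most four\<close>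

lemma emeasure_bounded_subspace_finite:
  fixes S :: "'a::euclidean_space set"
  assumes S: "subspace S" and K: "K \<in> sets borel" "\<And>x. x \<in> K \<Longrightarrow> norm x \<le> R"
  shows "emeasure (subspace_lborel S) K < \<infinity>"
proof -
  have "emeasure (subspace_lborel S) K = (\<integral>\<^sup>+x. indicator K x \<partial>subspace_lborel S)"
    using K(1) by simp
  also have "\<dots> \<le> (\<integral>\<^sup>+x. ennreal (exp (R\<^sup>2 / 2)) * ennreal (exp (- 1 * (norm x)\<^sup>2 / 2)) \<partial>subspace_lborel S)"
  proof (rule nn_integral_mono)
    fix x
    show "indicator K x \<le> ennreal (exp (R\<^sup>2 / 2)) * ennreal (exp (- 1 * (norm x)\<^sup>2 / 2))"
    proof (cases "x \<in> K")
      case True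
      then have "(norm x)\<^sup>2 \<le> R\<^sup>2" using K(2) by (intro power_mono) auto
      then have "1 \<le> exp (R\<^sup>2 / 2 + - 1 * (norm x)\<^sup>2 / 2)" by simp
      then show ?thesis using True
        by (simp only: ennreal_mult[symmetric, OF exp_ge_zero exp_ge_zero] exp_add[symmetric]) simp
    qed simp
  qed
  also have "\<dots> < \<infinity>"
    by (subst nn_integral_cmult) (simp_all only: nn_integral_subspace_gaussian[OF S zero_less_one], simp_all add: ennreal_mult_less_top)
  finally show ?thesis .
qed

lemma emeasure_body_measure:
  fixes f :: "'a::euclidean_space \<Rightarrow> real"
  assumes "f \<in> borel_measurable borel" "K \<in> sets borel"
  shows "emeasure (body_measure f) K = (\<integral>\<^sup>+x. ennreal (f x) * indicator K x \<partial>lborel)"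
  unfolding body_measure_def using assms by (subst emeasure_density) auto

lemma emeasure_section_measure:
  fixes f :: "'a::euclidean_space \<Rightarrow> real"
  assumes [measurable]: "f \<in> borel_measurable borel" "K \<in> sets borel"
  shows "emeasure (section_measure f \<xi>) (K \<inter> hyperplane_perp \<xi>)
    = (\<integral>\<^sup>+x. ennreal (f x) * indicator K x \<partial>subspace_lborel (hyperplane_perp \<xi>))"
proof -
  have [measurable]: "hyperplane_perp \<xi> \<in> sets borel" by (simp add: borel_closed)
  have "emeasure (section_measure f \<xi>) (K \<inter> hyperplane_perp \<xi>)
    = (\<integral>\<^sup>+x. ennreal (f x) * indicator (K \<inter> hyperplane_perp \<xi>) x \<partial>subspace_lborel (hyperplane_perp \<xi>))"
    unfolding section_measure_def by (subst emeasure_density) auto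
  also have "\<dots> = (\<integral>\<^sup>+x. ennreal (f x) * indicator K x \<partial>subspace_lborel (hyperplane_perp \<xi>))"
    by (rule nn_integral_cong_AE, use AE_subspace_lborel[OF subspace_hyperplane_perp] in eventually_elim) (auto simp: indicator_def)
  finally show ?thesis .
qed

text \<open>Both bodies contain a ball around 0, so after removing the common part the densities
  \<open>D\<close> on \<open>K - L\<close> and \<open>E\<close> on \<open>L - K\<close> vanish near
  the origin, as the chord comparison demands. The common part has finite measure on each hyperplane
  and can be cancelled.\<close>

lemma busemann_petty_affirmative:
  fixes f :: "'a::euclidean_space \<Rightarrow> real"
  assumes dim: "2 \<le> DIM('a)" "DIM('a) \<le> 4" and f: "continuous_on UNIV f" "\<And>x. f x \<ge> 0"
    and K: "convex_body K" "origin_symmetric K" and L: "convex_body L" "origin_symmetric L"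
    and sec: "sections_le f K L"
  shows "emeasure (body_measure f) K \<le> emeasure (body_measure f) L"
proof -
  have [measurable]: "f \<in> borel_measurable borel" using f(1) by (rule borel_measurable_continuous_onI)
  have [measurable]: "K \<in> sets borel" "L \<in> sets borel" using K L by (auto simp: convex_body_borel)
  have cc: "compact K" "compact L" "convex K" using K L by (auto simp: convex_body_def)
  define D where "D x = ennreal (f x) * indicator (K - L) x" for x
  define E where "E x = ennreal (f x) * indicator (L - K) x" for x
  define I where "I x = ennreal (f x) * indicator (K \<inter> L) x" for x
  have [measurable]: "D \<in> borel_measurable borel" "E \<in> borel_measurable borel" "I \<in> borel_measurable borel"
    unfolding D_def E_def I_def by measurable
  have split: "ennreal (f x) * indicator K x = I x + D x" "ennreal (f x) * indicator L x = I x + E x" for x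
    by (auto simp: D_def E_def I_def indicator_def)
  have ckl: "compact (K \<union> L)" using cc by auto
  have "bounded (f ` (K \<union> L))"
    using ckl f(1) by (intro compact_imp_bounded compact_continuous_image) (auto intro: continuous_on_subset)
  then obtain M where "\<And>x. x \<in> K \<union> L \<Longrightarrow> \<bar>f x\<bar> \<le> M" unfolding bounded_iff by auto
  then have M: "f x \<le> M" if "x \<in> K \<or> x \<in> L" for x using abs_le_D1[of "f x" M] that by auto
  obtain R where R: "\<And>x. x \<in> K \<union> L \<Longrightarrow> norm x \<le> R"
    using compact_imp_bounded[OF ckl] unfolding bounded_iff by auto
  have "0 \<in> interior (K \<inter> L)"
    using zero_in_interior[OF K] zero_in_interior[OF L] by simp
  then obtain \<epsilon> where \<epsilon>: "\<epsilon> > 0" "ball 0 \<epsilon> \<subseteq> K \<inter> L" unfolding mem_interior by auto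
  have out: "\<epsilon> \<le> norm x" if "x \<notin> K \<inter> L" for x
    using \<epsilon>(2) that by (metis dist_0_norm linorder_not_less mem_ball subsetD)
  have bdD: "D x \<le> ennreal M * indicator {x. \<epsilon> \<le> norm x \<and> norm x \<le> R} x" for x
    using M[of x] R[of x] out[of x] by (auto simp: D_def indicator_def intro!: ennreal_leI)
  have bdE: "E x \<le> ennreal M * indicator {x. \<epsilon> \<le> norm x \<and> norm x \<le> R} x" for x
    using M[of x] R[of x] out[of x] by (auto simp: E_def indicator_def intro!: ennreal_leI)
  have cmp: "(\<integral>\<^sup>+x. D x \<partial>subspace_lborel (hyperplane_perp \<xi>)) \<le> (\<integral>\<^sup>+x. E x \<partial>subspace_lborel (hyperplane_perp \<xi>))"
    if \<xi>: "\<xi> \<noteq> 0" for \<xi>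
  proof -
    define u where "u = \<xi> /\<^sub>R norm \<xi>"
    have u: "u \<in> sphere 0 1" "hyperplane_perp \<xi> = hyperplane_perp u"
      using \<xi> by (auto simp: u_def hyperplane_perp_scaleR)
    let ?H = "subspace_lborel (hyperplane_perp u)"
    have "(\<integral>\<^sup>+x. I x \<partial>?H) \<le> (\<integral>\<^sup>+x. ennreal M * indicator K x \<partial>?H)"
      using M by (intro nn_integral_mono) (auto simp: I_def indicator_def intro!: ennreal_leI)
    also have "\<dots> < \<infinity>"
      using emeasure_bounded_subspace_finite[of "hyperplane_perp u" K R] R
      by (simp add: nn_integral_cmult_indicator ennreal_mult_less_top)
    finally have fin: "(\<integral>\<^sup>+x. I x \<partial>?H) < \<infinity>" .
    have "(\<integral>\<^sup>+x. I x + D x \<partial>?H) \<le> (\<integral>\<^sup>+x. I x + E x \<partial>?H)"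
      using sec u(1) unfolding sections_le_def split[symmetric] by (simp add: emeasure_section_measure)
    then have "(\<integral>\<^sup>+x. I x \<partial>?H) + (\<integral>\<^sup>+x. D x \<partial>?H) \<le> (\<integral>\<^sup>+x. I x \<partial>?H) + (\<integral>\<^sup>+x. E x \<partial>?H)"
      by (simp add: nn_integral_add)
    then show ?thesis using fin unfolding u(2) ennreal_add_left_cancel_le by auto
  qed
  let ?\<Lambda> = "\<lambda>x. emeasure lborel {t::real. t *\<^sub>R x \<in> K}"
  have K0: "0 \<in> K" using zero_in_interior[OF K] interior_subset by auto
  have line: "closed {t::real. t *\<^sub>R x \<in> K}" for x
  proof -
    have "continuous_on UNIV (\<lambda>t::real. t *\<^sub>R x)" by (intro continuous_intros)
    from closed_vimage[OF compact_imp_closed[OF cc(1)] this] show ?thesis by (simp add: vimage_def)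
  qed
  have DK: "2 * D x \<le> D x * ?\<Lambda> x" for x
  proof (cases "x \<in> K")
    case True
    have "{-1..1} \<subseteq> {t::real. t *\<^sub>R x \<in> K}"
    proof
      fix t :: real assume "t \<in> {-1..1}"
      then have t: "0 \<le> \<bar>t\<bar>" "\<bar>t\<bar> \<le> 1" by auto
      have "\<bar>t\<bar> *\<^sub>R x + (1 - \<bar>t\<bar>) *\<^sub>R 0 \<in> K" using t True K0 by (intro convexD[OF cc(3)]) auto
      then have "\<bar>t\<bar> *\<^sub>R x \<in> K" by simp
      then show "t \<in> {t. t *\<^sub>R x \<in> K}"
        using origin_symmetric_uminus[OF K(2), of "t *\<^sub>R x"] by (auto simp: abs_if split: if_splits)
    qed
    then have "emeasure lborel {-1..1::real} \<le> ?\<Lambda> x"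
      using line by (intro emeasure_mono) auto
    then have "2 \<le> ?\<Lambda> x" by simp
    then show ?thesis by (simp add: mult.commute[of 2] mult_left_mono)
  qed (simp add: D_def)
  have EK: "E x * ?\<Lambda> x \<le> 2 * E x" for x
  proof (cases "x \<in> K")
    case False
    have "{t::real. t *\<^sub>R x \<in> K} \<subseteq> {-1..1}"
    proof
      fix t :: real assume "t \<in> {t. t *\<^sub>R x \<in> K}"
      then have t: "\<bar>t\<bar> *\<^sub>R x \<in> K"
        using origin_symmetric_uminus[OF K(2), of "t *\<^sub>R x"] by (auto simp: abs_if)
      show "t \<in> {-1..1}"
      proof (rule ccontr)
        assume "t \<notin> {-1..1}"
        then have a: "\<bar>t\<bar> > 1" by auto
        have "(1 / \<bar>t\<bar>) *\<^sub>R (\<bar>t\<bar> *\<^sub>R x) + (1 - 1 / \<bar>t\<bar>) *\<^sub>R 0 \<in> K"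
          using a t K0 by (intro convexD[OF cc(3)]) auto
        moreover have "t \<noteq> 0" using a by auto
        ultimately show False using False by simp
      qed
    qed
    then have "?\<Lambda> x \<le> emeasure lborel {-1..1::real}"
      by (intro emeasure_mono) auto
    then have "?\<Lambda> x \<le> 2" by simp
    then show ?thesis by (simp add: mult.commute[of 2] mult_left_mono)
  qed (simp add: E_def)
  have "2 * (\<integral>\<^sup>+x. D x \<partial>lborel) = (\<integral>\<^sup>+x. 2 * D x \<partial>lborel)" by (rule nn_integral_cmult[symmetric]) measurable
  also have "\<dots> \<le> (\<integral>\<^sup>+x. D x * ?\<Lambda> x \<partial>lborel)" by (rule nn_integral_mono) (rule DK)
  also have "\<dots> \<le> (\<integral>\<^sup>+x. E x * ?\<Lambda> x \<partial>lborel)"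
    by (rule chord_comparison[OF dim K _ _ \<epsilon>(1) bdD bdE cmp]) auto
  also have "\<dots> \<le> (\<integral>\<^sup>+x. 2 * E x \<partial>lborel)" by (rule nn_integral_mono) (rule EK)
  also have "\<dots> = 2 * (\<integral>\<^sup>+x. E x \<partial>lborel)" by (rule nn_integral_cmult) measurable
  finally have "(\<integral>\<^sup>+x. D x \<partial>lborel) \<le> (\<integral>\<^sup>+x. E x \<partial>lborel)"
    by (subst (asm) ennreal_mult_le_mult_iff) auto
  then show ?thesis
    by (simp add: emeasure_body_measure split nn_integral_add add_left_mono)
qed

section \<open>Moments of the cutoff function\<close>

definition cutoff :: "real \<Rightarrow> real" where
  "cutoff r = max 0 (1 - r\<^sup>2)"

text \<open>Up to the factor \<open>ball_moment d i\<close>, the integral of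
  \<open>cutoff (norm z) ^ i\<close> over the slice of the unit ball at height \<open>p\<close>. The
  slice is a ball of dimension \<open>d\<close> and radius \<open>sqrt (cutoff p)\<close>, whence
  the second factor.\<close>

definition slice_weight :: "nat \<Rightarrow> nat \<Rightarrow> real \<Rightarrow> real" where
  "slice_weight d i p = cutoff p ^ i * sqrt (cutoff p) ^ d"

definition slice_moment :: "nat \<Rightarrow> nat \<Rightarrow> nat \<Rightarrow> real" where
  "slice_moment d j i = (\<integral>p. p ^ j * slice_weight d i p \<partial>lborel)"

text \<open>For \<open>i \<ge> 1\<close>, the integral of \<open>cutoff (norm v) ^ i\<close> in
  dimension \<open>d\<close>, a Beta value. Slicing yields it as a product over dimensions, and only
  ratios of such values are ever computed.\<close>

primrec ball_moment :: "nat \<Rightarrow> nat \<Rightarrow> real" where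
  "ball_moment 0 i = 1"
| "ball_moment (Suc d) i = ball_moment d i * slice_moment d 0 i"

lemma cutoff_nonneg [simp]: "0 \<le> cutoff r" by (simp add: cutoff_def)

lemma cutoff_le_1 [simp]: "cutoff r \<le> 1" by (simp add: cutoff_def)

lemma continuous_on_cutoff [continuous_intros]:
  "continuous_on A g \<Longrightarrow> continuous_on A (\<lambda>x. cutoff (g x))"
  unfolding cutoff_def by (intro continuous_intros)

lemma measurable_cutoff [measurable]: "cutoff \<in> borel_measurable borel"
  unfolding cutoff_def[abs_def] by measurable

lemma cutoff_eq_0: "\<bar>r\<bar> \<ge> 1 \<Longrightarrow> cutoff r = 0"
  unfolding cutoff_def using one_le_power[of "\<bar>r\<bar>" 2] by simp

lemma cutoff_eq: "\<bar>r\<bar> \<le> 1 \<Longrightarrow> cutoff r = 1 - r\<^sup>2"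
  unfolding cutoff_def using abs_square_le_1[of r] by simp

lemma slice_weight_nonneg [simp]: "0 \<le> slice_weight d i p"
  by (simp add: slice_weight_def)

lemma slice_weight_eq_0: "\<bar>p\<bar> \<ge> 1 \<Longrightarrow> i \<ge> 1 \<Longrightarrow> slice_weight d i p = 0"
  by (simp add: slice_weight_def cutoff_eq_0)

lemma continuous_on_slice_weight [continuous_intros]: "continuous_on A (slice_weight d i)"
  unfolding slice_weight_def[abs_def] by (intro continuous_intros)

lemma measurable_slice_weight [measurable]: "slice_weight d i \<in> borel_measurable borel"
  unfolding slice_weight_def[abs_def] by measurable

lemma integrable_slice:
  assumes "i \<ge> 1" "continuous_on UNIV h"
  shows "integrable lborel (\<lambda>p. h p * slice_weight d i p)"
    and "(\<integral>p. h p * slice_weight d i p \<partial>lborel) = integral {-1..1} (\<lambda>p. h p * slice_weight d i p)"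
proof -
  have eq: "indicator {-1..1} p *\<^sub>R (h p * slice_weight d i p) = h p * slice_weight d i p" for p
    using slice_weight_eq_0[OF _ assms(1), of p d] by (cases "\<bar>p\<bar> \<ge> 1") (auto simp: indicator_def)
  have "set_integrable lborel {-1..1} (\<lambda>p. h p * slice_weight d i p)"
    by (intro borel_integrable_atLeastAtMost' continuous_intros continuous_on_subset[OF assms(2)]) auto
  from this set_borel_integral_eq_integral(2)[OF this]
  show "integrable lborel (\<lambda>p. h p * slice_weight d i p)"
    and "(\<integral>p. h p * slice_weight d i p \<partial>lborel) = integral {-1..1} (\<lambda>p. h p * slice_weight d i p)"
    by (simp_all only: set_integrable_def set_lebesgue_integral_def eq)
qed

text \<open>The two sides differ by the integral over [-1, 1] of the derivative of
  \<open>p ^ (j + 1) * slice_weight d (i + 1) p\<close>, which vanishes at both ends.\<close>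

lemma slice_moment_rec:
  assumes "i \<ge> 1"
  shows "(real j + 1) * slice_moment d j i = (real j + 3 + 2 * real i + real d) * slice_moment d (j + 2) i"
proof -
  define s where "s = real i + real d / 2"
  let ?f = "\<lambda>p::real. ((real j + 1) * p ^ j - (real j + 3 + 2 * real i + real d) * p ^ (j + 2)) * slice_weight d i p"
  \<comment> \<open>The exponent \<open>i + d / 2\<close> may be a half-integer. As a real power of
    \<open>1 - p\<^sup>2\<close> the weight is differentiable in the open interval, where the base
    is positive.\<close>
  have powr: "slice_weight d i p = (1 - p\<^sup>2) powr s" if "p \<in> {-1<..<1}" for p
  proof -
    define X where "X = 1 - p\<^sup>2"
    have X: "X > 0" using that abs_square_less_1[of p] by (auto simp: X_def)
    have "sqrt X ^ d = (X powr (1/2)) powr real d"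
      using X by (subst powr_realpow) (simp_all add: powr_half_sqrt)
    also have "\<dots> = X powr (real d / 2)" unfolding powr_powr by simp
    finally have 1: "sqrt X ^ d = X powr (real d / 2)" .
    have "X ^ i = X powr real i" using X by (rule powr_realpow[symmetric])
    then have "X ^ i * sqrt X ^ d = X powr s"
      unfolding 1 s_def powr_add by simp
    moreover have "cutoff p = X" using that by (simp add: cutoff_eq X_def abs_le_iff)
    ultimately show ?thesis by (simp add: slice_weight_def X_def)
  qed
  have "(?f has_integral 1 ^ (j + 1) * slice_weight d (i + 1) 1 - (-1) ^ (j + 1) * slice_weight d (i + 1) (-1)) {-1..1}"
  proof (rule fundamental_theorem_of_calculus_interior)
    show "continuous_on {-1..1} (\<lambda>p. p ^ (j + 1) * slice_weight d (i + 1) p)"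
      by (intro continuous_intros)
    fix p :: real assume p: "p \<in> {-1<..<1}"
    then have p1: "1 - p\<^sup>2 > 0" using abs_square_less_1[of p] by auto
    have "((\<lambda>p. p ^ (j + 1) * (1 - p\<^sup>2) powr (s + 1)) has_real_derivative
        (real j + 1) * p ^ j * (1 - p\<^sup>2) powr (s + 1) + p ^ (j + 1) * ((s + 1) * (1 - p\<^sup>2) powr s * (- 2 * p))) (at p)"
    proof -
      have "((\<lambda>p. p ^ (j + 1)) has_real_derivative (real j + 1) * p ^ j) (at p)"
        using DERIV_pow[of "j + 1" p] by (simp add: add.commute)
      moreover have "((\<lambda>p. (1 - p\<^sup>2) powr (s + 1)) has_real_derivative (s + 1) * (1 - p\<^sup>2) powr s * (- 2 * p)) (at p)"
        using p1 by (auto intro!: derivative_eq_intros simp: powr_diff)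
      ultimately show ?thesis by (rule DERIV_cong[OF DERIV_mult]) (simp add: mult.commute)
    qed
    moreover have "(real j + 1) * p ^ j * (1 - p\<^sup>2) powr (s + 1) + p ^ (j + 1) * ((s + 1) * (1 - p\<^sup>2) powr s * (- 2 * p)) = ?f p"
      using p1 unfolding powr[OF p] powr_add by (simp add: s_def algebra_simps power2_eq_square)
    ultimately have "((\<lambda>p. p ^ (j + 1) * (1 - p\<^sup>2) powr (s + 1)) has_real_derivative ?f p) (at p)" by simp
    moreover have "\<forall>\<^sub>F x in nhds p. x ^ (j + 1) * (1 - x\<^sup>2) powr (s + 1) = x ^ (j + 1) * slice_weight d (i + 1) x"
    proof -
      have "\<forall>\<^sub>F x in nhds p. x \<in> {-1<..<1}" using p by (intro eventually_nhds_in_open) auto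
      then show ?thesis
      proof eventually_elim
        case (elim x)
        then have "1 - x\<^sup>2 > 0" using abs_square_less_1[of x] by auto
        moreover have "slice_weight d (i + 1) x = (1 - x\<^sup>2) * slice_weight d i x"
          using elim cutoff_eq[of x] by (simp add: slice_weight_def abs_le_iff)
        ultimately show ?case unfolding powr[OF elim] by (simp add: powr_add mult.commute)
      qed
    qed
    ultimately have "((\<lambda>p. p ^ (j + 1) * slice_weight d (i + 1) p) has_real_derivative ?f p) (at p)"
      by (subst (asm) DERIV_cong_ev[OF refl _ refl]) auto
    then show "((\<lambda>p. p ^ (j + 1) * slice_weight d (i + 1) p) has_vector_derivative ?f p) (at p)"
      by (simp add: has_real_derivative_iff_has_vector_derivative)
  qed simp
  then have "integral {-1..1} ?f = 0"
    by (intro integral_unique) (simp add: slice_weight_eq_0)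
  then have "(\<integral>p. ?f p \<partial>lborel) = 0"
    using integrable_slice(2)[OF assms, of "\<lambda>p. (real j + 1) * p ^ j - (real j + 3 + 2 * real i + real d) * p ^ (j + 2)" d]
    by (simp add: continuous_intros)
  moreover have "(\<integral>p. ?f p \<partial>lborel) = (real j + 1) * slice_moment d j i - (real j + 3 + 2 * real i + real d) * slice_moment d (j + 2) i"
  proof -
    have "(\<integral>p. ?f p \<partial>lborel) = (\<integral>p. (real j + 1) * (p ^ j * slice_weight d i p) - (real j + 3 + 2 * real i + real d) * (p ^ (j + 2) * slice_weight d i p) \<partial>lborel)"
      by (intro Bochner_Integration.integral_cong) (auto simp: left_diff_distrib mult.assoc)
    also have "\<dots> = (\<integral>p. (real j + 1) * (p ^ j * slice_weight d i p) \<partial>lborel) - (\<integral>p. (real j + 3 + 2 * real i + real d) * (p ^ (j + 2) * slice_weight d i p) \<partial>lborel)"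
      by (intro Bochner_Integration.integral_diff integrable_mult_right integrable_slice(1)[OF assms] continuous_intros)
    finally show ?thesis by (simp add: slice_moment_def)
  qed
  ultimately show ?thesis by simp
qed

lemma slice_moment_pos:
  assumes "i \<ge> 1"
  shows "slice_moment d (2 * l) i > 0"
proof -
  have nn: "0 \<le> p ^ (2 * l) * slice_weight d i p" for p by (simp add: zero_le_even_power)
  have "slice_moment d (2 * l) i \<ge> 0"
    unfolding slice_moment_def by (intro integral_nonneg_AE AE_I2 nn)
  moreover have "slice_moment d (2 * l) i \<noteq> 0"
  proof
    assume "slice_moment d (2 * l) i = 0"
    then have "AE p in lborel. p ^ (2 * l) * slice_weight d i p = 0"
      unfolding slice_moment_def
      by (subst (asm) integral_nonneg_eq_0_iff_AE) (auto intro!: integrable_slice(1)[OF assms] continuous_intros nn)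
    then have "AE p in lborel. p \<notin> {0<..<1::real}"
    proof eventually_elim
      case (elim p)
      have "cutoff p > 0" if "0 < p" "p < 1" using that abs_square_less_1[of p] by (simp add: cutoff_def)
      then show ?case using elim by (auto simp: slice_weight_def)
    qed
    then have "{0<..<1::real} \<in> null_sets lborel"
      by (subst AE_iff_null_sets) auto
    then show False by (simp add: null_sets_def)
  qed
  ultimately show ?thesis by simp
qed

lemma ball_moment_pos: "i \<ge> 1 \<Longrightarrow> ball_moment d i > 0"
  using slice_moment_pos[of i _ 0] by (induction d) auto

text \<open>One factor \<open>cutoff p\<close> is replaced by \<open>1 - p\<^sup>2\<close>, and the
  second moment is eliminated with \<open>slice_moment_rec\<close>.\<close>

lemma slice_moment_Suc:
  assumes "i \<ge> 1"
  shows "slice_moment d 0 (Suc i) * (2 * real i + real d + 3) = slice_moment d 0 i * (2 * real i + real d + 2)"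
proof -
  have "slice_moment d 0 (Suc i) = (\<integral>p. p ^ 0 * slice_weight d i p - p ^ 2 * slice_weight d i p \<partial>lborel)"
    unfolding slice_moment_def
  proof (intro Bochner_Integration.integral_cong refl)
    fix p :: real
    show "p ^ 0 * slice_weight d (Suc i) p = p ^ 0 * slice_weight d i p - p ^ 2 * slice_weight d i p"
    proof (cases "\<bar>p\<bar> \<le> 1")
      case True
      then show ?thesis by (simp add: slice_weight_def cutoff_eq left_diff_distrib)
    next
      case False
      then show ?thesis using assms by (simp add: slice_weight_eq_0)
    qed
  qed
  also have "\<dots> = slice_moment d 0 i - slice_moment d 2 i"
    unfolding slice_moment_def
    by (intro Bochner_Integration.integral_diff integrable_slice(1)[OF assms] continuous_intros)
  finally have "slice_moment d 0 (Suc i) = slice_moment d 0 i - slice_moment d 2 i" .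
  moreover have "slice_moment d 0 i = (2 * real i + real d + 3) * slice_moment d 2 i"
    using slice_moment_rec[OF assms, of 0 d, unfolded add_0] by (simp add: algebra_simps)
  ultimately show ?thesis by (simp add: algebra_simps)
qed

lemma ball_moment_Suc:
  assumes "i \<ge> 1"
  shows "ball_moment d (Suc i) * (2 * real i + 2 + real d) = ball_moment d i * (2 * real i + 2)"
proof (induction d)
  case (Suc d)
  have p: "2 * real i + 2 + real d > 0" by linarith
  have "ball_moment (Suc d) (Suc i) * (2 * real i + 2 + real (Suc d)) * (2 * real i + 2 + real d)
      = (ball_moment d (Suc i) * (2 * real i + 2 + real d)) * (slice_moment d 0 (Suc i) * (2 * real i + real d + 3))"
    by (simp add: algebra_simps)
  also have "\<dots> = (ball_moment d i * (2 * real i + 2)) * (slice_moment d 0 i * (2 * real i + real d + 2))"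
    unfolding Suc slice_moment_Suc[OF assms] ..
  also have "\<dots> = ball_moment (Suc d) i * (2 * real i + 2) * (2 * real i + 2 + real d)"
    by (simp add: algebra_simps)
  finally show ?case using p by simp
qed simp

section \<open>Powers of the cutoff integrated over subspaces and slices\<close>

lemma nn_integral_slice_moment:
  assumes "i \<ge> 1"
  shows "(\<integral>\<^sup>+p. ennreal (p ^ (2 * l) * slice_weight d i p) \<partial>lborel) = ennreal (slice_moment d (2 * l) i)"
  unfolding slice_moment_def
  by (rule nn_integral_eq_integral)
     (auto intro!: integrable_slice(1)[OF assms] continuous_intros simp: zero_le_even_power)

text \<open>The hypothesis \<open>IH\<close> is the formula for the full subspace one dimension
  lower. It is left open here because that formula is proved by induction with this slice formula as
  its step.\<close>

lemma nn_integral_slice_cutoff: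
  fixes S :: "'a::euclidean_space set"
  assumes S: "subspace S" and u: "u \<in> S" "norm u = 1" and i: "i \<ge> 1" and d: "dim S = Suc d"
    and IH: "(\<integral>\<^sup>+v. ennreal (cutoff (norm v) ^ i) \<partial>subspace_lborel (S \<inter> hyperplane_perp u)) = ennreal (ball_moment d i)"
  shows "(\<integral>\<^sup>+v. ennreal (cutoff (norm (v + p *\<^sub>R u)) ^ i) \<partial>subspace_lborel (S \<inter> hyperplane_perp u))
    = ennreal (ball_moment d i * slice_weight d i p)"
proof -
  define V where "V = S \<inter> hyperplane_perp u"
  have V: "subspace V" unfolding V_def by (rule subspace_inter[OF S subspace_hyperplane_perp])
  have dimV: "dim V = d" using dim_hyperplane_section[OF S u] d by (simp add: V_def)
  have nrm: "(norm (v + p *\<^sub>R u))\<^sup>2 = (norm v)\<^sup>2 + p\<^sup>2" if "v \<in> V" for v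
  proof -
    have "v \<bullet> u = 0" using that by (simp add: V_def hyperplane_perp_def inner_commute)
    moreover have "u \<bullet> u = 1" using u(2) by (simp add: norm_eq_1)
    ultimately show ?thesis unfolding power2_norm_eq_inner
      by (simp add: inner_add_left inner_add_right inner_commute power2_eq_square)
  qed
  show ?thesis
  proof (cases "\<bar>p\<bar> < 1")
    case False
    have "(\<integral>\<^sup>+v. ennreal (cutoff (norm (v + p *\<^sub>R u)) ^ i) \<partial>subspace_lborel V) = (\<integral>\<^sup>+v. 0 \<partial>subspace_lborel V)"
    proof (rule nn_integral_cong_AE, use AE_subspace_lborel[OF V] in eventually_elim)
      case (elim v)
      have "1 \<le> p\<^sup>2" using False one_le_power[of "\<bar>p\<bar>" 2] by simp
      then have "cutoff (norm (v + p *\<^sub>R u)) = 0"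
        unfolding cutoff_def nrm[OF elim] using zero_le_power2[of "norm v"] by (intro max_absorb1) linarith
      then show ?case using i by simp
    qed
    then show ?thesis using slice_weight_eq_0[of p i d] False i by (simp add: V_def)
  next
    case True
    \<comment> \<open>On the slice at height \<open>p\<close> the cutoff is \<open>h\<^sup>2\<close>
      times the cutoff of the vector scaled down by \<open>h\<close>, so the slice integral is a
      scaled ball integral.\<close>
    define h where "h = sqrt (1 - p\<^sup>2)"
    have "p\<^sup>2 < 1" using True abs_square_less_1[of p] by auto
    then have h: "h > 0" "h\<^sup>2 = 1 - p\<^sup>2" by (auto simp: h_def)
    have cp: "cutoff p = h\<^sup>2" "sqrt (h\<^sup>2) = h"
      using True h(2) real_sqrt_unique[OF refl less_imp_le[OF h(1)]] by (simp_all only: cutoff_eq less_imp_le)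
    have "(\<integral>\<^sup>+v. ennreal (cutoff (norm (v + p *\<^sub>R u)) ^ i) \<partial>subspace_lborel V)
       = ennreal (\<bar>h\<bar> ^ dim V) * (\<integral>\<^sup>+v. ennreal (cutoff (norm (h *\<^sub>R v + p *\<^sub>R u)) ^ i) \<partial>subspace_lborel V)"
      using h by (intro nn_integral_subspace_scale[OF V]) auto
    also have "(\<integral>\<^sup>+v. ennreal (cutoff (norm (h *\<^sub>R v + p *\<^sub>R u)) ^ i) \<partial>subspace_lborel V)
       = (\<integral>\<^sup>+v. ennreal ((h\<^sup>2) ^ i) * ennreal (cutoff (norm v) ^ i) \<partial>subspace_lborel V)"
    proof (rule nn_integral_cong_AE, use AE_subspace_lborel[OF V] in eventually_elim)
      case (elim v)
      then have hv: "h *\<^sub>R v \<in> V" using V by (simp add: subspace_scale)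
      have "1 - (norm (h *\<^sub>R v + p *\<^sub>R u))\<^sup>2 = h\<^sup>2 * (1 - (norm v)\<^sup>2)"
        unfolding nrm[OF hv] using h by (simp add: power_mult_distrib algebra_simps)
      then have "cutoff (norm (h *\<^sub>R v + p *\<^sub>R u)) = h\<^sup>2 * cutoff (norm v)"
        unfolding cutoff_def using h(1) by (simp add: max_mult_distrib_left)
      then show ?case by (simp add: power_mult_distrib ennreal_mult)
    qed
    also have "\<dots> = ennreal ((h\<^sup>2) ^ i) * ennreal (ball_moment d i)"
      using IH by (simp add: nn_integral_cmult V_def)
    finally have "(\<integral>\<^sup>+v. ennreal (cutoff (norm (v + p *\<^sub>R u)) ^ i) \<partial>subspace_lborel V)
      = ennreal (\<bar>h\<bar> ^ d) * (ennreal ((h\<^sup>2) ^ i) * ennreal (ball_moment d i))" unfolding dimV .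
    also have "\<dots> = ennreal (ball_moment d i * ((h\<^sup>2) ^ i * h ^ d))"
      using h(1) ball_moment_pos[OF i, of d] by (simp add: ennreal_mult[symmetric] ac_simps)
    finally show ?thesis unfolding slice_weight_def cp V_def .
  qed
qed

lemma nn_integral_cutoff:
  fixes S :: "'a::euclidean_space set"
  assumes "subspace S" "i \<ge> 1"
  shows "(\<integral>\<^sup>+v. ennreal (cutoff (norm v) ^ i) \<partial>subspace_lborel S) = ennreal (ball_moment (dim S) i)"
  using assms(1)
proof (induction "dim S" arbitrary: S)
  case 0
  then have "S = span {}" using subspace_0 by (auto simp: dim_eq_0)
  then have "subspace_lborel S = onb_lborel {}"
    by (intro subspace_lborel_onb) (auto simp: orthonormal_def)
  moreover have "ball_moment (dim S) i = 1" unfolding 0(1)[symmetric] by simp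
  ultimately show ?case by (simp add: nn_integral_onb_empty cutoff_def)
next
  case (Suc d)
  obtain w where "w \<in> S" "w \<noteq> 0"
    using Suc.hyps(2) by (metis dim_eq_0 nat.distinct(1) subsetI singleton_iff)
  define u where "u = w /\<^sub>R norm w"
  have u: "u \<in> S" "norm u = 1"
    using \<open>w \<in> S\<close> \<open>w \<noteq> 0\<close> Suc.prems by (auto simp: u_def subspace_scale)
  define V where "V = S \<inter> hyperplane_perp u"
  have V: "subspace V" unfolding V_def by (rule subspace_inter[OF Suc.prems subspace_hyperplane_perp])
  have dimV: "d = dim V" using dim_hyperplane_section[OF Suc.prems u] Suc.hyps(2) by (simp add: V_def)
  note IH = Suc.hyps(1)[OF dimV V, folded dimV, unfolded V_def]
  have "(\<integral>\<^sup>+v. ennreal (cutoff (norm v) ^ i) \<partial>subspace_lborel S)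
     = (\<integral>\<^sup>+p. (\<integral>\<^sup>+v. ennreal (cutoff (norm (v + p *\<^sub>R u)) ^ i) \<partial>subspace_lborel (S \<inter> hyperplane_perp u)) \<partial>lborel)"
    by (rule nn_integral_subspace_split[OF Suc.prems u]) measurable
  also have "\<dots> = (\<integral>\<^sup>+p. ennreal (ball_moment d i) * ennreal (p ^ (2 * 0) * slice_weight d i p) \<partial>lborel)"
    unfolding nn_integral_slice_cutoff[OF Suc.prems u assms(2) Suc.hyps(2)[symmetric] IH]
    using ball_moment_pos[OF assms(2), of d] by (simp add: ennreal_mult)
  also have "\<dots> = ennreal (ball_moment d i) * (\<integral>\<^sup>+p. ennreal (p ^ (2 * 0) * slice_weight d i p) \<partial>lborel)"
    by (rule nn_integral_cmult) measurable
  also have "\<dots> = ennreal (ball_moment d i) * ennreal (slice_moment d (2 * 0) i)"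
    unfolding nn_integral_slice_moment[OF assms(2)] ..
  also have "\<dots> = ennreal (ball_moment (Suc d) i)"
    using ball_moment_pos[OF assms(2), of d] slice_moment_pos[OF assms(2), of d 0] by (simp add: ennreal_mult)
  finally show ?case using Suc.hyps(2) by simp
qed

lemma nn_integral_slice_cutoff':
  fixes S :: "'a::euclidean_space set"
  assumes S: "subspace S" and u: "u \<in> S" "norm u = 1" and i: "i \<ge> 1" and d: "dim S = Suc d"
  shows "(\<integral>\<^sup>+v. ennreal (cutoff (norm (v + p *\<^sub>R u)) ^ i) \<partial>subspace_lborel (S \<inter> hyperplane_perp u))
    = ennreal (ball_moment d i * slice_weight d i p)"
proof -
  have "subspace (S \<inter> hyperplane_perp u)" by (rule subspace_inter[OF S subspace_hyperplane_perp])
  moreover have "dim (S \<inter> hyperplane_perp u) = d" using dim_hyperplane_section[OF S u] d by simp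
  ultimately show ?thesis
    using nn_integral_cutoff[of "S \<inter> hyperplane_perp u" i] i by (intro nn_integral_slice_cutoff[OF S u i d]) auto
qed

text \<open>For \<open>i \<ge> 1\<close>, the integral of
  \<open>norm z ^ (2 * l) * cutoff (norm z) ^ i\<close> in dimension \<open>m\<close>. The recursion
  replaces a factor \<open>(norm z)\<^sup>2\<close> by \<open>1 - cutoff (norm z)\<close>.\<close>

primrec radial_moment :: "nat \<Rightarrow> nat \<Rightarrow> nat \<Rightarrow> real" where
  "radial_moment m 0 i = ball_moment m i"
| "radial_moment m (Suc l) i = radial_moment m l i - radial_moment m l (Suc i)"

lemma has_bochner_integral_cutoff:
  fixes S :: "'a::euclidean_space set"
  assumes "subspace S" "i \<ge> 1"
  shows "has_bochner_integral (subspace_lborel S) (\<lambda>z. cutoff (norm z) ^ i) (ball_moment (dim S) i)"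
  by (rule has_bochner_integral_nn_integral)
     (use nn_integral_cutoff[OF assms] ball_moment_pos[OF assms(2), of "dim S"] in auto)

lemma has_bochner_integral_radial_moment:
  fixes S :: "'a::euclidean_space set"
  assumes "subspace S" "i \<ge> 1"
  shows "has_bochner_integral (subspace_lborel S) (\<lambda>z. norm z ^ (2 * l) * cutoff (norm z) ^ i) (radial_moment (dim S) l i)"
  using assms(2)
proof (induction l arbitrary: i)
  case 0
  then show ?case using has_bochner_integral_cutoff[OF assms(1)] by simp
next
  case (Suc l)
  have "has_bochner_integral (subspace_lborel S)
      (\<lambda>z. norm z ^ (2 * l) * cutoff (norm z) ^ i - norm z ^ (2 * l) * cutoff (norm z) ^ Suc i)
      (radial_moment (dim S) l i - radial_moment (dim S) l (Suc i))"
    using Suc.IH[of i] Suc.IH[of "Suc i"] Suc.prems by (intro has_bochner_integral_diff) auto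
  moreover have "norm z ^ (2 * l) * cutoff (norm z) ^ i - norm z ^ (2 * l) * cutoff (norm z) ^ Suc i
      = norm z ^ (2 * Suc l) * cutoff (norm z) ^ i" for z :: 'a
  proof (cases "norm z \<le> 1")
    case True
    then have "(norm z)\<^sup>2 = 1 - cutoff (norm z)" by (simp add: cutoff_eq)
    then have "norm z ^ (2 * Suc l) * cutoff (norm z) ^ i = norm z ^ (2 * l) * (1 - cutoff (norm z)) * cutoff (norm z) ^ i"
      by (simp add: power_add[symmetric] power2_eq_square[symmetric] mult.assoc[symmetric])
    then show ?thesis by (simp add: algebra_simps)
  next
    case False
    then have "cutoff (norm z) = 0" by (intro cutoff_eq_0) auto
    then show ?thesis using Suc.prems by (cases i) auto
  qed
  ultimately show ?case by simp
qed

text \<open>The ratio of consecutive Beta values survives the differences in the definition. It in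
  turn makes the step from \<open>l\<close> to \<open>Suc l\<close> a ratio as well, in
  \<open>radial_moment_step\<close>.\<close>

lemma radial_moment_Suc:
  assumes "i \<ge> 1"
  shows "radial_moment m l (Suc i) * (2 * real i + 2 + real m + 2 * real l) = radial_moment m l i * (2 * real i + 2)"
  using assms
proof (induction l arbitrary: i)
  case 0
  then show ?case using ball_moment_Suc[of i m] by simp
next
  case (Suc l)
  define r where "r = 2 * real i + 2 + real m + 2 * real l"
  define s where "s = 2 * real i + 2"
  have pos: "r > 0" unfolding r_def by linarith
  have 1: "radial_moment m l (Suc i) * r = radial_moment m l i * s"
    using Suc.IH[OF Suc.prems] by (simp add: r_def s_def)
  have 2: "radial_moment m l (Suc (Suc i)) * (r + 2) = radial_moment m l (Suc i) * (s + 2)"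
    using Suc.IH[of "Suc i"] by (simp add: r_def s_def algebra_simps)
  have "(radial_moment m l (Suc i) - radial_moment m l (Suc (Suc i))) * (r + 2) = radial_moment m l (Suc i) * (r - s)"
    using 2 by (simp add: algebra_simps)
  moreover have "(radial_moment m l i - radial_moment m l (Suc i)) * s = radial_moment m l (Suc i) * (r - s)"
    using 1 by (simp add: algebra_simps)
  ultimately show ?case by (simp add: r_def s_def algebra_simps)
qed

lemma radial_moment_step:
  assumes "i \<ge> 1"
  shows "radial_moment m (Suc l) i * (2 * real i + 2 + real m + 2 * real l) = radial_moment m l i * (real m + 2 * real l)"
  using radial_moment_Suc[OF assms, of m l] by (simp add: algebra_simps)

text \<open>The mean of \<open>(z \<bullet> u)\<^bsup>2l\<^esup>\<close> over the unit sphere of dimension \<open>m - 1\<close>.\<close>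

definition sphere_moment :: "nat \<Rightarrow> nat \<Rightarrow> real" where
  "sphere_moment m l = (\<Prod>s<l. (2 * real s + 1) / (real m + 2 * real s))"

text \<open>Both sides evaluate the integral of the 2l-th power of a coordinate times a cutoff
  power, once by slices and once by averaging over directions. They obey the same recursion in
  \<open>l\<close>, so no integral over the sphere is involved.\<close>

lemma slice_moment_eq_sphere_moment:
  assumes "i \<ge> 1"
  shows "ball_moment d i * slice_moment d (2 * l) i = sphere_moment (Suc d) l * radial_moment (Suc d) l i"
proof (induction l)
  case (Suc l)
  define r where "r = 2 * real i + 2 + real (Suc d) + 2 * real l"
  define m where "m = real (Suc d) + 2 * real l"
  have pos: "r > 0" "m > 0" unfolding r_def m_def by linarith+
  have 1: "(2 * real l + 1) * slice_moment d (2 * l) i = r * slice_moment d (2 * Suc l) i"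
    using slice_moment_rec[OF assms, of "2 * l" d] by (simp add: r_def algebra_simps)
  have 2: "radial_moment (Suc d) (Suc l) i * r = radial_moment (Suc d) l i * m"
    using radial_moment_step[OF assms, of "Suc d" l] by (simp only: r_def m_def)
  have 3: "sphere_moment (Suc d) (Suc l) * m = sphere_moment (Suc d) l * (2 * real l + 1)"
    using pos by (simp add: sphere_moment_def m_def)
  have "(ball_moment d i * slice_moment d (2 * Suc l) i) * r = (2 * real l + 1) * (ball_moment d i * slice_moment d (2 * l) i)"
    using 1 by (simp add: ac_simps)
  also have "\<dots> = (sphere_moment (Suc d) l * (2 * real l + 1)) * radial_moment (Suc d) l i"
    unfolding Suc by (simp add: ac_simps)
  also have "\<dots> = (sphere_moment (Suc d) (Suc l) * radial_moment (Suc d) (Suc l) i) * r"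
    using 2 unfolding 3[symmetric] by (simp add: ac_simps)
  finally show ?case using pos by simp
qed (simp add: sphere_moment_def)

lemma sphere_moment_pos: "m \<ge> 1 \<Longrightarrow> sphere_moment m l > 0"
  unfolding sphere_moment_def by (intro prod_pos) (auto intro!: divide_pos_pos)

text \<open>Here dimension five enters, with \<open>m\<close> one less than the dimension of the
  space. For \<open>m = 3\<close> the product telescopes to exactly \<open>1 / (2 * l + 1)\<close>;
  a larger \<open>m\<close> makes every factor smaller.\<close>

lemma sphere_moment_less:
  assumes "m \<ge> 4" "l \<ge> 1"
  shows "sphere_moment m l < 1 / (2 * real l + 1)"
  using assms(2)
proof (induction l rule: nat_induct_at_least)
  case base
  then show ?case using assms(1) by (simp add: sphere_moment_def)
next
  case (Suc l)
  have "sphere_moment m (Suc l) = sphere_moment m l * ((2 * real l + 1) / (real m + 2 * real l))"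
    by (simp add: sphere_moment_def)
  also have "\<dots> < 1 / (2 * real l + 1) * ((2 * real l + 1) / (real m + 2 * real l))"
    using Suc assms(1) by (intro mult_strict_right_mono divide_pos_pos) auto
  also have "\<dots> = 1 / (real m + 2 * real l)" by simp
  also have "\<dots> \<le> 1 / (2 * real (Suc l) + 1)"
    using assms(1) by (intro divide_left_mono) auto
  finally show ?case .
qed

section \<open>Positive hyperplane integrals and negative mass\<close>

lemma nn_integral_split_signs:
  assumes "integrable M h"
  obtains p n where "(\<integral>\<^sup>+x. ennreal (h x) \<partial>M) = ennreal p" "(\<integral>\<^sup>+x. ennreal (- h x) \<partial>M) = ennreal n"
    "p \<ge> 0" "n \<ge> 0" "(\<integral>x. h x \<partial>M) = p - n" "(\<integral>x. \<bar>h x\<bar> \<partial>M) = p + n"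
proof -
  have i1: "integrable M (\<lambda>x. max 0 (h x))" and i2: "integrable M (\<lambda>x. max 0 (- h x))" using assms by auto
  have 1: "(\<integral>\<^sup>+x. ennreal (h x) \<partial>M) = ennreal (\<integral>x. max 0 (h x) \<partial>M)"
    by (subst nn_integral_eq_integral[symmetric, OF i1]) (auto simp: max_def ennreal_neg intro!: nn_integral_cong)
  have 2: "(\<integral>\<^sup>+x. ennreal (- h x) \<partial>M) = ennreal (\<integral>x. max 0 (- h x) \<partial>M)"
    by (subst nn_integral_eq_integral[symmetric, OF i2]) (auto simp: max_def ennreal_neg intro!: nn_integral_cong)
  have 3: "(\<integral>x. h x \<partial>M) = (\<integral>x. max 0 (h x) \<partial>M) - (\<integral>x. max 0 (- h x) \<partial>M)"
    by (subst Bochner_Integration.integral_diff[symmetric, OF i1 i2]) (auto intro!: Bochner_Integration.integral_cong)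
  have 4: "(\<integral>x. \<bar>h x\<bar> \<partial>M) = (\<integral>x. max 0 (h x) \<partial>M) + (\<integral>x. max 0 (- h x) \<partial>M)"
    by (subst Bochner_Integration.integral_add[symmetric, OF i1 i2]) (auto intro!: Bochner_Integration.integral_cong)
  show ?thesis
    by (rule that[OF 1 2 _ _ 3 4]) (auto intro!: integral_nonneg_AE)
qed

text \<open>For large \<open>N\<close> the weight \<open>p ^ (2 * N)\<close> concentrates at
  \<open>\<bar>p\<bar> = 1\<close>, where a further factor \<open>p ^ (2 * l)\<close> equals 1. The
  recursion gives this as a product of ratios tending to 1.\<close>

lemma slice_moment_ratio_tendsto:
  "(\<lambda>N. slice_moment d (2 * (N + l)) 1 / slice_moment d (2 * N) 1) \<longlonglongrightarrow> 1"
proof (induction l)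
  case 0
  have "slice_moment d (2 * N) 1 \<noteq> 0" for N using slice_moment_pos[of 1 d N] by simp
  then show ?case by simp
next
  case (Suc l)
  have step: "slice_moment d (2 * (N + Suc l)) 1 / slice_moment d (2 * N) 1
     = slice_moment d (2 * (N + l)) 1 / slice_moment d (2 * N) 1 * ((2 * real (N + l) + 1) / (2 * real (N + l) + (5 + real d)))" for N
  proof -
    define r where "r = 2 * real (N + l) + (5 + real d)"
    have r: "r > 0" unfolding r_def by linarith
    have "(2 * real (N + l) + 1) * slice_moment d (2 * (N + l)) 1 = r * slice_moment d (2 * (N + Suc l)) 1"
      using slice_moment_rec[of 1 "2 * (N + l)" d] by (simp add: r_def algebra_simps)
    then have "slice_moment d (2 * (N + Suc l)) 1 = slice_moment d (2 * (N + l)) 1 * ((2 * real (N + l) + 1) / r)"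
      using r by (simp add: field_simps)
    then show ?thesis by (simp add: r_def)
  qed
  have "(\<lambda>N. (2 * real (N + l) + 1) / (2 * real (N + l) + (5 + real d))) \<longlonglongrightarrow> 1" by real_asymp
  from tendsto_mult[OF Suc this] show ?case unfolding step by simp
qed

text \<open>The powers start at \<open>Suc k\<close>, so there is no constant term and the function
  vanishes outside the unit ball.\<close>

definition test_fun :: "(nat \<Rightarrow> real) \<Rightarrow> nat \<Rightarrow> 'a::euclidean_space \<Rightarrow> real" where
  "test_fun a K z = (\<Sum>k\<le>K. a k * cutoff (norm z) ^ Suc k)"

lemma measurable_test_fun [measurable]: "test_fun a K \<in> borel_measurable borel"
  unfolding test_fun_def[abs_def] by measurable

lemma has_bochner_integral_slice_cutoff:
  fixes S :: "'a::euclidean_space set"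
  assumes S: "subspace S" and u: "u \<in> S" "norm u = 1" and i: "i \<ge> 1" and d: "dim S = Suc d"
  shows "has_bochner_integral (subspace_lborel (S \<inter> hyperplane_perp u)) (\<lambda>v. cutoff (norm (v + p *\<^sub>R u)) ^ i)
    (ball_moment d i * slice_weight d i p)"
  by (rule has_bochner_integral_nn_integral)
     (use nn_integral_slice_cutoff'[OF assms] ball_moment_pos[OF i, of d] in auto)

text \<open>On slices the test function has integrals \<open>X \<surd>X\<^sup>d (\<kappa> + p\<^bsup>2N\<^esup>)\<close> with \<open>X = 1 - p\<^sup>2\<close>, concentrated
  near \<open>\<bar>p\<bar> = 1\<close>. The function \<open>1 - M |z|\<^bsup>2l\<^esup>\<close> is the superposition of hyperplanes \<open>z \<bullet> u = p\<close> with
  weight proportional to \<open>1 - (M / sphere_moment m l) p\<^bsup>2l\<^esup>\<close>, which is negative there.\<close>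

lemma test_function_exists:
  fixes S :: "'a::euclidean_space set"
  assumes S: "subspace S" "dim S = Suc d" and M: "sphere_moment (Suc d) l < M" and A: "A \<ge> 0"
  defines "T \<equiv> \<lambda>z::'a. 1 - M * norm z ^ (2 * l) - A * (norm z)\<^sup>2"
  shows "\<exists>a K \<theta>. \<theta> > 1 \<and>
     (\<forall>u p. u \<in> S \<longrightarrow> norm u = 1 \<longrightarrow>
        ennreal \<theta> * (\<integral>\<^sup>+v. ennreal (- test_fun a K (v + p *\<^sub>R u)) \<partial>subspace_lborel (S \<inter> hyperplane_perp u))
          \<le> (\<integral>\<^sup>+v. ennreal (test_fun a K (v + p *\<^sub>R u)) \<partial>subspace_lborel (S \<inter> hyperplane_perp u))) \<and>
     ennreal \<theta> * (\<integral>\<^sup>+z. ennreal (T z * test_fun a K z) \<partial>subspace_lborel S)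
       < (\<integral>\<^sup>+z. ennreal (- (T z * test_fun a K z)) \<partial>subspace_lborel S)"
proof -
  define m where "m = Suc d"
  define \<gamma> where "\<gamma> = sphere_moment m l"
  define \<gamma>1 where "\<gamma>1 = sphere_moment m 1"
  have \<gamma>: "\<gamma> > 0" "\<gamma>1 > 0" unfolding \<gamma>_def \<gamma>1_def m_def by (auto intro: sphere_moment_pos)
  define s where "s j = slice_moment d (2 * j) 1" for j
  have s_pos: "s j > 0" for j unfolding s_def by (rule slice_moment_pos) simp
  have M1: "M / \<gamma> > 1" using M \<gamma> by (simp add: \<gamma>_def m_def)
  have cross: "x * w < z * y" if "x / y < z / w" "y > 0" "w > 0" for x y z w :: real
    using that by (simp add: field_simps)
  \<comment> \<open>As \<open>M / \<gamma> > 1\<close>, the weight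
    \<open>1 - (M / \<gamma>) * p ^ (2 * l)\<close> is negative at \<open>\<bar>p\<bar> = 1\<close>,
    hence negative on average against \<open>p ^ (2 * N)\<close> once \<open>N\<close> is
    large.\<close>
  obtain N where N: "s N < (M / \<gamma>) * s (N + l)"
  proof -
    have "(\<lambda>N. s (N + l) / s N) \<longlonglongrightarrow> 1" unfolding s_def by (rule slice_moment_ratio_tendsto)
    moreover have "1 / (M / \<gamma>) < 1" using M1 by (subst divide_less_eq_1) auto
    ultimately have "\<forall>\<^sub>F N in sequentially. 1 / (M / \<gamma>) < s (N + l) / s N" by (rule order_tendstoD)
    then obtain N where "1 / (M / \<gamma>) < s (N + l) / s N" by (auto simp: eventually_sequentially)
    then have "1 * s N < s (N + l) * (M / \<gamma>)"
      by (rule cross) (use s_pos[of N] M1 in auto)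
    then have "s N < (M / \<gamma>) * s (N + l)" by (simp add: mult.commute)
    then show ?thesis by (rule that)
  qed
  define X where "X = (M / \<gamma>) * s (N + l) - s N"
  \<comment> \<open>Half of the available margin, as \<open>\<kappa> * s 0 = X / 2\<close>. A
    positive \<open>\<kappa>\<close> makes the slice integrals strictly positive also near
    \<open>p = 0\<close> without spoiling the sign of the mass.\<close>
  define \<kappa> where "\<kappa> = X / (2 * s 0)"
  have X: "X > 0" using N by (simp add: X_def)
  have "\<kappa> * s 0 = X / 2" using s_pos[of 0] by (simp add: \<kappa>_def)
  moreover have "s N - (M / \<gamma>) * s (N + l) = - X" by (simp add: X_def)
  ultimately have \<kappa>: "\<kappa> > 0" "s N - (M / \<gamma>) * s (N + l) + \<kappa> * s 0 < 0"
    using X s_pos[of 0] by (simp_all add: \<kappa>_def)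
  \<comment> \<open>\<open>\<alpha>\<close> are the coefficients of
    \<open>\<kappa> + (1 - x) ^ N\<close>, where \<open>1 - x\<close> becomes
    \<open>p\<^sup>2\<close> for \<open>x = cutoff p\<close>. Dividing by
    \<open>ball_moment d (Suc k)\<close> cancels the factors that slicing produces.\<close>
  define \<alpha> where "\<alpha> k = real (N choose k) * (-1) ^ k + (if k = 0 then \<kappa> else 0)" for k
  define a where "a k = \<alpha> k / ball_moment d (Suc k)" for k
  have bp: "ball_moment d (Suc k) > 0" for k by (rule ball_moment_pos) simp
  have aa: "a k * ball_moment d (Suc k) = \<alpha> k" for k using bp[of k] by (simp add: a_def)
  have poly: "(\<Sum>k\<le>N. \<alpha> k * x ^ Suc k) = x * (\<kappa> + (1 - x) ^ N)" for x
  proof -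
    have "(1 - x) ^ N = (\<Sum>k\<le>N. real (N choose k) * (- x) ^ k * 1 ^ (N - k))"
      using binomial_ring[of "- x" 1 N] by (simp add: algebra_simps)
    also have "\<dots> = (\<Sum>k\<le>N. real (N choose k) * (-1) ^ k * x ^ k)"
      by (intro sum.cong refl) (simp add: power_minus[of x])
    finally have "(\<Sum>k\<le>N. \<alpha> k * x ^ k) = (1 - x) ^ N + (\<Sum>k\<le>N. (if k = 0 then \<kappa> else 0) * x ^ k)"
      by (simp add: \<alpha>_def distrib_right sum.distrib)
    also have "(\<Sum>k\<le>N. (if k = 0 then \<kappa> else 0) * x ^ k) = \<kappa>"
      by (subst sum.remove[of _ 0]) auto
    finally have "x * (\<Sum>k\<le>N. \<alpha> k * x ^ k) = x * (\<kappa> + (1 - x) ^ N)" by simp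
    then show ?thesis by (simp add: sum_distrib_left ac_simps)
  qed
  have weight: "slice_weight d (Suc k) p = cutoff p ^ Suc k * sqrt (cutoff p) ^ d" for k p by (simp add: slice_weight_def)
  have W1: "slice_weight d 1 p = cutoff p * sqrt (cutoff p) ^ d" for p by (simp add: slice_weight_def)

  \<comment> \<open>On every slice the absolute integral is at most
    \<open>C * slice_weight d 1 p\<close>, while the integral is at least \<open>\<kappa>\<close>
    times that weight. So the positive part exceeds the negative one by the factor
    \<open>1 + \<kappa> / C\<close>, uniformly over all slices.\<close>
  define C where "C = (\<Sum>k\<le>N. \<bar>\<alpha> k\<bar>)"
  have "\<bar>\<alpha> 0\<bar> \<le> C" unfolding C_def by (rule member_le_sum) auto
  then have C: "C > 0" using \<kappa>(1) by (simp add: \<alpha>_def)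
  have R: "ennreal (1 + \<kappa> / C) * (\<integral>\<^sup>+v. ennreal (- test_fun a N (v + p *\<^sub>R u)) \<partial>subspace_lborel (S \<inter> hyperplane_perp u))
          \<le> (\<integral>\<^sup>+v. ennreal (test_fun a N (v + p *\<^sub>R u)) \<partial>subspace_lborel (S \<inter> hyperplane_perp u))"
    if u: "u \<in> S" "norm u = 1" for u p
  proof -
    let ?V = "subspace_lborel (S \<inter> hyperplane_perp u)"
    have hb: "has_bochner_integral ?V (\<lambda>v. cutoff (norm (v + p *\<^sub>R u)) ^ Suc k) (ball_moment d (Suc k) * slice_weight d (Suc k) p)" for k
      by (rule has_bochner_integral_slice_cutoff[OF S(1) u _ S(2)]) simp
    have "has_bochner_integral ?V (\<lambda>v. \<Sum>k\<le>N. a k * cutoff (norm (v + p *\<^sub>R u)) ^ Suc k)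
        (\<Sum>k\<le>N. a k * (ball_moment d (Suc k) * slice_weight d (Suc k) p))"
      by (intro has_bochner_integral_sum has_bochner_integral_mult_right hb)
    also have "(\<Sum>k\<le>N. a k * (ball_moment d (Suc k) * slice_weight d (Suc k) p)) = (\<Sum>k\<le>N. \<alpha> k * cutoff p ^ Suc k) * sqrt (cutoff p) ^ d"
      unfolding weight sum_distrib_right mult.assoc[symmetric] aa ..
    also have "\<dots> = slice_weight d 1 p * (\<kappa> + (1 - cutoff p) ^ N)"
      unfolding poly W1 by (simp add: ac_simps)
    finally have int: "has_bochner_integral ?V (\<lambda>v. test_fun a N (v + p *\<^sub>R u)) (slice_weight d 1 p * (\<kappa> + (1 - cutoff p) ^ N))"
      unfolding test_fun_def .
    have abs: "(\<integral>v. \<bar>test_fun a N (v + p *\<^sub>R u)\<bar> \<partial>?V) \<le> C * slice_weight d 1 p"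
    proof -
      have b1: "has_bochner_integral ?V (\<lambda>v. \<Sum>k\<le>N. \<bar>a k\<bar> * cutoff (norm (v + p *\<^sub>R u)) ^ Suc k)
        (\<Sum>k\<le>N. \<bar>a k\<bar> * (ball_moment d (Suc k) * slice_weight d (Suc k) p))"
        by (intro has_bochner_integral_sum has_bochner_integral_mult_right hb)
      have "(\<integral>v. \<bar>test_fun a N (v + p *\<^sub>R u)\<bar> \<partial>?V) \<le> (\<integral>v. (\<Sum>k\<le>N. \<bar>a k\<bar> * cutoff (norm (v + p *\<^sub>R u)) ^ Suc k) \<partial>?V)"
      proof (rule integral_mono)
        show "integrable ?V (\<lambda>v. \<bar>test_fun a N (v + p *\<^sub>R u)\<bar>)" using int by (auto simp: has_bochner_integral_iff)
        show "integrable ?V (\<lambda>v. \<Sum>k\<le>N. \<bar>a k\<bar> * cutoff (norm (v + p *\<^sub>R u)) ^ Suc k)" using b1 by (simp only: has_bochner_integral_iff)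
        show "\<bar>test_fun a N (v + p *\<^sub>R u)\<bar> \<le> (\<Sum>k\<le>N. \<bar>a k\<bar> * cutoff (norm (v + p *\<^sub>R u)) ^ Suc k)" for v
          unfolding test_fun_def by (rule order_trans[OF sum_abs]) (simp add: abs_mult)
      qed
      also have "\<dots> = (\<Sum>k\<le>N. \<bar>a k\<bar> * (ball_moment d (Suc k) * slice_weight d (Suc k) p))"
        using b1 by (simp only: has_bochner_integral_iff)
      also have "\<dots> \<le> (\<Sum>k\<le>N. \<bar>\<alpha> k\<bar> * slice_weight d 1 p)"
      proof (rule sum_mono)
        fix k
        have "\<bar>a k\<bar> * ball_moment d (Suc k) = \<bar>\<alpha> k\<bar>" using bp[of k] by (simp add: a_def)
        moreover have "slice_weight d (Suc k) p \<le> slice_weight d 1 p"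
          unfolding slice_weight_def by (intro mult_right_mono power_decreasing) auto
        ultimately show "\<bar>a k\<bar> * (ball_moment d (Suc k) * slice_weight d (Suc k) p) \<le> \<bar>\<alpha> k\<bar> * slice_weight d 1 p"
          by (simp add: mult.assoc[symmetric] mult_left_mono)
      qed
      finally show ?thesis by (simp add: C_def sum_distrib_right)
    qed
    have "integrable ?V (\<lambda>v. test_fun a N (v + p *\<^sub>R u))" using int by (simp add: has_bochner_integral_iff)
    from nn_integral_split_signs[OF this] obtain P Q where PQ:
      "(\<integral>\<^sup>+v. ennreal (test_fun a N (v + p *\<^sub>R u)) \<partial>?V) = ennreal P" "(\<integral>\<^sup>+v. ennreal (- test_fun a N (v + p *\<^sub>R u)) \<partial>?V) = ennreal Q"
      "P \<ge> 0" "Q \<ge> 0" "(\<integral>v. test_fun a N (v + p *\<^sub>R u) \<partial>?V) = P - Q" "(\<integral>v. \<bar>test_fun a N (v + p *\<^sub>R u)\<bar> \<partial>?V) = P + Q" .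
    have "P - Q = slice_weight d 1 p * (\<kappa> + (1 - cutoff p) ^ N)"
      using int PQ(5) by (simp add: has_bochner_integral_iff)
    also have "\<dots> \<ge> slice_weight d 1 p * \<kappa>" by (intro mult_left_mono) auto
    finally have 1: "slice_weight d 1 p * \<kappa> \<le> P - Q" .
    have "(\<kappa> / C) * (P + Q) \<le> (\<kappa> / C) * (C * slice_weight d 1 p)"
      using abs C \<kappa>(1) unfolding PQ(6) by (intro mult_left_mono) auto
    also have "\<dots> = slice_weight d 1 p * \<kappa>" using C by simp
    finally have "(\<kappa> / C) * (P + Q) \<le> P - Q" using 1 by simp
    moreover have "(\<kappa> / C) * Q \<le> (\<kappa> / C) * (P + Q)" using C \<kappa>(1) PQ(3) by (intro mult_left_mono) auto
    ultimately have "(1 + \<kappa> / C) * Q \<le> P" by (simp add: distrib_right)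
    then show ?thesis unfolding PQ(1,2) using C \<kappa>(1) PQ(4) by (subst ennreal_mult[symmetric]) (auto intro!: ennreal_leI)
  qed

  let ?S = "subspace_lborel S"
  have dimS: "dim S = m" using S(2) by (simp add: m_def)
  have rm: "has_bochner_integral ?S (\<lambda>z. norm z ^ (2 * j) * cutoff (norm z) ^ Suc k) (ball_moment d (Suc k) * slice_moment d (2 * j) (Suc k) / sphere_moment m j)" for j k
  proof -
    have "ball_moment d (Suc k) * slice_moment d (2 * j) (Suc k) / sphere_moment m j = radial_moment m j (Suc k)"
      using slice_moment_eq_sphere_moment[of "Suc k" d j] sphere_moment_pos[of m j] by (simp add: m_def)
    then show ?thesis using has_bochner_integral_radial_moment[OF S(1), of "Suc k" j] by (simp add: dimS)
  qed
  \<comment> \<open>The moment of order \<open>2 * j\<close> of the slice integrals, that is,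
    against \<open>p ^ (2 * N) + \<kappa>\<close>. Dividing by the sphere moment of order
    \<open>j\<close> gives the integral of the test function against
    \<open>norm z ^ (2 * j)\<close>.\<close>
  define \<beta> where "\<beta> j = (\<Sum>k\<le>N. \<alpha> k * slice_moment d (2 * j) (Suc k))" for j
  have \<beta>: "\<beta> j = s (j + N) + \<kappa> * s j" for j
  proof -
    have i: "integrable lborel (\<lambda>p. p ^ (2 * j) * slice_weight d (Suc k) p)" for j k
      by (intro integrable_slice(1) continuous_intros) auto
    have "\<beta> j = (\<Sum>k\<le>N. (\<integral>p. \<alpha> k * (p ^ (2 * j) * slice_weight d (Suc k) p) \<partial>lborel))"
      by (simp add: \<beta>_def slice_moment_def)
    also have "\<dots> = (\<integral>p. (\<Sum>k\<le>N. \<alpha> k * (p ^ (2 * j) * slice_weight d (Suc k) p)) \<partial>lborel)"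
      by (rule Bochner_Integration.integral_sum[symmetric]) (intro integrable_mult_right i)
    also have "\<dots> = (\<integral>p. p ^ (2 * (j + N)) * slice_weight d (Suc 0) p + \<kappa> * (p ^ (2 * j) * slice_weight d (Suc 0) p) \<partial>lborel)"
    proof (rule Bochner_Integration.integral_cong[OF refl])
      fix p :: real
      have "(\<Sum>k\<le>N. \<alpha> k * (p ^ (2 * j) * slice_weight d (Suc k) p)) = (\<Sum>k\<le>N. \<alpha> k * cutoff p ^ Suc k) * (p ^ (2 * j) * sqrt (cutoff p) ^ d)"
        unfolding weight sum_distrib_right by (intro sum.cong refl) (simp only: ac_simps)
      also have "\<dots> = slice_weight d 1 p * (\<kappa> + (1 - cutoff p) ^ N) * p ^ (2 * j)"
        unfolding poly W1 by (simp add: ac_simps)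
      also have "\<dots> = slice_weight d 1 p * (\<kappa> + p ^ (2 * N)) * p ^ (2 * j)"
      proof (cases "\<bar>p\<bar> \<le> 1")
        case True
        then have "(1 - cutoff p) ^ N = p ^ (2 * N)" by (simp add: cutoff_eq power_mult)
        then show ?thesis by simp
      next
        case False
        then have "slice_weight d 1 p = 0" by (intro slice_weight_eq_0) auto
        then show ?thesis by simp
      qed
      also have "\<dots> = p ^ (2 * (j + N)) * slice_weight d (Suc 0) p + \<kappa> * (p ^ (2 * j) * slice_weight d (Suc 0) p)"
        by (simp add: algebra_simps power_add)
      finally show "(\<Sum>k\<le>N. \<alpha> k * (p ^ (2 * j) * slice_weight d (Suc k) p))
         = p ^ (2 * (j + N)) * slice_weight d (Suc 0) p + \<kappa> * (p ^ (2 * j) * slice_weight d (Suc 0) p)" .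
    qed
    also have "\<dots> = (\<integral>p. p ^ (2 * (j + N)) * slice_weight d (Suc 0) p \<partial>lborel) + (\<integral>p. \<kappa> * (p ^ (2 * j) * slice_weight d (Suc 0) p) \<partial>lborel)"
      by (intro Bochner_Integration.integral_add integrable_mult_right i)
    finally show ?thesis by (simp add: s_def slice_moment_def)
  qed
  have int: "has_bochner_integral ?S (\<lambda>z. T z * test_fun a N z) (\<beta> 0 - M / \<gamma> * \<beta> l - A / \<gamma>1 * \<beta> 1)"
  proof -
    let ?b = "\<lambda>j k. ball_moment d (Suc k) * slice_moment d (2 * j) (Suc k) / sphere_moment m j"
    have "has_bochner_integral ?S (\<lambda>z. \<Sum>k\<le>N. a k * (norm z ^ (2 * 0) * cutoff (norm z) ^ Suc k - M * (norm z ^ (2 * l) * cutoff (norm z) ^ Suc k) - A * (norm z ^ (2 * 1) * cutoff (norm z) ^ Suc k)))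
        (\<Sum>k\<le>N. a k * (?b 0 k - M * ?b l k - A * ?b 1 k))"
      by (intro has_bochner_integral_sum has_bochner_integral_mult_right has_bochner_integral_diff rm)
    also have "(\<lambda>z::'a. \<Sum>k\<le>N. a k * (norm z ^ (2 * 0) * cutoff (norm z) ^ Suc k - M * (norm z ^ (2 * l) * cutoff (norm z) ^ Suc k) - A * (norm z ^ (2 * 1) * cutoff (norm z) ^ Suc k)))
       = (\<lambda>z. T z * test_fun a N z)"
      unfolding test_fun_def T_def sum_distrib_left by (intro ext sum.cong refl) (simp add: algebra_simps power2_eq_square)
    also have "(\<Sum>k\<le>N. a k * (?b 0 k - M * ?b l k - A * ?b 1 k)) = \<beta> 0 - M / \<gamma> * \<beta> l - A / \<gamma>1 * \<beta> 1"
    proof -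
      have "a k * (?b 0 k - M * ?b l k - A * ?b 1 k) = \<alpha> k * slice_moment d (2 * 0) (Suc k) - M / \<gamma> * (\<alpha> k * slice_moment d (2 * l) (Suc k)) - A / \<gamma>1 * (\<alpha> k * slice_moment d (2 * 1) (Suc k))" for k
        unfolding aa[symmetric] \<gamma>_def \<gamma>1_def by (simp add: sphere_moment_def[of m 0] algebra_simps)
      then show ?thesis unfolding \<beta>_def sum_distrib_left by (simp add: sum_subtractf)
    qed
    finally show ?thesis .
  qed
  have neg: "\<beta> 0 - M / \<gamma> * \<beta> l - A / \<gamma>1 * \<beta> 1 < 0"
  proof -
    have "M / \<gamma> * (\<kappa> * s l) \<ge> 0" "A / \<gamma>1 * \<beta> 1 \<ge> 0"
      using \<kappa>(1) s_pos[of l] s_pos[of 1] s_pos[of "1 + N"] A \<gamma> M1 unfolding \<beta> by (auto intro!: mult_nonneg_nonneg add_nonneg_nonneg)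
    then have "\<beta> 0 - M / \<gamma> * \<beta> l - A / \<gamma>1 * \<beta> 1 \<le> \<beta> 0 - M / \<gamma> * s (N + l)"
      unfolding \<beta>[of l] by (simp add: algebra_simps)
    also have "\<dots> < 0" using \<kappa>(2) unfolding \<beta>[of 0] by simp
    finally show ?thesis .
  qed
  have "integrable ?S (\<lambda>z. T z * test_fun a N z)" using int by (simp add: has_bochner_integral_iff)
  from nn_integral_split_signs[OF this] obtain P Q where PQ:
    "(\<integral>\<^sup>+z. ennreal (T z * test_fun a N z) \<partial>?S) = ennreal P" "(\<integral>\<^sup>+z. ennreal (- (T z * test_fun a N z)) \<partial>?S) = ennreal Q"
    "P \<ge> 0" "Q \<ge> 0" "(\<integral>z. T z * test_fun a N z \<partial>?S) = P - Q"
    "(\<integral>z. \<bar>T z * test_fun a N z\<bar> \<partial>?S) = P + Q" .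
  have PQ': "P < Q" using neg int PQ(5) by (simp add: has_bochner_integral_iff)
  \<comment> \<open>The smaller of the two admissible ratios, for slices and for the mass. The
    denominator \<open>P + 1\<close> allows \<open>P = 0\<close>.\<close>
  define \<theta> where "\<theta> = min (1 + \<kappa> / C) (1 + (Q - P) / (2 * (P + 1)))"
  have \<theta>: "\<theta> > 1" using C \<kappa>(1) PQ' PQ(3) by (simp add: \<theta>_def)
  have "\<theta> * P < Q"
  proof -
    have "\<theta> * P \<le> (1 + (Q - P) / (2 * (P + 1))) * P" using PQ(3) by (intro mult_right_mono) (auto simp: \<theta>_def)
    also have "\<dots> = P + (Q - P) / 2 * (P / (P + 1))" using PQ(3) by (simp add: field_simps)
    also have "\<dots> \<le> P + (Q - P) / 2 * 1" using PQ(3) PQ' by (intro add_left_mono mult_left_mono) auto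
    also have "\<dots> < Q" using PQ' by (simp add: field_simps)
    finally show ?thesis .
  qed
  then have "ennreal \<theta> * ennreal P < ennreal Q" using \<theta> PQ(3) by (simp add: ennreal_mult[symmetric] ennreal_less_iff)
  moreover have "ennreal \<theta> * x \<le> ennreal (1 + \<kappa> / C) * x" for x
    by (intro mult_right_mono ennreal_leI) (auto simp: \<theta>_def)
  ultimately show ?thesis
    using \<theta> R order_trans unfolding PQ(1,2)[symmetric] by (intro exI[of _ a] exI[of _ N] exI[of _ \<theta>]) blast
qed

section \<open>Bodies with prescribed lobes\<close>

definition axis_coord :: "'a::euclidean_space \<Rightarrow> 'a \<Rightarrow> real" where
  "axis_coord e x = (e \<bullet> x) / (e \<bullet> e)"

lemma perp_part_axis: "perp_part e x = x - axis_coord e x *\<^sub>R e"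
  by (simp add: perp_part_def axis_coord_def)

lemma axis_coord_add: "axis_coord e (x + y) = axis_coord e x + axis_coord e y"
  by (simp add: axis_coord_def inner_add_right add_divide_distrib)

lemma axis_coord_scaleR: "axis_coord e (r *\<^sub>R x) = r * axis_coord e x"
  by (simp add: axis_coord_def)

lemma perp_part_plus: "perp_part e (x + y) = perp_part e x + perp_part e y"
  by (simp add: perp_part_axis axis_coord_add algebra_simps)

lemma perp_part_scaleR: "perp_part e (r *\<^sub>R x) = r *\<^sub>R perp_part e x"
  by (simp add: perp_part_axis axis_coord_scaleR algebra_simps)

lemma continuous_on_axis_coord [continuous_intros]:
  "continuous_on A f \<Longrightarrow> continuous_on A (\<lambda>x. axis_coord e (f x))"
  by (cases "e = 0") (auto simp: axis_coord_def intro!: continuous_intros)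

lemma continuous_on_perp_part [continuous_intros]:
  "continuous_on A f \<Longrightarrow> continuous_on A (\<lambda>x. perp_part e (f x))"
  unfolding perp_part_axis by (intro continuous_intros)

lemma origin_symmetricI:
  assumes "\<And>x. - x \<in> K \<longleftrightarrow> x \<in> K"
  shows "origin_symmetric K"
  unfolding origin_symmetric_def
proof
  show "K \<subseteq> uminus ` K"
  proof
    fix x assume "x \<in> K"
    then show "x \<in> uminus ` K" by (intro image_eqI[of _ _ "- x"]) (simp_all add: assms)
  qed
qed (auto simp: assms)

text \<open>If an endpoint of the chord lies outside \<open>U\<close>, it is replaced by a point
  where the chord meets the frontier of \<open>U\<close>. There \<open>c\<close> equals the convex
  minorant \<open>S\<close>, which stays below the line joining the end values of \<open>c\<close>;
  between the two replaced points convexity on \<open>U\<close> applies.\<close>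

lemma convex_on_glue_chord:
  fixes c S :: "'a::euclidean_space \<Rightarrow> real"
  assumes S: "convex_on UNIV S" and le: "\<And>x. S x \<le> c x" and U: "closed U" "convex_on U c"
    and fr: "\<And>x. x \<in> frontier U \<Longrightarrow> c x = S x" and u: "0 \<le> u" "u \<le> 1"
    and q: "(1 - u) *\<^sub>R x + u *\<^sub>R y \<in> U"
  shows "c ((1 - u) *\<^sub>R x + u *\<^sub>R y) \<le> (1 - u) * c x + u * c y"
proof -
  define \<gamma> where "\<gamma> s = (1 - s) *\<^sub>R x + s *\<^sub>R y" for s
  define l where "l s = (1 - s) * c x + s * c y" for s
  have Sl: "S (\<gamma> s) \<le> l s" if "0 \<le> s" "s \<le> 1" for s
  proof -
    have "S (\<gamma> s) \<le> (1 - s) * S x + s * S y"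
      unfolding \<gamma>_def using that by (intro convex_onD[OF S]) auto
    also have "\<dots> \<le> l s" unfolding l_def using that le by (intro add_mono mult_left_mono) auto
    finally show ?thesis .
  qed
  have cont: "continuous_on A \<gamma>" for A unfolding \<gamma>_def by (intro continuous_intros)
  \<comment> \<open>Applied to both halves of the chord, with \<open>r\<close> the endpoint 0 or 1,
    this finds points of \<open>U\<close> on either side of \<open>u\<close> that lie below the
    line.\<close>
  have cross: "\<exists>s\<in>{a..b}. \<gamma> s \<in> U \<and> c (\<gamma> s) \<le> l s"
    if ab: "{a..b} \<subseteq> {0..1}" "u \<in> {a..b}" and r: "r \<in> {a..b}" "c (\<gamma> r) \<le> l r" for a b r
  proof (cases "\<gamma> r \<in> U")
    case True
    then show ?thesis using r by auto
  next
    case False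
    have "connected (\<gamma> ` {a..b})" by (intro connected_continuous_image cont) simp
    moreover have "\<gamma> ` {a..b} \<inter> U \<noteq> {}"
    proof -
      have "\<gamma> u \<in> \<gamma> ` {a..b} \<inter> U" using q ab(2) unfolding \<gamma>_def[symmetric] by blast
      then show ?thesis by blast
    qed
    moreover have "\<gamma> ` {a..b} - U \<noteq> {}"
    proof -
      have "\<gamma> r \<in> \<gamma> ` {a..b} - U" using False r(1) by blast
      then show ?thesis by blast
    qed
    ultimately have "\<gamma> ` {a..b} \<inter> frontier U \<noteq> {}" by (rule connected_Int_frontier)
    then obtain s where s: "s \<in> {a..b}" "\<gamma> s \<in> frontier U" by blast
    moreover have "\<gamma> s \<in> U" using s(2) U(1) frontier_subset_closed by auto
    moreover have "c (\<gamma> s) \<le> l s" using Sl[of s] fr[OF s(2)] s(1) ab by auto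
    ultimately show ?thesis by auto
  qed
  obtain s1 where s1: "s1 \<in> {0..u}" "\<gamma> s1 \<in> U" "c (\<gamma> s1) \<le> l s1"
    using cross[of 0 u 0] u by (auto simp: \<gamma>_def l_def)
  obtain s2 where s2: "s2 \<in> {u..1}" "\<gamma> s2 \<in> U" "c (\<gamma> s2) \<le> l s2"
    using cross[of u 1 1] u by (auto simp: \<gamma>_def l_def)
  have "c (\<gamma> u) \<le> l u"
  proof (cases "s1 = s2")
    case True
    then have "u = s1" using s1 s2 by auto
    then show ?thesis using s1 by simp
  next
    case False
    then have lt: "s1 < s2" using s1 s2 by auto
    define w where "w = (u - s1) / (s2 - s1)"
    have w: "0 \<le> w" "w \<le> 1" using lt s1 s2 by (auto simp: w_def)
    have uw: "u = (1 - w) * s1 + w * s2"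
    proof -
      have "w * (s2 - s1) = u - s1" using lt by (simp add: w_def)
      then show ?thesis by (simp add: algebra_simps)
    qed
    have "\<gamma> u = (1 - w) *\<^sub>R \<gamma> s1 + w *\<^sub>R \<gamma> s2"
      unfolding uw \<gamma>_def by (simp add: algebra_simps)
    then have "c (\<gamma> u) \<le> (1 - w) * c (\<gamma> s1) + w * c (\<gamma> s2)"
      using convex_onD[OF U(2) w s1(2) s2(2)] by simp
    also have "\<dots> \<le> (1 - w) * l s1 + w * l s2"
      using w s1 s2 by (intro add_mono mult_left_mono) auto
    also have "\<dots> = l u" unfolding uw l_def by (simp add: algebra_simps)
    finally show ?thesis .
  qed
  then show ?thesis by (simp add: \<gamma>_def l_def)
qed

text \<open>Gauge of a body symmetric about the origin. In the double cone \<open>norm z < 1\<close> around the axis \<open>e\<close>,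
  with points written as \<open>t (e + \<rho> z)\<close>, the body is \<open>\<bar>t\<bar> \<le> \<tau> z\<close>; outside it is the cylinder of
  radius \<open>\<rho> b\<close>.\<close>

definition lobe_gauge :: "'a::euclidean_space \<Rightarrow> real \<Rightarrow> real \<Rightarrow> ('a \<Rightarrow> real) \<Rightarrow> 'a \<Rightarrow> real" where
  "lobe_gauge e \<rho> b \<tau> x =
     (if norm (perp_part e x) < \<rho> * \<bar>axis_coord e x\<bar>
      then \<bar>axis_coord e x\<bar> / \<tau> (perp_part e x /\<^sub>R (\<rho> * axis_coord e x))
      else norm (perp_part e x) / (\<rho> * b))"

definition lobe_body :: "'a::euclidean_space \<Rightarrow> real \<Rightarrow> real \<Rightarrow> ('a \<Rightarrow> real) \<Rightarrow> 'a set" where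
  "lobe_body e \<rho> b \<tau> = {x. lobe_gauge e \<rho> b \<tau> x \<le> 1}"

text \<open>\<open>cyl\<close> says that the lobe stays inside the cylinder of radius
  \<open>\<rho> * b\<close>, and \<open>rim\<close> that lobe and cylinder meet on the boundary of
  the double cone. These are the two conditions under which the pieces of the gauge glue to a convex
  function.\<close>

locale lobe =
  fixes e :: "'a::euclidean_space" and \<rho> b \<beta> :: real and \<tau> :: "'a \<Rightarrow> real"
  assumes e: "e \<noteq> 0" and \<rho>: "\<rho> > 0" and b: "b > 0"
    and conc: "concave_on (cball 0 1) \<tau>"
    and pos: "\<And>z. norm z \<le> 1 \<Longrightarrow> \<tau> z > 0"
    and bnd: "\<And>z. norm z \<le> 1 \<Longrightarrow> \<tau> z \<le> \<beta>"
    and cyl: "\<And>z. norm z \<le> 1 \<Longrightarrow> norm z * \<tau> z \<le> b"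
    and rim: "\<And>z. norm z = 1 \<Longrightarrow> \<tau> z = b"
begin

abbreviation "N \<equiv> lobe_gauge e \<rho> b \<tau>"
abbreviation "t \<equiv> axis_coord e"
abbreviation "y \<equiv> perp_part e"

lemma gauge_minus: "N (- x) = N x"
proof -
  have "t (- x) = - t x" "y (- x) = - y x"
    using axis_coord_scaleR[of e "-1" x] perp_part_scaleR[of e "-1" x] by auto
  then show ?thesis by (simp add: lobe_gauge_def)
qed

lemma gauge_zero: "N 0 = 0"
proof -
  have "t 0 = 0" "y 0 = 0" by (simp_all add: axis_coord_def perp_part_def)
  then show ?thesis by (simp add: lobe_gauge_def)
qed

lemma gauge_scale:
  assumes "r \<ge> 0"
  shows "N (r *\<^sub>R x) = r * N x"
proof (cases "r = 0")
  case True
  then show ?thesis by (simp add: gauge_zero)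
next
  case False
  then have r: "r > 0" using assms by simp
  have 1: "norm (y (r *\<^sub>R x)) = r * norm (y x)" "\<rho> * \<bar>t (r *\<^sub>R x)\<bar> = r * (\<rho> * \<bar>t x\<bar>)"
    using r by (simp_all add: perp_part_scaleR axis_coord_scaleR abs_mult)
  have "inverse (\<rho> * (r * t x)) * r = inverse (\<rho> * t x)" using r by (simp add: field_simps)
  then have 2: "y (r *\<^sub>R x) /\<^sub>R (\<rho> * t (r *\<^sub>R x)) = y x /\<^sub>R (\<rho> * t x)"
    by (simp only: perp_part_scaleR axis_coord_scaleR scaleR_scaleR)
  have 3: "\<bar>t (r *\<^sub>R x)\<bar> = r * \<bar>t x\<bar>" using r by (simp add: axis_coord_scaleR abs_mult)
  have 4: "norm (y (r *\<^sub>R x)) < \<rho> * \<bar>t (r *\<^sub>R x)\<bar> \<longleftrightarrow> norm (y x) < \<rho> * \<bar>t x\<bar>"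
    unfolding 1 using r by simp
  show ?thesis unfolding lobe_gauge_def 4 2 unfolding 1 3 by simp
qed

lemma gauge_in_cone:
  assumes "norm (y x) \<le> \<rho> * t x" "t x > 0"
  shows "N x = t x / \<tau> (y x /\<^sub>R (\<rho> * t x))" "norm (y x /\<^sub>R (\<rho> * t x)) \<le> 1"
proof -
  have p: "\<rho> * t x > 0" using assms(2) \<rho> by simp
  show n: "norm (y x /\<^sub>R (\<rho> * t x)) \<le> 1" using assms p by (simp add: field_simps)
  show "N x = t x / \<tau> (y x /\<^sub>R (\<rho> * t x))"
  proof (cases "norm (y x) < \<rho> * t x")
    case True
    then show ?thesis using assms(2) by (simp add: lobe_gauge_def)
  next
    case False
    then have eq: "norm (y x) = \<rho> * t x" using assms(1) by simp
    have "norm (y x /\<^sub>R P) = 1" if "norm (y x) = P" "P > 0" for P using that by simp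
    from this[OF eq p] have "norm (y x /\<^sub>R (\<rho> * t x)) = 1" .
    then have "\<tau> (y x /\<^sub>R (\<rho> * t x)) = b" by (rule rim)
    then show ?thesis using eq assms(2) \<rho> by (simp add: lobe_gauge_def)
  qed
qed

lemma gauge_ge: "norm (y x) / (\<rho> * b) \<le> N x"
proof (cases "norm (y x) < \<rho> * \<bar>t x\<bar>")
  case True
  define z where "z = y x /\<^sub>R (\<rho> * t x)"
  have t0: "t x \<noteq> 0" using True \<rho> by auto
  have nz: "norm z * (\<rho> * \<bar>t x\<bar>) = norm (y x)" using t0 \<rho> by (simp add: z_def abs_mult field_simps)
  then have "norm z \<le> 1" using True t0 \<rho> by (simp add: z_def abs_mult field_simps)
  note z = pos[OF this] cyl[OF this]
  have "norm (y x) / (\<rho> * b) = \<bar>t x\<bar> * norm z / b" unfolding nz[symmetric] using \<rho> by simp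
  also have "\<dots> \<le> \<bar>t x\<bar> / \<tau> z"
  proof -
    have "\<bar>t x\<bar> * (norm z * \<tau> z) \<le> \<bar>t x\<bar> * b" using z by (intro mult_left_mono) auto
    then show ?thesis using z b by (simp add: field_simps)
  qed
  finally show ?thesis using True by (simp add: lobe_gauge_def z_def)
qed (simp add: lobe_gauge_def)

text \<open>In the cone the gauge is the perspective \<open>t / \<tau> (y / (\<rho> * t))\<close> of
  \<open>1 / \<tau>\<close>. The reciprocal of a positive concave function is convex, and
  perspectives of convex functions are subadditive.\<close>

lemma gauge_subadditive_cone:
  assumes x: "norm (y x) \<le> \<rho> * t x" and x': "norm (y x') \<le> \<rho> * t x'"
  shows "N (x + x') \<le> N x + N x'"
proof -
  have zero: "w = 0" if "norm (y w) \<le> \<rho> * t w" "t w \<le> 0" for w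
  proof -
    have "\<rho> * t w \<le> 0" using that(2) \<rho> by (simp add: mult_nonneg_nonpos)
    then have "norm (y w) = 0" "\<rho> * t w = 0" using that(1) norm_ge_zero[of "y w"] by linarith+
    then show ?thesis using \<rho> by (simp add: perp_part_axis)
  qed
  consider "t x \<le> 0" | "t x' \<le> 0" | "t x > 0" "t x' > 0" by linarith
  then show ?thesis
  proof cases
    case 1
    then have "x = 0" using zero x by simp
    then show ?thesis using gauge_zero by simp
  next
    case 2
    then have "x' = 0" using zero x' by simp
    then show ?thesis using gauge_zero by simp
  next
    case 3
    define z where "z = y x /\<^sub>R (\<rho> * t x)"
    define z' where "z' = y x' /\<^sub>R (\<rho> * t x')"
    define s where "s = t (x + x')"
    have s: "s = t x + t x'" "s > 0" using 3 by (auto simp: s_def axis_coord_add)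
    have cone: "norm (y (x + x')) \<le> \<rho> * t (x + x')"
      using x x' norm_triangle_ineq[of "y x" "y x'"] by (simp add: perp_part_plus axis_coord_add distrib_left)
    define w where "w = t x' / s"
    have w: "0 \<le> w" "w \<le> 1" "1 - w = t x / s" using 3 s by (auto simp: w_def field_simps)
    have zz: "norm z \<le> 1" "norm z' \<le> 1" "N x = t x / \<tau> z" "N x' = t x' / \<tau> z'"
      using gauge_in_cone[OF x 3(1)] gauge_in_cone[OF x' 3(2)] by (auto simp: z_def z'_def)
    have comb: "y (x + x') /\<^sub>R (\<rho> * s) = (1 - w) *\<^sub>R z + w *\<^sub>R z'"
    proof -
      have "(1 - w) *\<^sub>R z = y x /\<^sub>R (\<rho> * s)" unfolding w(3) z_def using 3 s(2) \<rho> by (simp add: field_simps)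
      moreover have "w *\<^sub>R z' = y x' /\<^sub>R (\<rho> * s)" unfolding w_def z'_def using 3 s(2) \<rho> by (simp add: field_simps)
      ultimately show ?thesis by (simp only: perp_part_plus scaleR_add_right)
    qed
    have "(1 - w) * \<tau> z + w * \<tau> z' \<le> \<tau> ((1 - w) *\<^sub>R z + w *\<^sub>R z')"
      using zz w by (intro concave_onD[OF conc]) auto
    moreover have tp: "(1 - w) * \<tau> z + w * \<tau> z' > 0"
    proof (cases "w = 0")
      case False
      then have "w * \<tau> z' > 0" "(1 - w) * \<tau> z \<ge> 0" using w(1,2) pos[OF zz(1)] pos[OF zz(2)] by auto
      then show ?thesis by linarith
    qed (use pos[OF zz(1)] in simp)
    ultimately have "s / \<tau> ((1 - w) *\<^sub>R z + w *\<^sub>R z') \<le> s * inverse ((1 - w) * \<tau> z + w * \<tau> z')"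
      using s(2) by (simp add: divide_inverse le_imp_inverse_le)
    also have "\<dots> \<le> s * ((1 - w) * inverse (\<tau> z) + w * inverse (\<tau> z'))"
    proof (rule mult_left_mono)
      have "convex_on {0<..} (inverse :: real \<Rightarrow> real)" by (rule convex_on_inverse) auto
      from convex_onD[OF this w(1,2), of "\<tau> z" "\<tau> z'"]
      show "inverse ((1 - w) * \<tau> z + w * \<tau> z') \<le> (1 - w) * inverse (\<tau> z) + w * inverse (\<tau> z')"
        using pos[OF zz(1)] pos[OF zz(2)] by simp
    qed (use s in simp)
    also have "\<dots> = t x / \<tau> z + t x' / \<tau> z'"
    proof -
      have "s * ((p / s) * a + (q / s) * c) = p * a + q * c" for p q a c using s(2) by (simp add: field_simps)
      from this[of "t x" "inverse (\<tau> z)" "t x'" "inverse (\<tau> z')"] show ?thesis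
        unfolding w(3) unfolding w_def by (simp only: divide_inverse)
    qed
    finally show ?thesis
      using gauge_in_cone(1)[OF cone] s(2) unfolding s_def[symmetric] comb zz(3,4) by simp
  qed
qed

text \<open>The cylinder gauge \<open>S\<close> is a convex minorant of \<open>N\<close>, equal to
  it outside the two cones and on their frontiers. \<open>N\<close> is convex on each cone, so the
  gluing lemma covers points of the cones and \<open>S\<close> all others.\<close>

lemma convex_on_gauge: "convex_on UNIV N"
proof -
  define S where "S x = norm (y x) / (\<rho> * b)" for x
  define U where "U = {x. norm (y x) \<le> \<rho> * t x}"
  define U' where "U' = {x. norm (y x) \<le> - (\<rho> * t x)}"
  have S: "convex_on UNIV S"
  proof (rule convex_onI)
    fix u :: real and x x' :: 'a assume u: "0 < u" "u < 1"
    have "norm (y ((1 - u) *\<^sub>R x + u *\<^sub>R x')) \<le> (1 - u) * norm (y x) + u * norm (y x')"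
      using u norm_triangle_ineq[of "(1 - u) *\<^sub>R y x" "u *\<^sub>R y x'"] by (simp add: perp_part_plus perp_part_scaleR)
    then show "S ((1 - u) *\<^sub>R x + u *\<^sub>R x') \<le> (1 - u) * S x + u * S x'"
      unfolding S_def using \<rho> b by (simp add: divide_right_mono add_divide_distrib[symmetric])
  qed simp
  have SN: "S x \<le> N x" for x unfolding S_def by (rule gauge_ge)
  have cl: "closed U" "closed U'" unfolding U_def U'_def
    by (intro closed_Collect_le continuous_intros)+
  have frU: "N x = S x" if "x \<in> frontier U" for x
  proof -
    have "open {x. norm (y x) < \<rho> * t x}" by (intro open_Collect_less continuous_intros)
    then have sub: "{x. norm (y x) < \<rho> * t x} \<subseteq> interior U" by (intro interior_maximal) (auto simp: U_def)
    have "x \<in> U" "x \<notin> interior U" using that cl(1) unfolding frontier_def by auto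
    moreover from this have "\<not> norm (y x) < \<rho> * t x" using sub by blast
    ultimately have "norm (y x) \<le> \<rho> * t x" "\<not> norm (y x) < \<rho> * t x" by (simp_all add: U_def)
    then have "norm (y x) = \<rho> * t x" by linarith
    then show ?thesis using norm_ge_zero[of "y x"] \<rho> by (simp add: lobe_gauge_def S_def zero_le_mult_iff)
  qed
  have frU': "N x = S x" if "x \<in> frontier U'" for x
  proof -
    have "open {x. norm (y x) < - (\<rho> * t x)}" by (intro open_Collect_less continuous_intros)
    then have sub: "{x. norm (y x) < - (\<rho> * t x)} \<subseteq> interior U'" by (intro interior_maximal) (auto simp: U'_def)
    have "x \<in> U'" "x \<notin> interior U'" using that cl(2) unfolding frontier_def by auto
    moreover from this have "\<not> norm (y x) < - (\<rho> * t x)" using sub by blast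
    ultimately have "norm (y x) \<le> - (\<rho> * t x)" "\<not> norm (y x) < - (\<rho> * t x)" by (simp_all add: U'_def)
    then have eq: "norm (y x) = - (\<rho> * t x)" by linarith
    then have "t x \<le> 0" using norm_ge_zero[of "y x"] \<rho> by (simp add: mult_le_0_iff)
    then show ?thesis using eq by (simp add: lobe_gauge_def S_def)
  qed
  have convU: "convex U"
  proof (rule convexI)
    fix x x' and u v :: real assume *: "x \<in> U" "x' \<in> U" "0 \<le> u" "0 \<le> v" "u + v = 1"
    have "norm (y (u *\<^sub>R x + v *\<^sub>R x')) \<le> u * norm (y x) + v * norm (y x')"
      using * norm_triangle_ineq[of "u *\<^sub>R y x" "v *\<^sub>R y x'"] by (simp add: perp_part_plus perp_part_scaleR)
    also have "\<dots> \<le> u * (\<rho> * t x) + v * (\<rho> * t x')" using * by (intro add_mono mult_left_mono) (auto simp: U_def)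
    finally show "u *\<^sub>R x + v *\<^sub>R x' \<in> U" by (simp add: U_def axis_coord_add axis_coord_scaleR algebra_simps)
  qed
  have NU: "convex_on U N"
  proof (rule convex_onI)
    fix u :: real and x x' assume *: "0 < u" "u < 1" "x \<in> U" "x' \<in> U"
    have sc: "norm (y (r *\<^sub>R w)) \<le> \<rho> * t (r *\<^sub>R w)" if "r \<ge> 0" "w \<in> U" for r w
      using mult_left_mono[of "norm (y w)" "\<rho> * t w" r] that by (simp add: U_def perp_part_scaleR axis_coord_scaleR ac_simps)
    have "N ((1 - u) *\<^sub>R x + u *\<^sub>R x') \<le> N ((1 - u) *\<^sub>R x) + N (u *\<^sub>R x')"
      using * by (intro gauge_subadditive_cone sc) auto
    then show "N ((1 - u) *\<^sub>R x + u *\<^sub>R x') \<le> (1 - u) * N x + u * N x'"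
      using * by (simp add: gauge_scale)
  qed (rule convU)
  have neg: "x \<in> U' \<longleftrightarrow> - x \<in> U" for x
    using axis_coord_scaleR[of e "-1" x] perp_part_scaleR[of e "-1" x] by (simp add: U_def U'_def)
  have NU': "convex_on U' N"
  proof (rule convex_onI)
    fix u :: real and x x' assume *: "0 < u" "u < 1" "x \<in> U'" "x' \<in> U'"
    have "N ((1 - u) *\<^sub>R (- x) + u *\<^sub>R (- x')) \<le> (1 - u) * N (- x) + u * N (- x')"
      using * neg by (intro convex_onD[OF NU]) auto
    moreover have "(1 - u) *\<^sub>R (- x) + u *\<^sub>R (- x') = - ((1 - u) *\<^sub>R x + u *\<^sub>R x')" by simp
    ultimately show "N ((1 - u) *\<^sub>R x + u *\<^sub>R x') \<le> (1 - u) * N x + u * N x'"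
      by (simp only: gauge_minus)
  next
    have "U' = uminus ` U"
    proof
      show "U' \<subseteq> uminus ` U"
      proof
        fix x assume "x \<in> U'"
        then show "x \<in> uminus ` U" by (intro image_eqI[of _ _ "- x"]) (simp_all add: neg)
      qed
    qed (auto simp: neg)
    then show "convex U'" using convex_negations[OF convU] by simp
  qed
  show ?thesis
  proof (rule convex_onI)
    fix u :: real and x x' :: 'a assume u: "0 < u" "u < 1"
    let ?q = "(1 - u) *\<^sub>R x + u *\<^sub>R x'"
    show "N ?q \<le> (1 - u) * N x + u * N x'"
    proof (cases "?q \<in> U \<or> ?q \<in> U'")
      case True
      then show ?thesis
        using convex_on_glue_chord[OF S SN cl(1) NU frU, of u x x'] convex_on_glue_chord[OF S SN cl(2) NU' frU', of u x x'] u
        by auto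
    next
      case False
      then have "N ?q = S ?q"
        by (auto simp: U_def U'_def lobe_gauge_def S_def abs_if split: if_splits)
      also have "\<dots> \<le> (1 - u) * S x + u * S x'" using u by (intro convex_onD[OF S]) auto
      also have "\<dots> \<le> (1 - u) * N x + u * N x'" using u SN by (intro add_mono mult_left_mono) auto
      finally show ?thesis .
    qed
  qed simp
qed

lemma origin_symmetric_lobe_body: "origin_symmetric (lobe_body e \<rho> b \<tau>)"
proof -
  have "- x \<in> lobe_body e \<rho> b \<tau> \<longleftrightarrow> x \<in> lobe_body e \<rho> b \<tau>" for x by (simp add: lobe_body_def gauge_minus)
  then show ?thesis by (rule origin_symmetricI)
qed

lemma convex_body_lobe_body: "convex_body (lobe_body e \<rho> b \<tau>)"
proof -
  let ?K = "lobe_body e \<rho> b \<tau>"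
  have cont: "continuous_on UNIV N" by (rule convex_on_continuous[OF open_UNIV convex_on_gauge])
  have "closed ?K" unfolding lobe_body_def by (intro closed_Collect_le cont continuous_intros)
  moreover have "bounded ?K"
    unfolding bounded_iff
  proof (intro exI ballI)
    fix x assume "x \<in> ?K"
    then have N1: "N x \<le> 1" by (simp add: lobe_body_def)
    have "norm (y x) / (\<rho> * b) \<le> 1" using gauge_ge[of x] N1 by linarith
    then have yb: "norm (y x) \<le> \<rho> * b" using \<rho> b by (simp add: divide_le_eq)
    have "\<bar>t x\<bar> \<le> \<bar>\<beta>\<bar> + b"
    proof (cases "norm (y x) < \<rho> * \<bar>t x\<bar>")
      case True
      then have t0: "t x \<noteq> 0" using \<rho> by auto
      define z where "z = y x /\<^sub>R (\<rho> * t x)"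
      have "norm z \<le> 1" using True t0 \<rho> by (simp add: z_def abs_mult field_simps)
      moreover have "N x = \<bar>t x\<bar> / \<tau> z" using True by (simp only: lobe_gauge_def z_def if_True)
      ultimately have "\<bar>t x\<bar> \<le> \<tau> z" "\<tau> z \<le> \<beta>"
        using N1 pos[of z] bnd[of z] by auto
      then show ?thesis using b by linarith
    next
      case False
      then have "\<rho> * \<bar>t x\<bar> \<le> \<rho> * b" using yb by simp
      then show ?thesis using \<rho> by simp
    qed
    moreover have "norm x \<le> norm (t x *\<^sub>R e) + norm (y x)"
      using norm_triangle_ineq[of "t x *\<^sub>R e" "y x"] by (simp add: perp_part_axis)
    ultimately show "norm x \<le> (\<bar>\<beta>\<bar> + b) * norm e + \<rho> * b"
      using yb mult_right_mono[of "\<bar>t x\<bar>" "\<bar>\<beta>\<bar> + b" "norm e"] by simp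
  qed
  moreover have "convex ?K"
  proof (rule convexI)
    fix x x' and u v :: real assume *: "x \<in> ?K" "x' \<in> ?K" "0 \<le> u" "0 \<le> v" "u + v = 1"
    then have u: "u = 1 - v" by simp
    have "N (u *\<^sub>R x + v *\<^sub>R x') \<le> u * N x + v * N x'"
      unfolding u using * by (intro convex_onD[OF convex_on_gauge]) auto
    also have "\<dots> \<le> u * 1 + v * 1" using * by (intro add_mono mult_left_mono) (auto simp: lobe_body_def)
    finally show "u *\<^sub>R x + v *\<^sub>R x' \<in> ?K" using * by (simp add: lobe_body_def)
  qed
  moreover have "0 \<in> interior ?K"
  proof -
    have "open {x. N x < 1}" by (intro open_Collect_less cont continuous_intros)
    then have "{x. N x < 1} \<subseteq> interior ?K" by (intro interior_maximal) (auto simp: lobe_body_def)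
    moreover have "N 0 = 0" using gauge_zero by simp
    ultimately show ?thesis by auto
  qed
  ultimately show ?thesis unfolding convex_body_def by (auto simp: compact_eq_bounded_closed)
qed

text \<open>The description of the body in the chart: for a common \<open>\<rho>\<close> and
  \<open>b\<close>, two lobe bodies differ only where \<open>norm z < 1\<close>.\<close>

lemma lobe_body_iff:
  assumes z: "z \<in> hyperplane_perp e" and s: "s \<noteq> 0"
  shows "s *\<^sub>R (e + \<rho> *\<^sub>R z) \<in> lobe_body e \<rho> b \<tau> \<longleftrightarrow> (if norm z < 1 then \<bar>s\<bar> \<le> \<tau> z else \<bar>s\<bar> * norm z \<le> b)"
proof -
  have ez: "e \<bullet> z = 0" using z by (simp add: hyperplane_perp_def)
  have ee: "e \<bullet> e \<noteq> 0" using e by simp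
  have t: "t (s *\<^sub>R (e + \<rho> *\<^sub>R z)) = s"
    using ee ez by (simp add: axis_coord_def inner_add_right)
  have y: "y (s *\<^sub>R (e + \<rho> *\<^sub>R z)) = (s * \<rho>) *\<^sub>R z"
    unfolding perp_part_axis t by (simp add: algebra_simps)
  have "norm ((s * \<rho>) *\<^sub>R z) < \<rho> * \<bar>s\<bar> \<longleftrightarrow> norm z < 1"
    using s \<rho> by (simp add: abs_mult mult.commute)
  moreover have "((s * \<rho>) *\<^sub>R z) /\<^sub>R (\<rho> * s) = z" using s \<rho> by (simp add: field_simps)
  moreover have "norm ((s * \<rho>) *\<^sub>R z) / (\<rho> * b) = \<bar>s\<bar> * norm z / b" using \<rho> by (simp add: abs_mult)
  ultimately show ?thesis
    unfolding lobe_body_def lobe_gauge_def mem_Collect_eq t y using pos[of z] b by (simp add: divide_le_eq)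
qed

end

section \<open>Perturbations of concave functions\<close>

text \<open>The defect in the convexity inequality, zero for affine functions. Bounding it by a
  multiple of \<open>u * (1 - u) * (norm (x - y))\<^sup>2\<close> states a second-order bound
  without derivatives.\<close>

definition chord_deviation :: "('a::euclidean_space \<Rightarrow> real) \<Rightarrow> 'a \<Rightarrow> 'a \<Rightarrow> real \<Rightarrow> real" where
  "chord_deviation P x y u = (1 - u) * P x + u * P y - P ((1 - u) *\<^sub>R x + u *\<^sub>R y)"

text \<open>A form of \<open>C\<^sup>1\<^sup>,\<^sup>1\<close> regularity on the unit ball that is stable under products.\<close>

definition tame :: "('a::euclidean_space \<Rightarrow> real) \<Rightarrow> bool" where
  "tame P \<longleftrightarrow> (\<exists>C\<ge>0. (\<forall>x\<in>cball 0 1. \<bar>P x\<bar> \<le> C) \<and> (\<forall>x\<in>cball 0 1. \<forall>y\<in>cball 0 1. \<bar>P x - P y\<bar> \<le> C * norm (x - y)) \<and>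
     (\<forall>x\<in>cball 0 1. \<forall>y\<in>cball 0 1. \<forall>u\<in>{0..1}. \<bar>chord_deviation P x y u\<bar> \<le> C * (u * (1 - u) * (norm (x - y))\<^sup>2)))"

lemma tameE:
  assumes "tame P"
  obtains C where "C \<ge> 0" "\<And>x. norm x \<le> 1 \<Longrightarrow> \<bar>P x\<bar> \<le> C"
    "\<And>x y. norm x \<le> 1 \<Longrightarrow> norm y \<le> 1 \<Longrightarrow> \<bar>P x - P y\<bar> \<le> C * norm (x - y)"
    "\<And>x y u. norm x \<le> 1 \<Longrightarrow> norm y \<le> 1 \<Longrightarrow> 0 \<le> u \<Longrightarrow> u \<le> 1 \<Longrightarrow> \<bar>chord_deviation P x y u\<bar> \<le> C * (u * (1 - u) * (norm (x - y))\<^sup>2)"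
  using assms unfolding tame_def by (auto simp: Ball_def)

lemma tameI:
  assumes "C \<ge> 0" "\<And>x. norm x \<le> 1 \<Longrightarrow> \<bar>P x\<bar> \<le> C"
    "\<And>x y. norm x \<le> 1 \<Longrightarrow> norm y \<le> 1 \<Longrightarrow> \<bar>P x - P y\<bar> \<le> C * norm (x - y)"
    "\<And>x y u. norm x \<le> 1 \<Longrightarrow> norm y \<le> 1 \<Longrightarrow> 0 \<le> u \<Longrightarrow> u \<le> 1 \<Longrightarrow> \<bar>chord_deviation P x y u\<bar> \<le> C * (u * (1 - u) * (norm (x - y))\<^sup>2)"
  shows "tame P"
  using assms unfolding tame_def by (auto intro!: exI[of _ C])

lemma norm_chord_le_1:
  assumes "norm x \<le> 1" "norm y \<le> 1" "0 \<le> u" "u \<le> 1"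
  shows "norm ((1 - u) *\<^sub>R x + u *\<^sub>R y) \<le> 1"
  using convexD_alt[OF convex_cball, of x 0 1 y u] assms by simp

lemma tame_const: "tame (\<lambda>_. k)"
proof (rule tameI[of "\<bar>k\<bar>"])
  fix x y :: 'a and u :: real assume u: "0 \<le> u" "u \<le> 1"
  have "chord_deviation (\<lambda>_. k) x y u = 0" by (simp add: chord_deviation_def algebra_simps)
  then show "\<bar>chord_deviation (\<lambda>_. k) x y u\<bar> \<le> \<bar>k\<bar> * (u * (1 - u) * (norm (x - y))\<^sup>2)" using u by simp
qed auto

lemma tame_linear:
  assumes "bounded_linear P"
  shows "tame P"
proof -
  interpret bounded_linear P by fact
  obtain C where C: "C \<ge> 0" "\<And>x. norm (P x) \<le> norm x * C" using nonneg_bounded by blast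
  show ?thesis
  proof (rule tameI[OF C(1)])
    fix x :: 'a assume "norm x \<le> 1"
    then have "norm x * C \<le> 1 * C" using C(1) by (intro mult_right_mono) auto
    then show "\<bar>P x\<bar> \<le> C" using C(2)[of x] by simp
  next
    fix x y
    show "\<bar>P x - P y\<bar> \<le> C * norm (x - y)" using C(2)[of "x - y"] by (simp add: diff mult.commute)
  next
    fix x y :: 'a and u :: real assume u: "0 \<le> u" "u \<le> 1"
    have "chord_deviation P x y u = 0" by (simp add: chord_deviation_def add scale)
    then show "\<bar>chord_deviation P x y u\<bar> \<le> C * (u * (1 - u) * (norm (x - y))\<^sup>2)" using C(1) u by simp
  qed
qed

lemma tame_add:
  assumes "tame P" "tame Q"
  shows "tame (\<lambda>x. P x + Q x)"
proof -
  obtain C where C: "C \<ge> 0" "\<And>x. norm x \<le> 1 \<Longrightarrow> \<bar>P x\<bar> \<le> C"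
    "\<And>x y. norm x \<le> 1 \<Longrightarrow> norm y \<le> 1 \<Longrightarrow> \<bar>P x - P y\<bar> \<le> C * norm (x - y)"
    "\<And>x y u. norm x \<le> 1 \<Longrightarrow> norm y \<le> 1 \<Longrightarrow> 0 \<le> u \<Longrightarrow> u \<le> 1 \<Longrightarrow> \<bar>chord_deviation P x y u\<bar> \<le> C * (u * (1 - u) * (norm (x - y))\<^sup>2)"
    using tameE[OF assms(1)] by blast
  obtain D where D: "D \<ge> 0" "\<And>x. norm x \<le> 1 \<Longrightarrow> \<bar>Q x\<bar> \<le> D"
    "\<And>x y. norm x \<le> 1 \<Longrightarrow> norm y \<le> 1 \<Longrightarrow> \<bar>Q x - Q y\<bar> \<le> D * norm (x - y)"
    "\<And>x y u. norm x \<le> 1 \<Longrightarrow> norm y \<le> 1 \<Longrightarrow> 0 \<le> u \<Longrightarrow> u \<le> 1 \<Longrightarrow> \<bar>chord_deviation Q x y u\<bar> \<le> D * (u * (1 - u) * (norm (x - y))\<^sup>2)"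
    using tameE[OF assms(2)] by blast
  show ?thesis
  proof (rule tameI[of "C + D"])
    fix x :: 'a assume x: "norm x \<le> 1"
    show "\<bar>P x + Q x\<bar> \<le> C + D" using C(2)[OF x] D(2)[OF x] by linarith
  next
    fix x y :: 'a assume xy: "norm x \<le> 1" "norm y \<le> 1"
    show "\<bar>P x + Q x - (P y + Q y)\<bar> \<le> (C + D) * norm (x - y)"
      using C(3)[OF xy] D(3)[OF xy] unfolding distrib_right by linarith
  next
    fix x y :: 'a and u :: real assume xy: "norm x \<le> 1" "norm y \<le> 1" "0 \<le> u" "u \<le> 1"
    have "chord_deviation (\<lambda>x. P x + Q x) x y u = chord_deviation P x y u + chord_deviation Q x y u"
      by (simp add: chord_deviation_def algebra_simps)
    then show "\<bar>chord_deviation (\<lambda>x. P x + Q x) x y u\<bar> \<le> (C + D) * (u * (1 - u) * (norm (x - y))\<^sup>2)"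
      using C(4)[OF xy] D(4)[OF xy] unfolding distrib_right by linarith
  qed (use C D in auto)
qed

lemma tame_mult:
  assumes "tame P" "tame Q"
  shows "tame (\<lambda>x. P x * Q x)"
proof -
  obtain C where C: "C \<ge> 0" "\<And>x. norm x \<le> 1 \<Longrightarrow> \<bar>P x\<bar> \<le> C"
    "\<And>x y. norm x \<le> 1 \<Longrightarrow> norm y \<le> 1 \<Longrightarrow> \<bar>P x - P y\<bar> \<le> C * norm (x - y)"
    "\<And>x y u. norm x \<le> 1 \<Longrightarrow> norm y \<le> 1 \<Longrightarrow> 0 \<le> u \<Longrightarrow> u \<le> 1 \<Longrightarrow> \<bar>chord_deviation P x y u\<bar> \<le> C * (u * (1 - u) * (norm (x - y))\<^sup>2)"
    using tameE[OF assms(1)] by blast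
  obtain D where D: "D \<ge> 0" "\<And>x. norm x \<le> 1 \<Longrightarrow> \<bar>Q x\<bar> \<le> D"
    "\<And>x y. norm x \<le> 1 \<Longrightarrow> norm y \<le> 1 \<Longrightarrow> \<bar>Q x - Q y\<bar> \<le> D * norm (x - y)"
    "\<And>x y u. norm x \<le> 1 \<Longrightarrow> norm y \<le> 1 \<Longrightarrow> 0 \<le> u \<Longrightarrow> u \<le> 1 \<Longrightarrow> \<bar>chord_deviation Q x y u\<bar> \<le> D * (u * (1 - u) * (norm (x - y))\<^sup>2)"
    using tameE[OF assms(2)] by blast
  have CD: "C * D \<ge> 0" using C D by simp
  show ?thesis
  proof (rule tameI[of "3 * (C * D)"])
    fix x :: 'a assume x: "norm x \<le> 1"
    have "\<bar>P x\<bar> * \<bar>Q x\<bar> \<le> C * D" using C(1) C(2)[OF x] D(2)[OF x] by (intro mult_mono) auto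
    then show "\<bar>P x * Q x\<bar> \<le> 3 * (C * D)" unfolding abs_mult using CD by linarith
  next
    fix x y :: 'a assume xy: "norm x \<le> 1" "norm y \<le> 1"
    have "P x * Q x - P y * Q y = P x * (Q x - Q y) + (P x - P y) * Q y" by (simp add: algebra_simps)
    also have "\<bar>\<dots>\<bar> \<le> \<bar>P x\<bar> * \<bar>Q x - Q y\<bar> + \<bar>P x - P y\<bar> * \<bar>Q y\<bar>"
      by (rule order_trans[OF abs_triangle_ineq]) (simp add: abs_mult)
    also have "\<dots> \<le> C * (D * norm (x - y)) + (C * norm (x - y)) * D"
      using C(1) D(1) C(2)[OF xy(1)] D(2)[OF xy(2)] C(3)[OF xy] D(3)[OF xy] by (intro add_mono mult_mono) auto
    also have "\<dots> = 2 * (C * D) * norm (x - y)" by simp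
    also have "\<dots> \<le> 3 * (C * D) * norm (x - y)" using CD by (intro mult_right_mono) auto
    finally show "\<bar>P x * Q x - P y * Q y\<bar> \<le> 3 * (C * D) * norm (x - y)" .
  next
    fix x y :: 'a and u :: real assume xy: "norm x \<le> 1" "norm y \<le> 1" "0 \<le> u" "u \<le> 1"
    let ?m = "(1 - u) *\<^sub>R x + u *\<^sub>R y"
    let ?w = "u * (1 - u) * (norm (x - y))\<^sup>2"
    have m: "norm ?m \<le> 1" by (rule norm_chord_le_1[OF xy])
    have w: "?w \<ge> 0" using xy by simp
    have EQ: "\<bar>(1 - u) * Q x + u * Q y\<bar> \<le> D"
    proof -
      have "\<bar>(1 - u) * Q x + u * Q y\<bar> \<le> (1 - u) * \<bar>Q x\<bar> + u * \<bar>Q y\<bar>"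
        using xy by (intro order_trans[OF abs_triangle_ineq]) (simp add: abs_mult)
      also have "\<dots> \<le> (1 - u) * D + u * D" using xy D by (intro add_mono mult_left_mono) auto
      finally show ?thesis by (simp add: algebra_simps)
    qed
    \<comment> \<open>Discrete Leibniz rule. The mixed term needs Lipschitz bounds and the other two
      need bounds on the values, which is why \<open>tame\<close> records both.\<close>
    have "chord_deviation (\<lambda>x. P x * Q x) x y u
      = u * (1 - u) * ((P x - P y) * (Q x - Q y)) + chord_deviation P x y u * ((1 - u) * Q x + u * Q y) + P ?m * chord_deviation Q x y u"
      by (simp add: chord_deviation_def algebra_simps)
    also have "\<bar>\<dots>\<bar> \<le> u * (1 - u) * (\<bar>P x - P y\<bar> * \<bar>Q x - Q y\<bar>) + \<bar>chord_deviation P x y u\<bar> * \<bar>(1 - u) * Q x + u * Q y\<bar> + \<bar>P ?m\<bar> * \<bar>chord_deviation Q x y u\<bar>"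
    proof -
      have tri: "\<bar>a + b + c\<bar> \<le> \<bar>a\<bar> + \<bar>b\<bar> + \<bar>c\<bar>" for a b c :: real by linarith
      show ?thesis by (rule order_trans[OF tri]) (use xy in \<open>simp add: abs_mult\<close>)
    qed
    also have "\<dots> \<le> u * (1 - u) * ((C * norm (x - y)) * (D * norm (x - y))) + (C * ?w) * D + C * (D * ?w)"
    proof (intro add_mono)
      show "u * (1 - u) * (\<bar>P x - P y\<bar> * \<bar>Q x - Q y\<bar>) \<le> u * (1 - u) * ((C * norm (x - y)) * (D * norm (x - y)))"
        using xy(3,4) C(1) C(3)[OF xy(1,2)] D(3)[OF xy(1,2)] by (intro mult_left_mono mult_mono) simp_all
      show "\<bar>chord_deviation P x y u\<bar> * \<bar>(1 - u) * Q x + u * Q y\<bar> \<le> (C * ?w) * D"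
        by (rule mult_mono[OF C(4)[OF xy] EQ]) (use C(1) w in simp_all)
      show "\<bar>P ?m\<bar> * \<bar>chord_deviation Q x y u\<bar> \<le> C * (D * ?w)"
        by (rule mult_mono[OF C(2)[OF m] D(4)[OF xy]]) (use C(1) in simp_all)
    qed
    also have "\<dots> = 3 * (C * D) * ?w" by (simp add: power2_eq_square algebra_simps)
    finally show "\<bar>chord_deviation (\<lambda>x. P x * Q x) x y u\<bar> \<le> 3 * (C * D) * ?w" .
  qed (use CD in simp)
qed

text \<open>The squared norm has exactly the deviation by which \<open>tame\<close> measures others,
  so a multiple of it can compensate any small tame perturbation.\<close>

lemma norm2_chord:
  fixes x y :: "'a::euclidean_space"
  shows "(1 - u) * (norm x)\<^sup>2 + u * (norm y)\<^sup>2 - (norm ((1 - u) *\<^sub>R x + u *\<^sub>R y))\<^sup>2 = u * (1 - u) * (norm (x - y))\<^sup>2"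
  unfolding power2_norm_eq_inner
  by (simp add: inner_add_left inner_add_right inner_diff_left inner_diff_right inner_commute[of y x] algebra_simps)

lemma tame_norm2: "tame (\<lambda>x::'a::euclidean_space. (norm x)\<^sup>2)"
proof (rule tameI[of 2])
  fix x :: 'a assume "norm x \<le> 1"
  then have "(norm x)\<^sup>2 \<le> 1" by (simp add: power_le_one)
  then show "\<bar>(norm x)\<^sup>2\<bar> \<le> 2" by simp
next
  fix x y :: 'a assume xy: "norm x \<le> 1" "norm y \<le> 1"
  have "\<bar>(norm x)\<^sup>2 - (norm y)\<^sup>2\<bar> = (norm x + norm y) * \<bar>norm x - norm y\<bar>"
    by (simp add: power2_eq_square square_diff_square_factored abs_mult)
  also have "\<dots> \<le> 2 * norm (x - y)" using xy norm_triangle_ineq3[of x y] by (intro mult_mono) auto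
  finally show "\<bar>(norm x)\<^sup>2 - (norm y)\<^sup>2\<bar> \<le> 2 * norm (x - y)" .
next
  fix x y :: 'a and u :: real assume "norm x \<le> 1" "norm y \<le> 1" "0 \<le> u" "u \<le> 1"
  then show "\<bar>chord_deviation (\<lambda>x. (norm x)\<^sup>2) x y u\<bar> \<le> 2 * (u * (1 - u) * (norm (x - y))\<^sup>2)"
    unfolding chord_deviation_def norm2_chord by simp
qed simp

lemma tame_power: "tame P \<Longrightarrow> tame (\<lambda>x. P x ^ k)"
  by (induction k) (auto intro: tame_const tame_mult)

lemma tame_sum: "(\<And>k. k \<in> I \<Longrightarrow> tame (P k)) \<Longrightarrow> tame (\<lambda>x. \<Sum>k\<in>I. P k x)"
  by (induction I rule: infinite_finite_induct) (auto intro: tame_const tame_add)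

lemma tame_real_polynomial_function: "real_polynomial_function P \<Longrightarrow> tame P"
  by (induction rule: real_polynomial_function.induct) (auto intro: tame_linear tame_const tame_add tame_mult)

section \<open>Concavity under small perturbations\<close>

lemma convex_on_norm_power: "convex_on UNIV (\<lambda>x::'a::euclidean_space. norm x ^ k)"
proof (rule convex_onI)
  fix u :: real and x y :: 'a assume u: "0 < u" "u < 1"
  have "norm ((1 - u) *\<^sub>R x + u *\<^sub>R y) \<le> (1 - u) * norm x + u * norm y"
    using u norm_triangle_ineq[of "(1 - u) *\<^sub>R x" "u *\<^sub>R y"] by simp
  then have "norm ((1 - u) *\<^sub>R x + u *\<^sub>R y) ^ k \<le> ((1 - u) * norm x + u * norm y) ^ k"
    by (intro power_mono) auto
  also have "\<dots> \<le> (1 - u) * norm x ^ k + u * norm y ^ k"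
  proof (induction k)
    case (Suc k)
    let ?a = "norm x" and ?b = "norm y" and ?c = "(1 - u) * norm x + u * norm y"
    \<comment> \<open>Used with \<open>p\<close>, \<open>q\<close> the powers \<open>a ^ k\<close>,
      \<open>b ^ k\<close>: the last product is then nonnegative for nonnegative \<open>a\<close>,
      \<open>b\<close>, and dropping it gives the step.\<close>
    have id: "((1 - u) * a + u * b) * ((1 - u) * p + u * q) = (1 - u) * (a * p) + u * (b * q) - u * (1 - u) * ((a - b) * (p - q))"
      for a b p q :: real by (simp add: algebra_simps)
    have "?c ^ Suc k \<le> ?c * ((1 - u) * ?a ^ k + u * ?b ^ k)"
      using Suc u by (simp add: mult_left_mono)
    also have "\<dots> = (1 - u) * ?a ^ Suc k + u * ?b ^ Suc k - u * (1 - u) * ((?a - ?b) * (?a ^ k - ?b ^ k))"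
      unfolding id power_Suc ..
    also have "\<dots> \<le> (1 - u) * ?a ^ Suc k + u * ?b ^ Suc k"
    proof -
      have "0 \<le> (?a - ?b) * (?a ^ k - ?b ^ k)"
      proof (cases "?a \<le> ?b")
        case True
        then have "?a ^ k \<le> ?b ^ k" by (intro power_mono) auto
        then show ?thesis using True by (intro mult_nonpos_nonpos) auto
      next
        case False
        then have "?b ^ k \<le> ?a ^ k" by (intro power_mono) auto
        then show ?thesis using False by (intro mult_nonneg_nonneg) auto
      qed
      then show ?thesis using u by simp
    qed
    finally show ?case .
  qed simp
  finally show "norm ((1 - u) *\<^sub>R x + u *\<^sub>R y) ^ k \<le> (1 - u) * norm x ^ k + u * norm y ^ k" .
qed simp

text \<open>\<open>A * (norm z)\<^sup>2\<close> has chord deviation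
  \<open>A * (u * (1 - u) * (norm (x - y))\<^sup>2)\<close>, that of \<open>\<eta> * \<psi>\<close>
  is at most \<open>\<eta> * C\<close> times the same quantity, and
  \<open>\<eta> \<le> A / (C + 1)\<close> lets the first dominate. This is the purpose of the
  quadratic term in the profile.\<close>

lemma concave_on_perturbation:
  fixes \<psi> :: "'a::euclidean_space \<Rightarrow> real"
  assumes "tame \<psi>" "A > 0" "M \<ge> 0"
  obtains \<eta>0 where "\<eta>0 > 0"
    "\<And>\<eta>. 0 \<le> \<eta> \<Longrightarrow> \<eta> \<le> \<eta>0 \<Longrightarrow> concave_on (cball 0 1) (\<lambda>z. 1 - M * norm z ^ k - A * (norm z)\<^sup>2 + \<eta> * \<psi> z)"
proof -
  obtain C where C: "C \<ge> 0" "\<And>x. norm x \<le> 1 \<Longrightarrow> \<bar>\<psi> x\<bar> \<le> C"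
    "\<And>x y. norm x \<le> 1 \<Longrightarrow> norm y \<le> 1 \<Longrightarrow> \<bar>\<psi> x - \<psi> y\<bar> \<le> C * norm (x - y)"
    "\<And>x y u. norm x \<le> 1 \<Longrightarrow> norm y \<le> 1 \<Longrightarrow> 0 \<le> u \<Longrightarrow> u \<le> 1 \<Longrightarrow> \<bar>chord_deviation \<psi> x y u\<bar> \<le> C * (u * (1 - u) * (norm (x - y))\<^sup>2)"
    using tameE[OF assms(1)] by blast
  have "concave_on (cball 0 1) (\<lambda>z. 1 - M * norm z ^ k - A * (norm z)\<^sup>2 + \<eta> * \<psi> z)"
    if \<eta>: "0 \<le> \<eta>" "\<eta> \<le> A / (C + 1)" for \<eta>
    unfolding concave_on_def
  proof (rule convex_onI)
    fix u :: real and x y :: 'a assume *: "0 < u" "u < 1" "x \<in> cball 0 1" "y \<in> cball 0 1"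
    let ?m = "(1 - u) *\<^sub>R x + u *\<^sub>R y" and ?w = "u * (1 - u) * (norm (x - y))\<^sup>2"
    have w: "?w \<ge> 0" using * by simp
    have "\<eta> * C \<le> A"
    proof -
      have "\<eta> * C \<le> A / (C + 1) * (C + 1)" using \<eta> C(1) by (intro mult_mono) auto
      then show ?thesis using C(1) by simp
    qed
    have "\<eta> * chord_deviation \<psi> x y u \<le> \<eta> * (C * ?w)"
      using C(4)[of x y u] * \<eta> by (intro mult_left_mono) auto
    also have "\<dots> \<le> A * ?w" using mult_right_mono[OF \<open>\<eta> * C \<le> A\<close> w] by (simp add: mult.assoc)
    finally have 1: "\<eta> * chord_deviation \<psi> x y u \<le> A * ((1 - u) * (norm x)\<^sup>2 + u * (norm y)\<^sup>2 - (norm ?m)\<^sup>2)"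
      unfolding norm2_chord .
    have "norm ?m ^ k \<le> (1 - u) * norm x ^ k + u * norm y ^ k"
      using * by (intro convex_onD[OF convex_on_norm_power]) auto
    then have 2: "M * norm ?m ^ k \<le> M * ((1 - u) * norm x ^ k + u * norm y ^ k)"
      using assms(3) by (rule mult_left_mono)
    show "- (1 - M * norm ?m ^ k - A * (norm ?m)\<^sup>2 + \<eta> * \<psi> ?m)
       \<le> (1 - u) * - (1 - M * norm x ^ k - A * (norm x)\<^sup>2 + \<eta> * \<psi> x) + u * - (1 - M * norm y ^ k - A * (norm y)\<^sup>2 + \<eta> * \<psi> y)"
      using 1 2 unfolding chord_deviation_def by (simp add: algebra_simps)
  qed simp
  moreover have "A / (C + 1) > 0" using assms(2) C(1) by simp
  ultimately show ?thesis using that by blast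
qed

section \<open>Integration in projective coordinates\<close>

lemma nn_integral_chart:
  fixes e :: "'a::euclidean_space"
  assumes e: "e \<noteq> 0" and \<rho>: "\<rho> > 0" and [measurable]: "F \<in> borel_measurable borel"
  defines "S \<equiv> hyperplane_perp e"
  shows "(\<integral>\<^sup>+x. F x \<partial>lborel) = ennreal (norm e * \<rho> ^ dim S) *
     (\<integral>\<^sup>+t. (\<integral>\<^sup>+z. ennreal (\<bar>t\<bar> ^ dim S) * F (t *\<^sub>R (e + \<rho> *\<^sub>R z)) \<partial>subspace_lborel S) \<partial>lborel)"
proof -
  define e1 where "e1 = e /\<^sub>R norm e"
  have e1: "norm e1 = 1" "hyperplane_perp e1 = S" using e by (auto simp: e1_def S_def hyperplane_perp_scaleR)
  have S: "subspace S" by (simp add: S_def)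
  interpret sigma_finite_measure "subspace_lborel S" by (rule sigma_finite_subspace_lborel[OF S])
  define G where "G s = (\<integral>\<^sup>+x. F (x + s *\<^sub>R e1) \<partial>subspace_lborel S)" for s
  have [measurable]: "G \<in> borel_measurable borel" unfolding G_def by measurable
  have "(\<integral>\<^sup>+x. F x \<partial>lborel) = (\<integral>\<^sup>+s. G s \<partial>lborel)"
    unfolding G_def e1(2)[symmetric] by (rule nn_integral_lborel_split[OF e1(1)]) measurable
  also have "\<dots> = ennreal (norm e) * (\<integral>\<^sup>+t. G (norm e * t) \<partial>lborel)"
    using nn_integral_real_affine[of G "norm e" 0] e by simp
  also have "(\<integral>\<^sup>+t. G (norm e * t) \<partial>lborel)
     = (\<integral>\<^sup>+t. ennreal (\<rho> ^ dim S) * (\<integral>\<^sup>+z. ennreal (\<bar>t\<bar> ^ dim S) * F (t *\<^sub>R (e + \<rho> *\<^sub>R z)) \<partial>subspace_lborel S) \<partial>lborel)"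
  proof (rule nn_integral_cong_AE, use AE_lborel_singleton[of "0::real"] in eventually_elim)
    case (elim t)
    have "(norm e * t) *\<^sub>R e1 = t *\<^sub>R e" using e by (simp add: e1_def)
    then have "G (norm e * t) = (\<integral>\<^sup>+x. F (x + t *\<^sub>R e) \<partial>subspace_lborel S)" by (simp add: G_def)
    also have "\<dots> = ennreal (\<bar>\<rho> * t\<bar> ^ dim S) * (\<integral>\<^sup>+z. F ((\<rho> * t) *\<^sub>R z + t *\<^sub>R e) \<partial>subspace_lborel S)"
      using elim \<rho> by (intro nn_integral_subspace_scale[OF S]) auto
    also have "\<dots> = ennreal (\<rho> ^ dim S) * (ennreal (\<bar>t\<bar> ^ dim S) * (\<integral>\<^sup>+z. F (t *\<^sub>R (e + \<rho> *\<^sub>R z)) \<partial>subspace_lborel S))"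
      using \<rho> by (simp add: abs_mult power_mult_distrib ennreal_mult mult.assoc algebra_simps)
    also have "ennreal (\<bar>t\<bar> ^ dim S) * (\<integral>\<^sup>+z. F (t *\<^sub>R (e + \<rho> *\<^sub>R z)) \<partial>subspace_lborel S)
       = (\<integral>\<^sup>+z. ennreal (\<bar>t\<bar> ^ dim S) * F (t *\<^sub>R (e + \<rho> *\<^sub>R z)) \<partial>subspace_lborel S)"
      by (rule nn_integral_cmult[symmetric]) measurable
    finally show ?case .
  qed
  also have "\<dots> = ennreal (\<rho> ^ dim S) * (\<integral>\<^sup>+t. (\<integral>\<^sup>+z. ennreal (\<bar>t\<bar> ^ dim S) * F (t *\<^sub>R (e + \<rho> *\<^sub>R z)) \<partial>subspace_lborel S) \<partial>lborel)"
    by (rule nn_integral_cmult) measurable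
  finally show ?thesis using \<rho> by (simp add: ennreal_mult mult.assoc)
qed

text \<open>In the chart a hyperplane through the origin other than the one orthogonal to
  \<open>e\<close> becomes the affine hyperplane of \<open>S\<close> at height \<open>p\<close> in
  direction \<open>u\<close>. The power of \<open>t\<close> is one lower than for the whole space,
  and \<open>c\<close> depends on the hyperplane but not on the integrand.\<close>

lemma nn_integral_section_chart:
  fixes e \<xi> :: "'a::euclidean_space"
  assumes e: "e \<noteq> 0" and \<rho>: "\<rho> > 0" and \<xi>: "perp_part e \<xi> \<noteq> 0"
  defines "S \<equiv> hyperplane_perp e"
  obtains u p c where "u \<in> S" "norm u = 1"
    "\<And>F. F \<in> borel_measurable borel \<Longrightarrow> (\<integral>\<^sup>+x. F x \<partial>subspace_lborel (hyperplane_perp \<xi>)) = ennreal c *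
     (\<integral>\<^sup>+t. (\<integral>\<^sup>+v. ennreal (\<bar>t\<bar> ^ dim (S \<inter> hyperplane_perp u)) * F (t *\<^sub>R (e + \<rho> *\<^sub>R (v + p *\<^sub>R u))) \<partial>subspace_lborel (S \<inter> hyperplane_perp u)) \<partial>lborel)"
proof -
  define w where "w = perp_part e \<xi>"
  define u where "u = w /\<^sub>R norm w"
  define \<alpha> where "\<alpha> = axis_coord e \<xi>"
  have w0: "norm w > 0" using \<xi> by (simp add: w_def)
  have S: "subspace S" by (simp add: S_def)
  have "w \<in> S" unfolding w_def S_def by (rule perp_part_in[OF e])
  then have u: "u \<in> S" "norm u = 1" using w0 S by (auto simp: u_def subspace_scale)
  have \<xi>eq: "\<xi> = \<alpha> *\<^sub>R e + norm w *\<^sub>R u"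
    using w0 by (simp add: u_def \<alpha>_def w_def perp_part_axis)
  have eu: "e \<bullet> u = 0" using u(1) by (simp add: S_def hyperplane_perp_def)
  have uu: "u \<bullet> u = 1" using u(2) by (simp add: norm_eq_1)
  \<comment> \<open>Makes \<open>q\<close> the vector of the hyperplane in the span of
    \<open>e\<close> and \<open>u\<close> with \<open>e\<close>-coordinate 1. Together with
    \<open>V\<close>, of codimension one, it spans the hyperplane, and
    \<open>p = b / \<rho>\<close>.\<close>
  define b where "b = - \<alpha> * (e \<bullet> e) / norm w"
  define q where "q = e + b *\<^sub>R u"
  have ep: "e \<bullet> e > 0" using e by simp
  have q\<xi>: "\<xi> \<bullet> q = 0"
  proof -
    have "\<xi> \<bullet> q = \<alpha> * (e \<bullet> e) + norm w * b"
      unfolding \<xi>eq q_def using eu uu by (simp add: inner_add_left inner_add_right inner_commute[of u e])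
    then show ?thesis using w0 by (simp add: b_def)
  qed
  have "e \<bullet> q = e \<bullet> e" by (simp add: q_def inner_add_right eu)
  then have q0: "q \<noteq> 0" using ep by auto
  define q1 where "q1 = q /\<^sub>R norm q"
  have q1: "norm q1 = 1" "q1 \<in> hyperplane_perp \<xi>" "hyperplane_perp q1 = hyperplane_perp q"
    using q0 q\<xi> by (auto simp: q1_def hyperplane_perp_scaleR) (simp add: hyperplane_perp_def)
  define V where "V = S \<inter> hyperplane_perp u"
  have VV: "hyperplane_perp \<xi> \<inter> hyperplane_perp q1 = V"
  proof -
    have "x \<in> hyperplane_perp \<xi> \<inter> hyperplane_perp q \<longleftrightarrow> x \<in> V" for x
    proof
      assume "x \<in> V"
      then show "x \<in> hyperplane_perp \<xi> \<inter> hyperplane_perp q"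
        by (simp add: V_def S_def hyperplane_perp_def \<xi>eq q_def inner_add_left)
    next
      assume "x \<in> hyperplane_perp \<xi> \<inter> hyperplane_perp q"
      then have 1: "\<alpha> * (e \<bullet> x) + norm w * (u \<bullet> x) = 0" and 2: "e \<bullet> x = - b * (u \<bullet> x)"
        by (simp_all add: hyperplane_perp_def \<xi>eq q_def inner_add_left)
      have "(norm w - \<alpha> * b) * (u \<bullet> x) = 0" using 1 unfolding 2 by (simp add: algebra_simps)
      moreover have "norm w - \<alpha> * b > 0"
      proof -
        have "- (\<alpha> * b) = \<alpha>\<^sup>2 * (e \<bullet> e) / norm w" by (simp add: b_def power2_eq_square)
        moreover have "\<alpha>\<^sup>2 * (e \<bullet> e) / norm w \<ge> 0" using w0 by simp
        ultimately show ?thesis using w0 by linarith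
      qed
      ultimately have "u \<bullet> x = 0" by simp
      then show "x \<in> V" using 2 by (simp add: V_def S_def hyperplane_perp_def)
    qed
    then show ?thesis unfolding q1(3) by blast
  qed
  have V: "subspace V" unfolding V_def by (rule subspace_inter[OF S subspace_hyperplane_perp])
  interpret sigma_finite_measure "subspace_lborel V" by (rule sigma_finite_subspace_lborel[OF V])
  define c where "c = norm q * \<rho> ^ dim V"
  define p where "p = b / \<rho>"
  show ?thesis
  proof (rule that[of u c p, folded V_def])
    fix F :: "'a \<Rightarrow> ennreal" assume [measurable]: "F \<in> borel_measurable borel"
    define G where "G s = (\<integral>\<^sup>+x. F (x + s *\<^sub>R q1) \<partial>subspace_lborel V)" for s
    have [measurable]: "G \<in> borel_measurable borel" unfolding G_def by measurable
    have "(\<integral>\<^sup>+x. F x \<partial>subspace_lborel (hyperplane_perp \<xi>)) = (\<integral>\<^sup>+s. G s \<partial>lborel)"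
      unfolding G_def VV[symmetric] by (rule nn_integral_subspace_split[OF subspace_hyperplane_perp q1(2,1)]) measurable
    also have "\<dots> = ennreal (norm q) * (\<integral>\<^sup>+t. G (norm q * t) \<partial>lborel)"
      using nn_integral_real_affine[of G "norm q" 0] q0 by simp
    also have "(\<integral>\<^sup>+t. G (norm q * t) \<partial>lborel)
       = (\<integral>\<^sup>+t. ennreal (\<rho> ^ dim V) * (\<integral>\<^sup>+v. ennreal (\<bar>t\<bar> ^ dim V) * F (t *\<^sub>R (e + \<rho> *\<^sub>R (v + p *\<^sub>R u))) \<partial>subspace_lborel V) \<partial>lborel)"
    proof (rule nn_integral_cong_AE, use AE_lborel_singleton[of "0::real"] in eventually_elim)
      case (elim t)
      have "(norm q * t) *\<^sub>R q1 = t *\<^sub>R q" using q0 by (simp add: q1_def)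
      then have "G (norm q * t) = (\<integral>\<^sup>+x. F (x + t *\<^sub>R q) \<partial>subspace_lborel V)" by (simp add: G_def)
      also have "\<dots> = ennreal (\<bar>\<rho> * t\<bar> ^ dim V) * (\<integral>\<^sup>+v. F ((\<rho> * t) *\<^sub>R v + t *\<^sub>R q) \<partial>subspace_lborel V)"
        using elim \<rho> by (intro nn_integral_subspace_scale[OF V]) auto
      also have "\<dots> = ennreal (\<rho> ^ dim V) * (ennreal (\<bar>t\<bar> ^ dim V) * (\<integral>\<^sup>+v. F (t *\<^sub>R (e + \<rho> *\<^sub>R (v + p *\<^sub>R u))) \<partial>subspace_lborel V))"
      proof -
        have "(\<rho> * t) *\<^sub>R v + t *\<^sub>R q = t *\<^sub>R (e + \<rho> *\<^sub>R (v + p *\<^sub>R u))" for v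
          using \<rho> by (simp add: q_def p_def algebra_simps)
        then show ?thesis using \<rho> by (simp add: abs_mult power_mult_distrib ennreal_mult mult.assoc)
      qed
      also have "ennreal (\<bar>t\<bar> ^ dim V) * (\<integral>\<^sup>+v. F (t *\<^sub>R (e + \<rho> *\<^sub>R (v + p *\<^sub>R u))) \<partial>subspace_lborel V)
         = (\<integral>\<^sup>+v. ennreal (\<bar>t\<bar> ^ dim V) * F (t *\<^sub>R (e + \<rho> *\<^sub>R (v + p *\<^sub>R u))) \<partial>subspace_lborel V)"
        by (rule nn_integral_cmult[symmetric]) measurable
      finally show ?case .
    qed
    also have "\<dots> = ennreal (\<rho> ^ dim V) * (\<integral>\<^sup>+t. (\<integral>\<^sup>+v. ennreal (\<bar>t\<bar> ^ dim V) * F (t *\<^sub>R (e + \<rho> *\<^sub>R (v + p *\<^sub>R u))) \<partial>subspace_lborel V) \<partial>lborel)"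
      by (rule nn_integral_cmult) measurable
    finally show "(\<integral>\<^sup>+x. F x \<partial>subspace_lborel (hyperplane_perp \<xi>)) = ennreal c *
       (\<integral>\<^sup>+t. (\<integral>\<^sup>+v. ennreal (\<bar>t\<bar> ^ dim V) * F (t *\<^sub>R (e + \<rho> *\<^sub>R (v + p *\<^sub>R u))) \<partial>subspace_lborel V) \<partial>lborel)"
      using \<rho> by (simp add: c_def ennreal_mult mult.assoc)
  qed (use u in auto)
qed

section \<open>The counterexample in high dimension\<close>

text \<open>For \<open>\<beta> < \<alpha>\<close> the band is empty and \<open>ennreal\<close> sends
  the negative length to 0, so one formula serves whichever of the two radial functions is
  larger.\<close>

lemma emeasure_symmetric_band:
  fixes \<alpha> \<beta> :: real
  assumes "\<alpha> > 0"
  shows "emeasure lborel {s. \<alpha> < \<bar>s\<bar> \<and> \<bar>s\<bar> \<le> \<beta>} = ennreal (2 * (\<beta> - \<alpha>))"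
proof (cases "\<alpha> \<le> \<beta>")
  case True
  have eq: "{s. \<alpha> < \<bar>s\<bar> \<and> \<bar>s\<bar> \<le> \<beta>} = {\<alpha><..\<beta>} \<union> {-\<beta>..<-\<alpha>}" using assms by auto
  have "{\<alpha><..\<beta>} \<inter> {-\<beta>..<-\<alpha>} = {}" using assms by auto
  then have "emeasure lborel ({\<alpha><..\<beta>} \<union> {-\<beta>..<-\<alpha>}) = emeasure lborel {\<alpha><..\<beta>} + emeasure lborel {-\<beta>..<-\<alpha>}"
    by (intro plus_emeasure[symmetric]) auto
  also have "\<dots> = ennreal (2 * (\<beta> - \<alpha>))"
    using True by (simp add: ennreal_plus[symmetric] del: ennreal_plus)
  finally show ?thesis unfolding eq .
next
  case False
  then have eq: "{s. \<alpha> < \<bar>s\<bar> \<and> \<bar>s\<bar> \<le> \<beta>} = {}" by auto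
  show ?thesis unfolding eq using False by (simp add: ennreal_neg)
qed

lemma nn_integral_band_le:
  fixes \<alpha> \<beta> hi :: real
  assumes "\<alpha> > 0" "hi \<ge> 0" "\<And>s. \<alpha> \<le> s \<Longrightarrow> s \<le> \<beta> \<Longrightarrow> \<phi> s \<le> hi"
  shows "(\<integral>\<^sup>+s. ennreal (\<phi> \<bar>s\<bar>) * indicator {s. \<alpha> < \<bar>s\<bar> \<and> \<bar>s\<bar> \<le> \<beta>} s \<partial>lborel) \<le> ennreal (2 * (\<beta> - \<alpha>) * hi)"
proof -
  have "(\<integral>\<^sup>+s. ennreal (\<phi> \<bar>s\<bar>) * indicator {s. \<alpha> < \<bar>s\<bar> \<and> \<bar>s\<bar> \<le> \<beta>} s \<partial>lborel)
     \<le> (\<integral>\<^sup>+s. ennreal hi * indicator {s. \<alpha> < \<bar>s\<bar> \<and> \<bar>s\<bar> \<le> \<beta>} s \<partial>lborel)"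
    using assms by (intro nn_integral_mono) (auto simp: indicator_def intro!: ennreal_leI)
  also have "\<dots> = ennreal hi * emeasure lborel {s. \<alpha> < \<bar>s\<bar> \<and> \<bar>s\<bar> \<le> \<beta>}"
    by (rule nn_integral_cmult_indicator) measurable
  also have "\<dots> = ennreal (2 * (\<beta> - \<alpha>) * hi)"
    unfolding emeasure_symmetric_band[OF assms(1)] using assms(2) by (simp add: ennreal_mult' mult.commute)
  finally show ?thesis .
qed

lemma nn_integral_band_ge:
  fixes \<alpha> \<beta> lo :: real
  assumes "\<alpha> > 0" "lo \<ge> 0" "\<And>s. \<alpha> \<le> s \<Longrightarrow> s \<le> \<beta> \<Longrightarrow> lo \<le> \<phi> s"
  shows "ennreal (2 * (\<beta> - \<alpha>) * lo) \<le> (\<integral>\<^sup>+s. ennreal (\<phi> \<bar>s\<bar>) * indicator {s. \<alpha> < \<bar>s\<bar> \<and> \<bar>s\<bar> \<le> \<beta>} s \<partial>lborel)"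
proof -
  have "ennreal (2 * (\<beta> - \<alpha>) * lo) = ennreal lo * emeasure lborel {s. \<alpha> < \<bar>s\<bar> \<and> \<bar>s\<bar> \<le> \<beta>}"
    unfolding emeasure_symmetric_band[OF assms(1)] using assms(2) by (simp add: ennreal_mult' mult.commute)
  also have "\<dots> = (\<integral>\<^sup>+s. ennreal lo * indicator {s. \<alpha> < \<bar>s\<bar> \<and> \<bar>s\<bar> \<le> \<beta>} s \<partial>lborel)"
    by (rule nn_integral_cmult_indicator[symmetric]) measurable
  also have "\<dots> \<le> (\<integral>\<^sup>+s. ennreal (\<phi> \<bar>s\<bar>) * indicator {s. \<alpha> < \<bar>s\<bar> \<and> \<bar>s\<bar> \<le> \<beta>} s \<partial>lborel)"
    using assms by (intro nn_integral_mono) (auto simp: indicator_def intro!: ennreal_leI)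
  finally show ?thesis .
qed

text \<open>To first order in \<open>\<eta>\<close>, passing from \<open>T\<close> to
  \<open>\<tau>\<close> changes a section by the integral of \<open>g\<close> over an affine
  hyperplane, since \<open>w\<close> nearly cancels the density \<open>F0\<close>. It changes the
  measure by the integral of \<open>T * g\<close>, the extra \<open>T\<close> stemming from the
  extra power of the radius. The actual changes differ from these by factors between
  \<open>(1 - \<kappa>) ^ 3\<close> and \<open>(1 + \<kappa>) ^ 3\<close>, a quotient that
  \<open>\<theta>\<close> covers.\<close>

lemma lobe_pair_comparison:
  fixes e :: "'a::euclidean_space" and f g T \<tau> F0 w :: "'a \<Rightarrow> real"
  defines "S \<equiv> hyperplane_perp e"
  assumes KT: "lobe e \<rho> b \<beta>1 T" and LT: "lobe e \<rho> b \<beta>2 \<tau>" and dimS: "dim S = Suc d"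
    and f [measurable]: "f \<in> borel_measurable borel" and f0: "\<And>x. f x \<ge> 0" and feven: "\<And>x. f (- x) = f x"
    and ffin: "\<And>R. \<exists>M. \<forall>x. norm x \<le> R \<longrightarrow> f x \<le> M"
    and \<kappa>: "0 < \<kappa>" "\<kappa> < 1" and \<eta>: "\<eta> > 0"
    and gm [measurable]: "g \<in> borel_measurable borel" and Tm [measurable]: "T \<in> borel_measurable borel"
    and g0: "\<And>z. norm z \<ge> 1 \<Longrightarrow> g z = 0"
    and F0: "\<And>z. z \<in> S \<Longrightarrow> norm z < 1 \<Longrightarrow> F0 z > 0"
    and \<tau>: "\<And>z. z \<in> S \<Longrightarrow> norm z < 1 \<Longrightarrow> \<tau> z - T z = \<eta> * w z * g z"
    and w: "\<And>z. z \<in> S \<Longrightarrow> norm z < 1 \<Longrightarrow> 1 - \<kappa> \<le> w z * F0 z \<and> w z * F0 z \<le> 1 + \<kappa>"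
    and close: "\<And>z s. z \<in> S \<Longrightarrow> norm z < 1 \<Longrightarrow> min (T z) (\<tau> z) \<le> s \<Longrightarrow> s \<le> max (T z) (\<tau> z) \<Longrightarrow>
        (1 - \<kappa>) * F0 z \<le> s ^ d * f (s *\<^sub>R (e + \<rho> *\<^sub>R z)) \<and> s ^ d * f (s *\<^sub>R (e + \<rho> *\<^sub>R z)) \<le> (1 + \<kappa>) * F0 z \<and>
        (1 - \<kappa>) * T z \<le> s \<and> s \<le> (1 + \<kappa>) * T z"
    and \<theta>: "\<theta> > 1" "(1 + \<kappa>) ^ 3 \<le> \<theta> * (1 - \<kappa>) ^ 3"
    and R: "\<And>u p. u \<in> S \<Longrightarrow> norm u = 1 \<Longrightarrow>
        ennreal \<theta> * (\<integral>\<^sup>+v. ennreal (- g (v + p *\<^sub>R u)) \<partial>subspace_lborel (S \<inter> hyperplane_perp u))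
          \<le> (\<integral>\<^sup>+v. ennreal (g (v + p *\<^sub>R u)) \<partial>subspace_lborel (S \<inter> hyperplane_perp u))"
    and M: "ennreal \<theta> * (\<integral>\<^sup>+z. ennreal (T z * g z) \<partial>subspace_lborel S)
       < (\<integral>\<^sup>+z. ennreal (- (T z * g z)) \<partial>subspace_lborel S)"
  shows "sections_le f (lobe_body e \<rho> b T) (lobe_body e \<rho> b \<tau>)"
    and "emeasure (body_measure f) (lobe_body e \<rho> b \<tau>) < emeasure (body_measure f) (lobe_body e \<rho> b T)"
proof -
  define K where "K = lobe_body e \<rho> b T"
  define L where "L = lobe_body e \<rho> b \<tau>"
  interpret K: lobe e \<rho> b \<beta>1 T by (rule KT)
  interpret L: lobe e \<rho> b \<beta>2 \<tau> by (rule LT)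
  note e = K.e and \<rho> = K.\<rho> and b = K.b
  have S: "subspace S" by (simp add: S_def)
  have cK: "convex_body K" "convex_body L" unfolding K_def L_def by (rule K.convex_body_lobe_body L.convex_body_lobe_body)+
  have [measurable]: "K \<in> sets borel" "L \<in> sets borel" using cK by (auto simp: convex_body_borel)
  define pt where "pt s z = s *\<^sub>R (e + \<rho> *\<^sub>R z)" for s z
  have [measurable]: "(\<lambda>s. pt s z) \<in> borel_measurable borel" "(\<lambda>(s, z). pt s z) \<in> borel_measurable (borel \<Otimes>\<^sub>M borel)" for z
    unfolding pt_def by measurable
  have inL: "pt s z \<in> L - K \<longleftrightarrow> norm z < 1 \<and> T z < \<bar>s\<bar> \<and> \<bar>s\<bar> \<le> \<tau> z"
    and inK: "pt s z \<in> K - L \<longleftrightarrow> norm z < 1 \<and> \<tau> z < \<bar>s\<bar> \<and> \<bar>s\<bar> \<le> T z" if "z \<in> S" "s \<noteq> 0" for s z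
    using K.lobe_body_iff[of z s] L.lobe_body_iff[of z s] that unfolding K_def L_def pt_def S_def by auto
  \<comment> \<open>The radial integral above \<open>z\<close>: exponent \<open>k = d\<close>
    belongs to sections, \<open>k = Suc d\<close> to the measure of the body.\<close>
  define H where "H X k z = (\<integral>\<^sup>+s. ennreal (\<bar>s\<bar> ^ k) * (ennreal (f (pt s z)) * indicator X (pt s z)) \<partial>lborel)" for X k z
  have fabs: "f (pt s z) = f (pt \<bar>s\<bar> z)" for s z
    using feven[of "pt s z"] by (cases "s \<ge> 0") (auto simp: pt_def)
  have H_eq: "H X k z = (\<integral>\<^sup>+s. ennreal ((\<lambda>s. s ^ k * f (pt s z)) \<bar>s\<bar>) * indicator {s. \<alpha> < \<bar>s\<bar> \<and> \<bar>s\<bar> \<le> \<beta>} s \<partial>lborel)"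
    if "\<And>s. s \<noteq> 0 \<Longrightarrow> pt s z \<in> X \<longleftrightarrow> \<alpha> < \<bar>s\<bar> \<and> \<bar>s\<bar> \<le> \<beta>" for X k z \<alpha> \<beta>
    unfolding H_def
  proof (rule nn_integral_cong_AE, use AE_lborel_singleton[of "0::real"] in eventually_elim)
    case (elim s)
    then show ?case using that[OF elim] f0 by (auto simp: indicator_def ennreal_mult fabs[symmetric])
  qed
  have HL: "H (L - K) k z = (\<integral>\<^sup>+s. ennreal ((\<lambda>s. s ^ k * f (pt s z)) \<bar>s\<bar>) * indicator {s. T z < \<bar>s\<bar> \<and> \<bar>s\<bar> \<le> \<tau> z} s \<partial>lborel)"
    if "z \<in> S" "norm z < 1" for k z
    by (rule H_eq) (use inL that in blast)
  have HK: "H (K - L) k z = (\<integral>\<^sup>+s. ennreal ((\<lambda>s. s ^ k * f (pt s z)) \<bar>s\<bar>) * indicator {s. \<tau> z < \<bar>s\<bar> \<and> \<bar>s\<bar> \<le> T z} s \<partial>lborel)"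
    if "z \<in> S" "norm z < 1" for k z
    by (rule H_eq) (use inK that in blast)
  have H_out: "H (L - K) k z = 0" "H (K - L) k z = 0" if "z \<in> S" "norm z \<ge> 1" for k z
  proof -
    have "H X k z = (\<integral>\<^sup>+s. 0 \<partial>(lborel::real measure))" if "\<And>s. s \<noteq> 0 \<Longrightarrow> pt s z \<notin> X" for X
      unfolding H_def
    proof (rule nn_integral_cong_AE, use AE_lborel_singleton[of "0::real"] in eventually_elim)
      case (elim s)
      then show ?case using that[OF elim] by simp
    qed
    then show "H (L - K) k z = 0" "H (K - L) k z = 0"
      using inL[OF \<open>z \<in> S\<close>] inK[OF \<open>z \<in> S\<close>] \<open>norm z \<ge> 1\<close> by auto
  qed
  have wpos: "w z > 0" if "z \<in> S" "norm z < 1" for z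
  proof -
    have "w z * F0 z > 0" using w[OF that] \<kappa> by linarith
    then show ?thesis using F0[OF that] by (simp add: zero_less_mult_iff)
  qed
  have Tpos: "T z > 0" "\<tau> z > 0" if "norm z < 1" for z using K.pos[of z] L.pos[of z] that by auto

  \<comment> \<open>\<open>C1\<close> and \<open>C2\<close> bound the gain of a section from below
    and its loss from above; \<open>C3\<close> and \<open>C4\<close> do the reverse for the whole
    body. Weight and density cost a factor each, and for the body the radius costs a third.\<close>
  have C1: "ennreal (2 * \<eta> * (1 - \<kappa>)\<^sup>2) * ennreal (g z) \<le> H (L - K) d z" if z: "z \<in> S" for z
  proof (cases "g z > 0")
    case True
    then have n: "norm z < 1" using g0[of z] by (cases "norm z < 1") auto
    have lt: "T z < \<tau> z" using \<tau>[OF z n] \<eta> wpos[OF z n] True by (smt (verit) mult_pos_pos)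
    have "2 * \<eta> * (1 - \<kappa>)\<^sup>2 * g z = 2 * (\<eta> * g z) * ((1 - \<kappa>) * (1 - \<kappa>))" by (simp add: power2_eq_square)
    also have "\<dots> \<le> 2 * (\<eta> * g z) * ((w z * F0 z) * (1 - \<kappa>))"
      using w[OF z n] \<kappa> \<eta> True by (intro mult_left_mono mult_right_mono) auto
    also have "\<dots> = 2 * (\<tau> z - T z) * ((1 - \<kappa>) * F0 z)" unfolding \<tau>[OF z n] by (simp add: ac_simps)
    finally have "ennreal (2 * \<eta> * (1 - \<kappa>)\<^sup>2) * ennreal (g z) \<le> ennreal (2 * (\<tau> z - T z) * ((1 - \<kappa>) * F0 z))"
      using \<eta> True by (subst ennreal_mult[symmetric]) (auto intro!: ennreal_leI)
    also have "\<dots> \<le> H (L - K) d z"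
      unfolding HL[OF z n]
      using close[OF z n] lt Tpos[OF n] F0[OF z n] \<kappa> by (intro nn_integral_band_ge) (auto simp: pt_def)
    finally show ?thesis .
  qed (simp add: ennreal_neg)
  have C2: "H (K - L) d z \<le> ennreal (2 * \<eta> * (1 + \<kappa>)\<^sup>2) * ennreal (- g z)" if z: "z \<in> S" for z
  proof (cases "norm z < 1")
    case n: True
    have "H (K - L) d z \<le> ennreal (2 * (T z - \<tau> z) * ((1 + \<kappa>) * F0 z))"
      unfolding HK[OF z n]
      using close[OF z n] Tpos[OF n] F0[OF z n] \<kappa> by (intro nn_integral_band_le) (auto simp: pt_def)
    also have "\<dots> \<le> ennreal (2 * \<eta> * (1 + \<kappa>)\<^sup>2 * (- g z))"
    proof (cases "g z \<le> 0")
      case True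
      have "2 * (T z - \<tau> z) * ((1 + \<kappa>) * F0 z) = 2 * (\<eta> * (- g z)) * ((w z * F0 z) * (1 + \<kappa>))"
        using \<tau>[OF z n] by (simp add: algebra_simps)
      also have "\<dots> \<le> 2 * (\<eta> * (- g z)) * ((1 + \<kappa>) * (1 + \<kappa>))"
        using w[OF z n] \<kappa> \<eta> True by (intro mult_left_mono mult_right_mono mult_nonneg_nonneg) auto
      also have "\<dots> = 2 * \<eta> * (1 + \<kappa>)\<^sup>2 * (- g z)" by (simp add: power2_eq_square)
      finally show ?thesis by (rule ennreal_leI)
    next
      case False
      then have "\<tau> z - T z \<ge> 0" using \<tau>[OF z n] \<eta> wpos[OF z n] by simp
      moreover have "(1 + \<kappa>) * F0 z \<ge> 0" using F0[OF z n] \<kappa> by simp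
      ultimately have "2 * (T z - \<tau> z) * ((1 + \<kappa>) * F0 z) \<le> 0"
        by (intro mult_nonpos_nonneg[of "2 * (T z - \<tau> z)"]) simp_all
      then show ?thesis by (subst ennreal_neg) simp_all
    qed
    also have "\<dots> = ennreal (2 * \<eta> * (1 + \<kappa>)\<^sup>2) * ennreal (- g z)"
      using \<eta> by (intro ennreal_mult') auto
    finally show ?thesis .
  next
    case False
    then show ?thesis using H_out(2)[OF z] by simp
  qed
  have C3: "H (L - K) (Suc d) z \<le> ennreal (2 * \<eta> * (1 + \<kappa>) ^ 3) * ennreal (T z * g z)" if z: "z \<in> S" for z
  proof (cases "norm z < 1")
    case n: True
    have hi: "s ^ Suc d * f (pt s z) \<le> (1 + \<kappa>) * T z * ((1 + \<kappa>) * F0 z)" if "T z \<le> s" "s \<le> \<tau> z" for s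
    proof -
      have "s * (s ^ d * f (pt s z)) \<le> ((1 + \<kappa>) * T z) * ((1 + \<kappa>) * F0 z)"
        using close[OF z n, of s] that Tpos[OF n] \<kappa> f0 unfolding pt_def by - (rule mult_mono, auto)
      then show ?thesis by (simp add: mult.assoc)
    qed
    have "H (L - K) (Suc d) z \<le> ennreal (2 * (\<tau> z - T z) * ((1 + \<kappa>) * T z * ((1 + \<kappa>) * F0 z)))"
      unfolding HL[OF z n]
      using hi Tpos[OF n] F0[OF z n] \<kappa> by (intro nn_integral_band_le) auto
    also have "\<dots> \<le> ennreal (2 * \<eta> * (1 + \<kappa>) ^ 3 * (T z * g z))"
    proof (cases "g z \<ge> 0")
      case True
      have "2 * (\<tau> z - T z) * ((1 + \<kappa>) * T z * ((1 + \<kappa>) * F0 z)) = 2 * \<eta> * (1 + \<kappa>)\<^sup>2 * (T z * g z) * (w z * F0 z)"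
        unfolding \<tau>[OF z n] by (simp add: power2_eq_square ac_simps)
      also have "\<dots> \<le> 2 * \<eta> * (1 + \<kappa>)\<^sup>2 * (T z * g z) * (1 + \<kappa>)"
        using w[OF z n] \<kappa> \<eta> True Tpos[OF n] by (intro mult_left_mono mult_nonneg_nonneg) auto
      also have "\<dots> = 2 * \<eta> * (1 + \<kappa>) ^ 3 * (T z * g z)" by (simp add: power2_eq_square power3_eq_cube)
      finally show ?thesis by (rule ennreal_leI)
    next
      case False
      then have "\<tau> z - T z \<le> 0" using \<tau>[OF z n] \<eta> wpos[OF z n] by (simp add: mult_nonneg_nonpos)
      moreover have "(1 + \<kappa>) * T z * ((1 + \<kappa>) * F0 z) \<ge> 0" using F0[OF z n] Tpos[OF n] \<kappa> by simp
      ultimately have "2 * (\<tau> z - T z) * ((1 + \<kappa>) * T z * ((1 + \<kappa>) * F0 z)) \<le> 0"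
        by (intro mult_nonpos_nonneg[of "2 * (\<tau> z - T z)"]) simp_all
      then show ?thesis by (subst ennreal_neg) simp_all
    qed
    also have "\<dots> = ennreal (2 * \<eta> * (1 + \<kappa>) ^ 3) * ennreal (T z * g z)"
      using \<eta> \<kappa> by (intro ennreal_mult') auto
    finally show ?thesis .
  next
    case False
    then show ?thesis using H_out(1)[OF z] by simp
  qed
  have C4: "ennreal (2 * \<eta> * (1 - \<kappa>) ^ 3) * ennreal (- (T z * g z)) \<le> H (K - L) (Suc d) z" if z: "z \<in> S" for z
  proof (cases "norm z < 1 \<and> g z < 0")
    case True
    then have n: "norm z < 1" and g: "g z < 0" by auto
    have lt: "\<tau> z < T z" using \<tau>[OF z n] \<eta> wpos[OF z n] g by (smt (verit) mult_pos_neg mult_pos_pos)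
    have lo: "(1 - \<kappa>) * T z * ((1 - \<kappa>) * F0 z) \<le> s ^ Suc d * f (pt s z)" if "\<tau> z \<le> s" "s \<le> T z" for s
    proof -
      have "((1 - \<kappa>) * T z) * ((1 - \<kappa>) * F0 z) \<le> s * (s ^ d * f (pt s z))"
        using close[OF z n, of s] that Tpos[OF n] \<kappa> F0[OF z n] unfolding pt_def by - (rule mult_mono, auto)
      then show ?thesis by (simp add: mult.assoc)
    qed
    have "2 * \<eta> * (1 - \<kappa>) ^ 3 * (- (T z * g z)) = 2 * \<eta> * (1 - \<kappa>)\<^sup>2 * (T z * (- g z)) * (1 - \<kappa>)"
      by (simp add: power2_eq_square power3_eq_cube ac_simps)
    also have "\<dots> \<le> 2 * \<eta> * (1 - \<kappa>)\<^sup>2 * (T z * (- g z)) * (w z * F0 z)"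
      using w[OF z n] \<kappa> \<eta> g Tpos[OF n] by (intro mult_left_mono mult_nonneg_nonneg) auto
    also have "\<dots> = 2 * (T z - \<tau> z) * ((1 - \<kappa>) * T z * ((1 - \<kappa>) * F0 z))"
    proof -
      have "T z - \<tau> z = \<eta> * w z * (- g z)" using \<tau>[OF z n] by simp
      then show ?thesis by (simp add: power2_eq_square ac_simps)
    qed
    finally have "ennreal (2 * \<eta> * (1 - \<kappa>) ^ 3) * ennreal (- (T z * g z)) \<le> ennreal (2 * (T z - \<tau> z) * ((1 - \<kappa>) * T z * ((1 - \<kappa>) * F0 z)))"
      using \<eta> \<kappa> by (subst ennreal_mult'[symmetric]) (auto intro!: ennreal_leI)
    also have "\<dots> \<le> H (K - L) (Suc d) z"
      unfolding HK[OF z n]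
      using lo Tpos[OF n] F0[OF z n] \<kappa> by (intro nn_integral_band_ge) auto
    finally show ?thesis .
  next
    case False
    have "- (T z * g z) \<le> 0"
    proof (cases "norm z < 1")
      case True
      then show ?thesis using False Tpos[OF True] by simp
    next
      case False
      then show ?thesis using g0[of z] by simp
    qed
    then show ?thesis by (simp add: ennreal_neg)
  qed

  define DL where "DL x = ennreal (f x) * indicator (L - K) x" for x
  define DK where "DK x = ennreal (f x) * indicator (K - L) x" for x
  define I where "I x = ennreal (f x) * indicator (K \<inter> L) x" for x
  have [measurable]: "DL \<in> borel_measurable borel" "DK \<in> borel_measurable borel" "I \<in> borel_measurable borel"
    unfolding DL_def DK_def I_def by measurable
  have split: "ennreal (f x) * indicator K x = I x + DK x" "ennreal (f x) * indicator L x = I x + DL x" for x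
    by (auto simp: DL_def DK_def I_def indicator_def)
  have Hm: "H X k \<in> borel_measurable borel" if [measurable]: "X \<in> sets borel" for X k
    unfolding H_def[abs_def] by measurable
  have [measurable]: "H (L - K) k \<in> borel_measurable borel" "H (K - L) k \<in> borel_measurable borel" for k
    by (auto intro!: Hm)
  show "sections_le f (lobe_body e \<rho> b T) (lobe_body e \<rho> b \<tau>)"
    unfolding sections_le_def K_def[symmetric] L_def[symmetric]
  proof
    fix \<xi> :: 'a assume "\<xi> \<in> sphere 0 1"
    let ?\<sigma> = "subspace_lborel (hyperplane_perp \<xi>)"
    have "(\<integral>\<^sup>+x. DK x \<partial>?\<sigma>) \<le> (\<integral>\<^sup>+x. DL x \<partial>?\<sigma>)"
    proof (cases "perp_part e \<xi> = 0")
      case True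
      \<comment> \<open>Here \<open>\<xi>\<close> is parallel to \<open>e\<close>. The section
        avoids both open cones and is cut out by the common cylinder, so it is the same for the two
        bodies.\<close>
      define a where "a = axis_coord e \<xi>"
      have \<xi>: "\<xi> = a *\<^sub>R e" using True by (simp add: perp_part_axis a_def)
      then have "a \<noteq> 0" using \<open>\<xi> \<in> sphere 0 1\<close> by auto
      then have "hyperplane_perp \<xi> = S" unfolding \<xi> S_def by (rule hyperplane_perp_scaleR)
      have "(\<integral>\<^sup>+x. DK x \<partial>?\<sigma>) = (\<integral>\<^sup>+x. 0 \<partial>?\<sigma>)"
      proof (rule nn_integral_cong_AE, use AE_subspace_lborel[OF subspace_hyperplane_perp[of \<xi>]] in eventually_elim)
        case (elim x)
        then have "axis_coord e x = 0"
          using \<open>hyperplane_perp \<xi> = S\<close> by (auto simp: S_def hyperplane_perp_def axis_coord_def)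
        then have "x \<in> K \<longleftrightarrow> x \<in> L" by (simp add: K_def L_def lobe_body_def lobe_gauge_def)
        then show ?case by (simp add: DK_def indicator_def)
      qed
      then show ?thesis by simp
    next
      case False
      obtain u c p where u: "u \<in> S" "norm u = 1" and
        chart: "\<And>F. F \<in> borel_measurable borel \<Longrightarrow> (\<integral>\<^sup>+x. F x \<partial>?\<sigma>) = ennreal c *
     (\<integral>\<^sup>+t. (\<integral>\<^sup>+v. ennreal (\<bar>t\<bar> ^ dim (S \<inter> hyperplane_perp u)) * F (t *\<^sub>R (e + \<rho> *\<^sub>R (v + p *\<^sub>R u))) \<partial>subspace_lborel (S \<inter> hyperplane_perp u)) \<partial>lborel)"
        by (rule nn_integral_section_chart[OF e \<rho> False, folded S_def]) (rule that)
      define V where "V = S \<inter> hyperplane_perp u"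
      have V: "subspace V" unfolding V_def by (rule subspace_inter[OF S subspace_hyperplane_perp])
      have dimV: "dim V = d" using dim_hyperplane_section[OF S u] dimS by (simp add: V_def)
      interpret sigma_finite_measure "subspace_lborel V" by (rule sigma_finite_subspace_lborel[OF V])
      interpret pair_sigma_finite "lborel :: real measure" "subspace_lborel V" ..
      have vS: "v + p *\<^sub>R u \<in> S" if "v \<in> V" for v
        using that u S by (auto simp: V_def intro!: subspace_add subspace_scale)
      have sec: "(\<integral>\<^sup>+x. ennreal (f x) * indicator X x \<partial>?\<sigma>) = ennreal c * (\<integral>\<^sup>+v. H X d (v + p *\<^sub>R u) \<partial>subspace_lborel V)"
        if [measurable]: "X \<in> sets borel" for X
      proof -
        have "(\<integral>\<^sup>+x. ennreal (f x) * indicator X x \<partial>?\<sigma>) = ennreal c *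
          (\<integral>\<^sup>+t. (\<integral>\<^sup>+v. ennreal (\<bar>t\<bar> ^ d) * (ennreal (f (pt t (v + p *\<^sub>R u))) * indicator X (pt t (v + p *\<^sub>R u))) \<partial>subspace_lborel V) \<partial>lborel)"
          using chart[of "\<lambda>x. ennreal (f x) * indicator X x"] by (simp add: V_def[symmetric] dimV pt_def)
        also have "(\<integral>\<^sup>+t. (\<integral>\<^sup>+v. ennreal (\<bar>t\<bar> ^ d) * (ennreal (f (pt t (v + p *\<^sub>R u))) * indicator X (pt t (v + p *\<^sub>R u))) \<partial>subspace_lborel V) \<partial>lborel)
          = (\<integral>\<^sup>+v. (\<integral>\<^sup>+t. ennreal (\<bar>t\<bar> ^ d) * (ennreal (f (pt t (v + p *\<^sub>R u))) * indicator X (pt t (v + p *\<^sub>R u))) \<partial>lborel) \<partial>subspace_lborel V)"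
          by (rule Fubini'[symmetric]) measurable
        finally show ?thesis unfolding H_def .
      qed
      let ?P = "\<integral>\<^sup>+v. ennreal (g (v + p *\<^sub>R u)) \<partial>subspace_lborel V" and ?Q = "\<integral>\<^sup>+v. ennreal (- g (v + p *\<^sub>R u)) \<partial>subspace_lborel V"
      have "(\<integral>\<^sup>+v. H (K - L) d (v + p *\<^sub>R u) \<partial>subspace_lborel V)
         \<le> (\<integral>\<^sup>+v. ennreal (2 * \<eta> * (1 + \<kappa>)\<^sup>2) * ennreal (- g (v + p *\<^sub>R u)) \<partial>subspace_lborel V)"
        by (rule nn_integral_mono_AE, use AE_subspace_lborel[OF V] in eventually_elim) (rule C2[OF vS])
      also have "\<dots> = ennreal (2 * \<eta> * (1 + \<kappa>)\<^sup>2) * ?Q" by (rule nn_integral_cmult) measurable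
      also have "\<dots> \<le> ennreal (2 * \<eta> * (1 - \<kappa>)\<^sup>2 * \<theta>) * ?Q"
      proof (intro mult_right_mono ennreal_leI)
        \<comment> \<open>Sections need only squares; the assumption on cubes implies this because
          \<open>1 - \<kappa> \<le> 1 + \<kappa>\<close>.\<close>
        have "(1 + \<kappa>)\<^sup>2 * (1 - \<kappa>) \<le> (1 + \<kappa>)\<^sup>2 * (1 + \<kappa>)" using \<kappa> by (intro mult_left_mono) auto
        also have "\<dots> \<le> \<theta> * (1 - \<kappa>) ^ 3" using \<theta>(2) by (simp add: power2_eq_square power3_eq_cube)
        also have "\<dots> = \<theta> * (1 - \<kappa>)\<^sup>2 * (1 - \<kappa>)" by (simp add: power2_eq_square power3_eq_cube)
        finally have "(1 + \<kappa>)\<^sup>2 \<le> \<theta> * (1 - \<kappa>)\<^sup>2" using \<kappa> by (simp add: mult_le_cancel_right)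
        then show "2 * \<eta> * (1 + \<kappa>)\<^sup>2 \<le> 2 * \<eta> * (1 - \<kappa>)\<^sup>2 * \<theta>"
          using mult_left_mono[of "(1 + \<kappa>)\<^sup>2" "\<theta> * (1 - \<kappa>)\<^sup>2" "2 * \<eta>"] \<eta> by (simp add: ac_simps)
      qed simp
      also have "\<dots> = ennreal (2 * \<eta> * (1 - \<kappa>)\<^sup>2) * (ennreal \<theta> * ?Q)"
        using \<eta> \<theta>(1) by (simp add: ennreal_mult mult.assoc)
      also have "\<dots> \<le> ennreal (2 * \<eta> * (1 - \<kappa>)\<^sup>2) * ?P"
        using R[OF u, of p] unfolding V_def by (intro mult_left_mono) auto
      also have "\<dots> = (\<integral>\<^sup>+v. ennreal (2 * \<eta> * (1 - \<kappa>)\<^sup>2) * ennreal (g (v + p *\<^sub>R u)) \<partial>subspace_lborel V)"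
        by (rule nn_integral_cmult[symmetric]) measurable
      also have "\<dots> \<le> (\<integral>\<^sup>+v. H (L - K) d (v + p *\<^sub>R u) \<partial>subspace_lborel V)"
        by (rule nn_integral_mono_AE, use AE_subspace_lborel[OF V] in eventually_elim) (rule C1[OF vS])
      finally show ?thesis unfolding DK_def DL_def by (subst (1 2) sec) (auto intro!: mult_left_mono)
    qed
    then show "emeasure (section_measure f \<xi>) (K \<inter> hyperplane_perp \<xi>) \<le> emeasure (section_measure f \<xi>) (L \<inter> hyperplane_perp \<xi>)"
      by (simp add: emeasure_section_measure split nn_integral_add add_left_mono)
  qed
  show "emeasure (body_measure f) (lobe_body e \<rho> b \<tau>) < emeasure (body_measure f) (lobe_body e \<rho> b T)"
  proof -
    interpret sigma_finite_measure "subspace_lborel S" by (rule sigma_finite_subspace_lborel[OF S])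
    interpret pair_sigma_finite "lborel :: real measure" "subspace_lborel S" ..
    define c where "c = norm e * \<rho> ^ Suc d"
    have c: "c > 0" using e \<rho> by (simp add: c_def)
    have vol: "(\<integral>\<^sup>+x. ennreal (f x) * indicator X x \<partial>lborel) = ennreal c * (\<integral>\<^sup>+z. H X (Suc d) z \<partial>subspace_lborel S)"
      if [measurable]: "X \<in> sets borel" for X
    proof -
      have "(\<integral>\<^sup>+x. ennreal (f x) * indicator X x \<partial>lborel) = ennreal c *
        (\<integral>\<^sup>+t. (\<integral>\<^sup>+z. ennreal (\<bar>t\<bar> ^ Suc d) * (ennreal (f (pt t z)) * indicator X (pt t z)) \<partial>subspace_lborel S) \<partial>lborel)"
        using nn_integral_chart[OF e \<rho>, of "\<lambda>x. ennreal (f x) * indicator X x"] dimS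
        by (simp add: S_def[symmetric] pt_def c_def del: power_Suc)
      also have "(\<integral>\<^sup>+t. (\<integral>\<^sup>+z. ennreal (\<bar>t\<bar> ^ Suc d) * (ennreal (f (pt t z)) * indicator X (pt t z)) \<partial>subspace_lborel S) \<partial>lborel)
        = (\<integral>\<^sup>+z. (\<integral>\<^sup>+t. ennreal (\<bar>t\<bar> ^ Suc d) * (ennreal (f (pt t z)) * indicator X (pt t z)) \<partial>lborel) \<partial>subspace_lborel S)"
        by (rule Fubini'[symmetric]) measurable
      finally show ?thesis unfolding H_def .
    qed
    let ?P = "\<integral>\<^sup>+z. ennreal (T z * g z) \<partial>subspace_lborel S" and ?Q = "\<integral>\<^sup>+z. ennreal (- (T z * g z)) \<partial>subspace_lborel S"
    define k where "k = 2 * \<eta> * (1 - \<kappa>) ^ 3"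
    have k: "k > 0" using \<eta> \<kappa> by (simp add: k_def)
    have "(\<integral>\<^sup>+z. H (L - K) (Suc d) z \<partial>subspace_lborel S) \<le> (\<integral>\<^sup>+z. ennreal (2 * \<eta> * (1 + \<kappa>) ^ 3) * ennreal (T z * g z) \<partial>subspace_lborel S)"
      by (rule nn_integral_mono_AE, use AE_subspace_lborel[OF S] in eventually_elim) (rule C3)
    also have "\<dots> = ennreal (2 * \<eta> * (1 + \<kappa>) ^ 3) * ?P" by (rule nn_integral_cmult) measurable
    also have "\<dots> \<le> ennreal (k * \<theta>) * ?P"
    proof (intro mult_right_mono ennreal_leI)
      show "2 * \<eta> * (1 + \<kappa>) ^ 3 \<le> k * \<theta>"
        unfolding k_def using mult_left_mono[OF \<theta>(2), of "2 * \<eta>"] \<eta> by (simp add: ac_simps)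
    qed simp
    also have "\<dots> = ennreal k * (ennreal \<theta> * ?P)"
      using k \<theta>(1) by (simp add: ennreal_mult mult.assoc)
    also have "\<dots> < ennreal k * ?Q"
    proof -
      have "ennreal k * (ennreal \<theta> * ?P) \<le> ennreal k * ?Q" using M by (intro mult_left_mono) auto
      moreover have "ennreal k * (ennreal \<theta> * ?P) \<noteq> ennreal k * ?Q"
        using M k by (auto simp: ennreal_mult_cancel_left)
      ultimately show ?thesis by simp
    qed
    also have "\<dots> = (\<integral>\<^sup>+z. ennreal k * ennreal (- (T z * g z)) \<partial>subspace_lborel S)"
      by (rule nn_integral_cmult[symmetric]) measurable
    also have "\<dots> \<le> (\<integral>\<^sup>+z. H (K - L) (Suc d) z \<partial>subspace_lborel S)"
      by (rule nn_integral_mono_AE, use AE_subspace_lborel[OF S] in eventually_elim) (rule C4[folded k_def])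
    finally have lt: "(\<integral>\<^sup>+z. H (L - K) (Suc d) z \<partial>subspace_lborel S) < (\<integral>\<^sup>+z. H (K - L) (Suc d) z \<partial>subspace_lborel S)" .
    have "(\<integral>\<^sup>+x. DL x \<partial>lborel) < (\<integral>\<^sup>+x. DK x \<partial>lborel)"
    proof -
      have "ennreal c * (\<integral>\<^sup>+z. H (L - K) (Suc d) z \<partial>subspace_lborel S) \<le> ennreal c * (\<integral>\<^sup>+z. H (K - L) (Suc d) z \<partial>subspace_lborel S)"
        using lt by (intro mult_left_mono) auto
      moreover have "ennreal c * (\<integral>\<^sup>+z. H (L - K) (Suc d) z \<partial>subspace_lborel S) \<noteq> ennreal c * (\<integral>\<^sup>+z. H (K - L) (Suc d) z \<partial>subspace_lborel S)"
        using lt c by (auto simp: ennreal_mult_cancel_left)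
      ultimately show ?thesis unfolding DL_def DK_def by (subst (1 2) vol) auto
    qed
    moreover have "(\<integral>\<^sup>+x. I x \<partial>lborel) < \<infinity>"
    proof -
      have cp: "compact K" using cK by (simp add: convex_body_def)
      obtain R where R: "\<And>x. x \<in> K \<Longrightarrow> norm x \<le> R" using compact_imp_bounded[OF cp] unfolding bounded_iff by auto
      obtain B where B: "\<And>x. norm x \<le> R \<Longrightarrow> f x \<le> B" using ffin by blast
      have "(\<integral>\<^sup>+x. I x \<partial>lborel) \<le> (\<integral>\<^sup>+x. ennreal B * indicator K x \<partial>lborel)"
        using B R by (intro nn_integral_mono) (auto simp: I_def indicator_def intro!: ennreal_leI)
      also have "\<dots> < \<infinity>"
        using emeasure_compact_finite[OF cp] by (simp add: nn_integral_cmult_indicator ennreal_mult_less_top)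
      finally show ?thesis .
    qed
    ultimately have "(\<integral>\<^sup>+x. I x \<partial>lborel) + (\<integral>\<^sup>+x. DL x \<partial>lborel) < (\<integral>\<^sup>+x. I x \<partial>lborel) + (\<integral>\<^sup>+x. DK x \<partial>lborel)"
      unfolding ennreal_add_left_cancel_less by auto
    then show ?thesis
      unfolding K_def[symmetric] L_def[symmetric] by (simp add: emeasure_body_measure split nn_integral_add)
  qed
qed

section \<open>Admissible perturbations and choice of parameters\<close>

lemma one_minus_power_le:
  fixes r :: real
  assumes "0 \<le> r" "r \<le> 1"
  shows "1 - r ^ j \<le> real j * (1 - r)"
  using Bernoulli_inequality[of "r - 1" j] assms by (simp add: algebra_simps)

lemma profile_bounds:
  fixes r M A :: real
  assumes "0 \<le> r" "r \<le> 1" "M \<ge> 0" "A \<ge> 0"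
  shows "1 - M - A \<le> 1 - M * r ^ k - A * r\<^sup>2" "1 - M * r ^ k - A * r\<^sup>2 \<le> 1"
proof -
  have p: "0 \<le> r ^ j" "r ^ j \<le> 1" for j using assms by (auto intro: power_le_one)
  have "M * r ^ k \<le> M" "A * r\<^sup>2 \<le> A" using p assms by (auto intro!: mult_left_le)
  moreover have "0 \<le> M * r ^ k" "0 \<le> A * r\<^sup>2" using p assms by auto
  ultimately show "1 - M - A \<le> 1 - M * r ^ k - A * r\<^sup>2" "1 - M * r ^ k - A * r\<^sup>2 \<le> 1" by linarith+
qed

text \<open>The delicate condition is the cylinder bound. With \<open>r = norm z\<close>, the
  function \<open>r * T z\<close> reaches \<open>b\<close> at \<open>r = 1\<close> with slope
  \<open>c = 1 - (2 * l + 1) * M - 3 * A > 0\<close>, and Bernoulli's inequality gives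
  \<open>b - r * T z \<ge> c * (1 - r)\<close> on the whole ball. A perturbation that vanishes
  linearly at the rim fits below this margin.\<close>

lemma lobe_perturbation:
  fixes e :: "'a::euclidean_space" and \<psi> :: "'a \<Rightarrow> real"
  assumes e: "e \<noteq> 0" and \<rho>: "\<rho> > 0" and M: "M \<ge> 0" and A: "A > 0" and MA: "M * (2 * real l + 1) + 3 * A < 1"
    and \<psi>: "tame \<psi>" and C: "C \<ge> 0" "\<And>z. norm z \<le> 1 \<Longrightarrow> \<bar>\<psi> z\<bar> \<le> C * (1 - norm z)"
  obtains \<eta>0 where "\<eta>0 > 0"
    "\<And>\<eta>. 0 \<le> \<eta> \<Longrightarrow> \<eta> \<le> \<eta>0 \<Longrightarrow>
      lobe e \<rho> (1 - M - A) 2 (\<lambda>z. 1 - M * norm z ^ (2 * l) - A * (norm z)\<^sup>2 + \<eta> * \<psi> z)"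
proof -
  define b where "b = 1 - M - A"
  define c where "c = 1 - (M * (2 * real l + 1) + 3 * A)"
  define T where "T z = 1 - M * norm z ^ (2 * l) - A * (norm z)\<^sup>2" for z :: 'a
  have c: "c > 0" using MA by (simp add: c_def)
  have "M \<le> M * (2 * real l + 1)" using M by (simp add: algebra_simps)
  then have b: "b > 0" using MA A by (simp add: b_def)
  obtain \<eta>1 where \<eta>1: "\<eta>1 > 0"
    "\<And>\<eta>. 0 \<le> \<eta> \<Longrightarrow> \<eta> \<le> \<eta>1 \<Longrightarrow> concave_on (cball 0 1) (\<lambda>z. 1 - M * norm z ^ (2 * l) - A * (norm z)\<^sup>2 + \<eta> * \<psi> z)"
    using concave_on_perturbation[OF \<psi> A M, of "2 * l"] by blast
  \<comment> \<open>\<open>\<eta>1\<close> preserves concavity; the bounds 1, \<open>c\<close> and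
    \<open>b / 2\<close> keep the profile at most 2, inside the cylinder and positive.\<close>
  define \<eta>0 where "\<eta>0 = min \<eta>1 (min 1 (min c (b / 2)) / (C + 1))"
  have "\<eta>0 > 0" using \<eta>1 c b C by (simp add: \<eta>0_def)
  moreover have "lobe e \<rho> (1 - M - A) 2 (\<lambda>z. 1 - M * norm z ^ (2 * l) - A * (norm z)\<^sup>2 + \<eta> * \<psi> z)"
    if \<eta>: "0 \<le> \<eta>" "\<eta> \<le> \<eta>0" for \<eta>
  proof -
    have "\<eta> * (C + 1) \<le> min 1 (min c (b / 2))"
      using \<eta>(2) C by (simp add: \<eta>0_def pos_le_divide_eq)
    then have \<eta>C: "\<eta> * C \<le> 1" "\<eta> * C \<le> c" "\<eta> * C < b"
      using \<eta>(1) b by (auto simp: algebra_simps)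
    have \<psi>le: "\<bar>\<eta> * \<psi> z\<bar> \<le> \<eta> * C * (1 - norm z)" if "norm z \<le> 1" for z
      using mult_left_mono[OF C(2)[OF that] \<eta>(1)] \<eta>(1) by (simp add: abs_mult mult.assoc)
    have \<psi>le': "\<bar>\<eta> * \<psi> z\<bar> \<le> \<eta> * C" if "norm z \<le> 1" for z
    proof -
      have "\<eta> * C * (1 - norm z) \<le> \<eta> * C * 1" using \<eta>(1) C(1) by (intro mult_left_mono) auto
      then show ?thesis using \<psi>le[OF that] by simp
    qed
    have T: "b \<le> T z" "T z \<le> 1" if "norm z \<le> 1" for z
      using profile_bounds[OF norm_ge_zero that M, of A "2 * l"] A by (auto simp: T_def b_def)
    show ?thesis
    proof
      show "concave_on (cball 0 1) (\<lambda>z. 1 - M * norm z ^ (2 * l) - A * (norm z)\<^sup>2 + \<eta> * \<psi> z)"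
        using \<eta>1(2)[of \<eta>] \<eta> by (simp add: \<eta>0_def)
      show "1 - M - A > 0" using b by (simp add: b_def)
      fix z :: 'a
      show "1 - M * norm z ^ (2 * l) - A * (norm z)\<^sup>2 + \<eta> * \<psi> z > 0" if "norm z \<le> 1"
        using T[OF that] \<psi>le'[OF that] \<eta>C unfolding T_def by linarith
      show "1 - M * norm z ^ (2 * l) - A * (norm z)\<^sup>2 + \<eta> * \<psi> z \<le> 2" if "norm z \<le> 1"
        using T[OF that] \<psi>le'[OF that] \<eta>C unfolding T_def by linarith
      show "1 - M * norm z ^ (2 * l) - A * (norm z)\<^sup>2 + \<eta> * \<psi> z = 1 - M - A" if "norm z = 1"
        using \<psi>le[of z] that by simp
      show "norm z * (1 - M * norm z ^ (2 * l) - A * (norm z)\<^sup>2 + \<eta> * \<psi> z) \<le> 1 - M - A" if z: "norm z \<le> 1"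
      proof -
        define r where "r = norm z"
        have r: "0 \<le> r" "r \<le> 1" using z by (auto simp: r_def)
        have "M * (1 - r ^ (2 * l + 1)) \<le> M * (real (2 * l + 1) * (1 - r))"
          by (intro mult_left_mono one_minus_power_le r M)
        moreover have "A * (1 - r ^ 3) \<le> A * (real 3 * (1 - r))"
          using A by (intro mult_left_mono one_minus_power_le r) auto
        moreover have "r * T z = r - M * r ^ (2 * l + 1) - A * r ^ 3"
          by (simp add: T_def r_def algebra_simps power2_eq_square power3_eq_cube)
        ultimately have "c * (1 - r) \<le> b - r * T z"
          by (simp add: b_def c_def algebra_simps)
        moreover have "r * (\<eta> * \<psi> z) \<le> c * (1 - r)"
        proof -
          have "r * (\<eta> * \<psi> z) \<le> r * \<bar>\<eta> * \<psi> z\<bar>" using r by (intro mult_left_mono) auto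
          also have "\<dots> \<le> 1 * \<bar>\<eta> * \<psi> z\<bar>" using r by (intro mult_right_mono) auto
          also have "\<dots> \<le> \<eta> * C * (1 - r)" using \<psi>le[OF z] by (simp add: r_def)
          also have "\<dots> \<le> c * (1 - r)" using \<eta>C r by (intro mult_right_mono) auto
          finally show ?thesis .
        qed
        ultimately have "r * T z + r * (\<eta> * \<psi> z) \<le> b" by linarith
        then show ?thesis by (simp add: T_def r_def b_def distrib_left)
      qed
    qed (use e \<rho> in auto)
  qed
  ultimately show ?thesis by (rule that)
qed

text \<open>Solves \<open>(1 + \<kappa>) / (1 - \<kappa>) = root 3 \<theta>\<close>.\<close>

lemma ratio_parameter:
  fixes \<theta> :: real
  assumes "\<theta> > 1"
  obtains \<kappa> where "0 < \<kappa>" "\<kappa> < 1" "(1 + \<kappa>) ^ 3 \<le> \<theta> * (1 - \<kappa>) ^ 3"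
proof -
  define q where "q = root 3 \<theta>"
  have q: "q > 1" "q ^ 3 = \<theta>" using assms by (auto simp: q_def)
  define \<kappa> where "\<kappa> = (q - 1) / (q + 1)"
  have "1 + \<kappa> = q * (1 - \<kappa>)" using q by (simp add: \<kappa>_def field_simps)
  then have "(1 + \<kappa>) ^ 3 = \<theta> * (1 - \<kappa>) ^ 3" by (simp add: power_mult_distrib q)
  moreover have "0 < \<kappa>" "\<kappa> < 1" using q by (auto simp: \<kappa>_def)
  ultimately show ?thesis using that[of \<kappa>] by simp
qed

text \<open>A point where \<open>f\<close> is nonzero excludes \<open>f = 0\<close>, for which all
  measures vanish. By continuity it can be moved off the origin, and the bodies differ only in
  directions near it.\<close>

lemma busemann_petty_negative:
  fixes f :: "'a::euclidean_space \<Rightarrow> real"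
  assumes dim: "DIM('a) \<ge> 5" and f: "continuous_on UNIV f" "\<And>x. f x \<ge> 0" "\<And>x. f (- x) = f x" and "f x0 \<noteq> 0"
  obtains K L where "convex_body K" "origin_symmetric K" "convex_body L" "origin_symmetric L"
    "sections_le f K L" "emeasure (body_measure f) L < emeasure (body_measure f) K"
proof -
  have pos_open: "open {x. f x > 0}" using f(1) by (intro open_Collect_less) auto
  obtain e where e: "e \<noteq> 0" "f e > 0"
  proof -
    have "x0 \<in> {x. f x > 0}" using \<open>f x0 \<noteq> 0\<close> f(2)[of x0] by simp
    moreover have "{x. f x > 0} \<noteq> {0}"
    proof
      assume eq: "{x. f x > 0} = {0}"
      show False using pos_open not_open_singleton[of "0::'a"] unfolding eq by simp
    qed
    ultimately obtain y where "y \<in> {x. f x > 0}" "y \<noteq> 0" by blast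
    then show ?thesis using that[of y] by simp
  qed
  obtain r where r: "r > 0" "\<And>x. dist e x < r \<Longrightarrow> f x > 0"
    using pos_open e unfolding open_contains_ball by (auto simp: subset_eq)
  define \<rho> where "\<rho> = r / 4"
  have \<rho>: "\<rho> > 0" using r by (simp add: \<rho>_def)
  \<comment> \<open>With \<open>1 - \<delta> \<le> T z \<le> 1\<close>, the points
    \<open>T z *\<^sub>R (e + \<rho> *\<^sub>R z)\<close> stay within \<open>r / 2 + r / 4\<close>
    of \<open>e\<close>, where \<open>f\<close> is positive. \<open>\<delta> \<le> 1/2\<close> keeps
    \<open>T\<close> at least \<open>1/2\<close>.\<close>
  define \<delta> where "\<delta> = min (1/2) (r / (2 * norm e))"
  have \<delta>: "\<delta> > 0" "\<delta> \<le> 1/2" "\<delta> * norm e \<le> r / 2"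
    using r e by (auto simp: \<delta>_def min_def field_simps)
  define S where "S = hyperplane_perp e"
  have S: "subspace S" by (simp add: S_def)
  define d where "d = DIM('a) - 2"
  have "dim S = DIM('a) - 1" using dim_hyperplane[OF e(1)] by (simp add: S_def hyperplane_perp_def)
  then have dimS: "dim S = Suc d" and d: "Suc d \<ge> 4" using dim by (auto simp: d_def)

  \<comment> \<open>A large \<open>l\<close> makes the upper limit \<open>1 / (2 * l + 1)\<close>
    for \<open>M\<close> small, so that the profile \<open>T\<close> stays close to 1.\<close>
  obtain l where l: "l \<ge> 1" "1 / (2 * real l + 1) < \<delta> / 2"
  proof -
    obtain k :: nat where k: "real k > 2 / \<delta>" using reals_Archimedean2 by blast
    have "1 / (2 * real (Suc k) + 1) < \<delta> / 2"
    proof -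
      have "2 < \<delta> * real k" using k \<delta>(1) by (simp add: pos_divide_less_eq mult.commute)
      also have "\<dots> \<le> \<delta> * (2 * real (Suc k) + 1)" using \<delta>(1) by (intro mult_left_mono) auto
      finally show ?thesis by (simp add: field_simps)
    qed
    then show ?thesis using that[of "Suc k"] by simp
  qed
  define \<gamma> where "\<gamma> = sphere_moment (Suc d) l"
  have \<gamma>: "0 < \<gamma>" "\<gamma> < 1 / (2 * real l + 1)"
    unfolding \<gamma>_def using sphere_moment_pos[of "Suc d" l] sphere_moment_less[OF d l(1)] by auto
  define M where "M = (\<gamma> + 1 / (2 * real l + 1)) / 2"
  have M: "\<gamma> < M" "M < 1 / (2 * real l + 1)" using \<gamma> by (auto simp: M_def)
  have M0: "M \<ge> 0" using M \<gamma> by simp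
  have Ml: "M * (2 * real l + 1) < 1" using M(2) by (simp add: pos_less_divide_eq)
  \<comment> \<open>The second bound makes \<open>3 * A\<close> at most half of the gap left by
    \<open>M\<close>; with \<open>M < \<delta> / 2\<close>, the first gives
    \<open>b \<ge> 1 - \<delta>\<close>.\<close>
  define A where "A = min (\<delta> / 4) ((1 - M * (2 * real l + 1)) / 6)"
  have A: "A > 0" "A \<le> \<delta> / 4" using \<delta> Ml by (auto simp: A_def)
  have MA: "M * (2 * real l + 1) + 3 * A < 1"
  proof -
    define q where "q = M * (2 * real l + 1)"
    have "A \<le> (1 - q) / 6" unfolding A_def q_def by (rule min.cobounded2)
    then have "6 * A \<le> 1 - q" by simp
    then show ?thesis using Ml unfolding q_def[symmetric] by argo
  qed
  define b where "b = 1 - M - A"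
  have b: "1 - \<delta> \<le> b" using M(2) l(2) A(2) \<delta>(1) unfolding b_def by linarith
  have b2: "b \<ge> 1/2" using b \<delta>(2) by linarith
  define T where "T = (\<lambda>z::'a. 1 - M * norm z ^ (2 * l) - A * (norm z)\<^sup>2)"
  have T: "b \<le> T z" "T z \<le> 1" if "norm z \<le> 1" for z
    using profile_bounds[OF norm_ge_zero that M0, of A "2 * l"] A by (auto simp: T_def b_def)
  have Tc: "continuous_on UNIV T" unfolding T_def by (intro continuous_intros)

  from test_function_exists[OF S dimS M(1)[unfolded \<gamma>_def] less_imp_le[OF A(1)], folded T_def]
  obtain a N \<theta> where "\<theta> > 1 \<and>
     (\<forall>u p. u \<in> S \<longrightarrow> norm u = 1 \<longrightarrow>
        ennreal \<theta> * (\<integral>\<^sup>+v. ennreal (- test_fun a N (v + p *\<^sub>R u)) \<partial>subspace_lborel (S \<inter> hyperplane_perp u))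
          \<le> (\<integral>\<^sup>+v. ennreal (test_fun a N (v + p *\<^sub>R u)) \<partial>subspace_lborel (S \<inter> hyperplane_perp u))) \<and>
     ennreal \<theta> * (\<integral>\<^sup>+z. ennreal (T z * test_fun a N z) \<partial>subspace_lborel S)
       < (\<integral>\<^sup>+z. ennreal (- (T z * test_fun a N z)) \<partial>subspace_lborel S)"
    unfolding T_def by (elim exE)
  then have \<theta>: "\<theta> > 1"
    and R: "\<And>u p. u \<in> S \<Longrightarrow> norm u = 1 \<Longrightarrow>
        ennreal \<theta> * (\<integral>\<^sup>+v. ennreal (- test_fun a N (v + p *\<^sub>R u)) \<partial>subspace_lborel (S \<inter> hyperplane_perp u))
          \<le> (\<integral>\<^sup>+v. ennreal (test_fun a N (v + p *\<^sub>R u)) \<partial>subspace_lborel (S \<inter> hyperplane_perp u))"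
    and mass: "ennreal \<theta> * (\<integral>\<^sup>+z. ennreal (T z * test_fun a N z) \<partial>subspace_lborel S)
       < (\<integral>\<^sup>+z. ennreal (- (T z * test_fun a N z)) \<partial>subspace_lborel S)"
    by blast+
  obtain \<kappa> where \<kappa>: "0 < \<kappa>" "\<kappa> < 1" "(1 + \<kappa>) ^ 3 \<le> \<theta> * (1 - \<kappa>) ^ 3"
    using ratio_parameter[OF \<theta>] by blast

  define \<phi> where "\<phi> = (\<lambda>(s, z). s ^ d * f (s *\<^sub>R (e + \<rho> *\<^sub>R z)))"
  have \<phi>c: "continuous_on UNIV \<phi>"
    unfolding \<phi>_def case_prod_unfold by (intro continuous_intros continuous_on_compose2[OF f(1)]) auto
  \<comment> \<open>The density with which a change of the radial function at \<open>z\<close>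
    enters the sections.\<close>
  define F0 where "F0 z = \<phi> (T z, z)" for z
  have F0c: "continuous_on (cball 0 1) F0"
    unfolding F0_def by (intro continuous_on_compose2[OF \<phi>c] continuous_intros continuous_on_subset[OF Tc]) auto
  have F0pos: "F0 z > 0" if "norm z \<le> 1" for z
  proof -
    have "norm (e - T z *\<^sub>R (e + \<rho> *\<^sub>R z)) = norm ((1 - T z) *\<^sub>R e - (T z * \<rho>) *\<^sub>R z)"
      by (simp add: algebra_simps)
    also have "\<dots> \<le> (1 - T z) * norm e + T z * \<rho> * norm z"
      using norm_triangle_ineq4[of "(1 - T z) *\<^sub>R e" "(T z * \<rho>) *\<^sub>R z"] T[OF that] b2 \<rho> by simp
    also have "\<dots> \<le> \<delta> * norm e + 1 * \<rho> * 1"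
      using T[OF that] b b2 \<rho> that by (intro add_mono mult_mono) auto
    also have "\<dots> < r" using \<delta> r by (simp add: \<rho>_def)
    finally have "f (T z *\<^sub>R (e + \<rho> *\<^sub>R z)) > 0" by (intro r) (simp add: dist_norm)
    then show ?thesis using T[OF that] b2 by (simp add: F0_def \<phi>_def)
  qed
  have cb: "compact (cball 0 1 :: 'a set)" "(cball 0 1 :: 'a set) \<noteq> {}" by auto
  obtain \<mu> where \<mu>: "\<mu> > 0" "\<And>z. norm z \<le> 1 \<Longrightarrow> \<mu> \<le> F0 z"
  proof -
    obtain z0 where "z0 \<in> cball 0 1" "\<And>z. z \<in> cball 0 1 \<Longrightarrow> F0 z0 \<le> F0 z"
      using continuous_attains_inf[OF cb F0c] by auto
    then show ?thesis using that[of "F0 z0"] F0pos[of z0] by auto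
  qed
  obtain B where B: "B > 0" "\<And>z. norm z \<le> 1 \<Longrightarrow> F0 z \<le> B"
  proof -
    obtain z0 where "z0 \<in> cball 0 1" "\<And>z. z \<in> cball 0 1 \<Longrightarrow> F0 z \<le> F0 z0"
      using continuous_attains_sup[OF cb F0c] by auto
    then show ?thesis using that[of "F0 z0"] F0pos[of z0] by auto
  qed
  \<comment> \<open>The ideal weight is \<open>1 / F0\<close>, which is only continuous. A
    polynomial approximation is tame, and its relative error is at most \<open>\<kappa>\<close>
    because \<open>F0 \<le> B\<close>.\<close>
  obtain w where wp: "real_polynomial_function w" and w: "\<And>z. z \<in> cball 0 1 \<Longrightarrow> \<bar>inverse (F0 z) - w z\<bar> < \<kappa> / B"
  proof (rule Stone_Weierstrass_real_polynomial_function[OF cb(1)])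
    show "continuous_on (cball 0 1) (\<lambda>z. inverse (F0 z))"
      by (intro continuous_on_inverse F0c) (use F0pos in force)
    show "0 < \<kappa> / B" using \<kappa> B by simp
  qed (use that in blast)
  have wF: "1 - \<kappa> \<le> w z * F0 z" "w z * F0 z \<le> 1 + \<kappa>" if "norm z \<le> 1" for z
  proof -
    have "\<bar>1 - w z * F0 z\<bar> = \<bar>inverse (F0 z) - w z\<bar> * F0 z"
      using F0pos[OF that] by (simp add: abs_mult[symmetric, of _ "F0 z", unfolded abs_of_pos[OF F0pos[OF that]]] left_diff_distrib)
    also have "\<dots> \<le> \<kappa> / B * B"
      using w[of z] B(2)[OF that] F0pos[OF that] that \<kappa> B(1) by (intro mult_mono) auto
    also have "\<dots> = \<kappa>" using B by simp
    finally show "1 - \<kappa> \<le> w z * F0 z" "w z * F0 z \<le> 1 + \<kappa>" by (auto simp: abs_le_iff)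
  qed

  \<comment> \<open>On the unit ball the cutoff is the polynomial
    \<open>1 - (norm z)\<^sup>2\<close>, hence tame. One such factor is split off to exhibit the
    linear decay of \<open>\<psi>\<close> at the rim.\<close>
  define v where "v z = w z * (\<Sum>k\<le>N. a k * (1 - (norm z)\<^sup>2) ^ k)" for z
  define \<psi> where "\<psi> z = (1 - (norm z)\<^sup>2) * v z" for z
  have t1: "tame (\<lambda>z::'a. 1 - (norm z)\<^sup>2)"
    using tame_add[OF tame_const[of 1] tame_mult[OF tame_const[of "-1"] tame_norm2]] by simp
  have tv: "tame v"
    unfolding v_def by (intro tame_mult tame_sum tame_power t1 tame_const tame_real_polynomial_function wp)
  have t\<psi>: "tame \<psi>" unfolding \<psi>_def by (intro tame_mult t1 tv)
  have \<psi>: "\<psi> z = w z * test_fun a N z" if "norm z \<le> 1" for z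
  proof -
    have "cutoff (norm z) = 1 - (norm z)\<^sup>2" using that by (simp add: cutoff_def power_le_one)
    then show ?thesis by (simp add: \<psi>_def v_def test_fun_def sum_distrib_left ac_simps)
  qed
  obtain C0 where C0: "C0 \<ge> 0" "\<And>z. norm z \<le> 1 \<Longrightarrow> \<bar>v z\<bar> \<le> C0"
    by (rule tameE[OF tv]) (rule that)
  have C: "\<bar>\<psi> z\<bar> \<le> 2 * C0 * (1 - norm z)" if "norm z \<le> 1" for z
  proof -
    have "\<bar>\<psi> z\<bar> = (1 - norm z) * ((1 + norm z) * \<bar>v z\<bar>)"
    proof -
      have "1 - (norm z)\<^sup>2 = (1 - norm z) * (1 + norm z)" by (simp add: power2_eq_square algebra_simps)
      then show ?thesis using that by (simp add: \<psi>_def abs_mult)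
    qed
    also have "\<dots> \<le> (1 - norm z) * (2 * C0)"
      using that C0 by (intro mult_left_mono mult_mono) auto
    finally show ?thesis by (simp add: ac_simps)
  qed
  have "2 * C0 \<ge> 0" using C0 by simp
  from lobe_perturbation[OF e(1) \<rho> M0 A(1) MA t\<psi> this C] obtain \<eta>0 where \<eta>0: "\<eta>0 > 0"
    and lobe: "\<And>\<eta>. 0 \<le> \<eta> \<Longrightarrow> \<eta> \<le> \<eta>0 \<Longrightarrow> lobe e \<rho> b 2 (\<lambda>z. T z + \<eta> * \<psi> z)"
    unfolding T_def b_def by blast

  \<comment> \<open>\<open>T\<close> takes values between \<open>1/2\<close> and 1 and the
    perturbation is at most \<open>1/4\<close>, so all radii that occur lie in this
    interval.\<close>
  have uc: "uniformly_continuous_on ({1/4..2} \<times> cball 0 1) \<phi>"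
    by (intro compact_uniformly_continuous compact_Times continuous_on_subset[OF \<phi>c]) auto
  have "\<kappa> * \<mu> > 0" using \<kappa> \<mu> by simp
  then obtain \<epsilon> where \<epsilon>: "\<epsilon> > 0"
    "\<And>x y. x \<in> {1/4..2} \<times> cball 0 1 \<Longrightarrow> y \<in> {1/4..2} \<times> cball 0 1 \<Longrightarrow> dist y x < \<epsilon> \<Longrightarrow> dist (\<phi> y) (\<phi> x) < \<kappa> * \<mu>"
    by (rule uniformly_continuous_onE[OF uc]) (rule that)
  \<comment> \<open>The three bounds serve the modulus of continuity, the range of radii, and the
    relative error \<open>\<kappa>\<close> of the radius against
    \<open>T z \<ge> 1/2\<close>.\<close>
  define \<zeta> where "\<zeta> = min (\<epsilon> / 2) (min (1/4) (\<kappa> / 2))"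
  have \<zeta>: "\<zeta> > 0" "\<zeta> < \<epsilon>" "\<zeta> \<le> 1/4" "\<zeta> \<le> \<kappa> / 2"
    using \<epsilon>(1) \<kappa>(1) unfolding \<zeta>_def by linarith+
  define \<eta> where "\<eta> = min \<eta>0 (\<zeta> / (2 * C0 + 1))"
  have C1: "2 * C0 + 1 > 0" using C0(1) by linarith
  have \<eta>: "\<eta> > 0" "\<eta> \<le> \<eta>0" "\<eta> \<le> \<zeta> / (2 * C0 + 1)"
    using \<eta>0 divide_pos_pos[OF \<zeta>(1) C1] unfolding \<eta>_def by linarith+
  have "\<eta> * (2 * C0) + \<eta> \<le> \<zeta>"
    using \<eta>(3) unfolding pos_le_divide_eq[OF C1] by (simp add: distrib_left)
  then have \<eta>C: "\<eta> * (2 * C0) < \<epsilon>" "\<eta> * (2 * C0) \<le> 1/4" "\<eta> * (2 * C0) \<le> \<kappa> / 2"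
    using \<eta>(1) \<zeta> by linarith+
  define \<tau> where "\<tau> = (\<lambda>z. T z + \<eta> * \<psi> z)"
  have KT: "lobe e \<rho> b 2 T" using lobe[of 0] \<eta>0 by simp
  have LT: "lobe e \<rho> b 2 \<tau>" unfolding \<tau>_def using lobe[of \<eta>] \<eta> by simp
  have near: "\<bar>\<tau> z - T z\<bar> \<le> \<eta> * (2 * C0)" if "norm z \<le> 1" for z
  proof -
    have "\<bar>\<psi> z\<bar> \<le> 2 * C0 * 1" by (rule order.trans[OF C[OF that]]) (use C0 in \<open>intro mult_left_mono, auto\<close>)
    then show ?thesis using \<eta>(1) by (simp add: \<tau>_def abs_mult)
  qed
  have close: "(1 - \<kappa>) * F0 z \<le> s ^ d * f (s *\<^sub>R (e + \<rho> *\<^sub>R z)) \<and> s ^ d * f (s *\<^sub>R (e + \<rho> *\<^sub>R z)) \<le> (1 + \<kappa>) * F0 z \<and>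
        (1 - \<kappa>) * T z \<le> s \<and> s \<le> (1 + \<kappa>) * T z"
    if z: "norm z < 1" and s: "min (T z) (\<tau> z) \<le> s" "s \<le> max (T z) (\<tau> z)" for z s
  proof -
    have z': "norm z \<le> 1" using z by simp
    have sT: "\<bar>s - T z\<bar> \<le> \<eta> * (2 * C0)" using near[OF z'] s by (auto simp: min_def max_def split: if_splits)
    have "\<kappa> * (1/2) \<le> \<kappa> * T z" using T[OF z'] b2 \<kappa> by (intro mult_left_mono) auto
    then have 1: "(1 - \<kappa>) * T z \<le> s" "s \<le> (1 + \<kappa>) * T z" using sT \<eta>C by (auto simp: algebra_simps abs_le_iff)
    have "dist (\<phi> (s, z)) (\<phi> (T z, z)) < \<kappa> * \<mu>"
    proof (rule \<epsilon>(2))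
      show "(T z, z) \<in> {1/4..2} \<times> cball 0 1" using T[OF z'] b2 z' by auto
      show "(s, z) \<in> {1/4..2} \<times> cball 0 1" using T[OF z'] b2 z' sT \<eta>C by (auto simp: abs_le_iff)
      show "dist (s, z) (T z, z) < \<epsilon>" using sT \<eta>C by (simp add: dist_Pair_Pair dist_real_def)
    qed
    moreover have "\<kappa> * \<mu> \<le> \<kappa> * F0 z" using \<mu>(2)[OF z'] \<kappa> by (intro mult_left_mono) auto
    ultimately have "\<bar>\<phi> (s, z) - F0 z\<bar> \<le> \<kappa> * F0 z" by (simp add: F0_def dist_real_def)
    then have "(1 - \<kappa>) * F0 z \<le> \<phi> (s, z)" "\<phi> (s, z) \<le> (1 + \<kappa>) * F0 z" by (auto simp: algebra_simps abs_le_iff)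
    then show ?thesis using 1 by (simp add: \<phi>_def)
  qed
  have fm: "f \<in> borel_measurable borel" using f(1) by (simp add: borel_measurable_continuous_onI)
  have ffin: "\<exists>M. \<forall>x. norm x \<le> R \<longrightarrow> f x \<le> M" for R
  proof -
    have "compact (f ` cball 0 R)" by (intro compact_continuous_image continuous_on_subset[OF f(1)]) auto
    then have "bounded (f ` cball 0 R)" by (rule compact_imp_bounded)
    then obtain M where M: "\<forall>y\<in>f ` cball 0 R. norm y \<le> M" unfolding bounded_iff ..
    have "f x \<le> M" if "norm x \<le> R" for x
      using bspec[OF M, of "f x"] that by simp
    then show ?thesis by blast
  qed
  have g0: "test_fun a N z = 0" if "norm z \<ge> 1" for z
  proof -
    have "1 \<le> (norm z)\<^sup>2" using that by simp
    then have "cutoff (norm z) = 0" by (simp add: cutoff_def)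
    then show ?thesis by (simp add: test_fun_def)
  qed
  have Tm: "T \<in> borel_measurable borel" using Tc by (rule borel_measurable_continuous_onI)
  have \<tau>eq: "\<tau> z - T z = \<eta> * w z * test_fun a N z" if "norm z < 1" for z
    using \<psi>[of z] that by (simp add: \<tau>_def)
  note main = lobe_pair_comparison[OF KT LT, folded S_def, OF dimS fm f(2,3) ffin \<kappa>(1,2) \<eta>(1) measurable_test_fun Tm g0 _ \<tau>eq _ close \<theta> \<kappa>(3) R mass]
  have "sections_le f (lobe_body e \<rho> b T) (lobe_body e \<rho> b \<tau>)"
    and "emeasure (body_measure f) (lobe_body e \<rho> b \<tau>) < emeasure (body_measure f) (lobe_body e \<rho> b T)"
    by (rule main; use F0pos wF in force)+
  then show ?thesis
    using that[of "lobe_body e \<rho> b T" "lobe_body e \<rho> b \<tau>"]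
      lobe.convex_body_lobe_body[OF KT] lobe.origin_symmetric_lobe_body[OF KT]
      lobe.convex_body_lobe_body[OF LT] lobe.origin_symmetric_lobe_body[OF LT] by blast
qed

theorem corollary2:
  fixes f :: "real ^ 'n \<Rightarrow> real"
  assumes "CARD('n) \<ge> 2"
    and "continuous_on UNIV f"
    and "\<And>x. f x \<ge> 0"
    and "\<And>x. f (- x) = f x"
  shows "(CARD('n) \<le> 4 \<longrightarrow>
            (\<forall>K L. convex_body K \<and> origin_symmetric K \<and> convex_body L \<and> origin_symmetric L \<and>
                   sections_le f K L \<longrightarrow>
                   emeasure (body_measure f) K \<le> emeasure (body_measure f) L)) \<and>
         (CARD('n) \<ge> 5 \<and> (\<exists>x. f x \<noteq> 0) \<longrightarrow>
            (\<exists>K L. convex_body K \<and> origin_symmetric K \<and> convex_body L \<and> origin_symmetric L \<and>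
                   sections_le f K L \<and>
                   emeasure (body_measure f) K > emeasure (body_measure f) L))"
proof (intro conjI impI allI)
  fix K L :: "(real ^ 'n) set"
  assume "CARD('n) \<le> 4"
    and "convex_body K \<and> origin_symmetric K \<and> convex_body L \<and> origin_symmetric L \<and> sections_le f K L"
  then show "emeasure (body_measure f) K \<le> emeasure (body_measure f) L"
    using assms by (intro busemann_petty_affirmative) auto
next
  assume asm: "CARD('n) \<ge> 5 \<and> (\<exists>x. f x \<noteq> 0)"
  then obtain x0 where "f x0 \<noteq> 0" by blast
  have "DIM(real ^ 'n) \<ge> 5" using asm by simp
  from busemann_petty_negative[OF this assms(2-4) \<open>f x0 \<noteq> 0\<close>]
  show "\<exists>K L. convex_body K \<and> origin_symmetric K \<and> convex_body L \<and> origin_symmetric L \<and>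
                   sections_le f K L \<and> emeasure (body_measure f) K > emeasure (body_measure f) L"
    by blast
qed

end
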